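(* Let $\mathbf{q}=(q_k)_{k\ge 1}$ be a non-zero sequence of non-negative real numbers which is admissible, with associated partition functions $W^{(\ell)}$ and constant $c_{\mathbf q}$ as defined in the context. Assume that $$\forall k\ge 1,\qquad q_k-2\,c_{\mathbf q}^{-2k}\,W^{(k)}\ \ge 0 .$$ Then there exists a slowly varying function $L_{\mathbf q}$ such that $1=O(L_{\mathbf q}(\ell))$, $L_{\mathbf q}(\ell)=O(\log \ell)$ as $\ell\to\infty$, and $$W^{(\ell)}\ \sim\ c_{\mathbf q}^{\ell+1}\,\frac{L_{\mathbf q}(\ell)}{2\ell^{2}}\qquad\text{as }\ell\to\infty .$$
   Context: A planar map is a finite connected planar graph embedded in the sphere, considered up to orientation-preserving homeomorphism, equipped with a distinguished oriented root edge; the face to the right of the root edge is the root face $f_r$. The degree $\deg(f)$ of a face is the number of edges surrounding it counted with multiplicity; the perimeter is $\deg(f_r)$. A map is bipartite if all face degrees are even. Let $\mathcal M^{(\ell)}$ be the set of finite rooted bipartite planar maps with perimeter $2\ell$. For a sequence $\mathbf q=(q_k)_{k\ge1}$ of non-negative reals, the weight of a map $\mathfrak m$ is $w_{\mathbf q}(\mathfrak m)=\prod_{f\neq f_r} q_{\deg(f)/2}$ (product over non-root faces), and $W^{(\ell)}=\sum_{\mathfrak m\in\mathcal M^{(\ell)}} w_{\mathbf q}(\mathfrak m)$. The sequence $\mathbf q$ is admissible if $W^{(\ell)}<\infty$ for all $\ell\ge1$; in that case it is known that the limit $c_{\mathbf q}=\lim_{\ell\to\infty}W^{(\ell+1)}/W^{(\ell)}$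 exists (and is finite and positive). A function $L:\mathbb R_+\to\mathbb R$ is slowly varying if $L(\lambda x)/L(x)\to1$ as $x\to\infty$ for every $\lambda>0$. *)

theory Defs
  imports "HOL-Analysis.Analysis" "HOL-Combinatorics.Permutations" "HOL-Library.Landau_Symbols"
begin

text \<open>Combinatorial encoding of finite rooted planar maps with n edges.
  Darts (half-edges) are {..<2n}; a labelled map is a triple (sigma, alpha, r):
  sigma permutes the darts (vertex rotation), alpha is a fixed-point-free involution
  of the darts (edges), r is the root dart. Faces are the orbits of phi = sigma o alpha.
  The root face is the face containing the root dart.\<close>

definition darts :: "nat \<Rightarrow> nat set" where
  "darts n = {..<2*n}"

definition orb :: "(nat \<Rightarrow> nat) \<Rightarrow> nat \<Rightarrow> nat set" where
  "orb f x = {(f ^^ k) x | k. True}"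

definition cycles_of :: "(nat \<Rightarrow> nat) \<Rightarrow> nat set \<Rightarrow> nat set set" where
  "cycles_of f D = (\<lambda>x. orb f x) ` D"

definition face_perm :: "(nat \<Rightarrow> nat) \<Rightarrow> (nat \<Rightarrow> nat) \<Rightarrow> (nat \<Rightarrow> nat)" where
  "face_perm \<sigma> \<alpha> = \<sigma> \<circ> \<alpha>"

definition faces :: "nat \<Rightarrow> (nat \<Rightarrow> nat) \<times> (nat \<Rightarrow> nat) \<times> nat \<Rightarrow> nat set set" where
  "faces n m = (case m of (\<sigma>, \<alpha>, r) \<Rightarrow> cycles_of (face_perm \<sigma> \<alpha>) (darts n))"

definition root_face :: "(nat \<Rightarrow> nat) \<times> (nat \<Rightarrow> nat) \<times> nat \<Rightarrow> nat set" where
  "root_face m = (case m of (\<sigma>, \<alpha>, r) \<Rightarrow> orb (face_perm \<sigma> \<alpha>) r)"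

text \<open>Planar (genus 0) connected map: Euler's formula V - E + F = 2.\<close>
definition is_planar_map :: "nat \<Rightarrow> (nat \<Rightarrow> nat) \<times> (nat \<Rightarrow> nat) \<times> nat \<Rightarrow> bool" where
  "is_planar_map n m = (case m of (\<sigma>, \<alpha>, r) \<Rightarrow>
      \<sigma> permutes darts n \<and> \<alpha> permutes darts n \<and>
      (\<forall>x\<in>darts n. \<alpha> x \<noteq> x \<and> \<alpha> (\<alpha> x) = x) \<and>
      r \<in> darts n \<and>
      (\<forall>x\<in>darts n. \<forall>y\<in>darts n.
          (x, y) \<in> ({(u, \<sigma> u) | u. True} \<union> {(u, \<alpha> u) | u. True})\<^sup>*) \<and>
      int (card (cycles_of \<sigma> (darts n))) - int (card (cycles_of \<alpha> (darts n)))
        + int (card (faces n m)) = 2)"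

text \<open>Rooted bipartite planar maps with n edges and perimeter 2l (all face degrees even).\<close>
definition maps_nl :: "nat \<Rightarrow> nat \<Rightarrow> ((nat \<Rightarrow> nat) \<times> (nat \<Rightarrow> nat) \<times> nat) set" where
  "maps_nl n l = {m. is_planar_map n m \<and> (\<forall>f\<in>faces n m. even (card f)) \<and>
                     card (root_face m) = 2 * l}"

text \<open>Isomorphism of rooted maps (orientation-preserving relabelling of darts preserving root).\<close>
definition map_iso :: "nat \<Rightarrow> (((nat \<Rightarrow> nat) \<times> (nat \<Rightarrow> nat) \<times> nat) \<times>
                                ((nat \<Rightarrow> nat) \<times> (nat \<Rightarrow> nat) \<times> nat)) set" where
  "map_iso n = {((\<sigma>, \<alpha>, r), (\<sigma>', \<alpha>', r')). \<exists>\<pi>. \<pi> permutes darts n \<and>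
       (\<forall>x\<in>darts n. \<pi> (\<sigma> x) = \<sigma>' (\<pi> x) \<and> \<pi> (\<alpha> x) = \<alpha>' (\<pi> x)) \<and> \<pi> r = r'}"

definition map_weight :: "(nat \<Rightarrow> real) \<Rightarrow> nat \<Rightarrow> (nat \<Rightarrow> nat) \<times> (nat \<Rightarrow> nat) \<times> nat \<Rightarrow> real" where
  "map_weight q n m = (\<Prod>f\<in>faces n m - {root_face m}. q (card f div 2))"

text \<open>Partition function W^(l): sum over isomorphism classes of rooted bipartite planar
  maps of perimeter 2l (grouped by number of edges n).\<close>
definition Wq :: "(nat \<Rightarrow> real) \<Rightarrow> nat \<Rightarrow> ennreal" where
  "Wq q l = (\<Sum>n. ennreal (\<Sum>C\<in>maps_nl n l // map_iso n.
                               map_weight q n (SOME m. m \<in> C)))"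

definition admissible :: "(nat \<Rightarrow> real) \<Rightarrow> bool" where
  "admissible q = (\<forall>l\<ge>1. Wq q l < \<infinity>)"

definition W :: "(nat \<Rightarrow> real) \<Rightarrow> nat \<Rightarrow> real" where
  "W q l = enn2real (Wq q l)"

definition c_q :: "(nat \<Rightarrow> real) \<Rightarrow> real" where
  "c_q q = lim (\<lambda>l. W q (l + 1) / W q l)"

definition slowly_varying :: "(real \<Rightarrow> real) \<Rightarrow> bool" where
  "slowly_varying L = (\<forall>t>0. ((\<lambda>x. L (t * x) / L x) \<longlongrightarrow> 1) at_top)"

end

theory Submission
  imports Defs "HOL-Computational_Algebra.Formal_Power_Series" "HOL-Real_Asymp.Real_Asymp"
begin

text \<open>Deleting the root edge of a labelled planar map gives Tutte's equation
  \<open>W (l + 1) = (\<Sum>i\<le>l. W i * W (l - i)) + (\<Sum>k\<ge>1. q k * W (l + k))\<close>, where \<open>W 0 = 1\<close>. Put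
  \<open>v n = W (n - 1) / c ^ n\<close> and \<open>a k = q (k + 1) * c ^ k\<close>, where \<open>c\<close> is the exponential growth rate.
  Criticality of \<open>c\<close> gives \<open>2 * \<Sum>v + \<Sum>a \<le> 1\<close>, so the Laurent series
  \<open>1 - 2 * V t - A (1 / t)\<close> has a Wiener-Hopf factorisation \<open>\<kappa> * (1 - U t) * (1 - D (1 / t))\<close> with
  non-negative coefficients. Tutte's equation says that the square of the series has no term in
  \<open>t ^ n\<close> for \<open>n \<ge> 2\<close>. By the maximum principle \<open>(1 - U t)\<^sup>2\<close> then has none either, and this forces
  \<open>U t = 1 - sqrt (1 - t)\<close>. Hence only \<open>D\<close> remains unknown, and \<open>v\<close> and \<open>a\<close> depend on it linearly.

  An explicit kernel eliminates \<open>D\<close>: with \<open>O l = (\<Sum>i<l. 1 / (2 * i + 1))\<close> and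
  \<open>T l m = 2 * m * (O l - O m) / (l\<^sup>2 - m\<^sup>2)\<close> one finds
  \<open>P\<^sup>2 * v (l + 1) = T l 1 - (\<Sum>m\<ge>1. \<delta> m * T l m)\<close>, where \<open>\<delta> m = a (m - 1) - 2 * v (m + 1)\<close> is
  non-negative exactly by the hypothesis on \<open>q\<close>. As \<open>l\<^sup>2 * T l m / m\<close> is within \<open>1 / 2\<close> of
  \<open>2 * (O l - O (min l m))\<close> and \<open>O l\<close> grows like \<open>ln l / 2\<close>, positivity of \<open>v\<close> gives
  \<open>(\<Sum>m. m * \<delta> m) \<le> 1\<close>, and \<open>l\<^sup>2 * v (l + 1)\<close> is slowly varying by dominated convergence.\<close>

section \<open>Cutting an edge of a planar map\<close>

text \<open>The hypothesis on \<open>q\<close> is phrased with the ratio limit \<open>c_q\<close>,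
  while the growth rate \<open>c\<close> used throughout is a supremum of roots. It becomes usable
  only after the ratio limit of \<open>v\<close> has identified the two, so the factorisation and
  the ratio limit come before the sign of \<open>\<delta>\<close> is known. The origin of
  \<open>\<delta>\<close>: in the series \<open>2 * V t + A (1 / t) - 1\<close> the coefficients of
  \<open>t ^ (1 - m)\<close> and \<open>t ^ (1 + m)\<close> differ by \<open>\<delta> m\<close>,
  except that the constant \<open>-1\<close> enters at \<open>m = 1\<close>; this exception produces
  the inhomogeneous term \<open>T l 1\<close>. Thus \<open>\<delta>\<close> is an odd part of the
  coefficients about index 1, and the kernel \<open>T\<close> recovers from it the coefficients of
  index at least 2. This works for every \<open>D\<close>: both sides are linear in
  \<open>D\<close>, so it suffices to treat one product \<open>t ^ (- j) * sqrt (1 - t)\<close> at a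
  time. That case rests on the fact that the sums of \<open>bc N / (N + k - 1 / 2)\<close> over
  \<open>N\<close> are proportional to \<open>bc k\<close>, and vanish for negative
  \<open>k\<close>. The constant \<open>P\<close> is \<open>Jf 0\<close>, in fact \<pi>; only its
  positivity is used.\<close>

abbreviation sw :: "nat \<Rightarrow> nat \<Rightarrow> nat \<Rightarrow> nat" where
  "sw \<equiv> Transposition.transpose"

section \<open>Orbits of permutations and their change under a transposition\<close>

lemma orb_refl: "x \<in> orb f x"
  unfolding orb_def by (metis (mono_tags, lifting) funpow_0 mem_Collect_eq)

lemma orbD: "y \<in> orb f x \<Longrightarrow> \<exists>k. (f ^^ k) x = y"
  unfolding orb_def by auto

lemma orb_step: "y \<in> orb f x \<Longrightarrow> f y \<in> orb f x"
  unfolding orb_def by (auto intro: exI[of _ "Suc _"])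

lemma orb_least: "x \<in> T \<Longrightarrow> f ` T \<subseteq> T \<Longrightarrow> orb f x \<subseteq> T"
proof -
  assume a: "x \<in> T" "f ` T \<subseteq> T"
  have "(f ^^ k) x \<in> T" for k by (induction k) (use a in auto)
  then show ?thesis by (auto simp: orb_def)
qed

lemma orb_mono: "y \<in> orb f x \<Longrightarrow> orb f y \<subseteq> orb f x"
  by (rule orb_least) (auto intro: orb_step)

lemma orb_cong: "x \<in> S \<Longrightarrow> f ` S \<subseteq> S \<Longrightarrow> (\<And>y. y \<in> S \<Longrightarrow> f y = f' y) \<Longrightarrow> orb f x = orb f' x"
proof -
  assume a: "x \<in> S" "f ` S \<subseteq> S" "\<And>y. y \<in> S \<Longrightarrow> f y = f' y"
  have "(f ^^ k) x = (f' ^^ k) x \<and> (f ^^ k) x \<in> S" for k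
    by (induction k) (use a in auto)
  then show ?thesis by (simp add: orb_def)
qed

lemma orb_subset: "bij_betw f S S \<Longrightarrow> x \<in> S \<Longrightarrow> orb f x \<subseteq> S"
  by (rule orb_least) (auto simp: bij_betw_def)

lemma funpow_mem: fixes f :: "nat \<Rightarrow> nat" shows "bij_betw f S S \<Longrightarrow> x \<in> S \<Longrightarrow> (f ^^ k) x \<in> S"
  using orb_subset[of f S x] by (auto simp: orb_def)

lemma funpow_inj_on: fixes f :: "nat \<Rightarrow> nat" shows "bij_betw f S S \<Longrightarrow> x \<in> S \<Longrightarrow> y \<in> S \<Longrightarrow> (f ^^ k) x = (f ^^ k) y \<Longrightarrow> x = y"
proof (induction k)
  case (Suc k)
  then have "(f ^^ k) x = (f ^^ k) y"
    using funpow_mem[OF Suc.prems(1,2)] funpow_mem[OF Suc.prems(1,3)]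
    by (auto simp: bij_betw_def dest: inj_onD)
  then show ?case using Suc by blast
qed auto

lemma ex_period:
  fixes f :: "nat \<Rightarrow> nat"
  assumes "finite S" "bij_betw f S S" "x \<in> S"
  shows "\<exists>m>0. (f ^^ m) x = x"
proof -
  have "\<not> inj_on (\<lambda>k. (f ^^ k) x) {..card S}"
    using pigeonhole[of "\<lambda>k. (f ^^ k) x" "{..card S}"] card_mono[OF assms(1), of "(\<lambda>k. (f ^^ k) x) ` {..card S}"]
      funpow_mem[OF assms(2,3)] by fastforce
  then obtain i j where ij: "(f ^^ i) x = (f ^^ j) x" "i < j"
    unfolding inj_on_def by (metis linorder_neqE_nat)
  have "(f ^^ i) ((f ^^ (j - i)) x) = (f ^^ i) x"
    using ij by (metis add_diff_inverse_nat funpow_add less_imp_not_less o_apply)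
  then have "(f ^^ (j - i)) x = x"
    using funpow_inj_on[OF assms(2)] funpow_mem[OF assms(2,3)] assms(3) by blast
  then show ?thesis using ij by (intro exI[of _ "j-i"]) auto
qed

lemma orb_sym:
  assumes "finite S" "bij_betw f S S" "x \<in> S" "y \<in> orb f x"
  shows "x \<in> orb f y"
proof -
  obtain k where k: "y = (f ^^ k) x" using assms(4) by (auto simp: orb_def)
  obtain m where m: "m > 0" "(f ^^ m) x = x" using ex_period[OF assms(1-3)] by auto
  have "(f ^^ (m * k)) x = x" for k
    by (induction k) (auto simp: funpow_add m)
  then have "(f ^^ (m * k - k)) y = x"
    unfolding k using m(1)
    by (metis (no_types, lifting) Nat.le_imp_diff_is_add Suc_leI diff_add_inverse2 funpow_add le_add1 mult_le_mono1 nat_mult_1 o_apply One_nat_def)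
  then show ?thesis by (auto simp: orb_def)
qed

lemma orb_eq:
  assumes "finite S" "bij_betw f S S" "x \<in> S" "y \<in> orb f x"
  shows "orb f y = orb f x"
  using orb_mono[OF assms(4)] orb_mono[OF orb_sym[OF assms]] by blast

lemma orb_disj:
  assumes "finite S" "bij_betw f S S" "x \<in> S" "y \<in> S"
  shows "orb f x = orb f y \<or> orb f x \<inter> orb f y = {}"
  using orb_eq[OF assms(1,2)] assms(3,4) by blast

lemma funpow_diff: "i \<le> k \<Longrightarrow> (f ^^ k) x = (f ^^ (k - i)) ((f ^^ i) x)"
  by (metis funpow_add le_add_diff_inverse2 o_apply)

definition ncyc :: "(nat \<Rightarrow> nat) \<Rightarrow> nat set \<Rightarrow> nat" where
  "ncyc f S = card (orb f ` S)"

lemma bij_betw_comp_transpose: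
  "bij_betw f S S \<Longrightarrow> a \<in> S \<Longrightarrow> b \<in> S \<Longrightarrow> bij_betw (f \<circ> sw a b) S S"
  by (rule bij_betw_trans[of _ S S]) (auto intro: permutes_imp_bij permutes_swap_id)

lemma comp_sw_apply:
  "(f \<circ> sw a b) a = f b" "(f \<circ> sw a b) b = f a" "x \<noteq> a \<Longrightarrow> x \<noteq> b \<Longrightarrow> (f \<circ> sw a b) x = f x"
  by auto

text \<open>From \<open>a\<close> the new map jumps to \<open>f b\<close> and then follows the cycle
  of \<open>b\<close>, which avoids \<open>a\<close>, so that \<open>F\<close> agrees with
  \<open>f\<close> until \<open>b\<close> is reached. The induction covers only iterates with
  \<open>i > 0\<close>, because the path leaves from \<open>a\<close> and meets \<open>b\<close>
  last.\<close>

lemma orb_transpose_merge_aux: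
  assumes "finite S" "bij_betw f S S" "a \<in> S" "b \<in> S" "b \<notin> orb f a"
  shows "orb f b \<subseteq> orb (f \<circ> sw a b) a"
proof -
  define F where "F = f \<circ> sw a b"
  have F: "F a = f b" "x \<noteq> a \<Longrightarrow> x \<noteq> b \<Longrightarrow> F x = f x" for x
    unfolding F_def by (auto simp: comp_sw_apply)
  have na: "a \<notin> orb f b" using orb_sym[OF assms(1,2,4)] assms(5) by blast
  have *: "(f ^^ i) b \<in> orb F a" if "i > 0" for i
    using that
  proof (induction i)
    case (Suc i)
    show ?case
    proof (cases "(f ^^ i) b = b")
      case True
      then show ?thesis using orb_step[OF orb_refl, of F a] F by simp
    next
      case False
      then have "i > 0" by (cases i) auto
      with Suc have "(f ^^ i) b \<in> orb F a" by simp
      moreover have "(f ^^ i) b \<noteq> a" using na by (auto simp: orb_def)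
      ultimately show ?thesis using orb_step[of "(f ^^ i) b" F a] False F by simp
    qed
  qed auto
  obtain m where "m > 0" "(f ^^ m) b = b" using ex_period[OF assms(1,2,4)] by auto
  then have "b \<in> orb F a" using *[of m] by simp
  then have "(f ^^ i) b \<in> orb F a" for i using * by (cases "i = 0") auto
  then show ?thesis unfolding F_def[symmetric] by (auto simp: orb_def)
qed

lemma orb_transpose_merge:
  assumes "finite S" "bij_betw f S S" "a \<in> S" "b \<in> S" "b \<notin> orb f a"
  shows "orb (f \<circ> sw a b) a = orb f a \<union> orb f b"
    and "orb (f \<circ> sw a b) b = orb f a \<union> orb f b"
    and "\<And>x. x \<notin> orb f a \<Longrightarrow> x \<notin> orb f b \<Longrightarrow> x \<in> S \<Longrightarrow> orb (f \<circ> sw a b) x = orb f x"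
proof -
  let ?f = "f \<circ> sw a b"
  note bij = bij_betw_comp_transpose[OF assms(2-4)]
  have na: "a \<notin> orb f b" using orb_sym[OF assms(1,2,4)] assms(5) by blast
  have 1: "orb f b \<subseteq> orb ?f a" by (rule orb_transpose_merge_aux) fact+
  have "orb f a \<subseteq> orb (f \<circ> sw b a) b" by (rule orb_transpose_merge_aux) fact+
  then have 2: "orb f a \<subseteq> orb ?f b" by (simp add: transpose_commute)
  have "b \<in> orb ?f a" using 1 orb_refl by blast
  then have 3: "orb ?f b = orb ?f a" using orb_eq[OF assms(1) bij assms(3)] by blast
  have "?f x \<in> orb f a \<union> orb f b" if "x \<in> orb f a \<union> orb f b" for x
    using that orb_step[of _ f] orb_refl by (auto simp: Transposition.transpose_def)
  then have "orb ?f a \<subseteq> orb f a \<union> orb f b"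
    by (intro orb_least) (auto intro: orb_refl)
  then show 4: "orb ?f a = orb f a \<union> orb f b" "orb ?f b = orb f a \<union> orb f b"
    using 1 2 3 by blast+
  fix x assume x: "x \<notin> orb f a" "x \<notin> orb f b" "x \<in> S"
  have "a \<notin> orb f x" "b \<notin> orb f x" using orb_sym[OF assms(1,2) x(3)] x by blast+
  then show "orb ?f x = orb f x"
    by (intro orb_cong[of _ "orb f x", symmetric]) (auto intro: orb_refl orb_step simp: Transposition.transpose_def)
qed

text \<open>If \<open>F\<close> led from \<open>a\<close> to \<open>b\<close>, take the first
  arrival time \<open>k\<close>. Until then the path runs along the \<open>f\<close>-cycle of
  \<open>b\<close> and does not return to \<open>a\<close>, so its points form an
  \<open>f\<close>-closed set that contains \<open>b\<close> but not \<open>a\<close>, although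
  \<open>a\<close> lies on the cycle of \<open>b\<close>.\<close>

lemma orb_transpose_split:
  assumes "finite S" "bij_betw f S S" "a \<in> S" "b \<in> S" "a \<noteq> b" "b \<in> orb f a"
  shows "b \<notin> orb (f \<circ> sw a b) a"
proof -
  define F where "F = f \<circ> sw a b"
  have F: "F a = f b" "x \<noteq> a \<Longrightarrow> x \<noteq> b \<Longrightarrow> F x = f x" for x
    unfolding F_def by (auto simp: comp_sw_apply)
  have "b \<notin> orb F a"
  proof
  assume b: "b \<in> orb F a"
  obtain k0 where "(F ^^ k0) a = b" using orbD[OF b] by (rule exE)
  define k where "k = (LEAST k. (F ^^ k) a = b)"
  have k: "(F ^^ k) a = b" unfolding k_def using \<open>(F ^^ k0) a = b\<close> by (rule LeastI)
  have kmin: "(F ^^ i) a \<noteq> b" if "i < k" for i using that not_less_Least unfolding k_def by blast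
  have nota: "(F ^^ i) a \<noteq> a" if "0 < i" "i \<le> k" for i
  proof
    assume i: "(F ^^ i) a = a"
    have "(F ^^ k) a = (F ^^ (k - i)) ((F ^^ i) a)"
      using that by (intro funpow_diff) simp
    then show False using i k kmin[of "k - i"] that by auto
  qed
  have k0: "k > 0" using k assms(5) by (cases k) auto
  have eq: "(F ^^ i) a = (f ^^ i) b" if "0 < i" "i \<le> k" for i
    using that
  proof (induction i)
    case (Suc i)
    show ?case
    proof (cases "i = 0")
      case False
      then have "(F ^^ i) a = (f ^^ i) b" "(F ^^ i) a \<noteq> a" "(F ^^ i) a \<noteq> b"
        using Suc nota[of i] kmin[of i] by auto
      then show ?thesis by (simp add: F)
    qed (simp add: F)
  qed auto
  let ?T = "(\<lambda>i. (f ^^ i) b) ` {1..k}"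
  have "f ` ?T \<subseteq> ?T"
  proof clarify
    fix i assume i: "i \<in> {1..k}"
    show "f ((f ^^ i) b) \<in> ?T"
    proof (cases "i = k")
      case True
      then have "f ((f ^^ i) b) = (f ^^ 1) b" using eq[of k] k k0 by simp
      then show ?thesis using k0 by (intro image_eqI[of _ _ 1]) auto
    next
      case False
      then show ?thesis using i by (intro image_eqI[of _ _ "Suc i"]) auto
    qed
  qed
  moreover have "b \<in> ?T" using eq[of k] k k0 by (intro image_eqI[of _ _ k]) auto
  ultimately have "orb f b \<subseteq> ?T" by (intro orb_least)
  moreover have "a \<in> orb f b" using orb_sym[OF assms(1,2,3,6)] .
  ultimately obtain i where "i \<in> {1..k}" "a = (f ^^ i) b" by auto
  then show False using eq[of i] nota[of i] by auto
  qed
  then show ?thesis by (simp add: F_def)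
qed

lemma comp_transpose_twice: "f \<circ> sw a b \<circ> sw a b = f"
  by (simp add: comp_assoc)

lemma orbits_transpose_merge:
  assumes "finite S" "bij_betw f S S" "a \<in> S" "b \<in> S" "b \<notin> orb f a"
  shows "orb (f \<circ> sw a b) ` S = insert (orb f a \<union> orb f b) (orb f ` S - {orb f a, orb f b})"
    (is "?L = ?R")
proof -
  note m = orb_transpose_merge[OF assms]
  have eq: "x \<in> orb f c \<longleftrightarrow> orb f x = orb f c" if "x \<in> S" "c \<in> S" for x c
    using orb_eq[OF assms(1,2) that(2)] orb_refl[of x f] by blast
  have eq': "orb (f \<circ> sw a b) x = orb f a \<union> orb f b" if "x \<in> orb f a \<union> orb f b" for x
    using orb_eq[OF assms(1) bij_betw_comp_transpose[OF assms(2-4)] assms(3), of x] that m by auto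
  show ?thesis
  proof
    show "?L \<subseteq> ?R"
    proof clarify
      fix x assume x: "x \<in> S" "orb (f \<circ> sw a b) x \<notin> orb f ` S - {orb f a, orb f b}"
      then have "x \<in> orb f a \<union> orb f b"
        using m(3)[of x] eq[OF x(1) assms(3)] eq[OF x(1) assms(4)] by auto
      then show "orb (f \<circ> sw a b) x = orb f a \<union> orb f b" by (rule eq')
    qed
    show "?R \<subseteq> ?L"
    proof
      fix C assume "C \<in> ?R"
      then consider "C = orb f a \<union> orb f b" | x where "x \<in> S" "C = orb f x" "C \<noteq> orb f a" "C \<noteq> orb f b"
        by blast
      then show "C \<in> ?L"
      proof cases
        case 1
        then show ?thesis using m(1) assms(3) by (metis imageI)
      next
        case 2
        then have "orb (f \<circ> sw a b) x = C" using m(3)[of x] eq assms(3,4) by metis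
        then show ?thesis using 2 by blast
      qed
    qed
  qed
qed

lemma ncyc_transpose_merge:
  assumes "finite S" "bij_betw f S S" "a \<in> S" "b \<in> S" "b \<notin> orb f a"
  shows "ncyc f S = Suc (ncyc (f \<circ> sw a b) S)"
proof -
  have ne: "orb f a \<noteq> orb f b" using assms(5) orb_refl by blast
  have nin: "orb f a \<union> orb f b \<notin> orb f ` S - {orb f a, orb f b}"
  proof
    assume "orb f a \<union> orb f b \<in> orb f ` S - {orb f a, orb f b}"
    then obtain x where x: "x \<in> S" "orb f x = orb f a \<union> orb f b" "orb f x \<noteq> orb f a" by blast
    then have "a \<in> orb f x" using orb_refl by blast
    then show False using orb_eq[OF assms(1,2) x(1)] x(3) by blast
  qed
  have "card {orb f a, orb f b} \<le> card (orb f ` S)"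
    using assms by (intro card_mono) auto
  then have "card (orb f ` S - {orb f a, orb f b}) + 2 = card (orb f ` S)"
    using ne assms by (subst card_Diff_subset) auto
  then show ?thesis
    using nin assms(1) by (simp add: ncyc_def orbits_transpose_merge[OF assms])
qed

lemma ncyc_transpose_split:
  assumes "finite S" "bij_betw f S S" "a \<in> S" "b \<in> S" "a \<noteq> b" "b \<in> orb f a"
  shows "ncyc (f \<circ> sw a b) S = Suc (ncyc f S)"
  using ncyc_transpose_merge[OF assms(1) bij_betw_comp_transpose[OF assms(2-4)] assms(3,4)
      orb_transpose_split[OF assms]] by (simp add: comp_transpose_twice)

section \<open>Connectedness, legs and Euler's formula\<close>

definition closed2 :: "(nat \<Rightarrow> nat) \<Rightarrow> (nat \<Rightarrow> nat) \<Rightarrow> nat set \<Rightarrow> bool" where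
  "closed2 f g T \<longleftrightarrow> f ` T \<subseteq> T \<and> g ` T \<subseteq> T"

text \<open>For permutations of a finite set, forward closed sets are closed under inverses too, so
  this is transitivity of the group generated by \<open>f\<close> and \<open>g\<close>. Invariant
  sets are easier to transport through cuts than paths are.\<close>

definition conn :: "nat set \<Rightarrow> (nat \<Rightarrow> nat) \<Rightarrow> (nat \<Rightarrow> nat) \<Rightarrow> bool" where
  "conn S f g \<longleftrightarrow> (\<forall>T\<subseteq>S. T \<noteq> {} \<longrightarrow> closed2 f g T \<longrightarrow> T = S)"

lemma connD: "conn S f g \<Longrightarrow> T \<subseteq> S \<Longrightarrow> T \<noteq> {} \<Longrightarrow> closed2 f g T \<Longrightarrow> T = S"
  by (auto simp: conn_def)

lemma bij_restrict:
  assumes "finite S" "bij_betw f S S" "T \<subseteq> S" "f ` T \<subseteq> T"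
  shows "bij_betw f T T"
  unfolding bij_betw_def
  using assms by (meson bij_betw_imp_inj_on endo_inj_surj finite_subset inj_on_subset)

lemma closed_Diff:
  assumes "finite S" "bij_betw f S S" "T \<subseteq> S" "f ` T \<subseteq> T"
  shows "f ` (S - T) \<subseteq> S - T"
proof -
  have "f ` T = T" using bij_restrict[OF assms] by (simp add: bij_betw_def)
  moreover have "f ` (S - T) = f ` S - f ` T"
    using assms by (intro inj_on_image_set_diff[of f S]) (auto simp: bij_betw_def)
  ultimately show ?thesis using assms by (simp add: bij_betw_def)
qed

lemma closed2_Diff:
  assumes "finite S" "bij_betw f S S" "bij_betw g S S" "T \<subseteq> S" "closed2 f g T"
  shows "closed2 f g (S - T)"
  using closed_Diff assms unfolding closed2_def by metis

lemma ncyc_disjoint_union: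
  assumes "finite S" "bij_betw f S S" "T \<subseteq> S" "f ` T \<subseteq> T"
  shows "ncyc f S = ncyc f T + ncyc f (S - T)"
proof -
  have "orb f ` S = orb f ` T \<union> orb f ` (S - T)" using assms(3) by blast
  moreover have "orb f ` T \<inter> orb f ` (S - T) = {}"
    using orb_least[of _ T f] orb_refl[of _ f] assms(4) by fast
  ultimately show ?thesis using assms(1,3)
    by (simp add: ncyc_def card_Un_disjoint finite_subset)
qed

lemma ncyc_cong: "f ` S \<subseteq> S \<Longrightarrow> (\<And>x. x \<in> S \<Longrightarrow> f x = f' x) \<Longrightarrow> ncyc f S = ncyc f' S"
  unfolding ncyc_def by (metis (no_types, lifting) image_cong orb_cong)

lemma closed2_Int: "closed2 f g T \<Longrightarrow> closed2 f g U \<Longrightarrow> closed2 f g (T \<inter> U)"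
  unfolding closed2_def by blast

definition fixpts :: "(nat \<Rightarrow> nat) \<Rightarrow> nat set \<Rightarrow> nat set" where
  "fixpts g S = {x \<in> S. g x = x}"

text \<open>Euler's formula for the face permutation \<open>f\<close>, the edge involution \<open>g\<close> and the vertex
  rotation \<open>f \<circ> g\<close>. Fixed points of \<open>g\<close> are allowed and stand for legs, that is, darts that are not part
  of an edge: cutting an edge turns its two darts into legs.\<close>
definition genus0 :: "(nat \<Rightarrow> nat) \<Rightarrow> (nat \<Rightarrow> nat) \<Rightarrow> nat set \<Rightarrow> bool" where
  "genus0 f g S \<longleftrightarrow> 2 * ncyc f S + 2 * ncyc (f \<circ> g) S + card (fixpts g S) = card S + 4"

text \<open>The edge has the darts \<open>a\<close> and \<open>b = g a\<close>. Composing
  \<open>f\<close> and \<open>g\<close> with the same transposition turns both darts into legs and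
  keeps the vertex rotation \<open>f \<circ> g\<close> on \<open>S\<close>, since \<open>g\<close>
  commutes with the exchange of \<open>a\<close> and \<open>b\<close>. Hence a cut can change only
  the faces and the connectedness.\<close>

locale cut_edge =
  fixes S :: "nat set" and f g :: "nat \<Rightarrow> nat" and a b :: nat
  assumes fin: "finite S" and bij_f: "bij_betw f S S" and bij_g: "bij_betw g S S"
    and invol: "\<And>x. x \<in> S \<Longrightarrow> g (g x) = x" and a: "a \<in> S" and gab: "g a = b" and ab: "a \<noteq> b"
begin

definition f' where "f' = f \<circ> sw a b"
definition g' where "g' = g \<circ> sw a b"

lemma b: "b \<in> S" using a gab bij_g by (auto simp: bij_betw_def)
lemma gba: "g b = a" using invol[OF a] gab by simp
lemma f'_simps: "f' a = f b" "f' b = f a" "x \<noteq> a \<Longrightarrow> x \<noteq> b \<Longrightarrow> f' x = f x"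
  unfolding f'_def by (auto simp: comp_sw_apply)
lemma g'_simps: "g' a = a" "g' b = b" "x \<noteq> a \<Longrightarrow> x \<noteq> b \<Longrightarrow> g' x = g x"
  unfolding g'_def by (auto simp: comp_sw_apply gab gba)
lemma bij_f': "bij_betw f' S S" unfolding f'_def by (rule bij_betw_comp_transpose[OF bij_f a b])
lemma bij_g': "bij_betw g' S S" unfolding g'_def by (rule bij_betw_comp_transpose[OF bij_g a b])
lemma g_other: "x \<in> S \<Longrightarrow> x \<noteq> a \<Longrightarrow> x \<noteq> b \<Longrightarrow> g x \<noteq> a \<and> g x \<noteq> b"
  using invol gab gba by metis

lemma invol': "x \<in> S \<Longrightarrow> g' (g' x) = x"
  using g'_simps g_other invol by metis

lemma fixpts': "fixpts g' S = insert a (insert b (fixpts g S))"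
proof -
  have "x \<in> S \<and> g' x = x \<longleftrightarrow> x = a \<or> x = b \<or> x \<in> S \<and> g x = x" for x
    using g'_simps a b by (cases "x = a"; cases "x = b") auto
  then show ?thesis unfolding fixpts_def by blast
qed

lemma card_fixpts': "card (fixpts g' S) = card (fixpts g S) + 2"
  unfolding fixpts' using fin ab gab gba by (simp add: fixpts_def)

lemma sigma': "x \<in> S \<Longrightarrow> (f' \<circ> g') x = (f \<circ> g) x"
  using f'_simps g'_simps g_other gab gba by (cases "x = a"; cases "x = b") auto

lemma bij_fg': "bij_betw (f' \<circ> g') S S" by (rule bij_betw_trans[OF bij_g' bij_f'])

lemma ncyc_sigma': "ncyc (f' \<circ> g') S = ncyc (f \<circ> g) S"
  by (rule ncyc_cong) (use bij_fg' sigma' in \<open>auto simp: bij_betw_def\<close>)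

text \<open>A set that treats \<open>a\<close> and \<open>b\<close> alike does not notice the cut,
  so questions of connectedness reduce to sets that separate the two darts.\<close>

lemma closed2_iff:
  assumes "a \<in> T \<longleftrightarrow> b \<in> T" shows "closed2 f' g' T \<longleftrightarrow> closed2 f g T"
proof -
  have sT: "sw a b x \<in> T" if "x \<in> T" for x
    using that assms unfolding Transposition.transpose_def by metis
  have "f' x \<in> f ` T" if "x \<in> T" for x
    unfolding f'_def o_apply by (rule imageI[OF sT[OF that]])
  moreover have "g' x \<in> g ` T" if "x \<in> T" for x
    unfolding g'_def o_apply by (rule imageI[OF sT[OF that]])
  moreover have "f x \<in> f' ` T" if "x \<in> T" for x
    using imageI[OF sT[OF that], of f'] by (simp add: f'_def)
  moreover have "g x \<in> g' ` T" if "x \<in> T" for x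
    using imageI[OF sT[OF that], of g'] by (simp add: g'_def)
  ultimately have "f' ` T = f ` T" "g' ` T = g ` T" by blast+
  then show ?thesis unfolding closed2_def by simp
qed

text \<open>A closed set that avoids both darts is closed for \<open>f\<close> and \<open>g\<close>
  as well, hence empty. As \<open>U\<close> contains exactly one of the darts, one of
  \<open>T\<close> and \<open>U - T\<close> avoids both. So a cut creates at most two
  components.\<close>

lemma conn_part:
  assumes c: "conn S f g" and U: "U \<subseteq> S" "closed2 f' g' U" "a \<in> U \<longleftrightarrow> b \<notin> U"
  shows "conn U f' g'"
  unfolding conn_def
proof (intro allI impI)
  fix T assume T: "T \<subseteq> U" "T \<noteq> {}" "closed2 f' g' T"
  have neither: "V = {}" if "V \<subseteq> S" "closed2 f' g' V" "a \<notin> V" "b \<notin> V" for V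
    using closed2_iff[of V] connD[OF c that(1)] a that by auto
  have "closed2 f' g' (U - T)"
    using closed2_Diff[OF finite_subset[OF U(1) fin], of f' g' T] U T
      bij_restrict[OF fin bij_f' U(1)] bij_restrict[OF fin bij_g' U(1)] by (simp add: closed2_def)
  then show "T = U"
    using neither[of T] neither[of "U - T"] T U by blast
qed

lemma conn_cases:
  assumes c: "conn S f g" and nc: "\<not> conn S f' g'"
  obtains T where "T \<subseteq> S" "a \<in> T" "b \<notin> T" "closed2 f' g' T" "conn T f' g'" "conn (S - T) f' g'"
proof -
  obtain T where T: "T \<subseteq> S" "T \<noteq> {}" "closed2 f' g' T" "T \<noteq> S" using nc by (auto simp: conn_def)
  note D = closed2_Diff[OF fin bij_f' bij_g' T(1,3)]
  have "\<not> (a \<in> T \<longleftrightarrow> b \<in> T)" using closed2_iff connD[OF c T(1,2)] T by blast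
  then consider "a \<in> T" "b \<notin> T" | "a \<in> S - T" "b \<notin> S - T" using a b by blast
  then show ?thesis
  proof cases
    case 1
    show ?thesis
      by (rule that[OF T(1) 1 T(3)]; rule conn_part[OF c]) (use T D 1 a b in auto)
  next
    case 2
    have "conn (S - (S - T)) f' g'"
      using T conn_part[OF c T(1,3)] 2 a b by (simp add: double_diff)
    moreover have "conn (S - T) f' g'"
      by (rule conn_part[OF c]) (use T D 2 a b in auto)
    ultimately show ?thesis using that[OF _ 2 D] by blast
  qed
qed

lemma conn_back: "conn S f' g' \<Longrightarrow> conn S f g"
proof -
  assume c: "conn S f' g'"
  show ?thesis unfolding conn_def
  proof (intro allI impI)
    fix T assume T: "T \<subseteq> S" "T \<noteq> {}" "closed2 f g T"
    then have "a \<in> T \<longleftrightarrow> b \<in> T" using gab gba by (auto simp: closed2_def)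
    then show "T = S" using closed2_iff T connD[OF c T(1,2)] by blast
  qed
qed

lemma conn_glue:
  assumes "T \<subseteq> S" "a \<in> T" "b \<notin> T" "closed2 f' g' T" "conn T f' g'" "conn (S - T) f' g'"
  shows "conn S f g"
  unfolding conn_def
proof (intro allI impI)
  fix U assume U: "U \<subseteq> S" "U \<noteq> {}" "closed2 f g U"
  then have ab: "a \<in> U \<longleftrightarrow> b \<in> U" using gab gba by (auto simp: closed2_def)
  then have c: "closed2 f' g' U" using closed2_iff U by blast
  have 1: "U \<inter> T = {} \<or> U \<inter> T = T"
    using connD[OF assms(5), of "U \<inter> T"] closed2_Int[OF c assms(4)] by blast
  have 2: "U \<inter> (S - T) = {} \<or> U \<inter> (S - T) = S - T"
    using connD[OF assms(6), of "U \<inter> (S - T)"]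
      closed2_Int[OF c closed2_Diff[OF fin bij_f' bij_g' assms(1,4)]] by blast
  show "U = S" using 1 2 ab U assms(1-3) b by blast
qed

lemma not_orb: "T \<subseteq> S \<Longrightarrow> a \<in> T \<Longrightarrow> b \<notin> T \<Longrightarrow> closed2 f' g' T \<Longrightarrow> b \<notin> orb f' a"
  using orb_least[of a T f'] by (auto simp: closed2_def)

lemma ncyc_merge: "b \<notin> orb f a \<Longrightarrow> ncyc f S = Suc (ncyc f' S)"
  unfolding f'_def by (rule ncyc_transpose_merge[OF fin bij_f a b])
lemma ncyc_split: "b \<in> orb f a \<Longrightarrow> ncyc f' S = Suc (ncyc f S)"
  unfolding f'_def by (rule ncyc_transpose_split[OF fin bij_f a b ab])
lemma orb_iff: "b \<in> orb f' a \<longleftrightarrow> b \<notin> orb f a"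
  using orb_transpose_merge(1)[OF fin bij_f a b] orb_transpose_split[OF fin bij_f a b ab] orb_refl[of b f]
  unfolding f'_def by blast

lemma fixpts_split: "T \<subseteq> S \<Longrightarrow> card (fixpts g' S) = card (fixpts g' T) + card (fixpts g' (S - T))"
proof -
  assume T: "T \<subseteq> S"
  have "fixpts g' S = fixpts g' T \<union> fixpts g' (S - T)" using T by (auto simp: fixpts_def)
  moreover have "finite T" using T fin finite_subset by blast
  ultimately show ?thesis
    using fin by (simp add: card_Un_disjoint fixpts_def disjoint_iff)
qed

lemma split_counts:
  assumes "T \<subseteq> S" "closed2 f' g' T"
  shows "ncyc f' S = ncyc f' T + ncyc f' (S - T)"
    "ncyc (f' \<circ> g') S = ncyc (f' \<circ> g') T + ncyc (f' \<circ> g') (S - T)"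
    "card S = card T + card (S - T)"
    "card (fixpts g' S) = card (fixpts g' T) + card (fixpts g' (S - T))"
proof -
  show "ncyc f' S = ncyc f' T + ncyc f' (S - T)"
    using assms(2) by (intro ncyc_disjoint_union[OF fin bij_f' assms(1)]) (simp add: closed2_def)
  show "ncyc (f' \<circ> g') S = ncyc (f' \<circ> g') T + ncyc (f' \<circ> g') (S - T)"
    using assms(2) by (intro ncyc_disjoint_union[OF fin bij_fg' assms(1)]) (fastforce simp: closed2_def)
  show "card S = card T + card (S - T)"
    using fin assms(1) by (metis card_Diff_subset card_mono finite_subset le_add_diff_inverse)
qed (rule fixpts_split[OF assms(1)])

end

text \<open>Non-negativity of the genus, by induction on the number of darts that lie in edges. A
  cut keeps the vertices and adds two legs. If the map stays connected, at most one face is lost; if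
  it falls apart, a face is gained, which is paid for by the constant 4 of the second
  component.\<close>

lemma euler_inequality:
  assumes "finite S" "S \<noteq> {}" "bij_betw f S S" "bij_betw g S S" "\<And>x. x \<in> S \<Longrightarrow> g (g x) = x" "conn S f g"
  shows "2 * ncyc f S + 2 * ncyc (f \<circ> g) S + card (fixpts g S) \<le> card S + 4"
  using assms
proof (induction "card S - card (fixpts g S)" arbitrary: S f g rule: less_induct)
  case less
  show ?case
  proof (cases "\<exists>a\<in>S. g a \<noteq> a")
    case False
    then have g: "g x = x" if "x \<in> S" for x using that by blast
    \<comment> \<open>Without edges \<open>g\<close> is the identity on \<open>S\<close>, and
      connectedness makes \<open>f\<close> a single cycle: one face and one vertex.\<close>
    have orb: "orb f x = S" if x: "x \<in> S" for x
    proof (rule connD[OF less.prems(6)])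
      show "orb f x \<subseteq> S" by (rule orb_subset[OF less.prems(3) x])
      then have "g ` orb f x \<subseteq> orb f x" using g by auto
      then show "closed2 f g (orb f x)" by (auto simp: closed2_def intro: orb_step)
    qed (use orb_refl in blast)
    then have "ncyc f S = 1" using less.prems(2) by (simp add: ncyc_def image_constant_conv cong: image_cong)
    moreover have "ncyc (f \<circ> g) S = ncyc f S"
      by (rule ncyc_cong[symmetric]) (use g less.prems(3) in \<open>auto simp: bij_betw_def\<close>)
    moreover have "fixpts g S = S" using g by (auto simp: fixpts_def)
    ultimately show ?thesis by simp
  next
    case True
    then obtain a where a: "a \<in> S" "g a \<noteq> a" by blast
    interpret cut_edge S f g a "g a" by unfold_locales (use less.prems a in auto)
    have fixle: "card (fixpts g' T) \<le> card T" if "T \<subseteq> S" for T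
      using finite_subset[OF that fin] by (auto intro: card_mono simp: fixpts_def)
    have lt: "card S - card (fixpts g' S) < card S - card (fixpts g S)"
      using card_fixpts' fixle[of S] by simp
    show ?thesis
    proof (cases "conn S f' g'")
      case True
      have "2 * ncyc f' S + 2 * ncyc (f' \<circ> g') S + card (fixpts g' S) \<le> card S + 4"
        by (rule less.hyps[OF lt fin less.prems(2) bij_f' bij_g' invol' True])
      moreover have "ncyc f S \<le> Suc (ncyc f' S)" using ncyc_merge ncyc_split by fastforce
      ultimately show ?thesis using ncyc_sigma' card_fixpts' by linarith
    next
      case False
      then obtain T where T: "T \<subseteq> S" "a \<in> T" "g a \<notin> T" "closed2 f' g' T" "conn T f' g'" "conn (S - T) f' g'"
        using conn_cases[OF less.prems(6)] by metis
      note D = closed2_Diff[OF fin bij_f' bij_g' T(1,4)]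
      have IH: "2 * ncyc f' U + 2 * ncyc (f' \<circ> g') U + card (fixpts g' U) \<le> card U + 4"
        if "U \<subseteq> S" "U \<noteq> {}" "closed2 f' g' U" "conn U f' g'" for U
      proof (rule less.hyps)
        have "card (fixpts g' (S - U)) \<le> card (S - U)" by (rule fixle) auto
        then show "card U - card (fixpts g' U) < card S - card (fixpts g S)"
          using lt split_counts[OF that(1,3)] by linarith
        show "finite U" "U \<noteq> {}" "conn U f' g'" using that finite_subset[OF _ fin] by blast+
        show "bij_betw f' U U" "bij_betw g' U U"
          using bij_restrict[OF fin bij_f' that(1)] bij_restrict[OF fin bij_g' that(1)] that(3)
          by (simp_all add: closed2_def)
      qed (use that(1) invol' in blast)
      have "ncyc f' S = Suc (ncyc f S)"
        using not_orb[OF T(1-4)] orb_iff ncyc_split by blast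
      moreover have "T \<noteq> {}" "S - T \<noteq> {}" using T b by blast+
      ultimately show ?thesis
        using IH[OF T(1) _ T(4,5)] IH[OF Diff_subset _ D T(6)] split_counts[OF T(1,4)] ncyc_sigma' card_fixpts'
        by linarith
    qed
  qed
qed

context cut_edge
begin

text \<open>The two sides of the edge lie in different faces. The cut merges them, which lowers the
  left-hand side of Euler's formula by 2, and the two new legs raise it by 2. A disconnected result
  would put \<open>a\<close> and \<open>b\<close> into different cycles of
  \<open>f'\<close>.\<close>

lemma genus0_merge:
  assumes "b \<notin> orb f a"
  shows "conn S f g \<longleftrightarrow> conn S f' g'" "genus0 f g S \<longleftrightarrow> genus0 f' g' S"
proof -
  show "conn S f g \<longleftrightarrow> conn S f' g'"
    using conn_back conn_cases not_orb orb_iff assms by metis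
  show "genus0 f g S \<longleftrightarrow> genus0 f' g' S"
    using ncyc_merge[OF assms] ncyc_sigma' card_fixpts' by (simp add: genus0_def)
qed

lemma euler_part:
  assumes "U \<subseteq> S" "U \<noteq> {}" "closed2 f' g' U" "conn U f' g'"
  shows "2 * ncyc f' U + 2 * ncyc (f' \<circ> g') U + card (fixpts g' U) \<le> card U + 4"
proof (rule euler_inequality)
  show "finite U" using assms(1) fin by (rule finite_subset)
  show "bij_betw f' U U" "bij_betw g' U U"
    using bij_restrict[OF fin bij_f' assms(1)] bij_restrict[OF fin bij_g' assms(1)] assms(3)
    by (simp_all add: closed2_def)
qed (use assms invol' in blast)+

text \<open>A combinatorial Jordan curve theorem: an edge with the same face on both sides is a
  bridge. The cut splits that face, so a connected result would exceed Euler's bound by 4. For two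
  components the bounds add up to an equality, and therefore each is an equality.\<close>

lemma genus0_split:
  assumes o: "b \<in> orb f a" and c: "conn S f g" and p: "genus0 f g S"
  obtains T where "T \<subseteq> S" "a \<in> T" "b \<notin> T" "closed2 f' g' T" "conn T f' g'" "conn (S - T) f' g'"
    "genus0 f' g' T" "genus0 f' g' (S - T)"
proof -
  have "\<not> conn S f' g'"
  proof
    assume "conn S f' g'"
    moreover have "S \<noteq> {}" "closed2 f' g' S" using a bij_f' bij_g' by (auto simp: closed2_def bij_betw_def)
    ultimately show False
      using euler_part[of S] ncyc_split[OF o] p ncyc_sigma' card_fixpts' unfolding genus0_def by simp
  qed
  then obtain T where T: "T \<subseteq> S" "a \<in> T" "b \<notin> T" "closed2 f' g' T" "conn T f' g'" "conn (S - T) f' g'"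
    using conn_cases[OF c] by metis
  note D = closed2_Diff[OF fin bij_f' bij_g' T(1,4)]
  have "T \<noteq> {}" "S - T \<noteq> {}" using T b by blast+
  then have "genus0 f' g' T \<and> genus0 f' g' (S - T)"
    using euler_part[OF T(1) _ T(4,5)] euler_part[OF Diff_subset _ D T(6)] split_counts[OF T(1,4)]
      ncyc_sigma' card_fixpts' ncyc_split[OF o] p unfolding genus0_def by linarith
  then show ?thesis using that T by blast
qed

lemma genus0_glue:
  assumes "T \<subseteq> S" "a \<in> T" "b \<notin> T" "closed2 f' g' T" "conn T f' g'" "conn (S - T) f' g'"
    "genus0 f' g' T" "genus0 f' g' (S - T)"
  shows "b \<in> orb f a" "conn S f g" "genus0 f g S"
proof -
  show o: "b \<in> orb f a" using not_orb[OF assms(1-4)] orb_iff by blast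
  show "conn S f g" by (rule conn_glue[OF assms(1-6)])
  show "genus0 f g S"
    using assms(7,8) split_counts[OF assms(1,4)] ncyc_sigma' card_fixpts' ncyc_split[OF o]
    unfolding genus0_def by linarith
qed

end

section \<open>Labelled planar maps with legs, and the insertion of a leg into a corner\<close>

definition pm :: "nat set \<Rightarrow> nat set \<Rightarrow> ((nat \<Rightarrow> nat) \<times> (nat \<Rightarrow> nat)) set" where
  "pm Z S = {(f, g). f permutes S \<and> g permutes S \<and> (\<forall>x\<in>S. g (g x) = x) \<and> fixpts g S = Z \<and>
    conn S f g \<and> genus0 f g S}"

text \<open>The face degrees are weighted by \<open>h\<close>, and the face of \<open>r\<close> is required to have degree \<open>d\<close>.\<close>
definition fwt :: "(nat \<Rightarrow> real) \<Rightarrow> nat set \<Rightarrow> (nat \<Rightarrow> nat) \<Rightarrow> nat \<Rightarrow> nat \<Rightarrow> real" where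
  "fwt h S f r d = (if card (orb f r) = d then \<Prod>C\<in>orb f ` S - {orb f r}. h (card C) else 0)"

lemma finite_pm: "finite S \<Longrightarrow> finite (pm Z S)"
  by (rule finite_subset[of _ "{f. f permutes S} \<times> {g. g permutes S}"])
    (auto simp: pm_def finite_permutations)

lemma ncyc_insert_fixed:
  assumes "finite S" "f permutes S" "z \<notin> S"
  shows "orb f z = {z}" "ncyc f (insert z S) = Suc (ncyc f S)" "{z} \<notin> orb f ` S"
proof -
  have fz: "f z = z" using assms permutes_not_in by metis
  show o: "orb f z = {z}"
    using orb_least[of z "{z}" f] orb_refl[of z f] fz by blast
  show n: "{z} \<notin> orb f ` S"
    using orb_refl[of _ f] assms(3) by (metis imageE singletonD)
  show "ncyc f (insert z S) = Suc (ncyc f S)"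
    using assms n by (simp add: ncyc_def o)
qed

lemma permutes_comp_sw:
  assumes "f permutes S" "t \<in> S"
  shows "(f \<circ> sw z t) permutes (insert z S)"
  by (rule permutes_compose[OF permutes_swap_id]) (use assms in \<open>auto intro: permutes_subset\<close>)

text \<open>\<open>f \<circ> sw z t\<close> inserts \<open>z\<close> into the cycle of
  \<open>t\<close>, right after \<open>t\<close>: now \<open>t\<close> goes to \<open>z\<close> and
  \<open>z\<close> goes to \<open>f t\<close>. With \<open>z\<close> regarded as a fixed point of
  \<open>f\<close>, this is a merge of two cycles, one of them trivial.\<close>

lemma orbits_insert:
  assumes "finite S" "f permutes S" "z \<notin> S" "t \<in> S"
  shows "orb (f \<circ> sw z t) z = insert z (orb f t)"
    "orb (f \<circ> sw z t) ` insert z S = insert (insert z (orb f t)) (orb f ` S - {orb f t})"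
    "ncyc (f \<circ> sw z t) (insert z S) = ncyc f S"
    "z \<notin> orb f t"
proof -
  have bij: "bij_betw f (insert z S) (insert z S)"
    by (rule permutes_imp_bij[OF permutes_subset[OF assms(2)]]) auto
  have bijS: "bij_betw f S S" by (rule permutes_imp_bij[OF assms(2)])
  note z = ncyc_insert_fixed[OF assms(1-3)]
  show "z \<notin> orb f t" using orb_subset[OF bijS assms(4)] assms(3) by blast
  have tz: "t \<notin> orb f z" using z assms(3,4) by auto
  have fin: "finite (insert z S)" using assms(1) by simp
  note m = fin bij insertI1 insertI2[OF assms(4)] tz
  show "orb (f \<circ> sw z t) z = insert z (orb f t)"
    using orb_transpose_merge(1)[OF m] z(1) by simp
  show "orb (f \<circ> sw z t) ` insert z S = insert (insert z (orb f t)) (orb f ` S - {orb f t})"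
    unfolding orbits_transpose_merge[OF m] using z by auto
  show "ncyc (f \<circ> sw z t) (insert z S) = ncyc f S"
    using ncyc_transpose_merge[OF m] z(2) by simp
qed

lemma fwt_insert:
  assumes "finite S" "f permutes S" "z \<notin> S" "t \<in> S"
  shows "fwt h (insert z S) (f \<circ> sw z t) z (Suc d) = fwt h S f t d"
proof -
  have fin: "finite (orb f t)"
    using finite_subset[OF orb_subset[OF permutes_imp_bij[OF assms(2)] assms(4)] assms(1)] .
  have "insert z (orb f t) \<notin> orb f ` S"
    using orb_subset[OF permutes_imp_bij[OF assms(2)]] assms(3) by fast
  then have "insert (insert z (orb f t)) (orb f ` S - {orb f t}) - {insert z (orb f t)} = orb f ` S - {orb f t}"
    by blast
  then show ?thesis
    using orbits_insert[OF assms] fin by (simp add: fwt_def)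
qed

text \<open>A leg placed after \<open>t\<close> in its face is placed after \<open>g t\<close> in
  the vertex rotation. So it changes neither the number of faces nor the number of vertices.\<close>

lemma comp_sw_invol:
  assumes "\<And>x. g (g x) = x" "g z = z"
  shows "f \<circ> sw z t \<circ> g = f \<circ> g \<circ> sw z (g t)"
proof
  fix x
  have "sw z t (g x) = g (sw z (g t) x)"
    unfolding Transposition.transpose_def using assms by metis
  then show "(f \<circ> sw z t \<circ> g) x = (f \<circ> g \<circ> sw z (g t)) x" by simp
qed

text \<open>Since \<open>z\<close> lies between \<open>t\<close> and \<open>f t\<close>, closed sets
  before and after the insertion correspond: \<open>z\<close> is added exactly to those that contain
  \<open>t\<close>.\<close>

lemma conn_insert:
  assumes f: "f permutes S" and g: "g permutes S" and z: "z \<notin> S" and t: "t \<in> S"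
  shows "conn (insert z S) (f \<circ> sw z t) g \<longleftrightarrow> conn S f g"
proof -
  define F where "F = f \<circ> sw z t"
  have fz: "f z = z" "g z = z" using f g z permutes_not_in by metis+
  have F: "F z = f t" "F t = z" "\<And>x. x \<noteq> z \<Longrightarrow> x \<noteq> t \<Longrightarrow> F x = f x"
    unfolding F_def using fz by (simp_all add: comp_sw_apply)
  have fS: "f x \<in> S \<longleftrightarrow> x \<in> S" "g x \<in> S \<longleftrightarrow> x \<in> S" for x using f g by (simp_all add: permutes_in_image)
  show ?thesis unfolding F_def[symmetric]
  proof
    assume c: "conn (insert z S) F g"
    show "conn S f g" unfolding conn_def
    proof (intro allI impI)
      fix T assume T: "T \<subseteq> S" "T \<noteq> {}" "closed2 f g T"
      define U where "U = (if t \<in> T then insert z T else T)"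
      have "F x \<in> U" "g x \<in> U" if "x \<in> U" for x
      proof -
        have x: "x \<in> T \<or> x = z \<and> t \<in> T" using that by (auto simp: U_def split: if_splits)
        have cl: "f y \<in> T" "g y \<in> T" if "y \<in> T" for y using that T by (auto simp: closed2_def)
        have TU: "T \<subseteq> U" by (auto simp: U_def)
        show "g x \<in> U" using x cl fz that TU by auto
        show "F x \<in> U"
        proof (cases "x = z \<or> x = t")
          case True
          then show ?thesis using x cl F TU z T(1) by (auto simp: U_def)
        next
          case False
          then show ?thesis using F x cl TU by auto
        qed
      qed
      then have "closed2 F g U" by (auto simp: closed2_def)
      moreover have "U \<subseteq> insert z S" "U \<noteq> {}" using T by (auto simp: U_def)
      ultimately have "U = insert z S" using connD[OF c] by blast
      then show "T = S" using z T(1) by (auto simp: U_def split: if_splits)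
    qed
  next
    assume c: "conn S f g"
    show "conn (insert z S) F g" unfolding conn_def
    proof (intro allI impI)
      fix T assume T: "T \<subseteq> insert z S" "T \<noteq> {}" "closed2 F g T"
      have cl: "F y \<in> T" "g y \<in> T" if "y \<in> T" for y using that T by (auto simp: closed2_def)
      have sub: "T - {z} \<subseteq> S" using T by blast
      have "f x \<in> T - {z}" "g x \<in> T - {z}" if x: "x \<in> T - {z}" for x
      proof -
        have "x \<in> S" using x sub by blast
        then show "g x \<in> T - {z}" using fS cl z x by auto
        have "f x \<in> S" using \<open>x \<in> S\<close> fS by blast
        moreover have "f x \<in> T"
        proof (cases "x = t")
          case True
          then have "z \<in> T" using cl[of x] x F by simp
          then show ?thesis using cl[of z] F True by simp
        next
          case False
          then show ?thesis using cl[of x] x F by auto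
        qed
        ultimately show "f x \<in> T - {z}" using z by blast
      qed
      then have "closed2 f g (T - {z})" by (auto simp: closed2_def)
      moreover have "T - {z} \<noteq> {}"
      proof
        assume "T - {z} = {}"
        then have "T = {z}" using T by blast
        then show False using cl[of z] F(1) fS(1)[of t] t z by auto
      qed
      ultimately have "T - {z} = S" using connD[OF c sub] by blast
      then have "t \<in> T" using t by blast
      then have "z \<in> T" using cl[of t] F by simp
      then show "T = insert z S" using \<open>T - {z} = S\<close> by blast
    qed
  qed
qed

lemma pm_insert_iff:
  assumes "finite S" "z \<notin> S" "t \<in> S" "z \<notin> Z" and f: "f permutes S" and g: "g permutes S"
  shows "(f \<circ> sw z t, g) \<in> pm (insert z Z) (insert z S) \<longleftrightarrow> (f, g) \<in> pm Z S"
proof -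
  have gz: "g z = z" using g assms permutes_not_in by metis
  have gp: "g permutes (insert z S)" by (rule permutes_subset[OF g]) auto
  have inv_iff: "(\<forall>x\<in>insert z S. g (g x) = x) \<longleftrightarrow> (\<forall>x\<in>S. g (g x) = x)" using gz by simp
  have fix_eq: "fixpts g (insert z S) = insert z (fixpts g S)" using gz by (auto simp: fixpts_def)
  have zf: "z \<notin> fixpts g S" using assms(2) by (simp add: fixpts_def)
  have fix_iff: "fixpts g (insert z S) = insert z Z \<longleftrightarrow> fixpts g S = Z"
    unfolding fix_eq by (metis zf assms(4) insert_ident)
  have gen: "genus0 (f \<circ> sw z t) g (insert z S) \<longleftrightarrow> genus0 f g S" if "\<forall>x\<in>S. g (g x) = x"
  proof -
    have gg: "g (g x) = x" for x using that g permutes_not_in by metis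
    have "g t \<in> S" using g assms(3) by (simp add: permutes_in_image)
    then have "ncyc (f \<circ> sw z t \<circ> g) (insert z S) = ncyc (f \<circ> g) S"
      unfolding comp_sw_invol[of g z, OF gg gz] using assms f g
      by (intro orbits_insert(3)) (auto intro: permutes_compose)
    moreover have "card (fixpts g (insert z S)) = Suc (card (fixpts g S))"
      unfolding fix_eq using zf assms(1) by (intro card_insert_disjoint) (simp add: fixpts_def)
    ultimately show ?thesis
      using orbits_insert(3)[OF assms(1) f assms(2,3)] assms(1,2) by (simp add: genus0_def ac_simps)
  qed
  show ?thesis
    using permutes_comp_sw[OF f assms(3), of z] f g gp inv_iff fix_iff gen conn_insert[OF f g assms(2,3)]
    unfolding pm_def mem_Collect_eq prod.case by blast
qed

text \<open>A leg occupies exactly one corner and is removed by closing the gap behind its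
  predecessor \<open>t\<close>. Connectedness together with \<open>S \<noteq> {}\<close> excludes
  \<open>t = z\<close>, where the leg would be a component of its own.\<close>

lemma pm_insert_bij:
  assumes "finite S" "S \<noteq> {}" "z \<notin> S" "Z \<subseteq> S"
  shows "bij_betw (\<lambda>(p, t). (fst p \<circ> sw z t, snd p)) (pm Z S \<times> S) (pm (insert z Z) (insert z S))"
proof -
  have zZ: "z \<notin> Z" using assms by blast
  show ?thesis
  proof (rule bij_betwI')
    fix x y assume "x \<in> pm Z S \<times> S" "y \<in> pm Z S \<times> S"
    then obtain f g t f1 g1 t1 where xy: "x = ((f, g), t)" "y = ((f1, g1), t1)"
      and p: "f permutes S" "f1 permutes S" and t: "t \<in> S" "t1 \<in> S" by (auto simp: pm_def)
    have fz: "f z = z" "f1 z = z" using p assms(3) permutes_not_in by metis+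
    have "f = f1 \<and> t = t1" if "f \<circ> sw z t = f1 \<circ> sw z t1"
    proof -
      have "(f \<circ> sw z t) t = z" "(f1 \<circ> sw z t1) t1 = z" using fz by simp_all
      moreover have "inj (f \<circ> sw z t)"
        using permutes_comp_sw[OF p(1) t(1), of z] permutes_inj by blast
      ultimately have "t = t1" using that by (metis injD)
      then show ?thesis using that comp_transpose_twice by metis
    qed
    then show "((case x of (p, t) \<Rightarrow> (fst p \<circ> sw z t, snd p)) = (case y of (p, t) \<Rightarrow> (fst p \<circ> sw z t, snd p)))
      \<longleftrightarrow> x = y"
      unfolding xy by auto
  next
    fix x assume "x \<in> pm Z S \<times> S"
    then obtain f g t where x: "x = ((f, g), t)" "(f, g) \<in> pm Z S" "t \<in> S" by auto
    then show "(case x of (p, t) \<Rightarrow> (fst p \<circ> sw z t, snd p)) \<in> pm (insert z Z) (insert z S)"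
      using pm_insert_iff[OF assms(1,3) x(3) zZ, of f g] by (simp add: pm_def)
  next
    fix y assume "y \<in> pm (insert z Z) (insert z S)"
    then obtain F g where y: "y = (F, g)" and F: "F permutes insert z S" "g permutes insert z S"
      "fixpts g (insert z S) = insert z Z" "conn (insert z S) F g" and Fg: "(F, g) \<in> pm (insert z Z) (insert z S)"
      by (auto simp: pm_def)
    have gz: "g z = z" using F(3) by (auto simp: fixpts_def)
    have gS: "g permutes S" using F(2) gz assms(3) by (auto simp: permutes_superset intro: permutes_superset)
    obtain t where t: "F t = z" using F(1) by (metis permutes_surj surjD)
    have "t \<noteq> z"
    proof
      assume "t = z"
      then have "closed2 F g {z}" using t gz by (simp add: closed2_def)
      then have "{z} = insert z S" using connD[OF F(4)] by blast
      then show False using assms(2,3) by blast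
    qed
    then have tS: "t \<in> S" using t F(1) by (metis insertE insertI1 permutes_in_image)
    define f where "f = F \<circ> sw z t"
    have "f permutes insert z S" unfolding f_def
      by (rule permutes_compose[OF permutes_swap_id F(1)]) (use tS in auto)
    moreover have "f z = z" using t by (simp add: f_def)
    ultimately have fS: "f permutes S" using assms(3) by (auto intro: permutes_superset)
    have "F = f \<circ> sw z t" by (simp add: f_def comp_transpose_twice)
    then have "(f, g) \<in> pm Z S" "y = (case ((f, g), t) of (p, t) \<Rightarrow> (fst p \<circ> sw z t, snd p))"
      using pm_insert_iff[OF assms(1,3) tS zZ fS gS] Fg y by auto
    then show "\<exists>x\<in>pm Z S \<times> S. y = (case x of (p, t) \<Rightarrow> (fst p \<circ> sw z t, snd p))" using tS by blast
  qed
qed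

lemma sum_pm_insert:
  assumes "finite S" "S \<noteq> {}" "z \<notin> S" "Z \<subseteq> S"
  shows "(\<Sum>(F, g)\<in>pm (insert z Z) (insert z S). \<phi> F g) = (\<Sum>(f, g)\<in>pm Z S. \<Sum>t\<in>S. \<phi> (f \<circ> sw z t) g)"
proof -
  have "(\<Sum>(F, g)\<in>pm (insert z Z) (insert z S). \<phi> F g)
    = (\<Sum>(p, t)\<in>pm Z S \<times> S. \<phi> (fst p \<circ> sw z t) (snd p))"
    using sum.reindex_bij_betw[OF pm_insert_bij[OF assms], of "\<lambda>(F, g). \<phi> F g", symmetric]
    by (simp add: case_prod_unfold)
  also have "\<dots> = (\<Sum>p\<in>pm Z S. \<Sum>t\<in>S. \<phi> (fst p \<circ> sw z t) (snd p))"
    by (simp add: sum.cartesian_product)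
  finally show ?thesis by (simp add: case_prod_unfold)
qed

definition legsum :: "(nat \<Rightarrow> real) \<Rightarrow> nat set \<Rightarrow> nat \<Rightarrow> nat \<Rightarrow> real" where
  "legsum h S z d = (\<Sum>(f, g)\<in>pm {z} S. fwt h S f z d)"

text \<open>Rooting at a dart and attaching a leg right after it are the same choice; the leg adds 1
  to the degree of the root face.\<close>

lemma legsum_insert:
  assumes "finite S" "S \<noteq> {}" "z \<notin> S"
  shows "legsum h (insert z S) z (Suc d) = (\<Sum>(f, g)\<in>pm {} S. \<Sum>r\<in>S. fwt h S f r d)"
  unfolding legsum_def
  using sum_pm_insert[OF assms, of "{}" "\<lambda>F g. fwt h (insert z S) F z (Suc d)"] fwt_insert[OF assms(1) _ assms(3)]
  by (auto simp: pm_def intro!: sum.cong)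

section \<open>Deleting a root edge with different faces on its two sides\<close>

definition cutset :: "nat set \<Rightarrow> nat \<Rightarrow> nat \<Rightarrow> ((nat \<Rightarrow> nat) \<times> (nat \<Rightarrow> nat)) set" where
  "cutset S r r' = {(f, g) \<in> pm {} S. g r = r'}"

lemma cut_edge_of_cutset:
  assumes "finite S" "(f, g) \<in> cutset S r r'" "r \<in> S"
  shows "cut_edge S f g r r'"
proof
  show "bij_betw f S S" "bij_betw g S S"
    using assms by (auto simp: cutset_def pm_def intro: permutes_imp_bij)
  show "r \<noteq> r'" using assms by (auto simp: cutset_def pm_def fixpts_def)
qed (use assms in \<open>auto simp: cutset_def pm_def\<close>)

lemma sw_fixed_comp:
  assumes "g r = r" "g r' = r'"
  shows "(g \<circ> sw r r') r = r'" "(g \<circ> sw r r') r' = r"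
  using assms by simp_all

lemma cut_edge_glue:
  assumes "finite S" "r \<in> S" "r' \<in> S" "r \<noteq> r'" "f permutes S" "g permutes S"
    "\<forall>x\<in>S. g (g x) = x" "g r = r" "g r' = r'"
  shows "cut_edge S (f \<circ> sw r r') (g \<circ> sw r r') r r'"
    "cut_edge.f' (f \<circ> sw r r') r r' = f" "cut_edge.g' (g \<circ> sw r r') r r' = g"
proof -
  show c: "cut_edge S (f \<circ> sw r r') (g \<circ> sw r r') r r'"
  proof
    show "bij_betw (f \<circ> sw r r') S S" "bij_betw (g \<circ> sw r r') S S"
      using bij_betw_comp_transpose[OF permutes_imp_bij] assms by blast+
    fix x assume x: "x \<in> S"
    show "(g \<circ> sw r r') ((g \<circ> sw r r') x) = x"
    proof (cases "x = r \<or> x = r'")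
      case True
      then show ?thesis using assms(8,9) by auto
    next
      case False
      then have "g x \<noteq> r" "g x \<noteq> r'" using assms(7)[rule_format, OF x] assms(8,9) by metis+
      then show ?thesis using False assms(7)[rule_format, OF x] by simp
    qed
  qed (use assms in auto)
  show "cut_edge.f' (f \<circ> sw r r') r r' = f" "cut_edge.g' (g \<circ> sw r r') r r' = g"
    unfolding cut_edge.f'_def[OF c] cut_edge.g'_def[OF c] by (simp_all add: comp_transpose_twice)
qed

lemma permutes_comp_sw_same:
  "f permutes S \<Longrightarrow> a \<in> S \<Longrightarrow> b \<in> S \<Longrightarrow> (f \<circ> sw a b) permutes S"
  by (rule permutes_compose[OF permutes_swap_id])

text \<open>The same map serves in both directions, as a transposition is its own inverse. By
  \<open>orb_iff\<close> the two conditions on \<open>r'\<close> are exchanged: two legs in a common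
  face become an edge between two faces, and conversely.\<close>

lemma cut_merge_bij:
  assumes "finite S" "r \<in> S" "r' \<in> S" "r \<noteq> r'"
  shows "bij_betw (\<lambda>p. (fst p \<circ> sw r r', snd p \<circ> sw r r')) {(f, g) \<in> pm {r, r'} S. r' \<in> orb f r}
     {(f, g) \<in> cutset S r r'. r' \<notin> orb f r}"
proof (rule bij_betw_byWitness[where f' = "\<lambda>p. (fst p \<circ> sw r r', snd p \<circ> sw r r')"])
  show "(\<lambda>p. (fst p \<circ> sw r r', snd p \<circ> sw r r')) ` {(f, g) \<in> pm {r, r'} S. r' \<in> orb f r}
    \<subseteq> {(f, g) \<in> cutset S r r'. r' \<notin> orb f r}"
  proof (rule image_subsetI)
    fix p assume "p \<in> {(f, g) \<in> pm {r, r'} S. r' \<in> orb f r}"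
    then obtain f g where p: "p = (f, g)" and fg: "(f, g) \<in> pm {r, r'} S" and o: "r' \<in> orb f r" by blast
    then have f: "f permutes S" "g permutes S" "\<forall>x\<in>S. g (g x) = x" "fixpts g S = {r, r'}"
      "conn S f g" "genus0 f g S" by (auto simp: pm_def)
    have gr: "g r = r" "g r' = r'" using f(4) by (auto simp: fixpts_def)
    note c = cut_edge_glue[OF assms f(1-3) gr]
    have o': "r' \<notin> orb (f \<circ> sw r r') r" using cut_edge.orb_iff[OF c(1)] o c(2) by simp
    have fx: "fixpts (g \<circ> sw r r') S = {}"
    proof -
      have "r \<notin> fixpts (g \<circ> sw r r') S" "r' \<notin> fixpts (g \<circ> sw r r') S"
        using assms(4) sw_fixed_comp[OF gr] by (auto simp: fixpts_def)
      moreover have "insert r (insert r' (fixpts (g \<circ> sw r r') S)) = {r, r'}"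
        using cut_edge.fixpts'[OF c(1)] f(4) c(3) by metis
      ultimately show ?thesis by (metis insertE insertI1 insertI2 singletonD subsetI subset_empty)
    qed
    have "conn S (f \<circ> sw r r') (g \<circ> sw r r')" "genus0 (f \<circ> sw r r') (g \<circ> sw r r') S"
      using cut_edge.genus0_merge[OF c(1) o'] f(5,6) unfolding c(2,3) by simp_all
    then have "(f \<circ> sw r r', g \<circ> sw r r') \<in> cutset S r r'"
      using fx permutes_comp_sw_same[OF f(1) assms(2,3)] permutes_comp_sw_same[OF f(2) assms(2,3)]
        cut_edge.invol[OF c(1)] sw_fixed_comp[OF gr] by (simp add: cutset_def pm_def)
    then show "(fst p \<circ> sw r r', snd p \<circ> sw r r') \<in> {(f, g) \<in> cutset S r r'. r' \<notin> orb f r}"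
      using o' by (simp add: p)
  qed
  show "(\<lambda>p. (fst p \<circ> sw r r', snd p \<circ> sw r r')) ` {(f, g) \<in> cutset S r r'. r' \<notin> orb f r}
    \<subseteq> {(f, g) \<in> pm {r, r'} S. r' \<in> orb f r}"
  proof (rule image_subsetI)
    fix p assume "p \<in> {(f, g) \<in> cutset S r r'. r' \<notin> orb f r}"
    then obtain f g where p: "p = (f, g)" and fg: "(f, g) \<in> cutset S r r'" and o: "r' \<notin> orb f r" by blast
    then have f: "f permutes S" "g permutes S" "fixpts g S = {}" "conn S f g" "genus0 f g S"
      by (auto simp: cutset_def pm_def)
    interpret cut_edge S f g r r' by (rule cut_edge_of_cutset[OF assms(1) fg assms(2)])
    have "fixpts g' S = {r, r'}" using fixpts' f(3) by simp
    then have "(f', g') \<in> pm {r, r'} S"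
      using genus0_merge[OF o] f invol' permutes_comp_sw_same[OF f(1) assms(2,3)] permutes_comp_sw_same[OF f(2) assms(2,3)]
      by (simp add: pm_def f'_def g'_def)
    moreover have "r' \<in> orb f' r" using orb_iff o by simp
    ultimately show "(fst p \<circ> sw r r', snd p \<circ> sw r r') \<in> {(f, g) \<in> pm {r, r'} S. r' \<in> orb f r}"
      by (simp add: f'_def g'_def p)
  qed
qed (simp_all add: comp_transpose_twice)

lemma orb_period:
  assumes "finite S" "bij_betw f S S" "r \<in> S"
  shows "(f ^^ card (orb f r)) r = r" "inj_on (\<lambda>i. (f ^^ i) r) {..<card (orb f r)}"
    "orb f r = (\<lambda>i. (f ^^ i) r) ` {..<card (orb f r)}"
proof -
  define m where "m = (LEAST m. m > 0 \<and> (f ^^ m) r = r)"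
  have m: "m > 0" "(f ^^ m) r = r"
    using LeastI_ex[OF ex_period[OF assms]] unfolding m_def by blast+
  have least: "\<not> (i > 0 \<and> (f ^^ i) r = r)" if "i < m" for i
    using that not_less_Least unfolding m_def by blast
  have neq: "(f ^^ i) r \<noteq> (f ^^ j) r" if "i < j" "j < m" for i j
  proof
    assume "(f ^^ i) r = (f ^^ j) r"
    also have "(f ^^ j) r = (f ^^ i) ((f ^^ (j - i)) r)"
      using that funpow_diff[of "j - i" j f r] by simp
    finally have "(f ^^ (j - i)) r = r"
      using funpow_inj_on[OF assms(2,3) funpow_mem[OF assms(2,3)]] by metis
    moreover have "j - i > 0" "j - i < m" using that by linarith+
    ultimately show False using least by blast
  qed
  then have inj: "inj_on (\<lambda>i. (f ^^ i) r) {..<m}"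
    unfolding inj_on_def by (metis lessThan_iff linorder_neqE_nat)
  have "orb f r \<subseteq> (\<lambda>i. (f ^^ i) r) ` {..<m}"
  proof (rule orb_least)
    show "r \<in> (\<lambda>i. (f ^^ i) r) ` {..<m}" using m by (intro image_eqI[of _ _ 0]) auto
    show "f ` (\<lambda>i. (f ^^ i) r) ` {..<m} \<subseteq> (\<lambda>i. (f ^^ i) r) ` {..<m}"
    proof -
      have "f ((f ^^ i) r) \<in> (\<lambda>i. (f ^^ i) r) ` {..<m}" if i: "i < m" for i
      proof (cases "Suc i = m")
        case True
        then have "f ((f ^^ i) r) = (f ^^ 0) r" using m(2) by auto
        then show ?thesis using m(1) by (intro image_eqI[of _ _ 0]) auto
      next
        case False
        then show ?thesis using i by (intro image_eqI[of _ _ "Suc i"]) auto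
      qed
      then show ?thesis by blast
    qed
  qed
  then have eq: "orb f r = (\<lambda>i. (f ^^ i) r) ` {..<m}" by (auto simp: orb_def)
  then have "card (orb f r) = m" using card_image[OF inj] by simp
  then show "(f ^^ card (orb f r)) r = r" "inj_on (\<lambda>i. (f ^^ i) r) {..<card (orb f r)}"
    "orb f r = (\<lambda>i. (f ^^ i) r) ` {..<card (orb f r)}"
    using m inj eq by simp_all
qed

lemma orb_funpow_bij:
  assumes "finite S" "bij_betw f S S" "r \<in> S"
  shows "bij_betw (\<lambda>k. (f ^^ (k - 1)) r) {1..card (orb f r)} (orb f r)"
proof (rule bij_betw_trans[where g = "\<lambda>i. (f ^^ i) r" and f = "\<lambda>k. k - 1", unfolded o_def])
  show "bij_betw (\<lambda>k. k - 1) {1..card (orb f r)} {..<card (orb f r)}"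
    by (rule bij_betw_byWitness[where f' = Suc]) auto
  show "bij_betw (\<lambda>i. (f ^^ i) r) {..<card (orb f r)} (orb f r)"
    using orb_period(2,3)[OF assms] by (simp add: bij_betw_def)
qed

text \<open>The leg \<open>z\<close> is put right after \<open>(f ^^ (k - 1)) r\<close> and then
  joined to \<open>r\<close>. The new edge divides the enlarged face of length
  \<open>card (orb f r) + 1\<close> into the cycle of \<open>z\<close>, consisting of
  \<open>z\<close> and the first \<open>k - 1\<close> successors of \<open>r\<close>, and the rest,
  which contains \<open>r\<close>.\<close>

lemma orb_insert_cut:
  assumes "finite S" "f permutes S" "r \<in> S" "z \<notin> S" and k: "1 \<le> k" "k \<le> card (orb f r)"
  defines "F \<equiv> f \<circ> sw z ((f ^^ (k - 1)) r) \<circ> sw r z"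
  shows "card (orb F z) = k" "card (orb F r) = Suc (card (orb f r)) - k"
    "orb F ` insert z S - {orb F r} = insert (orb F z) (orb f ` S - {orb f r})"
    "orb F z \<notin> orb f ` S - {orb f r}"
proof -
  define M where "M = card (orb f r)"
  define t where "t = (f ^^ (k - 1)) r"
  define G where "G = f \<circ> sw z t"
  note bij = permutes_imp_bij[OF assms(2)]
  note per = orb_period[OF assms(1) bij assms(3), folded M_def]
  have mem: "(f ^^ i) r \<in> S" for i by (rule funpow_mem[OF bij assms(3)])
  then have nz: "(f ^^ i) r \<noteq> z" for i using assms(4) by metis
  have inj: "(f ^^ i) r = (f ^^ j) r \<longleftrightarrow> i = j" if "i < M" "j < M" for i j
    using per(2) that by (auto simp: inj_on_def)
  have kM: "k \<le> M" using k by (simp add: M_def)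
  have fz: "f z = z" using assms(2,4) permutes_not_in by metis
  have rz: "r \<noteq> z" using assms(3,4) by blast
  have tS: "t \<in> S" using mem by (simp add: t_def)
  have ot: "orb f t = orb f r"
  proof (rule orb_eq[OF assms(1) bij assms(3)])
    show "t \<in> orb f r" unfolding t_def orb_def by blast
  qed
  have FG: "F = G \<circ> sw r z" by (simp add: F_def G_def t_def)
  define e where "e i = (if i = 0 then z else (f ^^ i) r)" for i :: nat
  have Fe: "F (e i) = e (if Suc i = k then 0 else Suc i)" if i: "i < k" for i
  proof (cases "i = 0")
    case True
    have "F z = G r" unfolding FG by simp
    also have "G r = (if k = 1 then z else f r)"
    proof (cases "k = 1")
      case True
      then show ?thesis using fz by (simp add: G_def t_def)
    next
      case False
      then have "t \<noteq> r" using inj[of "k - 1" 0] k kM by (simp add: t_def)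
      then show ?thesis using False rz by (simp add: G_def)
    qed
    finally show ?thesis using True by (auto simp: e_def)
  next
    case False
    have "(f ^^ i) r \<noteq> r" using inj[of i 0] False i kM by simp
    then have 1: "F ((f ^^ i) r) = G ((f ^^ i) r)" unfolding FG using nz by simp
    show ?thesis
    proof (cases "Suc i = k")
      case True
      then have "(f ^^ i) r = t" by (auto simp: t_def)
      then have "G ((f ^^ i) r) = z" using fz by (simp add: G_def)
      then show ?thesis using 1 True False by (simp add: e_def)
    next
      case nk: False
      then have "(f ^^ i) r \<noteq> t" using inj[of i "k - 1"] i k kM by (simp add: t_def)
      then have "G ((f ^^ i) r) = (f ^^ Suc i) r" using nz by (simp add: G_def)
      then show ?thesis using 1 nk False by (simp add: e_def)
    qed
  qed
  have oz: "orb F z = e ` {..<k}"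
  proof
    show "orb F z \<subseteq> e ` {..<k}"
    proof (rule orb_least)
      show "z \<in> e ` {..<k}" using k by (intro image_eqI[of _ _ 0]) (auto simp: e_def)
      show "F ` e ` {..<k} \<subseteq> e ` {..<k}" using Fe k by (auto split: if_splits)
    qed
    have "e i \<in> orb F z" if "i < k" for i
      using that
    proof (induction i)
      case 0
      then show ?case using orb_refl by (simp add: e_def)
    next
      case (Suc i)
      then have "F (e i) \<in> orb F z" using orb_step by simp
      then show ?case using Fe[of i] Suc.prems by simp
    qed
    then show "e ` {..<k} \<subseteq> orb F z" by auto
  qed
  have "inj_on e {..<k}"
    using inj nz kM by (auto simp: inj_on_def e_def)
  then show cz: "card (orb F z) = k" using oz card_image by force
  let ?S = "insert z S"
  have fin: "finite ?S" using assms(1) by simp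
  have bG: "bij_betw G ?S ?S"
    unfolding G_def by (rule permutes_imp_bij[OF permutes_comp_sw[OF assms(2) tS]])
  have rS: "r \<in> ?S" "z \<in> ?S" using assms(3) by auto
  note oi = orbits_insert[OF assms(1,2,4) tS, folded G_def, unfolded ot]
  have oGr: "r \<in> orb G z" using oi(1) orb_refl by blast
  then have GG: "orb G r = orb G z" "z \<in> orb G r"
    using orb_eq[OF fin bG rS(2)] orb_sym[OF fin bG rS(2)] by blast+
  have bF: "bij_betw F ?S ?S" unfolding FG by (rule bij_betw_comp_transpose[OF bG rS])
  have zF: "z \<notin> orb F r" unfolding FG by (rule orb_transpose_split[OF fin bG rS rz GG(2)])
  have FF: "F \<circ> sw r z = G" unfolding FG by (rule comp_transpose_twice)
  note mg = orb_transpose_merge(1)[OF fin bF rS zF, unfolded FF]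
    orbits_transpose_merge[OF fin bF rS zF, unfolded FF]
  have U: "orb F r \<union> orb F z = insert z (orb f r)" using mg(1) GG(1) oi(1) by simp
  have dis: "orb F r \<inter> orb F z = {}"
    using orb_disj[OF fin bF rS] zF orb_refl by blast
  have finr: "finite (orb f r)" using per(3) by (metis finite_imageI finite_lessThan)
  then have "finite (orb F r)" "finite (orb F z)" using U by (metis finite_Un finite_insert)+
  then have "card (orb F r) + k = Suc (card (orb f r))"
    using card_Un_disjoint[OF _ _ dis] U cz oi(4) finr by simp
  then show "card (orb F r) = Suc (card (orb f r)) - k" by simp
  have z1: "C \<subseteq> S" if "C \<in> orb f ` S" for C using orb_subset[OF bij] that by blast
  have n1: "insert z (orb f r) \<notin> orb f ` S - {orb f r}" using z1 assms(4) by blast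
  have zz: "z \<in> orb F z" by (rule orb_refl)
  show "orb F z \<notin> orb f ` S - {orb f r}" using z1 assms(4) zz by blast
  have n2: "insert z (orb f r) \<notin> orb F ` ?S - {orb F r, orb F z}"
  proof
    assume "insert z (orb f r) \<in> orb F ` ?S - {orb F r, orb F z}"
    then obtain x where x: "x \<in> ?S" "orb F x = insert z (orb f r)" "orb F x \<noteq> orb F z" by blast
    then have "z \<in> orb F x" by blast
    then show False using orb_eq[OF fin bF x(1)] x(3) by blast
  qed
  have "orb F ` ?S - {orb F r, orb F z} = orb f ` S - {orb f r}"
    using mg(2) oi(2) n1 n2 unfolding U by (metis insert_ident)
  moreover have "orb F z \<in> orb F ` ?S" "orb F z \<noteq> orb F r" using zz zF by blast+
  ultimately show "orb F ` ?S - {orb F r} = insert (orb F z) (orb f ` S - {orb f r})" by blast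
qed

text \<open>Cutting the edge leaves the legs \<open>r\<close> and \<open>r'\<close> in one face.
  Removing \<open>r'\<close> as well gives a map with the single leg \<open>r\<close>. The places
  for \<open>r'\<close> in the face of \<open>r\<close> are numbered by \<open>k\<close>, and this
  \<open>k\<close> is the degree of the non-root face that the edge bounds, whence the factor
  \<open>h k\<close>.\<close>

lemma sum_cut_merge:
  assumes "finite S" "r \<in> S" "r' \<in> S" "r \<noteq> r'" "d \<ge> 1"
  shows "(\<Sum>(f, g)\<in>{(f, g) \<in> cutset S r r'. r' \<notin> orb f r}. fwt h S f r d)
    = (\<Sum>k=1..card S. h k * legsum h (S - {r'}) r (d + k - 1))"
proof -
  define T where "T = S - {r'}"
  have T: "finite T" "T \<noteq> {}" "r' \<notin> T" "{r} \<subseteq> T" "insert r' T = S" "r \<in> T"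
    using assms by (auto simp: T_def)
  have "(\<Sum>(f, g)\<in>{(f, g) \<in> cutset S r r'. r' \<notin> orb f r}. fwt h S f r d)
    = (\<Sum>(f, g)\<in>{(f, g) \<in> pm {r, r'} S. r' \<in> orb f r}. fwt h S (f \<circ> sw r r') r d)"
    using sum.reindex_bij_betw[OF cut_merge_bij[OF assms(1-4)], of "\<lambda>(f, g). fwt h S f r d", symmetric]
    by (simp add: case_prod_unfold)
  also have "\<dots> = (\<Sum>(f, g)\<in>pm {r, r'} S. if r' \<in> orb f r then fwt h S (f \<circ> sw r r') r d else 0)"
    by (rule sum.mono_neutral_cong_left) (use finite_pm[OF assms(1)] in \<open>auto split: if_splits\<close>)
  also have "\<dots> = (\<Sum>(f, g)\<in>pm (insert r' {r}) (insert r' T). if r' \<in> orb f r then fwt h S (f \<circ> sw r r') r d else 0)"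
    using T(5) by (simp add: insert_commute)
  also have "\<dots> = (\<Sum>(f, g)\<in>pm {r} T. \<Sum>t\<in>T. if r' \<in> orb (f \<circ> sw r' t) r then fwt h S (f \<circ> sw r' t \<circ> sw r r') r d else 0)"
    by (rule sum_pm_insert[OF T(1-4)])
  also have "\<dots> = (\<Sum>(f, g)\<in>pm {r} T. \<Sum>k=1..card S. h k * fwt h T f r (d + k - 1))"
  proof (intro sum.cong refl, clarify)
    fix f g assume "(f, g) \<in> pm {r} T"
    then have f: "f permutes T" by (simp add: pm_def)
    note bij = permutes_imp_bij[OF f]
    have fS: "f permutes S" by (rule permutes_subset[OF f]) (use T in blast)
    have iff: "r' \<in> orb (f \<circ> sw r' t) r \<longleftrightarrow> t \<in> orb f r" if t: "t \<in> T" for t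
    proof -
      have F: "bij_betw (f \<circ> sw r' t) S S"
        using permutes_imp_bij[OF permutes_comp_sw[OF f t, of r']] T(5) by simp
      have "r' \<in> orb (f \<circ> sw r' t) r \<longleftrightarrow> r \<in> orb (f \<circ> sw r' t) r'"
        using orb_sym[OF assms(1) F] assms(2,3) by blast
      also have "\<dots> \<longleftrightarrow> r \<in> orb f t" unfolding orbits_insert(1)[OF T(1) f T(3) t] using assms(4) by simp
      also have "\<dots> \<longleftrightarrow> t \<in> orb f r" using orb_sym[OF T(1) bij] t T(6) by blast
      finally show ?thesis .
    qed
    have oT: "orb f r \<subseteq> T" by (rule orb_subset[OF bij T(6)])
    have cT: "card (orb f r) \<le> card S" using oT T assms(1) by (intro card_mono) auto
    have "(\<Sum>t\<in>T. if r' \<in> orb (f \<circ> sw r' t) r then fwt h S (f \<circ> sw r' t \<circ> sw r r') r d else 0)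
      = (\<Sum>t\<in>orb f r. fwt h S (f \<circ> sw r' t \<circ> sw r r') r d)"
      by (rule sum.mono_neutral_cong_right) (use T(1) oT iff in auto)
    also have "\<dots> = (\<Sum>k=1..card (orb f r). fwt h S (f \<circ> sw r' ((f ^^ (k - 1)) r) \<circ> sw r r') r d)"
      by (rule sum.reindex_bij_betw[OF orb_funpow_bij[OF T(1) bij T(6)], symmetric])
    also have "\<dots> = (\<Sum>k=1..card (orb f r). h k * fwt h T f r (d + k - 1))"
    proof (rule sum.cong[OF refl])
      fix k assume "k \<in> {1..card (orb f r)}"
      then have k: "1 \<le> k" "k \<le> card (orb f r)" by auto
      define F where "F = f \<circ> sw r' ((f ^^ (k - 1)) r) \<circ> sw r r'"
      note o = orb_insert_cut[OF T(1) f T(6) T(3) k, folded F_def, unfolded T(5)]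
      have "finite (orb f ` T - {orb f r})" using T(1) by simp
      then have 1: "(\<Prod>C\<in>orb F ` S - {orb F r}. h (card C)) = h k * (\<Prod>C\<in>orb f ` T - {orb f r}. h (card C))"
        unfolding o(3) using o(4) by (subst prod.insert) (simp_all only: o(1) not_False_eq_True)
      have 2: "Suc (card (orb f r)) - k = d \<longleftrightarrow> card (orb f r) = d + k - 1" using k assms(5) by linarith
      show "fwt h S (f \<circ> sw r' ((f ^^ (k - 1)) r) \<circ> sw r r') r d = h k * fwt h T f r (d + k - 1)"
        unfolding F_def[symmetric] fwt_def o(2) 1 2 by simp
    qed
    \<comment> \<open>Extending the range is harmless: for \<open>k\<close> beyond the length of the
      face, \<open>d + k - 1\<close> exceeds that length because \<open>d \<ge> 1\<close>, and
      \<open>fwt\<close> is 0.\<close>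
    also have "\<dots> = (\<Sum>k=1..card S. h k * fwt h T f r (d + k - 1))"
      by (rule sum.mono_neutral_left) (use cT assms(5) in \<open>auto simp: fwt_def\<close>)
    finally show "(\<Sum>t\<in>T. if r' \<in> orb (f \<circ> sw r' t) r then fwt h S (f \<circ> sw r' t \<circ> sw r r') r d else 0)
      = (\<Sum>k=1..card S. h k * fwt h T f r (d + k - 1))" .
  qed
  also have "\<dots> = (\<Sum>k=1..card S. h k * legsum h T r (d + k - 1))"
    unfolding legsum_def sum_distrib_left case_prod_unfold by (rule sum.swap)
  finally show ?thesis by (simp add: T_def)
qed

section \<open>Deleting a root edge that is a bridge\<close>

lemma conn_cong:
  assumes "\<And>x. x \<in> S \<Longrightarrow> f x = f1 x" "\<And>x. x \<in> S \<Longrightarrow> g x = g1 x"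
  shows "conn S f g \<longleftrightarrow> conn S f1 g1"
proof -
  have "closed2 f g T \<longleftrightarrow> closed2 f1 g1 T" if "T \<subseteq> S" for T
  proof -
    have "f ` T = f1 ` T" "g ` T = g1 ` T" using that assms by (auto intro!: image_cong)
    then show ?thesis by (simp add: closed2_def)
  qed
  then show ?thesis unfolding conn_def by blast
qed

lemma genus0_cong:
  assumes "f1 ` S \<subseteq> S" "g1 ` S \<subseteq> S" "\<And>x. x \<in> S \<Longrightarrow> f x = f1 x" "\<And>x. x \<in> S \<Longrightarrow> g x = g1 x"
  shows "genus0 f g S \<longleftrightarrow> genus0 f1 g1 S"
proof -
  have "ncyc f1 S = ncyc f S" by (rule ncyc_cong) (use assms in auto)
  moreover have "ncyc (f1 \<circ> g1) S = ncyc (f \<circ> g) S"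
  proof (rule ncyc_cong)
    show "(f1 \<circ> g1) ` S \<subseteq> S" using assms(1,2) by fastforce
    show "(f1 \<circ> g1) x = (f \<circ> g) x" if "x \<in> S" for x
      using that assms by (simp add: image_subset_iff)
  qed
  moreover have "fixpts g S = fixpts g1 S" using assms(4) by (auto simp: fixpts_def)
  ultimately show ?thesis by (simp add: genus0_def)
qed

definition restr :: "(nat \<Rightarrow> nat) \<Rightarrow> nat set \<Rightarrow> nat \<Rightarrow> nat" where
  "restr f T = (\<lambda>x. if x \<in> T then f x else x)"

lemma restr_permutes:
  assumes "bij_betw f S S" "finite S" "T \<subseteq> S" "f ` T \<subseteq> T"
  shows "restr f T permutes T"
proof (rule bij_imp_permutes)
  show "bij_betw (restr f T) T T"
    using bij_restrict[OF assms(2,1,3,4)] by (rule bij_betw_cong[THEN iffD1, rotated]) (simp add: restr_def)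
qed (simp add: restr_def)

lemma permutes_disjoint_comp:
  assumes "f1 permutes T" "f2 permutes U" "T \<inter> U = {}"
  shows "x \<in> T \<Longrightarrow> (f1 \<circ> f2) x = f1 x" "x \<in> U \<Longrightarrow> (f1 \<circ> f2) x = f2 x" "(f1 \<circ> f2) permutes (T \<union> U)"
proof -
  show "(f1 \<circ> f2) x = f1 x" if "x \<in> T"
  proof -
    have "x \<notin> U" using that assms(3) by blast
    then show ?thesis using permutes_not_in[OF assms(2)] by simp
  qed
  show "(f1 \<circ> f2) x = f2 x" if x: "x \<in> U"
  proof -
    have "f2 x \<in> U" using x assms(2) by (simp add: permutes_in_image)
    then show ?thesis using assms permutes_not_in[OF assms(1), of "f2 x"] by auto
  qed
  show "(f1 \<circ> f2) permutes (T \<union> U)"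
    by (rule permutes_compose) (use assms in \<open>auto intro: permutes_subset\<close>)
qed

type_synonym gmap = "(nat \<Rightarrow> nat) \<times> (nat \<Rightarrow> nat)"

text \<open>The component of \<open>r\<close> after the cut is recorded by its dart set
  \<open>T\<close>; given \<open>T\<close>, the two components are independent maps with one leg
  each.\<close>

definition splits :: "nat set \<Rightarrow> nat \<Rightarrow> nat \<Rightarrow> (nat set \<times> gmap \<times> gmap) set" where
  "splits S r r' = (SIGMA T:{T. T \<subseteq> S \<and> r \<in> T \<and> r' \<notin> T}. pm {r} T \<times> pm {r'} (S - T))"

definition glue :: "nat \<Rightarrow> nat \<Rightarrow> nat set \<times> gmap \<times> gmap \<Rightarrow> gmap" where
  "glue r r' x = (case x of (T, (f1, g1), (f2, g2)) \<Rightarrow> (f1 \<circ> f2 \<circ> sw r r', g1 \<circ> g2 \<circ> sw r r'))"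

text \<open>\<open>f1\<close> and \<open>f2\<close> are the identity off their own parts, so their
  composition is the disjoint union of the two permutations; likewise for \<open>g1\<close> and
  \<open>g2\<close>.\<close>

locale split_pair =
  fixes S T :: "nat set" and f1 g1 f2 g2 :: "nat \<Rightarrow> nat" and r r' :: nat
  assumes fin: "finite S" and T: "T \<subseteq> S" "r \<in> T" "r' \<notin> T" "r' \<in> S"
    and p1: "(f1, g1) \<in> pm {r} T" and p2: "(f2, g2) \<in> pm {r'} (S - T)"
begin

definition F where "F = f1 \<circ> f2"
definition G where "G = g1 \<circ> g2"

lemma perms: "f1 permutes T" "g1 permutes T" "f2 permutes (S - T)" "g2 permutes (S - T)"
  using p1 p2 by (auto simp: pm_def)
lemma F_on: "x \<in> T \<Longrightarrow> F x = f1 x" "x \<in> S - T \<Longrightarrow> F x = f2 x"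
  unfolding F_def using permutes_disjoint_comp(1,2)[OF perms(1,3)] by auto
lemma G_on: "x \<in> T \<Longrightarrow> G x = g1 x" "x \<in> S - T \<Longrightarrow> G x = g2 x"
  unfolding G_def using permutes_disjoint_comp(1,2)[OF perms(2,4)] by auto
lemma F_perm: "F permutes S" and G_perm: "G permutes S"
  unfolding F_def G_def using permutes_disjoint_comp(3)[OF perms(1,3)] permutes_disjoint_comp(3)[OF perms(2,4)] T(1)
  by (simp_all add: Un_absorb1)
lemma im: "f1 ` T \<subseteq> T" "g1 ` T \<subseteq> T" "f2 ` (S - T) \<subseteq> S - T" "g2 ` (S - T) \<subseteq> S - T"
  using perms by (simp_all add: permutes_image)
lemma invol: "\<forall>x\<in>S. G (G x) = x"
proof
  fix x assume "x \<in> S"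
  then consider "x \<in> T" | "x \<in> S - T" by blast
  then show "G (G x) = x"
  proof cases
    case 1
    then have "g1 x \<in> T" "g1 (g1 x) = x" using p1 im(2) by (auto simp: pm_def)
    then show ?thesis using 1 G_on(1) by simp
  next
    case 2
    then have "g2 x \<in> S - T" "g2 (g2 x) = x" using p2 im(4) by (auto simp: pm_def)
    then show ?thesis using 2 G_on(2) by simp
  qed
qed
lemma Gr: "G r = r" "G r' = r'"
  using G_on(1)[of r] G_on(2)[of r'] T p1 p2 by (auto simp: pm_def fixpts_def)
lemma rS: "r \<in> S" "r \<noteq> r'" using T by auto
lemma fixG: "fixpts G S = {r, r'}"
proof -
  have "fixpts G S = fixpts g1 T \<union> fixpts g2 (S - T)"
  proof -
    have "x \<in> S \<and> G x = x \<longleftrightarrow> x \<in> T \<and> g1 x = x \<or> x \<in> S - T \<and> g2 x = x" for x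
      using T(1) G_on(1)[of x] G_on(2)[of x] by (cases "x \<in> T") auto
    then show ?thesis unfolding fixpts_def by blast
  qed
  then show ?thesis using p1 p2 by (auto simp: pm_def)
qed

lemmas cg = cut_edge_glue[OF fin rS(1) T(4) rS(2) F_perm G_perm invol Gr]

lemma conn_parts: "closed2 F G T" "conn T F G" "conn (S - T) F G" "genus0 F G T" "genus0 F G (S - T)"
proof -
  have "F ` T = f1 ` T" "G ` T = g1 ` T" using F_on G_on by auto
  then show "closed2 F G T" using im by (simp add: closed2_def)
  have "conn T F G = conn T f1 g1" by (rule conn_cong) (simp_all add: F_on G_on)
  then show "conn T F G" using p1 by (simp add: pm_def)
  have "conn (S - T) F G = conn (S - T) f2 g2" by (rule conn_cong) (simp_all add: F_on G_on)
  then show "conn (S - T) F G" using p2 by (simp add: pm_def)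
  have "genus0 F G T = genus0 f1 g1 T" by (rule genus0_cong) (simp_all add: F_on G_on im)
  then show "genus0 F G T" using p1 by (simp add: pm_def)
  have "genus0 F G (S - T) = genus0 f2 g2 (S - T)"
    by (rule genus0_cong) (use im in \<open>simp_all add: F_on G_on\<close>)
  then show "genus0 F G (S - T)" using p2 by (simp add: pm_def)
qed

lemma glue_mem: "(F \<circ> sw r r', G \<circ> sw r r') \<in> cutset S r r'" "r' \<in> orb (F \<circ> sw r r') r"
proof -
  note gg = cut_edge.genus0_glue[OF cg(1) T(1-3), unfolded cg(2,3), OF conn_parts]
  show "r' \<in> orb (F \<circ> sw r r') r" by (rule gg(1))
  have "r \<notin> fixpts (G \<circ> sw r r') S" "r' \<notin> fixpts (G \<circ> sw r r') S"
    using rS(2) sw_fixed_comp[OF Gr] by (auto simp: fixpts_def)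
  moreover have "fixpts (G \<circ> sw r r') S \<subseteq> {r, r'}"
    using cut_edge.fixpts'[OF cg(1)] fixG cg(3) by (metis subset_insertI2 subset_refl)
  ultimately have "fixpts (G \<circ> sw r r') S = {}" by blast
  then show "(F \<circ> sw r r', G \<circ> sw r r') \<in> cutset S r r'"
    using gg(2,3) permutes_comp_sw_same[OF F_perm rS(1) T(4)] permutes_comp_sw_same[OF G_perm rS(1) T(4)]
      cut_edge.invol[OF cg(1)] sw_fixed_comp[OF Gr] by (simp add: cutset_def pm_def)
qed

lemma orb_F: "x \<in> T \<Longrightarrow> orb F x = orb f1 x" "x \<in> S - T \<Longrightarrow> orb F x = orb f2 x"
proof -
  show "orb F x = orb f1 x" if "x \<in> T"
    by (rule orb_cong[of _ T, symmetric]) (use that im F_on in auto)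
  show "orb F x = orb f2 x" if "x \<in> S - T"
    by (rule orb_cong[of _ "S - T", symmetric]) (use that im F_on in auto)
qed

lemma orb_in: "x \<in> T \<Longrightarrow> orb f1 x \<subseteq> T" "x \<in> S - T \<Longrightarrow> orb f2 x \<subseteq> S - T"
  using orb_subset[OF permutes_imp_bij[OF perms(1)]] orb_subset[OF permutes_imp_bij[OF perms(3)]] by auto

text \<open>The bridge merges the two root faces, so their degrees add up and neither of them is
  weighted. The remaining faces are shared out between the components, which makes the weight a
  product.\<close>

lemma fwt_glue:
  "fwt h S (F \<circ> sw r r') r d = (\<Sum>i\<le>d. fwt h T f1 r i * fwt h (S - T) f2 r' (d - i))"
proof -
  note bij = permutes_imp_bij[OF F_perm]
  have r'T: "r' \<in> S - T" using T by blast
  have n: "r' \<notin> orb F r" unfolding orb_F(1)[OF T(2)] using orb_in(1)[OF T(2)] T(3) by blast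
  note o1 = orb_transpose_merge(1)[OF fin bij rS(1) T(4) n, unfolded orb_F(1)[OF T(2)] orb_F(2)[OF r'T]]
  note o2 = orbits_transpose_merge[OF fin bij rS(1) T(4) n, unfolded orb_F(1)[OF T(2)] orb_F(2)[OF r'T]]
  have fi: "finite T" "finite (S - T)" using fin T finite_subset by auto
  have fo: "finite (orb f1 r)" "finite (orb f2 r')"
    using orb_in(1)[OF T(2)] orb_in(2)[OF r'T] fi finite_subset by blast+
  have dis: "orb f1 r \<inter> orb f2 r' = {}" using orb_in(1)[OF T(2)] orb_in(2)[OF r'T] by blast
  have cd: "card (orb (F \<circ> sw r r') r) = card (orb f1 r) + card (orb f2 r')"
    unfolding o1 by (rule card_Un_disjoint[OF fo dis])
  have oF: "orb F ` S = orb f1 ` T \<union> orb f2 ` (S - T)"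
    using orb_F T(1) by (metis (no_types, lifting) Diff_partition image_Un image_cong)
  have d1: "C \<subseteq> T \<and> C \<noteq> {}" if "C \<in> orb f1 ` T" for C using that orb_in(1) orb_refl by fast
  have d2: "C \<subseteq> S - T \<and> C \<noteq> {}" if "C \<in> orb f2 ` (S - T)" for C using that orb_in(2) orb_refl by fast
  have nU: "orb f1 r \<union> orb f2 r' \<notin> orb f1 ` T" "orb f1 r \<union> orb f2 r' \<notin> orb f2 ` (S - T)"
    using d1 d2 orb_refl[of r f1] orb_refl[of r' f2] T by blast+
  have n12: "orb f1 r \<notin> orb f2 ` (S - T)" "orb f2 r' \<notin> orb f1 ` T"
    using d1 d2 orb_refl[of r f1] orb_refl[of r' f2] T by blast+
  have rest: "orb (F \<circ> sw r r') ` S - {orb (F \<circ> sw r r') r}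
    = (orb f1 ` T - {orb f1 r}) \<union> (orb f2 ` (S - T) - {orb f2 r'})"
    unfolding o1 o2 oF using nU n12 by blast
  have rd: "(orb f1 ` T - {orb f1 r}) \<inter> (orb f2 ` (S - T) - {orb f2 r'}) = {}"
    using d1 d2 by blast
  have pr: "(\<Prod>C\<in>orb (F \<circ> sw r r') ` S - {orb (F \<circ> sw r r') r}. h (card C))
    = (\<Prod>C\<in>orb f1 ` T - {orb f1 r}. h (card C)) * (\<Prod>C\<in>orb f2 ` (S - T) - {orb f2 r'}. h (card C))"
    unfolding rest by (rule prod.union_disjoint[OF _ _ rd]) (use fi in auto)
  define A where "A = (\<Prod>C\<in>orb f1 ` T - {orb f1 r}. h (card C))"
  define B where "B = (\<Prod>C\<in>orb f2 ` (S - T) - {orb f2 r'}. h (card C))"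
  have "(\<Sum>i\<le>d. fwt h T f1 r i * fwt h (S - T) f2 r' (d - i))
    = (\<Sum>i\<le>d. if i = card (orb f1 r) then (if card (orb f2 r') = d - i then A * B else 0) else 0)"
    by (rule sum.cong) (simp_all add: fwt_def A_def B_def)
  also have "\<dots> = (if card (orb f1 r) + card (orb f2 r') = d then A * B else 0)"
    by (subst sum.delta) auto
  finally show ?thesis unfolding fwt_def cd pr A_def B_def by simp
qed

end

lemma split_pairI: "finite S \<Longrightarrow> r' \<in> S \<Longrightarrow> (T, (f1, g1), (f2, g2)) \<in> splits S r r' \<Longrightarrow> split_pair S T f1 g1 f2 g2 r r'"
  unfolding splits_def by unfold_locales auto

lemma glue_bij:
  assumes fin: "finite S" and r: "r \<in> S" and r': "r' \<in> S" and rr: "r \<noteq> r'"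
  shows "bij_betw (glue r r') (splits S r r') {(f, g) \<in> cutset S r r'. r' \<in> orb f r}"
  unfolding bij_betw_def
proof
  show "inj_on (glue r r') (splits S r r')"
  proof (rule inj_onI)
    fix x y assume x: "x \<in> splits S r r'" and y: "y \<in> splits S r r'" and eq: "glue r r' x = glue r r' y"
    obtain T f1 g1 f2 g2 where xx: "x = (T, (f1, g1), (f2, g2))" by (metis prod.exhaust)
    obtain U e1 k1 e2 k2 where yy: "y = (U, (e1, k1), (e2, k2))" by (metis prod.exhaust)
    interpret X: split_pair S T f1 g1 f2 g2 r r' by (rule split_pairI) (use fin r' x xx in auto)
    interpret Y: split_pair S U e1 k1 e2 k2 r r' by (rule split_pairI) (use fin r' y yy in auto)
    have "X.F \<circ> sw r r' = Y.F \<circ> sw r r'" "X.G \<circ> sw r r' = Y.G \<circ> sw r r'"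
      using eq by (simp_all add: xx yy glue_def X.F_def Y.F_def X.G_def Y.G_def)
    then have FG: "X.F = Y.F" "X.G = Y.G" by (metis comp_transpose_twice)+
    \<comment> \<open>The dart set is determined by the glued map: \<open>T \<inter> U\<close> is
      closed and contains \<open>r\<close>, and both \<open>T\<close> and \<open>U\<close> are
      connected, so it equals each of them.\<close>
    have ci: "closed2 X.F X.G (T \<inter> U)"
      using closed2_Int[OF X.conn_parts(1), of U] Y.conn_parts(1) FG by simp
    have "T \<inter> U = T" by (rule connD[OF X.conn_parts(2) _ _ ci]) (use X.T Y.T in auto)
    moreover have "T \<inter> U = U"
      by (rule connD[OF Y.conn_parts(2)[folded FG] _ _ ci]) (use X.T Y.T in auto)
    ultimately have TU: "T = U" by simp
    have eqI: "a = b" if "a permutes V" "b permutes V" "\<And>x. x \<in> V \<Longrightarrow> a x = b x" for a b :: "nat \<Rightarrow> nat" and V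
      using that permutes_not_in by (metis ext)
    have "f1 = e1" by (rule eqI[OF X.perms(1) Y.perms(1)[folded TU]]) (use X.F_on(1) Y.F_on(1) FG TU in metis)
    moreover have "g1 = k1" by (rule eqI[OF X.perms(2) Y.perms(2)[folded TU]]) (use X.G_on(1) Y.G_on(1) FG TU in metis)
    moreover have "f2 = e2" by (rule eqI[OF X.perms(3) Y.perms(3)[folded TU]]) (use X.F_on(2) Y.F_on(2) FG TU in metis)
    moreover have "g2 = k2" by (rule eqI[OF X.perms(4) Y.perms(4)[folded TU]]) (use X.G_on(2) Y.G_on(2) FG TU in metis)
    ultimately show "x = y" using xx yy TU by simp
  qed
  show "glue r r' ` splits S r r' = {(f, g) \<in> cutset S r r'. r' \<in> orb f r}" (is "?L = ?R")
  proof
    show "?L \<subseteq> ?R"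
    proof (rule image_subsetI)
      fix x assume x: "x \<in> splits S r r'"
      obtain T f1 g1 f2 g2 where xx: "x = (T, (f1, g1), (f2, g2))" by (metis prod.exhaust)
      interpret X: split_pair S T f1 g1 f2 g2 r r' by (rule split_pairI) (use fin r' x xx in auto)
      show "glue r r' x \<in> ?R" using X.glue_mem by (simp add: xx glue_def X.F_def X.G_def)
    qed
    show "?R \<subseteq> ?L"
    proof
      fix p assume "p \<in> ?R"
      then obtain f g where p: "p = (f, g)" and c: "(f, g) \<in> cutset S r r'" and o: "r' \<in> orb f r" by blast
      interpret cut_edge S f g r r' by (rule cut_edge_of_cutset[OF fin c r])
      have fg: "f permutes S" "g permutes S" "fixpts g S = {}" "conn S f g" "genus0 f g S"
        using c by (auto simp: cutset_def pm_def)
      obtain T where T: "T \<subseteq> S" "r \<in> T" "r' \<notin> T" "closed2 f' g' T" "conn T f' g'" "conn (S - T) f' g'"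
        "genus0 f' g' T" "genus0 f' g' (S - T)" using genus0_split[OF o fg(4,5)] by metis
      have D: "closed2 f' g' (S - T)" by (rule closed2_Diff[OF fin bij_f' bij_g' T(1,4)])
      have fx: "fixpts g' S = {r, r'}" using fixpts' fg(3) by simp
      have part: "(restr f' V, restr g' V) \<in> pm (V \<inter> {r, r'}) V"
        if V: "V \<subseteq> S" "closed2 f' g' V" "conn V f' g'" "genus0 f' g' V" for V
      proof -
        have im: "f' ` V \<subseteq> V" "g' ` V \<subseteq> V" using V(2) by (simp_all add: closed2_def)
        have eq: "x \<in> V \<Longrightarrow> restr f' V x = f' x" "x \<in> V \<Longrightarrow> restr g' V x = g' x" for x
          by (simp_all add: restr_def)
        have "\<forall>x\<in>V. restr g' V (restr g' V x) = x" using im(2) V(1) invol' by (auto simp: restr_def)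
        moreover have "fixpts (restr g' V) V = V \<inter> {r, r'}"
        proof -
          have "fixpts (restr g' V) V = V \<inter> fixpts g' S" using V(1) eq by (auto simp: fixpts_def)
          then show ?thesis using fx by simp
        qed
        moreover have "conn V (restr f' V) (restr g' V)" using conn_cong[of V "restr f' V" f' "restr g' V" g'] eq V(3) by simp
        moreover have "genus0 (restr f' V) (restr g' V) V"
          using genus0_cong[of f' V g' "restr f' V" "restr g' V"] im eq V(4) by simp
        ultimately show ?thesis
          using restr_permutes[OF bij_f' fin V(1) im(1)] restr_permutes[OF bij_g' fin V(1) im(2)]
          by (simp add: pm_def)
      qed
      have i: "T \<inter> {r, r'} = {r}" "(S - T) \<inter> {r, r'} = {r'}" using T r' by auto
      have mem: "(T, (restr f' T, restr g' T), (restr f' (S - T), restr g' (S - T))) \<in> splits S r r'"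
        using part[OF T(1,4,5,7)] part[OF Diff_subset D T(6,8)] T(1-3) unfolding splits_def i by simp
      have re: "restr a T \<circ> restr a (S - T) = a"
        if "a permutes S" "a ` T \<subseteq> T" "a ` (S - T) \<subseteq> S - T" for a :: "nat \<Rightarrow> nat"
      proof
        fix x
        show "(restr a T \<circ> restr a (S - T)) x = a x"
          using that permutes_not_in[OF that(1), of x] T(1) by (cases "x \<in> S"; cases "x \<in> T") (auto simp: restr_def)
      qed
      have "restr f' T \<circ> restr f' (S - T) = f'" "restr g' T \<circ> restr g' (S - T) = g'"
        by (rule re; use permutes_comp_sw_same[OF fg(1) r r'] permutes_comp_sw_same[OF fg(2) r r'] T(4) D
            in \<open>simp add: closed2_def f'_def g'_def\<close>)+
      then have "glue r r' (T, (restr f' T, restr g' T), (restr f' (S - T), restr g' (S - T))) = p"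
        unfolding glue_def p by (simp add: f'_def g'_def comp_transpose_twice)
      then show "p \<in> ?L" using mem by (metis imageI)
    qed
  qed
qed

lemma sum_cut_split:
  assumes fin: "finite S" and r: "r \<in> S" and r': "r' \<in> S" and rr: "r \<noteq> r'"
  shows "(\<Sum>(f, g)\<in>{(f, g) \<in> cutset S r r'. r' \<in> orb f r}. fwt h S f r d)
    = (\<Sum>T | T \<subseteq> S \<and> r \<in> T \<and> r' \<notin> T. \<Sum>i\<le>d. legsum h T r i * legsum h (S - T) r' (d - i))"
proof -
  have "(\<Sum>(f, g)\<in>{(f, g) \<in> cutset S r r'. r' \<in> orb f r}. fwt h S f r d)
    = (\<Sum>x\<in>splits S r r'. case glue r r' x of (f, g) \<Rightarrow> fwt h S f r d)"
    by (rule sum.reindex_bij_betw[OF glue_bij[OF assms], symmetric])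
  also have "\<dots> = (\<Sum>(T, p1, p2)\<in>splits S r r'. \<Sum>i\<le>d. fwt h T (fst p1) r i * fwt h (S - T) (fst p2) r' (d - i))"
  proof (rule sum.cong[OF refl], clarify)
    fix T f1 g1 f2 g2 assume x: "(T, (f1, g1), (f2, g2)) \<in> splits S r r'"
    interpret X: split_pair S T f1 g1 f2 g2 r r' by (rule split_pairI[OF fin r' x])
    show "(case glue r r' (T, (f1, g1), (f2, g2)) of (f, g) \<Rightarrow> fwt h S f r d)
      = (\<Sum>i\<le>d. fwt h T (fst (f1, g1)) r i * fwt h (S - T) (fst (f2, g2)) r' (d - i))"
      using X.fwt_glue by (simp add: glue_def X.F_def)
  qed
  also have "\<dots> = (\<Sum>T | T \<subseteq> S \<and> r \<in> T \<and> r' \<notin> T. \<Sum>p1\<in>pm {r} T. \<Sum>p2\<in>pm {r'} (S - T).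
      \<Sum>i\<le>d. fwt h T (fst p1) r i * fwt h (S - T) (fst p2) r' (d - i))"
  proof -
    have "finite {T. T \<subseteq> S \<and> r \<in> T \<and> r' \<notin> T}" using fin by simp
    moreover have "finite (pm {r} T)" "finite (pm {r'} (S - T))" if "T \<subseteq> S" for T
      using finite_pm[OF finite_subset[OF that fin]] finite_pm[OF finite_Diff[OF fin]] by auto
    ultimately have *: "(\<Sum>T | T \<subseteq> S \<and> r \<in> T \<and> r' \<notin> T. \<Sum>p\<in>pm {r} T \<times> pm {r'} (S - T). \<Phi> T (fst p) (snd p))
      = (\<Sum>(T, p)\<in>splits S r r'. \<Phi> T (fst p) (snd p))" for \<Phi> :: "nat set \<Rightarrow> gmap \<Rightarrow> gmap \<Rightarrow> real"
      unfolding splits_def by (intro sum.Sigma) auto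
    have "(\<Sum>p1\<in>A. \<Sum>p2\<in>B. \<Psi> p1 p2) = (\<Sum>p\<in>A \<times> B. \<Psi> (fst p) (snd p))"
      for A B :: "gmap set" and \<Psi> :: "gmap \<Rightarrow> gmap \<Rightarrow> real"
      by (simp add: sum.cartesian_product case_prod_unfold)
    then show ?thesis
      using *[of "\<lambda>T p1 p2. \<Sum>i\<le>d. fwt h T (fst p1) r i * fwt h (S - T) (fst p2) r' (d - i)"]
      by (simp only: case_prod_unfold)
  qed
  also have "\<dots> = (\<Sum>T | T \<subseteq> S \<and> r \<in> T \<and> r' \<notin> T. \<Sum>i\<le>d. legsum h T r i * legsum h (S - T) r' (d - i))"
  proof (rule sum.cong[OF refl])
    fix T
    have "(\<Sum>p1\<in>pm {r} T. \<Sum>p2\<in>pm {r'} (S - T). \<Sum>i\<le>d. fwt h T (fst p1) r i * fwt h (S - T) (fst p2) r' (d - i))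
      = (\<Sum>p1\<in>pm {r} T. \<Sum>i\<le>d. \<Sum>p2\<in>pm {r'} (S - T). fwt h T (fst p1) r i * fwt h (S - T) (fst p2) r' (d - i))"
      by (rule sum.cong[OF refl], rule sum.swap)
    also have "\<dots> = (\<Sum>i\<le>d. \<Sum>p1\<in>pm {r} T. \<Sum>p2\<in>pm {r'} (S - T). fwt h T (fst p1) r i * fwt h (S - T) (fst p2) r' (d - i))"
      by (rule sum.swap)
    also have "\<dots> = (\<Sum>i\<le>d. legsum h T r i * legsum h (S - T) r' (d - i))"
      unfolding legsum_def case_prod_unfold by (simp add: sum_product)
    finally show "(\<Sum>p1\<in>pm {r} T. \<Sum>p2\<in>pm {r'} (S - T). \<Sum>i\<le>d. fwt h T (fst p1) r i * fwt h (S - T) (fst p2) r' (d - i))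
      = (\<Sum>i\<le>d. legsum h T r i * legsum h (S - T) r' (d - i))" .
  qed
  finally show ?thesis .
qed

section \<open>Independence of the names of the darts\<close>

lemma ex_permutes_matching:
  fixes S S' :: "nat set"
  assumes "finite S" "finite S'" "card S = card S'" "z \<in> S" "z' \<in> S'"
  shows "\<exists>\<pi>. bij \<pi> \<and> \<pi> ` S = S' \<and> \<pi> z = z'"
proof -
  have "card (S - {z}) = card (S' - {z'})" using assms by simp
  then obtain a where a: "bij_betw a (S - {z}) (S' - {z'})"
    using assms finite_same_card_bij by (metis finite_Diff)
  have "bij_betw (a(z := z')) {z} {z'}" by (simp add: bij_betw_def)
  moreover have "bij_betw (a(z := z')) (S - {z}) (S' - {z'})"
    using a by (rule bij_betw_cong[THEN iffD1, rotated]) auto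
  ultimately have "bij_betw (a(z := z')) ({z} \<union> (S - {z})) ({z'} \<union> (S' - {z'}))"
    by (rule bij_betw_combine) auto
  moreover have "{z} \<union> (S - {z}) = S" "{z'} \<union> (S' - {z'}) = S'" using assms(4,5) by auto
  ultimately have b: "bij_betw (a(z := z')) S S'" by simp
  have "card ((S \<union> S') - S) = card ((S \<union> S') - S')"
    using assms(1-3) by (simp add: card_Diff_subset)
  then obtain c where c: "bij_betw c ((S \<union> S') - S) ((S \<union> S') - S')"
    using assms finite_same_card_bij by (metis finite_Diff finite_Un)
  \<comment> \<open>Conjugation wants a bijection of the whole type. The bijection from
    \<open>S\<close> to \<open>S'\<close> is completed by one from \<open>S' - S\<close> to
    \<open>S - S'\<close> and by the identity elsewhere.\<close>
  define \<pi> where "\<pi> x = (if x \<in> S then (a(z := z')) x else if x \<in> S' then c x else x)" for x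
  have 1: "bij_betw \<pi> S S'" using b by (rule bij_betw_cong[THEN iffD1, rotated]) (simp add: \<pi>_def)
  have 2: "bij_betw \<pi> (S' - S) (S - S')" 
  proof -
    have "(S \<union> S') - S = S' - S" "(S \<union> S') - S' = S - S'" by auto
    then have "bij_betw c (S' - S) (S - S')" using c by simp
    then show ?thesis by (rule bij_betw_cong[THEN iffD1, rotated]) (simp add: \<pi>_def)
  qed
  have 3: "bij_betw \<pi> (- (S \<union> S')) (- (S \<union> S'))"
    using bij_betw_id by (rule bij_betw_cong[THEN iffD1, rotated]) (simp add: \<pi>_def)
  have "bij_betw \<pi> (S \<union> (S' - S)) (S' \<union> (S - S'))"
    by (rule bij_betw_combine[OF 1 2]) auto
  then have "bij_betw \<pi> ((S \<union> (S' - S)) \<union> - (S \<union> S')) ((S' \<union> (S - S')) \<union> - (S \<union> S'))"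
    by (rule bij_betw_combine[OF _ 3]) auto
  moreover have "(S \<union> (S' - S)) \<union> - (S \<union> S') = UNIV" "(S' \<union> (S - S')) \<union> - (S \<union> S') = UNIV" by auto
  ultimately have "bij \<pi>" by metis
  moreover have "\<pi> z = z'" using assms(4) by (simp add: \<pi>_def)
  ultimately show ?thesis using 1 by (auto simp: bij_betw_def)
qed

definition conj_perm :: "(nat \<Rightarrow> nat) \<Rightarrow> (nat \<Rightarrow> nat) \<Rightarrow> nat \<Rightarrow> nat" where
  "conj_perm \<pi> f = \<pi> \<circ> f \<circ> inv \<pi>"

lemma conj_perm_comp: "bij \<pi> \<Longrightarrow> conj_perm \<pi> f \<circ> conj_perm \<pi> g = conj_perm \<pi> (f \<circ> g)"
  by (auto simp: conj_perm_def fun_eq_iff bij_is_inj)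

lemma conj_perm_apply: "bij \<pi> \<Longrightarrow> conj_perm \<pi> f (\<pi> x) = \<pi> (f x)"
  by (simp add: conj_perm_def bij_is_inj)

lemma conj_perm_inverse: "bij \<pi> \<Longrightarrow> conj_perm (inv \<pi>) (conj_perm \<pi> f) = f"
  by (auto simp: conj_perm_def fun_eq_iff bij_is_inj inv_inv_eq)

lemma orb_conj: "bij \<pi> \<Longrightarrow> orb (conj_perm \<pi> f) (\<pi> x) = \<pi> ` orb f x"
proof -
  assume b: "bij \<pi>"
  have "(conj_perm \<pi> f ^^ k) (\<pi> x) = \<pi> ((f ^^ k) x)" for k
    by (induction k) (simp_all add: conj_perm_apply[OF b])
  then show ?thesis by (auto simp: orb_def)
qed

lemma card_image_bij: "bij \<pi> \<Longrightarrow> card (\<pi> ` A) = card A"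
  by (meson bij_is_inj card_image inj_on_subset subset_UNIV)

lemma ncyc_conj: "bij \<pi> \<Longrightarrow> ncyc (conj_perm \<pi> f) (\<pi> ` S) = ncyc f S"
proof -
  assume b: "bij \<pi>"
  have "orb (conj_perm \<pi> f) ` \<pi> ` S = (`) \<pi> ` orb f ` S"
    by (simp add: image_image orb_conj[OF b])
  moreover have "inj_on ((`) \<pi>) A" for A
    using b by (meson bij_is_inj inj_on_image inj_on_subset subset_UNIV)
  ultimately show ?thesis by (simp add: ncyc_def card_image)
qed

lemma permutes_conj: "bij \<pi> \<Longrightarrow> f permutes S \<Longrightarrow> conj_perm \<pi> f permutes (\<pi> ` S)"
proof (rule bij_imp_permutes)
  assume b: "bij \<pi>" and f: "f permutes S"
  show "bij_betw (conj_perm \<pi> f) (\<pi> ` S) (\<pi> ` S)"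
  proof -
    have "bij (conj_perm \<pi> f)" unfolding conj_perm_def using b f
      by (intro bij_comp bij_imp_bij_inv) (auto intro: permutes_bij)
    moreover have "conj_perm \<pi> f ` \<pi> ` S = \<pi> ` f ` S"
      by (simp add: image_image conj_perm_apply[OF b])
    ultimately show ?thesis using permutes_image[OF f]
      by (metis bij_betw_def inj_on_subset subset_UNIV)
  qed
  fix x assume "x \<notin> \<pi> ` S"
  then have "inv \<pi> x \<notin> S" using b by (metis bij_inv_eq_iff imageI)
  then show "conj_perm \<pi> f x = x" using f b by (simp add: conj_perm_def permutes_not_in bij_is_surj surj_f_inv_f)
qed

lemma pm_conj:
  assumes b: "bij \<pi>" and p: "(f, g) \<in> pm Z S"
  shows "(conj_perm \<pi> f, conj_perm \<pi> g) \<in> pm (\<pi> ` Z) (\<pi> ` S)"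
proof -
  have p': "f permutes S" "g permutes S" "\<forall>x\<in>S. g (g x) = x" "fixpts g S = Z" "conn S f g" "genus0 f g S"
    using p by (auto simp: pm_def)
  have inj: "\<pi> x = \<pi> y \<longleftrightarrow> x = y" for x y using b by (metis bij_pointE)
  have fx: "fixpts (conj_perm \<pi> g) (\<pi> ` S) = \<pi> ` Z"
    using p'(4) by (auto simp: fixpts_def conj_perm_apply[OF b] inj)
  have "conn (\<pi> ` S) (conj_perm \<pi> f) (conj_perm \<pi> g)" unfolding conn_def
  proof (intro allI impI)
    fix T assume T: "T \<subseteq> \<pi> ` S" "T \<noteq> {}" "closed2 (conj_perm \<pi> f) (conj_perm \<pi> g) T"
    obtain U where U: "U \<subseteq> S" "T = \<pi> ` U" using T(1) by (metis subset_imageE)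
    have "closed2 f g U"
      using T(3) unfolding U closed2_def image_image conj_perm_apply[OF b] by (auto simp: inj image_iff)
    then show "T = \<pi> ` S" using connD[OF p'(5) U(1)] U T(2) by auto
  qed
  moreover have "genus0 (conj_perm \<pi> f) (conj_perm \<pi> g) (\<pi> ` S)"
    using p'(4,6) fx by (simp add: genus0_def conj_perm_comp[OF b] ncyc_conj[OF b] card_image_bij[OF b])
  ultimately show ?thesis
    using p'(1-3) fx permutes_conj[OF b] by (auto simp: pm_def conj_perm_apply[OF b])
qed

lemma fwt_conj: "bij \<pi> \<Longrightarrow> fwt h (\<pi> ` S) (conj_perm \<pi> f) (\<pi> r) d = fwt h S f r d"
proof -
  assume b: "bij \<pi>"
  have inj: "inj_on ((`) \<pi>) A" for A
    using b by (meson bij_is_inj inj_on_image inj_on_subset subset_UNIV)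
  have "orb (conj_perm \<pi> f) ` \<pi> ` S - {\<pi> ` orb f r} = (`) \<pi> ` (orb f ` S - {orb f r})"
    using inj_on_image_set_diff[OF inj[of UNIV], of "orb f ` S" "{orb f r}"]
    by (simp add: image_image orb_conj[OF b])
  then show ?thesis
    by (simp add: fwt_def orb_conj[OF b] card_image_bij[OF b] prod.reindex[OF inj])
qed

lemma legsum_conj:
  assumes b: "bij \<pi>"
  shows "legsum h (\<pi> ` S) (\<pi> z) d = legsum h S z d"
proof -
  have bi: "bij (inv \<pi>)" using b by (rule bij_imp_bij_inv)
  have "bij_betw (\<lambda>(f, g). (conj_perm \<pi> f, conj_perm \<pi> g)) (pm {z} S) (pm {\<pi> z} (\<pi> ` S))"
  proof (rule bij_betw_byWitness[where f' = "\<lambda>(f, g). (conj_perm (inv \<pi>) f, conj_perm (inv \<pi>) g)"])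
    show "(\<lambda>(f, g). (conj_perm \<pi> f, conj_perm \<pi> g)) ` pm {z} S \<subseteq> pm {\<pi> z} (\<pi> ` S)"
      using pm_conj[OF b, of _ _ "{z}" S] by auto
    have "inv \<pi> ` \<pi> ` S = S" "inv \<pi> (\<pi> z) = z" using b by (simp_all add: bij_is_inj image_inv_f_f)
    then show "(\<lambda>(f, g). (conj_perm (inv \<pi>) f, conj_perm (inv \<pi>) g)) ` pm {\<pi> z} (\<pi> ` S) \<subseteq> pm {z} S"
      using pm_conj[OF bi, of _ _ "{\<pi> z}" "\<pi> ` S"] by auto
  qed (auto simp: conj_perm_inverse[OF b], metis conj_perm_inverse[OF bi] b inv_inv_eq, metis conj_perm_inverse[OF bi] b inv_inv_eq)
  from sum.reindex_bij_betw[OF this, of "\<lambda>(f, g). fwt h (\<pi> ` S) f (\<pi> z) d"]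
  show ?thesis by (simp add: legsum_def fwt_conj[OF b] case_prod_unfold)
qed

section \<open>Tutte's equation\<close>

text \<open>A leg is inserted in the root corner, so it increases the perimeter by one; \<open>leg h N d\<close> counts
  labelled maps with \<open>N\<close> darts besides the leg. The map with a single vertex and no edge is included.\<close>
definition leg :: "(nat \<Rightarrow> real) \<Rightarrow> nat \<Rightarrow> nat \<Rightarrow> real" where
  "leg h N d = legsum h {..N} 0 d"

lemma legsum_eq_leg:
  assumes "finite S" "card S = Suc N" "z \<in> S"
  shows "legsum h S z d = leg h N d"
proof -
  obtain \<pi> where "bij \<pi>" "\<pi> ` {..N} = S" "\<pi> 0 = z"
    using ex_permutes_matching[of "{..N}" S 0 z] assms by auto
  then show ?thesis using legsum_conj[of \<pi> h "{..N}" 0 d] by (simp add: leg_def)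
qed

text \<open>The vertex map, in which the leg is the only dart. It is the source of the value 1 at
  perimeter 0.\<close>

lemma pm_singleton: "pm {z} {z} = {(id, id)}"
proof -
  have e: "f permutes {z} \<longleftrightarrow> f = id" for f :: "nat \<Rightarrow> nat" by (simp add: permutes_sing)
  have "genus0 id id {z}" by (simp add: genus0_def ncyc_def fixpts_def)
  moreover have "conn {z} id id" by (auto simp: conn_def)
  ultimately show ?thesis by (auto simp: pm_def e fixpts_def)
qed

lemma leg_0: "leg h 0 d = (if d = 1 then 1 else 0)"
proof -
  have "orb id x = {x}" for x using orb_least[of x "{x}" id] orb_refl[of x id] by auto
  then show ?thesis
    using pm_singleton[of 0] by (auto simp: leg_def legsum_def fwt_def)
qed

lemma leg_degree_0: "leg h N 0 = 0"
proof -
  have "fwt h {..N} f 0 0 = 0" if "f permutes {..N}" for f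
  proof -
    have "orb f 0 \<subseteq> {..N}" by (rule orb_subset[OF permutes_imp_bij[OF that]]) simp
    then have "finite (orb f 0)" by (rule finite_subset) simp
    moreover have "orb f 0 \<noteq> {}" using orb_refl[of 0 f] by blast
    ultimately have "card (orb f 0) \<noteq> 0" by simp
    then show ?thesis by (simp add: fwt_def)
  qed
  then show ?thesis by (auto simp: leg_def legsum_def pm_def intro!: sum.neutral)
qed

text \<open>A single dart besides the leg has no partner to form an edge with.\<close>

lemma leg_Suc_0: "leg h (Suc 0) d = 0"
proof -
  have "pm {0} {..Suc 0} = {}"
  proof -
    have False if "g permutes {..Suc 0}" "fixpts g {..Suc 0} = {0}" for g
    proof -
      have f: "fixpts g {..Suc 0} = {0}" "0 \<in> {..Suc 0}" "Suc 0 \<in> {..Suc 0}" using that(2) by auto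
      have "g 0 = 0" "g (Suc 0) \<noteq> Suc 0" using f unfolding fixpts_def by blast+
      moreover have "g (Suc 0) \<in> {..Suc 0}" using permutes_in_image[OF that(1)] f(3) by blast
      then have "g (Suc 0) = 0 \<or> g (Suc 0) = Suc 0" by (simp add: le_Suc_eq)
      ultimately have "g (Suc 0) = g 0" by metis
      then show False using injD[OF permutes_inj[OF that(1)], of "Suc 0" 0] by simp
    qed
    then show ?thesis by (auto simp: pm_def)
  qed
  then show ?thesis by (simp add: leg_def legsum_def)
qed

text \<open>A leg that is alone in its face and fixed by the involution is a component by
  itself.\<close>

lemma leg_Suc_1:
  assumes "N \<ge> 1" shows "leg h N 1 = 0"
proof -
  have "fwt h {..N} f 0 1 = 0" if "(f, g) \<in> pm {0} {..N}" for f g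
  proof -
    have p: "f permutes {..N}" "fixpts g {..N} = {0}" "conn {..N} f g" using that by (auto simp: pm_def)
    have "card (orb f 0) \<noteq> 1"
    proof
      assume "card (orb f 0) = 1"
      then have "orb f 0 = {0}" using orb_refl[of 0 f] by (metis card_1_singletonE singletonD)
      then have "f 0 = 0" using orb_step[OF orb_refl, of f 0] by simp
      moreover have "g 0 = 0" using p(2) by (auto simp: fixpts_def)
      ultimately have "closed2 f g {0}" by (simp add: closed2_def)
      then have "{0} = {..N}" using connD[OF p(3)] by blast
      then show False using assms by auto
    qed
    then show ?thesis by (simp add: fwt_def)
  qed
  then show ?thesis by (auto simp: leg_def legsum_def intro!: sum.neutral)
qed

section \<open>The recursion for labelled maps\<close>

lemma card_Ico_choose_sum:
  assumes "finite A" "card A = N"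
  shows "(\<Sum>X | X \<subseteq> A. F (card X)) = (\<Sum>s\<le>N. real (N choose s) * F s)"
proof -
  have "(\<Sum>X\<in>Pow A. F (card X)) = (\<Sum>s\<in>{..N}. \<Sum>X\<in>{X \<in> Pow A. card X = s}. F (card X))"
    by (rule sum.group[symmetric]) (use assms card_mono in auto)
  also have "\<dots> = (\<Sum>s\<le>N. real (N choose s) * F s)"
  proof (rule sum.cong[OF refl])
    fix s
    have "(\<Sum>X\<in>{X \<in> Pow A. card X = s}. F (card X)) = (\<Sum>X\<in>{X. X \<subseteq> A \<and> card X = s}. F s)"
      by (rule sum.cong) auto
    then show "(\<Sum>X\<in>{X \<in> Pow A. card X = s}. F (card X)) = real (N choose s) * F s"
      using n_subsets[OF assms(1), of s] assms(2) by simp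
  qed
  finally show ?thesis by (simp add: Pow_def)
qed

text \<open>If the root edge is a bridge, the other \<open>N\<close> darts are distributed over its
  two sides, with \<open>N choose s\<close> ways to put \<open>s\<close> of them on the side of
  \<open>r\<close>. Otherwise all \<open>N\<close> of them remain with the leg \<open>r\<close> once
  \<open>r'\<close> has been removed.\<close>

lemma rooted_sum_pair:
  assumes fin: "finite S" and cS: "card S = Suc (Suc N)" and r: "r \<in> S" "r' \<in> S" "r \<noteq> r'" and d: "d \<ge> 1"
  shows "(\<Sum>(f, g)\<in>cutset S r r'. fwt h S f r d)
    = (\<Sum>s\<le>N. real (N choose s) * (\<Sum>i\<le>d. leg h s i * leg h (N - s) (d - i)))
      + (\<Sum>k=1..N + 2. h k * leg h N (d + k - 1))"
proof -
  have finc: "finite (cutset S r r')"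
    by (rule finite_subset[OF _ finite_pm[OF fin]]) (auto simp: cutset_def)
  have "(\<Sum>(f, g)\<in>cutset S r r'. fwt h S f r d)
    = (\<Sum>(f, g)\<in>{(f, g) \<in> cutset S r r'. r' \<in> orb f r}. fwt h S f r d)
    + (\<Sum>(f, g)\<in>{(f, g) \<in> cutset S r r'. r' \<notin> orb f r}. fwt h S f r d)"
    by (subst sum.union_disjoint[symmetric]) (auto intro: finite_subset[OF _ finc] intro!: sum.cong)
  also have "(\<Sum>(f, g)\<in>{(f, g) \<in> cutset S r r'. r' \<notin> orb f r}. fwt h S f r d)
    = (\<Sum>k=1..N + 2. h k * leg h N (d + k - 1))"
    unfolding sum_cut_merge[OF fin r d] cS
    using legsum_eq_leg[of "S - {r'}" N r] fin cS r by (intro sum.cong) auto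
  also have "(\<Sum>(f, g)\<in>{(f, g) \<in> cutset S r r'. r' \<in> orb f r}. fwt h S f r d)
    = (\<Sum>T | T \<subseteq> S \<and> r \<in> T \<and> r' \<notin> T. \<Sum>i\<le>d. legsum h T r i * legsum h (S - T) r' (d - i))"
    by (rule sum_cut_split[OF fin r])
  also have "\<dots> = (\<Sum>X | X \<subseteq> S - {r, r'}. \<Sum>i\<le>d. leg h (card X) i * leg h (N - card X) (d - i))"
  proof (rule sum.reindex_bij_witness[where i = "insert r" and j = "\<lambda>T. T - {r}"])
    fix T assume T: "T \<in> {T. T \<subseteq> S \<and> r \<in> T \<and> r' \<notin> T}"
    then have fT: "finite T" using fin finite_subset by auto
    have rT: "T \<subseteq> S" "r \<in> T" "r' \<notin> T" using T by blast+
    have c1: "card T = Suc (card (T - {r}))" by (rule card.remove[OF fT rT(2)])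
    have "card (S - T) = Suc (Suc N) - card T" using card_Diff_subset[OF fT rT(1)] cS by simp
    moreover have "card (S - T) > 0" using rT r fin by (auto simp: card_gt_0_iff)
    ultimately have c2: "card (S - T) = Suc (N - card (T - {r}))" using c1 by linarith
    have "legsum h T r i = leg h (card (T - {r})) i" for i
      by (rule legsum_eq_leg[OF fT c1 rT(2)])
    moreover have "legsum h (S - T) r' i = leg h (N - card (T - {r})) i" for i
      by (rule legsum_eq_leg[OF _ c2]) (use rT r fin in blast)+
    ultimately
    show "(\<Sum>i\<le>d. leg h (card (T - {r})) i * leg h (N - card (T - {r})) (d - i))
      = (\<Sum>i\<le>d. legsum h T r i * legsum h (S - T) r' (d - i))" by simp
  qed (use r in auto)
  also have "\<dots> = (\<Sum>s\<le>N. real (N choose s) * (\<Sum>i\<le>d. leg h s i * leg h (N - s) (d - i)))"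
    by (rule card_Ico_choose_sum) (use fin cS r in \<open>auto simp: card_Diff_subset\<close>)
  finally show ?thesis .
qed

lemma rooted_sum:
  assumes fin: "finite S" and cS: "card S = Suc (Suc N)" and d: "d \<ge> 1"
  shows "(\<Sum>(f, g)\<in>pm {} S. \<Sum>r\<in>S. fwt h S f r d) = real (N + 2) * real (N + 1) *
    ((\<Sum>s\<le>N. real (N choose s) * (\<Sum>i\<le>d. leg h s i * leg h (N - s) (d - i)))
      + (\<Sum>k=1..N + 2. h k * leg h N (d + k - 1)))"
    (is "_ = _ * ?R")
proof -
  have "(\<Sum>(f, g)\<in>pm {} S. \<Sum>r\<in>S. fwt h S f r d) = (\<Sum>r\<in>S. \<Sum>(f, g)\<in>pm {} S. fwt h S f r d)"
    unfolding case_prod_unfold by (rule sum.swap)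
  also have "\<dots> = (\<Sum>r\<in>S. \<Sum>r'\<in>S - {r}. \<Sum>(f, g)\<in>cutset S r r'. fwt h S f r d)"
  proof (rule sum.cong[OF refl])
    fix r assume r: "r \<in> S"
    have "(\<Sum>p\<in>pm {} S. fwt h S (fst p) r d)
      = (\<Sum>r'\<in>S - {r}. \<Sum>p\<in>{p \<in> pm {} S. snd p r = r'}. fwt h S (fst p) r d)"
    proof (rule sum.group[symmetric])
      show "(\<lambda>p. snd p r) ` pm {} S \<subseteq> S - {r}"
        using r by (auto simp: pm_def fixpts_def permutes_in_image)
    qed (use fin finite_pm in auto)
    then show "(\<Sum>(f, g)\<in>pm {} S. fwt h S f r d) = (\<Sum>r'\<in>S - {r}. \<Sum>(f, g)\<in>cutset S r r'. fwt h S f r d)"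
      by (simp add: cutset_def case_prod_unfold)
  qed
  also have "\<dots> = (\<Sum>r\<in>S. \<Sum>r'\<in>S - {r}. ?R)"
    by (intro sum.cong refl rooted_sum_pair[OF fin cS _ _ _ d]) auto
  also have "\<dots> = (\<Sum>r\<in>S. real (N + 1) * ?R)"
    using fin cS by (intro sum.cong) auto
  also have "\<dots> = real (N + 2) * (real (N + 1) * ?R)"
    using cS by (simp add: algebra_simps)
  finally show ?thesis by (simp only: mult.assoc)
qed

text \<open>The leg is traded for a root dart, and the root edge is then deleted. The factor in
  front counts the ordered pairs of labels for the darts of that edge; it is what division by
  \<open>fact (N + 2)\<close> absorbs.\<close>

lemma leg_rec:
  assumes "d \<ge> 1"
  shows "leg h (N + 2) (Suc d) = real (N + 2) * real (N + 1) *
    ((\<Sum>s\<le>N. real (N choose s) * (\<Sum>i\<le>d. leg h s i * leg h (N - s) (d - i)))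
      + (\<Sum>k=1..N + 2. h k * leg h N (d + k - 1)))"
proof -
  have "legsum h (insert 0 {1..N + 2}) 0 (Suc d) = (\<Sum>(f, g)\<in>pm {} {1..N + 2}. \<Sum>r\<in>{1..N + 2}. fwt h {1..N + 2} f r d)"
    by (rule legsum_insert) auto
  moreover have "legsum h (insert 0 {1..N + 2}) 0 (Suc d) = leg h (N + 2) (Suc d)"
    by (rule legsum_eq_leg) auto
  ultimately show ?thesis using rooted_sum[of "{1..N + 2}" N d h] assms by simp
qed

section \<open>Translation to the encoding of maps and isomorphism classes in the statement\<close>

lemma card_orbits_involution:
  assumes "finite D" "\<forall>x\<in>D. g x \<in> D \<and> g x \<noteq> x \<and> g (g x) = x"
  shows "2 * card (orb g ` D) = card D"
proof -
  have o: "orb g x = {x, g x}" if x: "x \<in> D" for x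
  proof
    show "orb g x \<subseteq> {x, g x}" by (rule orb_least) (use assms x in auto)
    show "{x, g x} \<subseteq> orb g x" using orb_refl orb_step[OF orb_refl] by blast
  qed
  have "2 * card (orb g ` D) = card (\<Union> (orb g ` D))"
  proof (rule card_partition)
    show "finite (\<Union> (orb g ` D))" using assms(1) o by simp
    show "card c = 2" if "c \<in> orb g ` D" for c
      using that assms(2) o by (metis card_2_iff imageE)
    show "c1 \<inter> c2 = {}" if c: "c1 \<in> orb g ` D" "c2 \<in> orb g ` D" "c1 \<noteq> c2" for c1 c2
    proof -
      obtain x y where xy: "x \<in> D" "y \<in> D" "c1 = {x, g x}" "c2 = {y, g y}"
        using c(1,2) o by blast
      have "g (g x) = x" "g (g y) = y" using assms(2) xy by auto
      then show ?thesis using c(3) unfolding xy by (auto; metis)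
    qed
  qed (use assms in auto)
  moreover have "\<Union> (orb g ` D) = D" using o assms(2) by auto
  ultimately show ?thesis by simp
qed

text \<open>Reachability is by \<open>\<sigma>\<close> and \<open>\<alpha>\<close>, but
  \<open>conn\<close> speaks of the face permutation. As \<open>\<alpha>\<close> is an involution,
  \<open>\<sigma>\<close> is \<open>\<sigma> \<circ> \<alpha>\<close> after \<open>\<alpha>\<close>,
  so the closed sets are the same.\<close>

lemma conn_iff_rtrancl:
  assumes "finite D" "\<sigma> permutes D" "\<alpha> permutes D" "\<forall>x\<in>D. \<alpha> (\<alpha> x) = x"
  shows "(\<forall>x\<in>D. \<forall>y\<in>D. (x, y) \<in> ({(u, \<sigma> u) | u. True} \<union> {(u, \<alpha> u) | u. True})\<^sup>*)
    \<longleftrightarrow> conn D (\<sigma> \<circ> \<alpha>) \<alpha>" (is "(\<forall>x\<in>D. \<forall>y\<in>D. (x, y) \<in> ?R\<^sup>*) \<longleftrightarrow> _")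
proof
  assume *: "\<forall>x\<in>D. \<forall>y\<in>D. (x, y) \<in> ?R\<^sup>*"
  show "conn D (\<sigma> \<circ> \<alpha>) \<alpha>" unfolding conn_def
  proof (intro allI impI)
    fix T assume T: "T \<subseteq> D" "T \<noteq> {}" "closed2 (\<sigma> \<circ> \<alpha>) \<alpha> T"
    have cl: "\<alpha> x \<in> T" "\<sigma> (\<alpha> x) \<in> T" if "x \<in> T" for x using T(3) that by (auto simp: closed2_def)
    have cl2: "\<sigma> x \<in> T" if "x \<in> T" for x
      using cl(2)[OF cl(1)[OF that]] assms(4) T(1) that by auto
    obtain x where x: "x \<in> T" using T(2) by blast
    have "y \<in> T" if "(x, y) \<in> ?R\<^sup>*" for y
      using that by (induction rule: rtrancl_induct) (use x cl cl2 in auto)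
    then show "T = D" using * x T(1) by blast
  qed
next
  assume c: "conn D (\<sigma> \<circ> \<alpha>) \<alpha>"
  show "\<forall>x\<in>D. \<forall>y\<in>D. (x, y) \<in> ?R\<^sup>*"
  proof
    fix x assume x: "x \<in> D"
    define T where "T = {y \<in> D. (x, y) \<in> ?R\<^sup>*}"
    have s: "\<alpha> y \<in> T" "\<sigma> y \<in> T" if "y \<in> T" for y
    proof -
      have y: "y \<in> D" "(x, y) \<in> ?R\<^sup>*" using that by (simp_all add: T_def)
      have "(y, \<alpha> y) \<in> ?R" "(y, \<sigma> y) \<in> ?R" by blast+
      then have "(x, \<alpha> y) \<in> ?R\<^sup>*" "(x, \<sigma> y) \<in> ?R\<^sup>*" using y(2) by (meson rtrancl.rtrancl_into_rtrancl)+
      moreover have "\<alpha> y \<in> D" "\<sigma> y \<in> D" using y(1) assms(2,3) by (simp_all add: permutes_in_image)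
      ultimately show "\<alpha> y \<in> T" "\<sigma> y \<in> T" by (simp_all add: T_def)
    qed
    then have "closed2 (\<sigma> \<circ> \<alpha>) \<alpha> T" by (auto simp: closed2_def)
    moreover have "T \<subseteq> D" "x \<in> T" using x by (auto simp: T_def)
    ultimately have "T = D" using connD[OF c] by blast
    then show "\<forall>y\<in>D. (x, y) \<in> ?R\<^sup>*" by (auto simp: T_def)
  qed
qed

text \<open>The vertex rotation of the pair is
  \<open>\<sigma> \<circ> \<alpha> \<circ> \<alpha> = \<sigma>\<close>, and \<open>\<alpha>\<close>
  has \<open>n\<close> cycles on the \<open>2 * n\<close> darts. In the absence of legs
  \<open>genus0\<close> is then twice the equation \<open>V - E + F = 2\<close>.\<close>

lemma is_planar_map_iff:
  "is_planar_map n (\<sigma>, \<alpha>, r) \<longleftrightarrow> \<sigma> permutes darts n \<and> (\<sigma> \<circ> \<alpha>, \<alpha>) \<in> pm {} (darts n) \<and> r \<in> darts n"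
proof (cases "\<sigma> permutes darts n \<and> \<alpha> permutes darts n \<and> (\<forall>x\<in>darts n. \<alpha> x \<noteq> x \<and> \<alpha> (\<alpha> x) = x)")
  case True
  have fin: "finite (darts n)" and cd: "card (darts n) = 2 * n" by (simp_all add: darts_def)
  have E: "card (orb \<alpha> ` darts n) = n"
    using card_orbits_involution[OF fin, of \<alpha>] True cd by (simp add: permutes_in_image)
  have "\<sigma> \<circ> \<alpha> \<circ> \<alpha> = \<sigma>"
  proof
    fix x show "(\<sigma> \<circ> \<alpha> \<circ> \<alpha>) x = \<sigma> x"
      using True permutes_not_in[of \<alpha> "darts n" x] by (cases "x \<in> darts n") auto
  qed
  moreover have "fixpts \<alpha> (darts n) = {}" using True by (auto simp: fixpts_def)
  ultimately have "genus0 (\<sigma> \<circ> \<alpha>) \<alpha> (darts n) \<longleftrightarrow>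
     int (card (orb \<sigma> ` darts n)) - int n + int (card (orb (\<sigma> \<circ> \<alpha>) ` darts n)) = 2"
    by (simp add: genus0_def ncyc_def cd) linarith
  note gen = this
  have fx: "fixpts \<alpha> (darts n) = {}" using True by (auto simp: fixpts_def)
  have pc: "(\<sigma> \<circ> \<alpha>) permutes darts n" using True by (intro permutes_compose) auto
  have cc: "(\<forall>x\<in>darts n. \<forall>y\<in>darts n. (x, y) \<in> ({(u, \<sigma> u) | u. True} \<union> {(u, \<alpha> u) | u. True})\<^sup>*)
    \<longleftrightarrow> conn (darts n) (\<sigma> \<circ> \<alpha>) \<alpha>"
    using True by (intro conn_iff_rtrancl[OF fin]) auto
  show ?thesis
    unfolding is_planar_map_def pm_def cycles_of_def faces_def face_perm_def prod.case mem_Collect_eq cc E gen fx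
    using True pc by blast
next
  case False
  then show ?thesis by (auto simp: is_planar_map_def pm_def fixpts_def)
qed

text \<open>Odd faces get weight 0, which removes the non-bipartite maps.\<close>
definition bip :: "(nat \<Rightarrow> real) \<Rightarrow> nat \<Rightarrow> real" where
  "bip q m = (if even m then q (m div 2) else 0)"

lemma finite_planar_maps: "finite {m. is_planar_map n m}"
proof (rule finite_subset)
  show "{m. is_planar_map n m} \<subseteq> {f. f permutes darts n} \<times> {f. f permutes darts n} \<times> darts n"
    by (auto simp: is_planar_map_def)
  show "finite ({f. f permutes darts n} \<times> {f. f permutes darts n} \<times> darts n)"
    by (simp add: darts_def finite_permutations)
qed

text \<open>The rotation is recovered as \<open>\<sigma> = f \<circ> g\<close>. A map with a face of
  odd degree contributes 0 on the right: that face cannot be the root face, whose degree is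
  \<open>2 * l\<close>, so it brings in a factor \<open>bip q\<close> equal to 0.\<close>

lemma sum_map_weight:
  "(\<Sum>m\<in>maps_nl n l. map_weight q n m)
    = (\<Sum>(f, g)\<in>pm {} (darts n). \<Sum>r\<in>darts n. fwt (bip q) (darts n) f r (2 * l))"
proof -
  let ?D = "darts n"
  let ?w = "\<lambda>(\<sigma>, \<alpha>, r). fwt (bip q) ?D (\<sigma> \<circ> \<alpha>) r (2 * l)"
  have fin: "finite ?D" by (simp add: darts_def)
  have "(\<Sum>m\<in>maps_nl n l. map_weight q n m) = (\<Sum>m\<in>{m. is_planar_map n m}. ?w m)"
  proof (rule sum.mono_neutral_cong_left[OF finite_planar_maps])
    show "maps_nl n l \<subseteq> {m. is_planar_map n m}" by (auto simp: maps_nl_def)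
    show "\<forall>m\<in>{m. is_planar_map n m} - maps_nl n l. ?w m = 0"
    proof clarify
      fix \<sigma> \<alpha> r assume p: "is_planar_map n (\<sigma>, \<alpha>, r)" and n: "(\<sigma>, \<alpha>, r) \<notin> maps_nl n l"
      show "fwt (bip q) ?D (\<sigma> \<circ> \<alpha>) r (2 * l) = 0"
      proof (cases "card (orb (\<sigma> \<circ> \<alpha>) r) = 2 * l")
        case True
        then obtain C where C: "C \<in> orb (\<sigma> \<circ> \<alpha>) ` ?D" "odd (card C)"
          using p n by (auto simp: maps_nl_def root_face_def face_perm_def faces_def cycles_of_def)
        then have "C \<in> orb (\<sigma> \<circ> \<alpha>) ` ?D - {orb (\<sigma> \<circ> \<alpha>) r}" using True by auto
        moreover have "bip q (card C) = 0" using C(2) by (simp add: bip_def)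
        ultimately have "(\<Prod>C\<in>orb (\<sigma> \<circ> \<alpha>) ` ?D - {orb (\<sigma> \<circ> \<alpha>) r}. bip q (card C)) = 0"
          using fin by (intro prod_zero) auto
        then show ?thesis by (simp add: fwt_def)
      qed (simp add: fwt_def)
    qed
    show "map_weight q n m = ?w m" if "m \<in> maps_nl n l" for m
      using that by (cases m) (auto simp: maps_nl_def map_weight_def fwt_def root_face_def face_perm_def
          faces_def cycles_of_def bip_def intro!: prod.cong)
  qed
  also have "\<dots> = (\<Sum>(p, r)\<in>pm {} ?D \<times> ?D. fwt (bip q) ?D (fst p) r (2 * l))"
  proof (rule sum.reindex_bij_witness[where i = "\<lambda>((f, g), r). (f \<circ> g, g, r)" and j = "\<lambda>(\<sigma>, \<alpha>, r). ((\<sigma> \<circ> \<alpha>, \<alpha>), r)"])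
    have inv: "f \<circ> g \<circ> g = f" if "g permutes ?D" "\<forall>x\<in>?D. g (g x) = x" for f g :: "nat \<Rightarrow> nat"
    proof
      fix x show "(f \<circ> g \<circ> g) x = f x"
        using that permutes_not_in[OF that(1), of x] by (cases "x \<in> ?D") auto
    qed
    fix a assume a: "a \<in> {m. is_planar_map n m}"
    obtain \<sigma> \<alpha> r where e: "a = (\<sigma>, \<alpha>, r)" by (metis prod.exhaust)
    have p: "\<sigma> permutes ?D" "(\<sigma> \<circ> \<alpha>, \<alpha>) \<in> pm {} ?D" "r \<in> ?D" using a e is_planar_map_iff by auto
    then have "\<sigma> \<circ> \<alpha> \<circ> \<alpha> = \<sigma>" by (intro inv) (auto simp: pm_def)
    then show "(\<lambda>((f, g), r). (f \<circ> g, g, r)) ((\<lambda>(\<sigma>, \<alpha>, r). ((\<sigma> \<circ> \<alpha>, \<alpha>), r)) a) = a" using e by simp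
    show "(\<lambda>(\<sigma>, \<alpha>, r). ((\<sigma> \<circ> \<alpha>, \<alpha>), r)) a \<in> pm {} ?D \<times> ?D" using p e by simp
    show "(case (\<lambda>(\<sigma>, \<alpha>, r). ((\<sigma> \<circ> \<alpha>, \<alpha>), r)) a of (p, r) \<Rightarrow> fwt (bip q) ?D (fst p) r (2 * l)) = ?w a"
      using e by simp
  next
    have inv: "f \<circ> g \<circ> g = f" if "g permutes ?D" "\<forall>x\<in>?D. g (g x) = x" for f g :: "nat \<Rightarrow> nat"
    proof
      fix x show "(f \<circ> g \<circ> g) x = f x"
        using that permutes_not_in[OF that(1), of x] by (cases "x \<in> ?D") auto
    qed
    fix b assume b: "b \<in> pm {} ?D \<times> ?D"
    obtain f g r where e: "b = ((f, g), r)" by (metis prod.exhaust)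
    have p: "f permutes ?D" "g permutes ?D" "\<forall>x\<in>?D. g (g x) = x" "(f, g) \<in> pm {} ?D" "r \<in> ?D"
      using b e by (auto simp: pm_def)
    note i = inv[OF p(2,3), of f]
    show "(\<lambda>(\<sigma>, \<alpha>, r). ((\<sigma> \<circ> \<alpha>, \<alpha>), r)) ((\<lambda>((f, g), r). (f \<circ> g, g, r)) b) = b" using i e by simp
    show "(\<lambda>((f, g), r). (f \<circ> g, g, r)) b \<in> {m. is_planar_map n m}"
      using p i e permutes_compose[OF p(2,1)] by (simp add: is_planar_map_iff)
  qed
  finally show ?thesis by (simp add: sum.cartesian_product case_prod_unfold)
qed

definition relabel :: "(nat \<Rightarrow> nat) \<Rightarrow> (nat \<Rightarrow> nat) \<times> (nat \<Rightarrow> nat) \<times> nat \<Rightarrow> (nat \<Rightarrow> nat) \<times> (nat \<Rightarrow> nat) \<times> nat" where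
  "relabel \<pi> m = (case m of (\<sigma>, \<alpha>, r) \<Rightarrow> (conj_perm \<pi> \<sigma>, conj_perm \<pi> \<alpha>, \<pi> r))"

lemma faces_iso:
  assumes m: "is_planar_map n (\<sigma>, \<alpha>, r)" and pi: "\<pi> permutes darts n"
    and eq: "\<forall>x\<in>darts n. \<pi> (\<sigma> x) = \<sigma>' (\<pi> x) \<and> \<pi> (\<alpha> x) = \<alpha>' (\<pi> x)"
  shows "faces n (\<sigma>', \<alpha>', \<pi> r) = (`) \<pi> ` faces n (\<sigma>, \<alpha>, r)"
    "root_face (\<sigma>', \<alpha>', \<pi> r) = \<pi> ` root_face (\<sigma>, \<alpha>, r)"
proof -
  have b: "bij \<pi>" using pi by (rule permutes_bij)
  have p: "\<sigma> permutes darts n" "\<alpha> permutes darts n" "r \<in> darts n"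
    using m by (auto simp: is_planar_map_def)
  have im: "\<pi> ` darts n = darts n" by (rule permutes_image[OF pi])
  have e: "conj_perm \<pi> (\<sigma> \<circ> \<alpha>) (\<pi> x) = (\<sigma>' \<circ> \<alpha>') (\<pi> x)" if "x \<in> darts n" for x
  proof -
    have "\<alpha> x \<in> darts n" using p(2) that by (simp add: permutes_in_image)
    then have "\<pi> (\<sigma> (\<alpha> x)) = \<sigma>' (\<alpha>' (\<pi> x))" using eq that by metis
    then show ?thesis by (simp add: conj_perm_apply[OF b])
  qed
  have cp: "conj_perm \<pi> (\<sigma> \<circ> \<alpha>) permutes darts n"
    using permutes_conj[OF b permutes_compose[OF p(2,1)]] im by simp
  have o: "orb (\<sigma>' \<circ> \<alpha>') (\<pi> x) = \<pi> ` orb (\<sigma> \<circ> \<alpha>) x" if x: "x \<in> darts n" for x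
  proof -
    have "orb (conj_perm \<pi> (\<sigma> \<circ> \<alpha>)) (\<pi> x) = orb (\<sigma>' \<circ> \<alpha>') (\<pi> x)"
    proof (rule orb_cong[of _ "darts n"])
      show "\<pi> x \<in> darts n" using x im by blast
      show "conj_perm \<pi> (\<sigma> \<circ> \<alpha>) ` darts n \<subseteq> darts n" using permutes_image[OF cp] by simp
      show "conj_perm \<pi> (\<sigma> \<circ> \<alpha>) y = (\<sigma>' \<circ> \<alpha>') y" if "y \<in> darts n" for y
        using e that im by (metis imageE)
    qed
    then show ?thesis using orb_conj[OF b] by simp
  qed
  show "root_face (\<sigma>', \<alpha>', \<pi> r) = \<pi> ` root_face (\<sigma>, \<alpha>, r)"
    using o[OF p(3)] by (simp add: root_face_def face_perm_def)
  have "orb (\<sigma>' \<circ> \<alpha>') ` \<pi> ` darts n = (`) \<pi> ` orb (\<sigma> \<circ> \<alpha>) ` darts n"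
    using o by (auto simp: image_image)
  then show "faces n (\<sigma>', \<alpha>', \<pi> r) = (`) \<pi> ` faces n (\<sigma>, \<alpha>, r)"
    by (simp add: faces_def cycles_of_def face_perm_def im)
qed

text \<open>Planarity is assumed on one side only. A class of \<open>map_iso\<close> also contains
  triples that act arbitrarily outside the darts, and the representative picked by
  \<open>SOME\<close> may be one of these.\<close>

lemma map_weight_iso:
  assumes m: "is_planar_map n m" and iso: "(m, m') \<in> map_iso n"
  shows "map_weight q n m' = map_weight q n m"
proof -
  obtain \<sigma> \<alpha> r where e: "m = (\<sigma>, \<alpha>, r)" by (metis prod.exhaust)
  obtain \<sigma>' \<alpha>' r' where e': "m' = (\<sigma>', \<alpha>', r')" by (metis prod.exhaust)
  obtain \<pi> where pi: "\<pi> permutes darts n" "\<pi> r = r'"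
    and eq: "\<forall>x\<in>darts n. \<pi> (\<sigma> x) = \<sigma>' (\<pi> x) \<and> \<pi> (\<alpha> x) = \<alpha>' (\<pi> x)"
    using iso by (auto simp: map_iso_def e e')
  have b: "bij \<pi>" using pi(1) by (rule permutes_bij)
  note f = faces_iso[OF m[unfolded e] pi(1) eq]
  have inj: "inj_on ((`) \<pi>) A" for A
    using b by (meson bij_is_inj inj_on_image inj_on_subset subset_UNIV)
  have "faces n m' - {root_face m'} = (`) \<pi> ` (faces n m - {root_face m})"
    using inj_on_image_set_diff[OF inj[of UNIV], of "faces n m" "{root_face m}"] f
    unfolding e e' pi(2) by simp
  then show ?thesis
    by (simp add: map_weight_def prod.reindex[OF inj] card_image_bij[OF b])
qed

lemma equiv_map_iso: "equiv UNIV (map_iso n)"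
proof (rule equivI)
  show "map_iso n \<subseteq> UNIV \<times> UNIV" by simp
  show "refl (map_iso n)"
    by (rule refl_onI) (auto simp: map_iso_def intro!: exI[of _ id] permutes_id)
  show "sym (map_iso n)"
  proof (rule symI)
    fix m m' assume "(m, m') \<in> map_iso n"
    then obtain \<sigma> \<alpha> r \<sigma>' \<alpha>' r' \<pi> where e: "m = (\<sigma>, \<alpha>, r)" "m' = (\<sigma>', \<alpha>', r')"
      and pi: "\<pi> permutes darts n" "\<pi> r = r'"
      and eq: "\<forall>x\<in>darts n. \<pi> (\<sigma> x) = \<sigma>' (\<pi> x) \<and> \<pi> (\<alpha> x) = \<alpha>' (\<pi> x)"
      unfolding map_iso_def by blast
    have "inv \<pi> permutes darts n" by (rule permutes_inv[OF pi(1)])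
    moreover have "inv \<pi> (\<sigma>' x) = \<sigma> (inv \<pi> x)" "inv \<pi> (\<alpha>' x) = \<alpha> (inv \<pi> x)" if "x \<in> darts n" for x
    proof -
      have x: "\<pi> (inv \<pi> x) = x" "inv \<pi> x \<in> darts n"
        using permutes_inverses[OF pi(1)] that \<open>inv \<pi> permutes darts n\<close> by (simp_all add: permutes_in_image)
      then show "inv \<pi> (\<sigma>' x) = \<sigma> (inv \<pi> x)" "inv \<pi> (\<alpha>' x) = \<alpha> (inv \<pi> x)"
        using eq permutes_inverses(2)[OF pi(1)] by metis+
    qed
    moreover have "inv \<pi> r' = r" using pi permutes_inverses(2)[OF pi(1)] by metis
    ultimately show "(m', m) \<in> map_iso n" unfolding map_iso_def e by blast
  qed
  show "trans (map_iso n)"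
  proof (rule transI)
    fix m1 m2 m3 assume "(m1, m2) \<in> map_iso n" "(m2, m3) \<in> map_iso n"
    then obtain s a r s' a' r' s'' a'' r'' \<pi> \<rho> where e: "m1 = (s, a, r)" "m2 = (s', a', r')" "m3 = (s'', a'', r'')"
      and pi: "\<pi> permutes darts n" "\<pi> r = r'" "\<rho> permutes darts n" "\<rho> r' = r''"
      and eq: "\<forall>x\<in>darts n. \<pi> (s x) = s' (\<pi> x) \<and> \<pi> (a x) = a' (\<pi> x)"
        "\<forall>x\<in>darts n. \<rho> (s' x) = s'' (\<rho> x) \<and> \<rho> (a' x) = a'' (\<rho> x)"
      unfolding map_iso_def by blast
    have "(\<rho> \<circ> \<pi>) permutes darts n" by (rule permutes_compose[OF pi(1,3)])
    moreover have "(\<rho> \<circ> \<pi>) (s x) = s'' ((\<rho> \<circ> \<pi>) x) \<and> (\<rho> \<circ> \<pi>) (a x) = a'' ((\<rho> \<circ> \<pi>) x)" if "x \<in> darts n" for x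
    proof -
      have "\<pi> x \<in> darts n" using pi(1) that by (simp add: permutes_in_image)
      then show ?thesis using eq that by simp
    qed
    moreover have "(\<rho> \<circ> \<pi>) r = r''" using pi by simp
    ultimately show "(m1, m3) \<in> map_iso n" unfolding map_iso_def e by blast
  qed
qed

text \<open>A rooted connected map has no automorphism, since the set of fixed darts is closed.\<close>
lemma card_iso_class:
  assumes m: "m \<in> maps_nl n l"
  shows "card {m' \<in> maps_nl n l. (m, m') \<in> map_iso n} = fact (2 * n)"
proof -
  obtain \<sigma> \<alpha> r where e: "m = (\<sigma>, \<alpha>, r)" by (metis prod.exhaust)
  let ?D = "darts n"
  have pl: "is_planar_map n (\<sigma>, \<alpha>, r)" using m e by (simp add: maps_nl_def)
  then have p: "\<sigma> permutes ?D" "(\<sigma> \<circ> \<alpha>, \<alpha>) \<in> pm {} ?D" "r \<in> ?D" "\<alpha> permutes ?D" "conn ?D (\<sigma> \<circ> \<alpha>) \<alpha>"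
    by (auto simp: is_planar_map_iff pm_def)
  have "{m' \<in> maps_nl n l. (m, m') \<in> map_iso n} = (\<lambda>\<pi>. relabel \<pi> m) ` {\<pi>. \<pi> permutes ?D}" (is "?L = ?R")
  proof
    show "?L \<subseteq> ?R"
    proof
      fix m' assume m': "m' \<in> ?L"
      obtain \<sigma>' \<alpha>' r' where e': "m' = (\<sigma>', \<alpha>', r')" by (metis prod.exhaust)
      obtain \<pi> where pi: "\<pi> permutes ?D" "\<pi> r = r'"
        and eq: "\<forall>x\<in>?D. \<pi> (\<sigma> x) = \<sigma>' (\<pi> x) \<and> \<pi> (\<alpha> x) = \<alpha>' (\<pi> x)"
        using m' unfolding e e' map_iso_def by blast
      have b: "bij \<pi>" using pi(1) by (rule permutes_bij)
      have p': "\<sigma>' permutes ?D" "\<alpha>' permutes ?D" using m' by (auto simp: e' maps_nl_def is_planar_map_def)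
      have "conj_perm \<pi> s = s'" if "s permutes ?D" "s' permutes ?D" "\<forall>x\<in>?D. \<pi> (s x) = s' (\<pi> x)" for s s'
      proof
        fix y
        obtain x where y: "y = \<pi> x" using b by (metis bij_pointE)
        show "conj_perm \<pi> s y = s' y"
        proof (cases "x \<in> ?D")
          case True
          then show ?thesis using that(3) y by (simp add: conj_perm_apply[OF b])
        next
          case False
          then have "y \<notin> ?D" using y permutes_in_image[OF pi(1)] by simp
          then show ?thesis using False permutes_not_in[OF that(1)] permutes_not_in[OF that(2)] y
            by (simp add: conj_perm_apply[OF b])
        qed
      qed
      then have "m' = relabel \<pi> m" using p(1,4) p' eq pi(2) by (simp add: e e' relabel_def)
      then show "m' \<in> ?R" using pi(1) by blast
    qed
    show "?R \<subseteq> ?L"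
    proof (rule image_subsetI)
      fix \<pi> assume "\<pi> \<in> {\<pi>. \<pi> permutes ?D}"
      then have pi: "\<pi> permutes ?D" by simp
      have b: "bij \<pi>" using pi by (rule permutes_bij)
      have im: "\<pi> ` ?D = ?D" by (rule permutes_image[OF pi])
      have eq: "\<forall>x\<in>?D. \<pi> (\<sigma> x) = conj_perm \<pi> \<sigma> (\<pi> x) \<and> \<pi> (\<alpha> x) = conj_perm \<pi> \<alpha> (\<pi> x)"
        by (simp add: conj_perm_apply[OF b])
      have "(m, relabel \<pi> m) \<in> map_iso n" unfolding e relabel_def map_iso_def using pi eq by auto
      moreover have "is_planar_map n (relabel \<pi> m)"
        using permutes_conj[OF b p(1)] pm_conj[OF b p(2)] p(3) im
        by (auto simp: e relabel_def is_planar_map_iff conj_perm_comp[OF b])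
      moreover have "faces n (relabel \<pi> m) = (`) \<pi> ` faces n m" "root_face (relabel \<pi> m) = \<pi> ` root_face m"
        using faces_iso[OF pl pi eq] by (simp_all add: e relabel_def)
      ultimately show "relabel \<pi> m \<in> ?L"
        using m by (auto simp: maps_nl_def card_image_bij[OF b])
    qed
  qed
  moreover have "inj_on (\<lambda>\<pi>. relabel \<pi> m) {\<pi>. \<pi> permutes ?D}"
  proof (rule inj_onI)
    fix \<pi> \<rho> assume "\<pi> \<in> {\<pi>. \<pi> permutes ?D}" "\<rho> \<in> {\<pi>. \<pi> permutes ?D}" and eq: "relabel \<pi> m = relabel \<rho> m"
    then have pi: "\<pi> permutes ?D" "\<rho> permutes ?D" by auto
    note b = permutes_bij[OF pi(1)] permutes_bij[OF pi(2)]
    have E: "conj_perm \<pi> \<sigma> = conj_perm \<rho> \<sigma>" "conj_perm \<pi> \<alpha> = conj_perm \<rho> \<alpha>" "\<pi> r = \<rho> r"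
      using eq by (simp_all add: e relabel_def)
    define T where "T = {x \<in> ?D. \<pi> x = \<rho> x}"
    have step: "s x \<in> T" if "s permutes ?D" "conj_perm \<pi> s = conj_perm \<rho> s" "x \<in> T" for s x
    proof -
      have "\<pi> (s x) = conj_perm \<pi> s (\<pi> x)" by (simp add: conj_perm_apply[OF b(1)])
      also have "\<dots> = conj_perm \<rho> s (\<rho> x)" using that by (simp add: T_def)
      also have "\<dots> = \<rho> (s x)" by (simp add: conj_perm_apply[OF b(2)])
      finally show ?thesis using that by (simp add: T_def permutes_in_image)
    qed
    have "closed2 (\<sigma> \<circ> \<alpha>) \<alpha> T" unfolding closed2_def
      using step[OF p(1) E(1)] step[OF p(4) E(2)] by auto
    moreover have "T \<subseteq> ?D" "r \<in> T" using p(3) E(3) by (auto simp: T_def)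
    ultimately have "T = ?D" using connD[OF p(5)] by blast
    then have "\<pi> x = \<rho> x" if "x \<in> ?D" for x using that by (auto simp: T_def)
    then show "\<pi> = \<rho>" using pi permutes_not_in by (metis ext)
  qed
  ultimately have "card {m' \<in> maps_nl n l. (m, m') \<in> map_iso n} = card {\<pi>. \<pi> permutes ?D}"
    by (simp add: card_image)
  also have "\<dots> = fact (2 * n)" by (simp add: card_permutations darts_def)
  finally show ?thesis .
qed

lemma sum_iso_classes:
  "(\<Sum>C\<in>maps_nl n l // map_iso n. map_weight q n (SOME m. m \<in> C)) * fact (2 * n)
    = (\<Sum>m\<in>maps_nl n l. map_weight q n m)"
proof -
  let ?M = "maps_nl n l" and ?R = "map_iso n"
  have fin: "finite ?M" by (rule finite_subset[OF _ finite_planar_maps[of n]]) (auto simp: maps_nl_def)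
  have "(\<Sum>m\<in>?M. map_weight q n m) = (\<Sum>C\<in>?M // ?R. \<Sum>m\<in>{m \<in> ?M. ?R `` {m} = C}. map_weight q n m)"
    by (rule sum.group[symmetric]) (use fin in \<open>auto simp: quotient_def\<close>)
  also have "\<dots> = (\<Sum>C\<in>?M // ?R. map_weight q n (SOME m. m \<in> C) * fact (2 * n))"
  proof (rule sum.cong[OF refl])
    fix C assume "C \<in> ?M // ?R"
    then obtain m where m: "m \<in> ?M" "C = ?R `` {m}" by (auto simp: quotient_def)
    have "m \<in> C" using m(2) equiv_class_self[OF equiv_map_iso[of n] UNIV_I[of m]] by simp
    then have "(SOME m. m \<in> C) \<in> C" by (rule someI)
    then have some: "map_weight q n (SOME m. m \<in> C) = map_weight q n m"
      using m by (intro map_weight_iso) (auto simp: maps_nl_def)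
    have set: "{m' \<in> ?M. ?R `` {m'} = C} = {m' \<in> ?M. (m, m') \<in> ?R}"
      unfolding m(2) using eq_equiv_class_iff[OF equiv_map_iso[of n], of m] by auto
    have "(\<Sum>m'\<in>{m' \<in> ?M. ?R `` {m'} = C}. map_weight q n m') = (\<Sum>m'\<in>{m' \<in> ?M. (m, m') \<in> ?R}. map_weight q n m)"
      unfolding set using m(1) by (intro sum.cong refl map_weight_iso) (auto simp: maps_nl_def)
    also have "\<dots> = map_weight q n m * fact (2 * n)"
      using card_iso_class[OF m(1)] by (simp add: mult.commute)
    finally show "(\<Sum>m\<in>{m \<in> ?M. ?R `` {m} = C}. map_weight q n m) = map_weight q n (SOME m. m \<in> C) * fact (2 * n)"
      using some by simp
  qed
  finally show ?thesis by (simp add: sum_distrib_right)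
qed

section \<open>The recursion by the number of edges, and its sum\<close>

definition wcoef :: "(nat \<Rightarrow> real) \<Rightarrow> nat \<Rightarrow> nat \<Rightarrow> real" where
  "wcoef q n l = leg (bip q) (2 * n) (2 * l + 1) / fact (2 * n)"

text \<open>The leg accounts for the degree \<open>2 * l + 1\<close>, and the factorial for the
  labels of the \<open>2 * n\<close> darts. At \<open>n = 0\<close> both sides vanish, since the
  vertex map has perimeter 0.\<close>

lemma sum_iso_classes_eq_wcoef:
  assumes "l \<ge> 1"
  shows "(\<Sum>C\<in>maps_nl n l // map_iso n. map_weight q n (SOME m. m \<in> C)) = wcoef q n l"
proof (cases "n = 0")
  case True
  have "maps_nl 0 l = {}" by (auto simp: maps_nl_def is_planar_map_def darts_def)
  then show ?thesis using True assms leg_0 by (simp add: wcoef_def)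
next
  case False
  have "legsum (bip q) (insert (2 * n) (darts n)) (2 * n) (Suc (2 * l))
    = (\<Sum>(f, g)\<in>pm {} (darts n). \<Sum>r\<in>darts n. fwt (bip q) (darts n) f r (2 * l))"
    by (rule legsum_insert) (use False in \<open>auto simp: darts_def lessThan_empty_iff\<close>)
  moreover have "legsum (bip q) (insert (2 * n) (darts n)) (2 * n) (Suc (2 * l)) = leg (bip q) (2 * n) (Suc (2 * l))"
    by (rule legsum_eq_leg) (auto simp: darts_def)
  ultimately have "leg (bip q) (2 * n) (2 * l + 1)
     = (\<Sum>C\<in>maps_nl n l // map_iso n. map_weight q n (SOME m. m \<in> C)) * fact (2 * n)"
    using sum_iso_classes sum_map_weight by simp
  then show ?thesis by (simp add: wcoef_def)
qed

text \<open>The darts besides the leg are matched in pairs; in the recursion, one factor of each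
  product inherits the odd number.\<close>

lemma leg_odd: "odd N \<Longrightarrow> leg h N d = 0"
proof (induction N arbitrary: d rule: less_induct)
  case (less N)
  show ?case
  proof (cases "N = 1 \<or> d = 0 \<or> d = 1")
    case True
    then show ?thesis using leg_Suc_0 leg_degree_0 leg_Suc_1[of N h] less.prems
      by (metis One_nat_def Suc_leI odd_pos)
  next
    case False
    then obtain N' where N': "N = N' + 2"
      using less.prems by (metis One_nat_def Suc_eq_plus1 add_2_eq_Suc' even_zero not0_implies_Suc)
    obtain d' where d': "d = Suc d'" "d' \<ge> 1" using False by (cases d) auto
    have o: "odd N'" using less.prems N' by simp
    have "leg h s i * leg h (N' - s) (d' - i) = 0" if "s \<le> N'" for s i
    proof (cases "odd s")
      case True
      then show ?thesis using less.IH[of s] that N' by simp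
    next
      case False
      then have "odd (N' - s)" using o that by simp
      then show ?thesis using less.IH[of "N' - s"] N' by simp
    qed
    then have "(\<Sum>i\<le>d'. leg h s i * leg h (N' - s) (d' - i)) = 0" if "s \<le> N'" for s
      using that by (intro sum.neutral) blast
    then show ?thesis
      unfolding N' d'(1) leg_rec[OF d'(2)] using less.IH[of N'] o N' by simp
  qed
qed

text \<open>If all other faces have even degree, so has the root face before the leg is attached;
  the leg makes its degree odd.\<close>

lemma leg_bip_even: "even d \<Longrightarrow> leg (bip q) N d = 0"
proof (induction N arbitrary: d rule: less_induct)
  case (less N)
  consider "d = 0" | "N = 0" "d > 0" | "N = 1" | "N > 1" "d > 0" by (metis gr0I less_one linorder_neqE_nat)
  then show ?case
  proof cases
    case 4
    then obtain N' where N': "N = N' + 2" by (metis Suc_1 Suc_leI add.commute le_Suc_ex)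
    obtain d' where d': "d = Suc d'" using 4 by (cases d) auto
    have o: "odd d'" using less.prems d' by simp
    then have d1: "d' \<ge> 1" by (cases d') auto
    have "leg (bip q) s i * leg (bip q) (N' - s) (d' - i) = 0" if "s \<le> N'" "i \<le> d'" for s i
    proof (cases "even i")
      case True
      then show ?thesis using less.IH[of s] that N' by simp
    next
      case False
      then have "even (d' - i)" using o that by simp
      then show ?thesis using less.IH[of "N' - s"] N' by simp
    qed
    then have "(\<Sum>i\<le>d'. leg (bip q) s i * leg (bip q) (N' - s) (d' - i)) = 0" if "s \<le> N'" for s
      using that by (intro sum.neutral) (metis atMost_iff)
    moreover have "bip q k * leg (bip q) N' (d' + k - 1) = 0" if "k \<ge> 1" for k
      using less.IH[of N' "d' + k - 1"] o d1 that N' by (cases "even k") (simp, simp add: bip_def)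
    then have "(\<Sum>k=1..N' + 2. bip q k * leg (bip q) N' (d' + k - 1)) = 0"
      by (intro sum.neutral) (metis atLeastAtMost_iff)
    ultimately show ?thesis
      unfolding N' d' leg_rec[OF d1] by simp
  qed (use less.prems leg_degree_0 leg_0 leg_Suc_0 in auto)
qed

lemma leg_large: "d > Suc N \<Longrightarrow> leg h N d = 0"
proof (induction N arbitrary: d rule: less_induct)
  case (less N)
  consider "N = 0" | "N = 1" | "N > 1" by linarith
  then show ?case
  proof cases
    case 3
    then obtain N' where N': "N = N' + 2" by (metis Suc_1 Suc_leI add.commute le_Suc_ex)
    obtain d' where d': "d = Suc d'" using less.prems by (cases d) auto
    have d1: "d' \<ge> 1" "d' > N' + 2" using less.prems d' N' by auto
    have "leg h s i * leg h (N' - s) (d' - i) = 0" if "s \<le> N'" for s i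
    proof (cases "i > Suc s")
      case True
      then show ?thesis using less.IH[of s i] that N' by simp
    next
      case False
      then have "d' - i > Suc (N' - s)" using d1 that by linarith
      then show ?thesis using less.IH[of "N' - s" "d' - i"] N' by simp
    qed
    then have "(\<Sum>i\<le>d'. leg h s i * leg h (N' - s) (d' - i)) = 0" if "s \<le> N'" for s
      using that by (intro sum.neutral) blast
    moreover have "leg h N' (d' + k - 1) = 0" if "k \<ge> 1" for k
      using less.IH[of N' "d' + k - 1"] d1 that N' by simp
    ultimately show ?thesis
      unfolding N' d' leg_rec[OF d1(1)] by simp
  qed (use less.prems leg_0 leg_Suc_0 in auto)
qed

lemma sum_even_support:
  fixes F :: "nat \<Rightarrow> real"
  assumes "\<And>s. odd s \<Longrightarrow> F s = 0"
  shows "(\<Sum>s\<le>2 * n. F s) = (\<Sum>a\<le>n. F (2 * a))"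
  by (induction n) (simp_all add: assms)

lemma sum_odd_support:
  fixes F :: "nat \<Rightarrow> real"
  assumes "\<And>s. even s \<Longrightarrow> F s = 0"
  shows "(\<Sum>s\<le>2 * n + 2. F s) = (\<Sum>a\<le>n. F (2 * a + 1))"
proof (induction n)
  case 0
  then show ?case by (simp add: assms numeral_2_eq_2)
next
  case (Suc n)
  have "F (2 * n + 4) = 0" by (rule assms) simp
  moreover have "2 * Suc n + 2 = Suc (Suc (2 * n + 2))" "2 * n + 4 = Suc (Suc (2 * n + 2))"
    "2 * Suc n + 1 = Suc (2 * n + 2)" by simp_all
  ultimately show ?case using Suc by (simp only: sum.atMost_Suc)
qed

lemma sum_even_support':
  fixes F :: "nat \<Rightarrow> real"
  assumes "\<And>s. odd s \<Longrightarrow> F s = 0"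
  shows "(\<Sum>s=1..2 * n. F s) = (\<Sum>a=1..n. F (2 * a))"
  by (induction n) (simp_all add: assms)

lemma wcoef_0: "wcoef q 0 l = (if l = 0 then 1 else 0)"
  by (simp add: wcoef_def leg_0)

lemma wcoef_perimeter_0: "wcoef q n 0 = (if n = 0 then 1 else 0)"
  using leg_Suc_1[of "2 * n" "bip q"] by (cases "n = 0") (auto simp: wcoef_def leg_0)

lemma wcoef_large: "l > n \<Longrightarrow> wcoef q n l = 0"
  by (simp add: wcoef_def leg_large)

text \<open>The factorials turn the binomial convolution over dart sets into an ordinary one, and
  the parity lemmas leave only even numbers of darts and odd degrees.\<close>

lemma wcoef_Suc_Suc:
  "wcoef q (Suc n) (Suc l) = (\<Sum>a\<le>n. \<Sum>b\<le>l. wcoef q a b * wcoef q (n - a) (l - b))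
    + (\<Sum>k=1..n + 1. q k * wcoef q n (l + k))"
proof -
  let ?L = "leg (bip q)"
  define N d where "N = 2 * n" and "d = 2 * l + 2"
  have "?L (N + 2) (Suc d) = real (N + 2) * real (N + 1) *
    ((\<Sum>s\<le>N. real (N choose s) * (\<Sum>i\<le>d. ?L s i * ?L (N - s) (d - i)))
      + (\<Sum>k=1..N + 2. bip q k * ?L N (d + k - 1)))"
    by (rule leg_rec) (simp add: d_def)
  moreover have "fact (N + 2) = real (N + 2) * real (N + 1) * fact N" by (simp add: algebra_simps)
  ultimately have "?L (N + 2) (Suc d) / fact (N + 2)
    = ((\<Sum>s\<le>N. real (N choose s) * (\<Sum>i\<le>d. ?L s i * ?L (N - s) (d - i)))
      + (\<Sum>k=1..N + 2. bip q k * ?L N (d + k - 1))) / fact N"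
    by (simp add: divide_simps)
  also have "\<dots> = (\<Sum>s\<le>N. \<Sum>i\<le>d. (?L s i / fact s) * (?L (N - s) (d - i) / fact (N - s)))
      + (\<Sum>k=1..N + 2. bip q k * (?L N (d + k - 1) / fact N))"
    unfolding add_divide_distrib sum_divide_distrib
  proof (intro arg_cong2[of _ _ _ _ "(+)"] sum.cong refl)
    fix s assume s: "s \<in> {..N}"
    have "real (N choose s) / fact N = 1 / (fact s * fact (N - s))"
      using s binomial_fact[of s N, where 'a = real] by (simp add: divide_simps)
    then have *: "real (N choose s) * X / fact N = 1 / (fact s * fact (N - s)) * X" for X
      by (metis times_divide_eq_left)
    then show "real (N choose s) * (\<Sum>i\<le>d. ?L s i * ?L (N - s) (d - i)) / fact N
      = (\<Sum>i\<le>d. ?L s i / fact s * (?L (N - s) (d - i) / fact (N - s)))"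
      unfolding * by (simp add: sum_distrib_left)
  qed simp
  also have "(\<Sum>s\<le>N. \<Sum>i\<le>d. (?L s i / fact s) * (?L (N - s) (d - i) / fact (N - s)))
    = (\<Sum>a\<le>n. \<Sum>i\<le>d. (?L (2 * a) i / fact (2 * a)) * (?L (N - 2 * a) (d - i) / fact (N - 2 * a)))"
    unfolding N_def by (rule sum_even_support) (simp add: leg_odd)
  also have "\<dots> = (\<Sum>a\<le>n. \<Sum>b\<le>l. wcoef q a b * wcoef q (n - a) (l - b))"
  proof (rule sum.cong[OF refl])
    fix a assume a: "a \<in> {..n}"
    have "(\<Sum>i\<le>d. (?L (2 * a) i / fact (2 * a)) * (?L (N - 2 * a) (d - i) / fact (N - 2 * a)))
      = (\<Sum>b\<le>l. (?L (2 * a) (2 * b + 1) / fact (2 * a)) * (?L (N - 2 * a) (d - (2 * b + 1)) / fact (N - 2 * a)))"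
      unfolding d_def by (rule sum_odd_support) (simp add: leg_bip_even)
    also have "\<dots> = (\<Sum>b\<le>l. wcoef q a b * wcoef q (n - a) (l - b))"
    proof (rule sum.cong[OF refl])
      fix b assume b: "b \<in> {..l}"
      have "N - 2 * a = 2 * (n - a)" "d - (2 * b + 1) = 2 * (l - b) + 1" using b by (auto simp: N_def d_def)
      then show "?L (2 * a) (2 * b + 1) / fact (2 * a) * (?L (N - 2 * a) (d - (2 * b + 1)) / fact (N - 2 * a))
        = wcoef q a b * wcoef q (n - a) (l - b)" by (simp only: wcoef_def)
    qed
    finally show "(\<Sum>i\<le>d. (?L (2 * a) i / fact (2 * a)) * (?L (N - 2 * a) (d - i) / fact (N - 2 * a)))
      = (\<Sum>b\<le>l. wcoef q a b * wcoef q (n - a) (l - b))" .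
  qed
  also have "(\<Sum>k=1..N + 2. bip q k * (?L N (d + k - 1) / fact N))
    = (\<Sum>j=1..n + 1. bip q (2 * j) * (?L N (d + 2 * j - 1) / fact N))"
  proof -
    have "N + 2 = 2 * (n + 1)" by (simp add: N_def)
    then show ?thesis by (simp only:) (rule sum_even_support', simp add: bip_def)
  qed
  also have "\<dots> = (\<Sum>k=1..n + 1. q k * wcoef q n (l + k))"
  proof (rule sum.cong[OF refl])
    fix k assume "k \<in> {1..n + 1}"
    have "d + 2 * k - 1 = 2 * (l + k) + 1" by (simp add: d_def)
    then show "bip q (2 * k) * (?L N (d + 2 * k - 1) / fact N) = q k * wcoef q n (l + k)"
      by (simp only: wcoef_def N_def) (simp add: bip_def)
  qed
  also have "?L (N + 2) (Suc d) / fact (N + 2) = wcoef q (Suc n) (Suc l)"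
  proof -
    have "N + 2 = 2 * Suc n" "Suc d = 2 * Suc l + 1" by (simp_all add: N_def d_def)
    then show ?thesis by (simp only: wcoef_def)
  qed
  finally show ?thesis .
qed

lemma wcoef_nonneg: "\<forall>k\<ge>1. q k \<ge> 0 \<Longrightarrow> wcoef q n l \<ge> 0"
proof (induction n arbitrary: l rule: less_induct)
  case (less n)
  show ?case
  proof (cases n)
    case 0
    then show ?thesis by (simp add: wcoef_0)
  next
    case (Suc n')
    show ?thesis
    proof (cases l)
      case 0
      then show ?thesis by (simp add: wcoef_perimeter_0)
    next
      case l: (Suc l')
      show ?thesis unfolding Suc l wcoef_Suc_Suc
        using less Suc by (intro add_nonneg_nonneg sum_nonneg mult_nonneg_nonneg) auto
    qed
  qed
qed

lemma wcoef_sums: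
  assumes nonneg: "\<forall>k\<ge>1. q k \<ge> 0" and adm: "admissible q"
  shows "(\<lambda>n. wcoef q n l) sums (if l = 0 then 1 else W q l)"
proof (cases "l = 0")
  case True
  have "(\<lambda>n. wcoef q n 0) sums (\<Sum>n\<in>{0}. wcoef q n 0)"
    by (rule sums_finite) (auto simp: wcoef_perimeter_0)
  then show ?thesis using True by (simp add: wcoef_perimeter_0)
next
  case False
  have w: "wcoef q n l \<ge> 0" for n by (rule wcoef_nonneg[OF nonneg])
  have eq: "Wq q l = (\<Sum>n. ennreal (wcoef q n l))"
    unfolding Wq_def using False sum_iso_classes_eq_wcoef[of l] by simp
  have fin: "Wq q l < \<infinity>" using adm False by (simp add: admissible_def)
  then have "summable (\<lambda>n. wcoef q n l)"
    using w eq by (intro summable_suminf_not_top) auto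
  moreover have "W q l = (\<Sum>n. wcoef q n l)"
    unfolding W_def eq using w calculation
    by (subst suminf_ennreal2) (auto simp: suminf_nonneg)
  ultimately show ?thesis using False by (simp add: summable_sums)
qed

text \<open>The sums over \<open>n\<close> and \<open>k\<close> are interchanged through two
  inequalities between partial sums, all terms being non-negative. For fixed \<open>n\<close> the
  sum over \<open>k\<close> is finite, because the perimeter is bounded by the number of edges
  (\<open>wcoef_large\<close>).\<close>

lemma tutte_equation:
  assumes nonneg: "\<forall>k\<ge>1. q k \<ge> 0" and adm: "admissible q"
  defines "Z \<equiv> \<lambda>l. if l = 0 then 1 else W q l"
  shows "(\<lambda>k. q (Suc k) * Z (l + Suc k)) sums (Z (Suc l) - (\<Sum>b\<le>l. Z b * Z (l - b)))"
proof -
  define w where "w = wcoef q"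
  have w0: "w n m \<ge> 0" for n m unfolding w_def by (rule wcoef_nonneg[OF nonneg])
  have ws: "(\<lambda>n. w n m) sums Z m" for m unfolding w_def Z_def by (rule wcoef_sums[OF nonneg adm])
  have q0: "q (Suc k) \<ge> 0" for k using nonneg by simp
  have wle: "(\<Sum>n<M. w n m) \<le> Z m" for M m
    using sum_le_suminf[of "\<lambda>n. w n m" "{..<M}"] ws[of m] w0 by (auto simp: sums_iff)
  define R where "R = Z (Suc l) - (\<Sum>b\<le>l. Z b * Z (l - b))"
  define r where "r n = (\<Sum>k\<le>n. q (Suc k) * w n (l + Suc k))" for n
  have "(\<lambda>n. w (Suc n) (Suc l)) sums Z (Suc l)"
    using ws[of "Suc l"] by (subst sums_Suc_iff) (simp add: w_def wcoef_0)
  moreover have "(\<lambda>n. \<Sum>b\<le>l. \<Sum>a\<le>n. w a b * w (n - a) (l - b)) sums (\<Sum>b\<le>l. Z b * Z (l - b))"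
  proof (rule sums_sum)
    fix b
    have "summable (\<lambda>n. norm (w n b))" "summable (\<lambda>n. norm (w n (l - b)))"
      using ws w0 by (auto simp: sums_iff)
    from Cauchy_product_sums[OF this] show "(\<lambda>n. \<Sum>a\<le>n. w a b * w (n - a) (l - b)) sums (Z b * Z (l - b))"
      using ws by (simp add: sums_iff)
  qed
  ultimately have "(\<lambda>n. w (Suc n) (Suc l) - (\<Sum>b\<le>l. \<Sum>a\<le>n. w a b * w (n - a) (l - b))) sums R"
    unfolding R_def by (rule sums_diff)
  moreover have "w (Suc n) (Suc l) - (\<Sum>b\<le>l. \<Sum>a\<le>n. w a b * w (n - a) (l - b)) = r n" for n
  proof -
    have "(\<Sum>k=1..n + 1. q k * w n (l + k)) = r n"
      unfolding r_def by (rule sum.reindex_bij_witness[where i = Suc and j = "\<lambda>k. k - 1"]) auto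
    moreover have "(\<Sum>b\<le>l. \<Sum>a\<le>n. w a b * w (n - a) (l - b)) = (\<Sum>a\<le>n. \<Sum>b\<le>l. w a b * w (n - a) (l - b))"
      by (rule sum.swap)
    ultimately show ?thesis unfolding w_def wcoef_Suc_Suc by simp
  qed
  ultimately have rR: "r sums R" by simp
  have r0: "r n \<ge> 0" for n unfolding r_def by (intro sum_nonneg mult_nonneg_nonneg q0 w0)
  have full: "(\<Sum>k<K. q (Suc k) * w n (l + Suc k)) \<le> r n" for n K
  proof -
    have "(\<Sum>k<K. q (Suc k) * w n (l + Suc k)) = (\<Sum>k\<in>{..<K} \<inter> {..n}. q (Suc k) * w n (l + Suc k))"
    proof (rule sum.mono_neutral_right)
      have "w n (l + Suc k) = 0" if "k \<notin> {..n}" for k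
        unfolding w_def by (rule wcoef_large) (use that in simp)
      then show "\<forall>k\<in>{..<K} - {..<K} \<inter> {..n}. q (Suc k) * w n (l + Suc k) = 0"
        by (metis DiffE IntI mult_zero_right)
    qed auto
    also have "\<dots> \<le> r n" unfolding r_def
      by (rule sum_mono2) (auto intro: mult_nonneg_nonneg q0 w0)
    finally show ?thesis .
  qed
  have up: "(\<Sum>k<K. q (Suc k) * Z (l + Suc k)) \<le> R" for K
  proof -
    have "(\<lambda>n. \<Sum>k<K. q (Suc k) * w n (l + Suc k)) sums (\<Sum>k<K. q (Suc k) * Z (l + Suc k))"
      by (intro sums_sum sums_mult ws)
    then show ?thesis by (rule sums_le[OF full _ rR])
  qed
  have Z0: "Z m \<ge> 0" for m using wle[where M = 0] by simp
  have sm: "summable (\<lambda>k. q (Suc k) * Z (l + Suc k))"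
    by (rule summableI_nonneg_bounded[of _ R]) (use up q0 Z0 in auto)
  have "(\<Sum>n<M. r n) \<le> (\<Sum>k. q (Suc k) * Z (l + Suc k))" for M
  proof -
    \<comment> \<open>Only \<open>k \<le> n\<close> occurs in \<open>r n\<close>, so for
      \<open>n < M\<close> the square of side \<open>M\<close> contains all the terms.\<close>
    have "(\<Sum>n<M. r n) \<le> (\<Sum>n<M. \<Sum>k<M. q (Suc k) * w n (l + Suc k))"
      unfolding r_def by (intro sum_mono sum_mono2) (auto intro: mult_nonneg_nonneg q0 w0)
    also have "\<dots> = (\<Sum>k<M. q (Suc k) * (\<Sum>n<M. w n (l + Suc k)))"
      unfolding sum_distrib_left by (rule sum.swap)
    also have "\<dots> \<le> (\<Sum>k<M. q (Suc k) * Z (l + Suc k))"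
      by (intro sum_mono mult_left_mono wle q0)
    also have "\<dots> \<le> (\<Sum>k. q (Suc k) * Z (l + Suc k))"
      by (rule sum_le_suminf[OF sm]) (auto intro: mult_nonneg_nonneg q0 Z0)
    finally show ?thesis .
  qed
  then have "R \<le> (\<Sum>k. q (Suc k) * Z (l + Suc k))"
    using rR by (metis suminf_le_const sums_iff)
  moreover have "(\<Sum>k. q (Suc k) * Z (l + Suc k)) \<le> R" by (rule suminf_le_const[OF sm up])
  ultimately show ?thesis using sm unfolding R_def[symmetric] by (simp add: sums_iff)
qed

section \<open>The normalised equation and its total mass\<close>

text \<open>\<open>v_le_1\<close> and \<open>radius\<close> together say that the exponential growth
  rate of \<open>v\<close> is exactly 1; this is the form in which criticality is used. The equation
  starts at \<open>n = 2\<close> because \<open>v\<close> is shifted by one index.\<close>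

locale norm_tutte =
  fixes v a :: "nat \<Rightarrow> real"
  assumes v_0: "v 0 = 0" and v_nonneg: "v n \<ge> 0" and v_1: "v 1 > 0" and v_le_1: "v n \<le> 1"
    and a_nonneg: "a k \<ge> 0"
    and tutte: "n \<ge> 2 \<Longrightarrow> (\<lambda>k. a k * v (n + k)) sums (v n - (\<Sum>i\<le>n. v i * v (n - i)))"
    and radius: "y > 1 \<Longrightarrow> \<exists>n. v n * y ^ n > 1"
begin

lemma tutte_ge: "n \<ge> 2 \<Longrightarrow> (\<Sum>i\<le>n. v i * v (n - i)) + (\<Sum>k<K. a k * v (n + k)) \<le> v n"
  using sum_le_suminf[of "\<lambda>k. a k * v (n + k)" "{..<K}"] tutte[of n] a_nonneg v_nonneg
  by (auto simp: sums_iff)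

lemma v_supermult: "v n * v m \<le> v (n + m)"
proof (cases "n = 0 \<or> m = 0")
  case False
  have "v n * v (n + m - n) \<le> (\<Sum>i\<le>n + m. v i * v (n + m - i))"
    by (rule member_le_sum[of n]) (auto intro: mult_nonneg_nonneg v_nonneg)
  also have "\<dots> \<le> v (n + m)" using tutte_ge[of "n + m" 0] False by simp
  finally show ?thesis by simp
qed (auto simp: v_0 v_nonneg)

lemma v_pos: "n \<ge> 1 \<Longrightarrow> v n > 0"
proof (induction n rule: dec_induct)
  case base
  then show ?case by (rule v_1)
next
  case (step n)
  then show ?case using v_supermult[of n 1] v_1 by (auto intro: less_le_trans[OF mult_pos_pos])
qed

definition wsum :: "real \<Rightarrow> nat \<Rightarrow> real" where
  "wsum y M = (\<Sum>n\<le>M. v n * y ^ n)"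

lemma wsum_mono: "y > 1 \<Longrightarrow> M \<le> N \<Longrightarrow> wsum y M \<le> wsum y N"
  unfolding wsum_def by (rule sum_mono2) (auto intro: mult_nonneg_nonneg v_nonneg)

lemma wsum_nonneg: "y > 1 \<Longrightarrow> wsum y M \<ge> 0"
  unfolding wsum_def by (intro sum_nonneg mult_nonneg_nonneg v_nonneg) auto

text \<open>Supermultiplicativity carries the single large term provided by \<open>radius\<close> to
  all multiples of its index. It is applied at \<open>sqrt y\<close>, so that a factor
  \<open>sqrt y ^ (n * k)\<close> is left over, which is unbounded.\<close>

lemma wsum_unbounded:
  assumes y: "y > 1" shows "\<exists>M. wsum y M > B"
proof -
  define z where "z = sqrt y"
  have z: "z > 1" "z * z = y" using y by (auto simp: z_def)
  obtain n where n: "v n * z ^ n > 1" using radius[OF z(1)] by blast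
  then have n0: "n \<ge> 1" using v_0 by (cases n) auto
  have pw: "v n ^ m \<le> v (m * n)" if "m \<ge> 1" for m
    using that
  proof (induction m rule: dec_induct)
    case (step m)
    have "v n ^ Suc m \<le> v n * v (m * n)" using step by (simp add: mult_left_mono v_nonneg)
    also have "\<dots> \<le> v (Suc m * n)" using v_supermult[of n "m * n"] by simp
    finally show ?case .
  qed simp
  obtain m where m: "z ^ m > B" using real_arch_pow[OF z(1)] by blast
  define k where "k = Suc m"
  have "B < z ^ k" by (rule less_le_trans[OF m power_increasing]) (use z(1) in \<open>simp_all add: k_def\<close>)
  also have "\<dots> \<le> z ^ (n * k)" using n0 z(1) by (intro power_increasing) auto
  also have "\<dots> \<le> (v n * z ^ n) ^ k * z ^ (n * k)"
    using mult_right_mono[OF one_le_power[of "v n * z ^ n" k], of "z ^ (n * k)"] n z(1) by simp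
  also have "\<dots> = v n ^ k * y ^ (k * n)"
    by (simp add: power_mult_distrib z(2)[symmetric] power_mult[symmetric] mult.commute mult.left_commute)
  also have "\<dots> \<le> v (k * n) * y ^ (k * n)"
    using pw[of k] y by (intro mult_right_mono) (auto simp: k_def)
  also have "\<dots> \<le> wsum y (k * n)"
    unfolding wsum_def using y by (intro member_le_sum) (auto intro: mult_nonneg_nonneg v_nonneg)
  finally show ?thesis by blast
qed

text \<open>Otherwise the partial sums would grow by a factor \<open>1 / \<theta> > y ^ K\<close> every \<open>K\<close> steps, although
  \<open>v n \<le> 1\<close> makes them \<open>O(y ^ n)\<close>.\<close>
lemma wsum_window:
  assumes y: "y > 1" and th: "0 < \<theta>" "\<theta> * y ^ K < 1"
  shows "\<exists>M\<ge>M0. wsum y M \<ge> \<theta> * wsum y (M + K)"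
proof (rule ccontr)
  assume "\<not> ?thesis"
  then have neg: "wsum y M < \<theta> * wsum y (M + K)" if "M \<ge> M0" for M using that by force
  obtain M1 where "wsum y M1 > 0" using wsum_unbounded[OF y] by blast
  define N where "N = max M0 M1"
  have N: "wsum y N > 0" "N \<ge> M0" using wsum_mono[OF y, of M1 N] \<open>wsum y M1 > 0\<close> by (auto simp: N_def)
  have it: "wsum y N \<le> \<theta> ^ j * wsum y (N + j * K)" for j
  proof (induction j)
    case (Suc j)
    have "\<theta> ^ j * wsum y (N + j * K) \<le> \<theta> ^ j * (\<theta> * wsum y (N + j * K + K))"
      using neg[of "N + j * K"] N(2) th(1) by (intro mult_left_mono) auto
    then show ?case using Suc by (simp add: ac_simps)
  qed simp
  have up: "wsum y M \<le> (real M + 1) * y ^ M" for M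
  proof -
    have "wsum y M \<le> (\<Sum>n\<le>M. 1 * y ^ M)"
      unfolding wsum_def using y by (intro sum_mono mult_mono v_le_1 power_increasing) auto
    then show ?thesis by (simp add: algebra_simps)
  qed
  define \<rho> where "\<rho> = \<theta> * y ^ K"
  have rho: "0 \<le> \<rho>" "\<rho> < 1" using th y by (simp_all add: \<rho>_def)
  have bd: "wsum y N \<le> y ^ N * ((real N + 1) * \<rho> ^ j + real K * (real j * \<rho> ^ j))" for j
  proof -
    have "wsum y N \<le> \<theta> ^ j * ((real (N + j * K) + 1) * y ^ (N + j * K))"
      using it[of j] up[of "N + j * K"] th(1) by (meson mult_left_mono order_trans zero_le_power less_imp_le)
    also have "\<dots> = y ^ N * ((real N + 1) * \<rho> ^ j + real K * (real j * \<rho> ^ j))"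
      by (simp add: \<rho>_def power_add power_mult power_mult_distrib algebra_simps)
    finally show ?thesis .
  qed
  have "(\<lambda>j. y ^ N * ((real N + 1) * \<rho> ^ j + real K * (real j * \<rho> ^ j))) \<longlonglongrightarrow> y ^ N * ((real N + 1) * 0 + real K * 0)"
    using rho by (intro tendsto_intros LIMSEQ_power_zero powser_times_n_limit_0) auto
  then have "wsum y N \<le> 0" using bd by (intro LIMSEQ_le_const) auto
  then show False using N by simp
qed

text \<open>From the convolution only the pairs are kept with one index at most \<open>K\<close> and
  the other in \<open>{K<..M - K}\<close>. They occur in both orders, which gives the factor 2, and
  their index sum is at most \<open>M\<close>. From the linear part only the shifts
  \<open>k < K\<close> are kept.\<close>

lemma wsum_ineq:
  assumes y: "y > 1" and M: "M \<ge> 2 * K" and K: "K \<ge> 2"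
  shows "2 * wsum y K * (wsum y (M - K) - wsum y K) + (\<Sum>k<K. a k / y ^ k) * (wsum y M - wsum y K) \<le> wsum y M"
proof -
  define t where "t n = v n * y ^ n" for n
  have t0: "t n \<ge> 0" for n unfolding t_def using y by (intro mult_nonneg_nonneg v_nonneg) auto
  have S: "wsum y M = (\<Sum>n\<le>M. t n)" for M by (simp add: wsum_def t_def)
  have Sd: "wsum y N - wsum y L = (\<Sum>n\<in>{L<..N}. t n)" if "L \<le> N" for L N
  proof -
    have "{..N} = {..L} \<union> {L<..N}" using that by auto
    moreover have "sum t ({..L} \<union> {L<..N}) = sum t {..L} + sum t {L<..N}"
      by (rule sum.union_disjoint) auto
    ultimately show ?thesis unfolding S by simp
  qed
  let ?A = "{..K} \<times> {K<..M - K}" and ?B = "{K<..M - K} \<times> {..K}"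
  have "2 * wsum y K * (wsum y (M - K) - wsum y K) = (\<Sum>(i, j)\<in>?A. t i * t j) + (\<Sum>(i, j)\<in>?B. t i * t j)"
    using M Sd[of K "M - K"] by (simp add: S sum.cartesian_product[symmetric] sum_product[symmetric])
  also have "\<dots> = (\<Sum>(i, j)\<in>?A \<union> ?B. t i * t j)"
    by (rule sum.union_disjoint[symmetric]) auto
  also have "\<dots> \<le> (\<Sum>(i, j)\<in>{(i, j). i + j \<le> M}. t i * t j)"
  proof (rule sum_mono2)
    show "finite {(i, j). i + j \<le> M}" by (rule finite_subset[of _ "{..M} \<times> {..M}"]) auto
  qed (use M t0 in \<open>auto intro: mult_nonneg_nonneg\<close>)
  also have "\<dots> = (\<Sum>n\<le>M. \<Sum>i\<le>n. t i * t (n - i))" by (rule sum.triangle_reindex_eq)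
  finally have 1: "2 * wsum y K * (wsum y (M - K) - wsum y K) \<le> (\<Sum>n\<le>M. \<Sum>i\<le>n. t i * t (n - i))" .
  have 2: "(\<Sum>k<K. a k / y ^ k) * (wsum y M - wsum y K) \<le> (\<Sum>n=2..M. \<Sum>k<K. a k / y ^ k * t (n + k))"
  proof -
    have "(\<Sum>k<K. a k / y ^ k) * (wsum y M - wsum y K) = (\<Sum>k<K. a k / y ^ k * (\<Sum>n\<in>{K<..M}. t n))"
      using Sd[of K M] M by (simp add: sum_distrib_right)
    also have "\<dots> \<le> (\<Sum>k<K. a k / y ^ k * (\<Sum>n=2..M. t (n + k)))"
    proof (intro sum_mono mult_left_mono)
      fix k assume k: "k \<in> {..<K}"
      have "(\<Sum>n\<in>{K<..M}. t n) \<le> (\<Sum>n\<in>{2 + k..M + k}. t n)"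
        by (rule sum_mono2) (use k t0 in auto)
      also have "\<dots> = (\<Sum>n=2..M. t (n + k))" by (rule sum.shift_bounds_cl_nat_ivl)
      finally show "(\<Sum>n\<in>{K<..M}. t n) \<le> (\<Sum>n=2..M. t (n + k))" .
      show "0 \<le> a k / y ^ k" using a_nonneg y by simp
    qed
    also have "\<dots> = (\<Sum>n=2..M. \<Sum>k<K. a k / y ^ k * t (n + k))"
      unfolding sum_distrib_left by (rule sum.swap)
    finally show ?thesis .
  qed
  have 3: "(\<Sum>n\<le>M. \<Sum>i\<le>n. t i * t (n - i)) = (\<Sum>n=2..M. \<Sum>i\<le>n. t i * t (n - i))"
  proof (rule sum.mono_neutral_right)
    show "\<forall>n\<in>{..M} - {2..M}. (\<Sum>i\<le>n. t i * t (n - i)) = 0"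
    proof
      fix n assume "n \<in> {..M} - {2..M}"
      then have "n = 0 \<or> n = 1" by auto
      then show "(\<Sum>i\<le>n. t i * t (n - i)) = 0" using v_0 by (auto simp: t_def)
    qed
  qed auto
  have 4: "(\<Sum>i\<le>n. t i * t (n - i)) + (\<Sum>k<K. a k / y ^ k * t (n + k)) \<le> t n" if "n \<ge> 2" for n
  proof -
    have "(\<Sum>i\<le>n. t i * t (n - i)) = (\<Sum>i\<le>n. v i * v (n - i)) * y ^ n"
      unfolding sum_distrib_right t_def
      by (rule sum.cong) (auto simp: power_add[symmetric] mult.assoc mult.left_commute)
    moreover have "(\<Sum>k<K. a k / y ^ k * t (n + k)) = (\<Sum>k<K. a k * v (n + k)) * y ^ n"
      unfolding sum_distrib_right t_def using y by (intro sum.cong) (auto simp: power_add)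
    ultimately show ?thesis
      using mult_right_mono[OF tutte_ge[OF that, of K], of "y ^ n"] y by (simp add: t_def distrib_right)
  qed
  have "(\<Sum>n\<le>M. \<Sum>i\<le>n. t i * t (n - i)) + (\<Sum>n=2..M. \<Sum>k<K. a k / y ^ k * t (n + k)) \<le> (\<Sum>n=2..M. t n)"
    unfolding 3 sum.distrib[symmetric] by (rule sum_mono) (use 4 in auto)
  also have "\<dots> \<le> wsum y M" unfolding S by (rule sum_mono2) (use t0 in auto)
  finally show ?thesis using 1 2 by linarith
qed

text \<open>If the mass exceeded 1, summing Tutte's equation against \<open>y ^ n\<close> for \<open>y\<close> slightly above 1 would
  contradict the growth bound: convolution with the masses then enlarges the partial sums.\<close>
lemma mass_le_1: "2 * (\<Sum>i\<le>K. v i) + (\<Sum>k<K. a k) \<le> 1"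
proof -
  have main: "2 * (\<Sum>i\<le>K. v i) + (\<Sum>k<K. a k) \<le> 1" if K: "K \<ge> 2" for K
  proof (rule ccontr)
    define X where "X = 2 * (\<Sum>i\<le>K. v i) + (\<Sum>k<K. a k)"
    assume "\<not> 2 * (\<Sum>i\<le>K. v i) + (\<Sum>k<K. a k) \<le> 1"
    then have X: "X > 1" by (simp add: X_def)
    \<comment> \<open>Two demands meet here: \<open>\<theta> * y ^ K = 1 / y < 1\<close> is required
      by \<open>wsum_window\<close>, and \<open>\<theta> * X = 2 * X / (1 + X)\<close> still exceeds
      1.\<close>
    define y where "y = root (K + 1) ((1 + X) / 2)"
    have y: "y > 1" using X by (simp add: y_def)
    have yK: "y ^ (K + 1) = (1 + X) / 2" unfolding y_def by (rule real_root_pow_pos2) (use X in auto)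
    define \<theta> where "\<theta> = 1 / y ^ (K + 1)"
    have th: "\<theta> > 0" "\<theta> * y ^ K < 1" using y by (simp_all add: \<theta>_def)
    define s where "s = wsum y K"
    define A where "A = (\<Sum>k<K. a k / y ^ k)"
    have s: "(\<Sum>i\<le>K. v i) \<le> s" unfolding s_def wsum_def
    proof (rule sum_mono)
      show "v i \<le> v i * y ^ i" for i using y mult_left_mono[OF one_le_power[of y i], of "v i"] v_nonneg by simp
    qed
    have s0: "s \<ge> 0" unfolding s_def by (rule wsum_nonneg[OF y])
    have A: "\<theta> * (\<Sum>k<K. a k) \<le> A" unfolding A_def sum_distrib_left
    proof (rule sum_mono)
      fix k assume "k \<in> {..<K}"
      then have "y ^ k \<le> y ^ (K + 1)" using y by (intro power_increasing) auto
      then have "a k / y ^ (K + 1) \<le> a k / y ^ k" using y a_nonneg by (intro divide_left_mono) auto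
      then show "\<theta> * a k \<le> a k / y ^ k" by (simp add: \<theta>_def)
    qed
    have A0: "A \<ge> 0" unfolding A_def using a_nonneg y by (intro sum_nonneg) auto
    define e where "e = 2 * s * \<theta> + A - 1"
    have "\<theta> * X \<le> 2 * s * \<theta> + A"
    proof -
      have "\<theta> * (\<Sum>i\<le>K. v i) \<le> \<theta> * s" by (rule mult_left_mono[OF s]) (use th in simp)
      moreover have "\<theta> * X = 2 * (\<theta> * (\<Sum>i\<le>K. v i)) + \<theta> * (\<Sum>k<K. a k)"
        by (simp add: X_def algebra_simps)
      ultimately show ?thesis using A by (simp add: mult.commute)
    qed
    moreover have "\<theta> * X = 2 * X / (1 + X)" unfolding \<theta>_def yK using X by simp
    moreover have "2 * X / (1 + X) > 1" using X by simp
    ultimately have e: "e > 0" by (simp add: e_def)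
    \<comment> \<open>Beyond this size, the surplus \<open>e\<close> of the mass over 1 outweighs
      the boundary terms of \<open>wsum_ineq\<close>.\<close>
    obtain M1 where M1: "wsum y M1 > (2 * s * s + A * s) / e" using wsum_unbounded[OF y] by blast
    obtain N where N: "N \<ge> max M1 K" "wsum y N \<ge> \<theta> * wsum y (N + K)"
      using wsum_window[OF y th] by blast
    define M where "M = N + K"
    have "2 * s * (wsum y N - s) + A * (wsum y M - s) \<le> wsum y M"
      using wsum_ineq[OF y, of K M] K N(1) by (simp add: M_def s_def A_def)
    moreover have "2 * s * (\<theta> * wsum y M) \<le> 2 * s * wsum y N"
      using N(2) s0 by (intro mult_left_mono) (auto simp: M_def)
    ultimately have "e * wsum y M \<le> 2 * s * s + A * s" by (simp add: e_def algebra_simps)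
    moreover have "wsum y M \<ge> wsum y M1" using N(1) by (intro wsum_mono[OF y]) (simp add: M_def)
    then have "e * wsum y M > 2 * s * s + A * s"
      using M1 e by (simp add: pos_divide_less_eq mult.commute) (meson less_le_trans mult_left_mono less_imp_le)
    ultimately show False by simp
  qed
  have "2 * (\<Sum>i\<le>K. v i) + (\<Sum>k<K. a k) \<le> 2 * (\<Sum>i\<le>K + 2. v i) + (\<Sum>k<K + 2. a k)"
    by (intro add_mono mult_left_mono sum_mono2) (auto intro: v_nonneg a_nonneg)
  also have "\<dots> \<le> 1" by (rule main) simp
  finally show ?thesis .
qed

end

section \<open>Exponential growth of the partition functions\<close>

lemma catalan_type_bound:
  fixes Z :: "nat \<Rightarrow> real"
  assumes b: "b > 0" and Z: "\<And>l. Z l \<ge> 0" and Z0: "Z 0 = 1"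
    and rec: "\<And>l. Z (Suc l) \<le> b * (\<Sum>i\<le>l. Z i * Z (l - i))"
  shows "Z l \<le> 2 * (4 * b) ^ l"
proof -
  define x where "x = 1 / (4 * b)"
  have x: "x > 0" "b * x = 1 / 4" using b by (simp_all add: x_def)
  define t where "t l = Z l * x ^ l" for l
  have t0: "t l \<ge> 0" for l using Z x by (simp add: t_def)
  \<comment> \<open>At \<open>x = 1 / (4 * b)\<close> each partial sum is at most
    \<open>1 + s ^ 2 / 4\<close>, where \<open>s\<close> is the previous one, and 2 is the fixed
    point of this map. Equality in the recursion would give rescaled Catalan numbers.\<close>
  have "(\<Sum>l\<le>N. t l) \<le> 2" for N
  proof (induction N)
    case 0
    then show ?case by (simp add: t_def Z0)
  next
    case (Suc N)
    have "(\<Sum>l\<le>N. t (Suc l)) \<le> (\<Sum>l\<le>N. 1 / 4 * (\<Sum>i\<le>l. t i * t (l - i)))"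
    proof (rule sum_mono)
      fix l
      have "t (Suc l) \<le> b * (\<Sum>i\<le>l. Z i * Z (l - i)) * x ^ Suc l"
        unfolding t_def using rec x by (intro mult_right_mono) auto
      also have "\<dots> = b * x * (\<Sum>i\<le>l. Z i * Z (l - i) * x ^ l)"
        by (simp add: sum_distrib_right[symmetric])
      also have "(\<Sum>i\<le>l. Z i * Z (l - i) * x ^ l) = (\<Sum>i\<le>l. t i * t (l - i))"
        unfolding t_def by (rule sum.cong) (auto simp: power_add[symmetric] mult.assoc mult.left_commute)
      finally show "t (Suc l) \<le> 1 / 4 * (\<Sum>i\<le>l. t i * t (l - i))" using x by simp
    qed
    also have "\<dots> = 1 / 4 * (\<Sum>(i, j)\<in>{(i, j). i + j \<le> N}. t i * t j)"
      by (simp only: sum_distrib_left[symmetric] sum.triangle_reindex_eq)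
    also have "\<dots> \<le> 1 / 4 * (\<Sum>(i, j)\<in>{..N} \<times> {..N}. t i * t j)"
      by (intro mult_left_mono sum_mono2) (use t0 in \<open>auto intro: mult_nonneg_nonneg\<close>)
    also have "(\<Sum>(i, j)\<in>{..N} \<times> {..N}. t i * t j) = (\<Sum>l\<le>N. t l) * (\<Sum>l\<le>N. t l)"
      by (simp add: sum.cartesian_product[symmetric] sum_product)
    also have "\<dots> \<le> 2 * 2" using Suc t0 by (intro mult_mono sum_nonneg) auto
    finally have "(\<Sum>l\<le>N. t (Suc l)) \<le> 1" by simp
    then show ?case unfolding sum.atMost_Suc_shift by (simp add: t_def Z0)
  qed
  moreover have "t l \<le> (\<Sum>l\<le>l. t l)" by (rule member_le_sum) (use t0 in auto)
  ultimately have "t l \<le> 2" by (meson order_trans)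
  then have "t l * (4 * b) ^ l \<le> 2 * (4 * b) ^ l" using b by (intro mult_right_mono) auto
  moreover have "t l * (4 * b) ^ l = Z l"
  proof -
    have "x * (4 * b) = 1" using b by (simp add: x_def)
    then show ?thesis unfolding t_def mult.assoc power_mult_distrib[symmetric] by simp
  qed
  ultimately show ?thesis by linarith
qed

locale map_tutte =
  fixes q Z :: "nat \<Rightarrow> real"
  assumes q_nonneg: "k \<ge> 1 \<Longrightarrow> q k \<ge> 0" and q_nz: "\<exists>k\<ge>1. q k \<noteq> 0"
    and Z_0: "Z 0 = 1" and Z_nonneg: "Z l \<ge> 0"
    and eq: "(\<lambda>k. q (Suc k) * Z (l + Suc k)) sums (Z (Suc l) - (\<Sum>b\<le>l. Z b * Z (l - b)))"
begin

lemma Z_ge: "(\<Sum>b\<le>l. Z b * Z (l - b)) + (\<Sum>k<K. q (Suc k) * Z (l + Suc k)) \<le> Z (Suc l)"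
  using sum_le_suminf[of "\<lambda>k. q (Suc k) * Z (l + Suc k)" "{..<K}"] eq[of l] q_nonneg Z_nonneg
  by (auto simp: sums_iff)

lemma Z_mult: "Z i * Z j \<le> Z (i + j + 1)"
proof -
  have "Z i * Z (i + j - i) \<le> (\<Sum>b\<le>i + j. Z b * Z (i + j - b))"
    by (rule member_le_sum[of i]) (auto intro: mult_nonneg_nonneg Z_nonneg)
  then show ?thesis using Z_ge[of "i + j" 0] by simp
qed

lemma Z_mono: "i \<le> j \<Longrightarrow> Z i \<le> Z j"
  by (rule lift_Suc_mono_le) (use Z_mult[of _ 0] Z_0 in auto)

lemma Z_ge_1: "Z l \<ge> 1" using Z_mono[of 0 l] Z_0 by simp

text \<open>If \<open>q k > 0\<close> for some \<open>k \<ge> 2\<close>, the single term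
  \<open>q k * Z (l + k)\<close> of Tutte's equation and monotonicity bound \<open>Z (l + 2)\<close>
  by a multiple of \<open>Z (l + 1)\<close>. Otherwise the infinite sum reduces to
  \<open>q 1 * Z (l + 1)\<close>, and solving for \<open>Z (l + 1)\<close> leaves a recursion of
  Catalan type.\<close>

lemma Z_exp_bound: "\<exists>C. \<forall>l. Z l \<le> C ^ Suc l"
proof (cases "\<exists>k\<ge>2. q k \<noteq> 0")
  case True
  then obtain k where k: "k \<ge> 2" "q k \<noteq> 0" by blast
  then have qk: "q k > 0" using q_nonneg[of k] by simp
  define C where "C = max (Z 1) (1 / q k)"
  have C: "C \<ge> 1" "C \<ge> Z 1" "C \<ge> 1 / q k" using Z_ge_1[of 1] by (auto simp: C_def)
  have step: "Z (Suc (Suc l)) \<le> C * Z (Suc l)" for l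
  proof -
    have "(\<Sum>j\<in>{k - 1}. q (Suc j) * Z (l + Suc j)) \<le> (\<Sum>j<k. q (Suc j) * Z (l + Suc j))"
      using k q_nonneg Z_nonneg by (intro sum_mono2) auto
    also have "\<dots> \<le> Z (Suc l)"
      using Z_ge[of l k] sum_nonneg[of "{..l}" "\<lambda>b. Z b * Z (l - b)"] Z_nonneg by simp
    finally have "q k * Z (l + k) \<le> Z (Suc l)" using k by simp
    then have "Z (l + k) \<le> 1 / q k * Z (Suc l)" using qk by (simp add: field_simps)
    also have "\<dots> \<le> C * Z (Suc l)" using C Z_nonneg by (intro mult_right_mono) auto
    finally show ?thesis using Z_mono[of "Suc (Suc l)" "l + k"] k by simp
  qed
  have "Z (Suc l) \<le> C ^ Suc l" for l
  proof (induction l)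
    case (Suc l)
    have "Z (Suc (Suc l)) \<le> C * C ^ Suc l" using step[of l] Suc C(1) by (meson mult_left_mono order_trans zero_le_one)
    then show ?case by simp
  qed (use C in simp)
  then have "Z (Suc l) \<le> C ^ Suc (Suc l)" for l
    by (rule order_trans) (use C(1) in \<open>intro power_increasing; simp\<close>)
  moreover have "Z 0 \<le> C ^ Suc 0" using C(1) Z_0 by simp
  ultimately have "Z l \<le> C ^ Suc l" for l by (cases l) blast+
  then show ?thesis by blast
next
  case False
  then have qz: "q (Suc k) = 0" if "k \<ge> 1" for k using that by auto
  have e: "q 1 * Z (Suc l) = Z (Suc l) - (\<Sum>b\<le>l. Z b * Z (l - b))" for l
  proof -
    have "(\<lambda>k. q (Suc k) * Z (l + Suc k)) sums (\<Sum>k\<in>{0}. q (Suc k) * Z (l + Suc k))"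
      by (rule sums_finite) (use qz in auto)
    then show ?thesis using sums_unique2[OF eq[of l]] by simp
  qed
  have "q 1 * Z 1 = Z 1 - 1" using e[of 0] Z_0 by simp
  then have "(1 - q 1) * Z 1 = 1" by (simp add: algebra_simps)
  then have q1: "1 - q 1 > 0" using Z_ge_1[of 1] by (smt (verit) mult_nonpos_nonneg)
  define b where "b = 1 / (1 - q 1)"
  have b: "b > 0" using q1 by (simp add: b_def)
  have "Z (Suc l) \<le> b * (\<Sum>i\<le>l. Z i * Z (l - i))" for l
  proof -
    have "(1 - q 1) * Z (Suc l) = (\<Sum>i\<le>l. Z i * Z (l - i))" using e[of l] by (simp add: algebra_simps)
    then have "b * ((1 - q 1) * Z (Suc l)) = b * (\<Sum>i\<le>l. Z i * Z (l - i))" by simp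
    then show ?thesis using q1 by (simp add: b_def)
  qed
  from catalan_type_bound[OF b Z_nonneg Z_0 this] have bd: "Z l \<le> 2 * (4 * b) ^ l" for l .
  define C where "C = max 2 (4 * b)"
  have "Z l \<le> C ^ Suc l" for l
  proof -
    have "2 * (4 * b) ^ l \<le> C * C ^ l" using b by (intro mult_mono power_mono) (auto simp: C_def)
    then show ?thesis using bd[of l] by simp
  qed
  then show ?thesis by blast
qed

text \<open>The root has index \<open>l + 1\<close> because
  \<open>Z i * Z j \<le> Z (i + j + 1)\<close>: it is the shifted sequence that is
  supermultiplicative. As a supremum, \<open>c\<close> gives \<open>Z l \<le> c ^ (l + 1)\<close>
  without a further constant.\<close>

definition c :: real where "c = (SUP l. root (Suc l) (Z l))"

lemma bdd_roots: "bdd_above (range (\<lambda>l. root (Suc l) (Z l)))"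
proof -
  obtain C where C: "\<And>l. Z l \<le> C ^ Suc l" using Z_exp_bound by blast
  have C0: "C \<ge> 0" using C[of 0] Z_0 by simp
  have "root (Suc l) (Z l) \<le> C" for l
  proof -
    have "root (Suc l) (Z l) \<le> root (Suc l) (C ^ Suc l)" by (rule real_root_le_mono[OF zero_less_Suc C])
    also have "\<dots> = C" by (rule real_root_power_cancel[OF zero_less_Suc C0])
    finally show ?thesis .
  qed
  then show ?thesis by (auto simp: bdd_above_def)
qed

lemma c_ge: "root (Suc l) (Z l) \<le> c"
  unfolding c_def by (rule cSUP_upper[OF _ bdd_roots]) auto

lemma c_pos: "c > 0" using c_ge[of 0] Z_0 by simp

lemma Z_le: "Z l \<le> c ^ Suc l"
proof -
  have "root (Suc l) (Z l) ^ Suc l \<le> c ^ Suc l"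
    using c_ge Z_nonneg by (intro power_mono) auto
  then show ?thesis using Z_nonneg real_root_pow_pos2[of "Suc l" "Z l"] by simp
qed

definition v :: "nat \<Rightarrow> real" where "v n = (if n = 0 then 0 else Z (n - 1) / c ^ n)"
definition a :: "nat \<Rightarrow> real" where "a k = q (Suc k) * c ^ k"

sublocale norm_tutte v a
proof
  show "v 0 = 0" "v n \<ge> 0" "v 1 > 0" "a k \<ge> 0" for n k
    using c_pos Z_nonneg Z_0 q_nonneg by (auto simp: v_def a_def)
  show "v n \<le> 1" for n
    using Z_le[of "n - 1"] c_pos by (cases n) (auto simp: v_def)
  show "(\<lambda>k. a k * v (n + k)) sums (v n - (\<Sum>i\<le>n. v i * v (n - i)))" if n: "n \<ge> 2" for n
  proof -
    obtain l where l: "n = Suc (Suc l)" using n by (metis add_2_eq_Suc le_Suc_ex)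
    have "(\<lambda>k. q (Suc k) * Z (l + Suc k) / c ^ n) sums ((Z (Suc l) - (\<Sum>b\<le>l. Z b * Z (l - b))) / c ^ n)"
      by (rule sums_divide[OF eq])
    moreover have "q (Suc k) * Z (l + Suc k) / c ^ n = a k * v (n + k)" for k
    proof -
      have "n + k \<noteq> 0" "n + k - 1 = l + Suc k" using l by auto
      then have "v (n + k) = Z (l + Suc k) / (c ^ n * c ^ k)" by (simp only: v_def if_False power_add)
      moreover have "x * z / y = x * p * (z / (y * p))" if "p \<noteq> 0" for x y z p :: real
        using that by simp
      moreover have "c ^ k \<noteq> 0" using c_pos by simp
      ultimately show ?thesis unfolding a_def by metis
    qed
    moreover have "(\<Sum>i\<le>n. v i * v (n - i)) = (\<Sum>b\<le>l. Z b * Z (l - b)) / c ^ n"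
    proof -
      have "(\<Sum>i\<le>n. v i * v (n - i)) = (\<Sum>i\<in>{1..Suc l}. v i * v (n - i))"
        by (rule sum.mono_neutral_right) (auto simp: v_def l)
      also have "\<dots> = (\<Sum>b\<le>l. Z b * Z (l - b) / c ^ n)"
      proof (rule sum.reindex_bij_witness[where i = Suc and j = "\<lambda>i. i - 1"])
        fix i assume i: "i \<in> {1..Suc l}"
        then have "c ^ n = c ^ i * c ^ (n - i)" by (simp add: power_add[symmetric] l)
        moreover have "n - i \<noteq> 0" "n - i - 1 = l - (i - 1)" using i l by auto
        ultimately show "Z (i - 1) * Z (l - (i - 1)) / c ^ n = v i * v (n - i)" using i by (simp add: v_def)
      qed auto
      finally show ?thesis by (simp add: sum_divide_distrib)
    qed
    moreover have "v n = Z (Suc l) / c ^ n" by (simp add: v_def l)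
    ultimately show ?thesis by (simp add: diff_divide_distrib)
  qed
  show "\<exists>n. v n * y ^ n > 1" if y: "y > 1" for y
  proof -
    have "c / y < c" using y c_pos by (simp add: field_simps)
    then obtain l where l: "c / y < root (Suc l) (Z l)"
      unfolding c_def using less_cSUP_iff[OF _ bdd_roots] by auto
    have "(c / y) ^ Suc l < root (Suc l) (Z l) ^ Suc l"
      using l c_pos y by (intro power_strict_mono) auto
    also have "\<dots> = Z l" using Z_nonneg by (intro real_root_pow_pos2) auto
    finally have "c ^ Suc l < Z l * y ^ Suc l"
      using y by (simp only: power_divide) (simp add: pos_divide_less_eq)
    then have "1 < v (Suc l) * y ^ Suc l" using c_pos by (simp add: v_def field_simps)
    then show ?thesis by blast
  qed
qed

end

section \<open>Wiener-Hopf factorisation\<close>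

lemma summable_on_abs_iff: "(f :: 'a \<Rightarrow> real) summable_on A \<longleftrightarrow> (\<lambda>x. \<bar>f x\<bar>) summable_on A"
  using summable_on_iff_abs_summable_on_real[of f A] by simp

lemma summable_on_bounded_mult:
  fixes f g :: "'a \<Rightarrow> real"
  assumes "f summable_on A" "\<And>x. x \<in> A \<Longrightarrow> \<bar>g x\<bar> \<le> C"
  shows "(\<lambda>x. f x * g x) summable_on A"
proof -
  have "(\<lambda>x. \<bar>f x\<bar> * C) summable_on A"
    using assms(1) summable_on_abs_iff[of f A] by (intro summable_on_cmult_left) simp
  then have "(\<lambda>x. norm (f x * g x)) summable_on A"
    by (rule Infinite_Sum.abs_summable_on_comparison_test') (use assms(2) in \<open>auto simp: abs_mult intro: mult_left_mono\<close>)
  then show ?thesis by (rule Infinite_Sum.abs_summable_summable)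
qed

lemma prod_summable_on:
  fixes f :: "'a \<Rightarrow> real" and g :: "'b \<Rightarrow> real"
  assumes "f summable_on A" "g summable_on B"
  shows "(\<lambda>(i, j). f i * g j) summable_on A \<times> B"
    "(\<Sum>\<^sub>\<infinity>(i, j)\<in>A \<times> B. f i * g j) = infsum f A * infsum g B"
proof -
  have "(\<lambda>p. norm (f (fst p) * g (snd p))) summable_on A \<times> B"
    unfolding Infinite_Sum.abs_summable_on_Sigma_iff
    using assms summable_on_abs_iff[of f A] summable_on_abs_iff[of g B]
    by (auto simp: abs_mult infsum_cmult_right' intro!: summable_on_cmult_right summable_on_cmult_left)
  then have *: "(\<lambda>p. f (fst p) * g (snd p)) summable_on A \<times> B" by (rule Infinite_Sum.abs_summable_summable)
  then show "(\<lambda>(i, j). f i * g j) summable_on A \<times> B" by (simp add: case_prod_unfold)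
  show "(\<Sum>\<^sub>\<infinity>(i, j)\<in>A \<times> B. f i * g j) = infsum f A * infsum g B"
    using infsum_Sigma_banach[OF *]
    by (simp add: case_prod_unfold infsum_cmult_right' infsum_cmult_left')
qed

lemma summable_on_sums:
  fixes f :: "nat \<Rightarrow> real"
  assumes "f summable_on UNIV" shows "f sums infsum f UNIV"
  by (rule has_sum_imp_sums) (rule has_sum_infsum[OF assms])

lemma infsum_le_of_partial:
  fixes f :: "nat \<Rightarrow> real"
  assumes "\<And>n. f n \<ge> 0" "\<And>N. (\<Sum>n\<le>N. f n) \<le> C"
  shows "f summable_on UNIV" "infsum f UNIV \<le> C"
proof -
  have le: "(\<Sum>n<N. f n) \<le> C" for N
    using assms(2)[of N] sum_mono2[of "{..N}" "{..<N}" f] assms(1) by fastforce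
  have s: "summable f" by (rule summableI_nonneg_bounded[OF assms(1) le])
  show so: "f summable_on UNIV" by (rule summable_nonneg_imp_summable_on[OF s assms(1)])
  show "infsum f UNIV \<le> C"
    using summable_on_sums[OF so] suminf_le_const[OF s le] by (simp add: sums_iff)
qed

text \<open>The coefficients of non-negative index of the product of \<open>f (1 / t)\<close> and
  \<open>g t\<close>.\<close>

definition cor :: "(nat \<Rightarrow> real) \<Rightarrow> (nat \<Rightarrow> real) \<Rightarrow> nat \<Rightarrow> real" where
  "cor f g k = (\<Sum>\<^sub>\<infinity>j. f j * g (k + j))"

lemma summable_on_le_infsum:
  fixes f :: "'a \<Rightarrow> real"
  assumes "f summable_on UNIV" "\<And>n. f n \<ge> 0" shows "f n \<le> infsum f UNIV"
  using infsum_mono2[of f "{n}" UNIV] assms by simp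

lemma cor_summable:
  fixes f g :: "nat \<Rightarrow> real"
  assumes "f summable_on UNIV" "g summable_on UNIV" "\<And>n. g n \<ge> 0"
  shows "(\<lambda>j. f j * g (k + j)) summable_on UNIV"
  by (rule summable_on_bounded_mult[OF assms(1), of _ "infsum g UNIV"])
    (use summable_on_le_infsum[OF assms(2,3)] assms(3) in simp)

lemma cor_nonneg: "(\<And>n. f n \<ge> 0) \<Longrightarrow> (\<And>n. g n \<ge> 0) \<Longrightarrow> cor f g k \<ge> 0"
  unfolding cor_def by (rule infsum_nonneg) simp

text \<open>The product of the masses is a sum over all pairs \<open>(i, j)\<close>. Those with
  \<open>i \<le> j\<close> make up \<open>cor f g\<close>, the others make up \<open>cor g f\<close>
  at positive indices.\<close>

lemma cor_total:
  assumes f: "f summable_on UNIV" "\<And>n. f n \<ge> 0" and g: "g summable_on UNIV" "\<And>n. g n \<ge> 0"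
  shows "cor f g summable_on UNIV" "(\<lambda>k. cor g f (Suc k)) summable_on UNIV"
    "infsum (cor f g) UNIV + (\<Sum>\<^sub>\<infinity>k. cor g f (Suc k)) = infsum f UNIV * infsum g UNIV"
proof -
  let ?P = "\<lambda>(i, j). f i * g j"
  let ?h1 = "\<lambda>(k, j). (j, k + j :: nat)" and ?h2 = "\<lambda>(k, j). (Suc k + j, j)"
  have P: "?P summable_on UNIV" using prod_summable_on(1)[OF f(1) g(1)] by simp
  have inj: "inj ?h1" "inj ?h2" by (auto simp: inj_on_def)
  have r1: "range ?h1 = {(i, j). i \<le> j}"
  proof
    show "{(i, j). i \<le> j} \<subseteq> range ?h1"
    proof clarify
      fix i j :: nat assume "i \<le> j"
      then have "(i, j) = ?h1 (j - i, i)" by simp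
      then show "(i, j) \<in> range ?h1" by (rule range_eqI)
    qed
  qed auto
  have r2: "range ?h2 = {(i, j). i > j}"
  proof
    show "{(i, j). i > j} \<subseteq> range ?h2"
    proof clarify
      fix i j :: nat assume "j < i"
      then have "(i, j) = ?h2 (i - Suc j, j)" by simp
      then show "(i, j) \<in> range ?h2" by (rule range_eqI)
    qed
  qed auto
  have s: "?P summable_on range ?h1" "?P summable_on range ?h2"
    using summable_on_subset_banach[OF P] by auto
  then have S: "(?P \<circ> ?h1) summable_on UNIV \<times> UNIV" "(?P \<circ> ?h2) summable_on UNIV \<times> UNIV"
    using summable_on_reindex[OF inj(1)] summable_on_reindex[OF inj(2)] by auto
  have o: "?P \<circ> ?h1 = (\<lambda>(k, j). f j * g (k + j))" "?P \<circ> ?h2 = (\<lambda>(k, j). g j * f (Suc k + j))"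
    by (auto simp: fun_eq_iff)
  show "cor f g summable_on UNIV"
    using summable_on_Sigma_banach[OF S(1)[unfolded o]] by (simp add: cor_def[abs_def])
  show "(\<lambda>k. cor g f (Suc k)) summable_on UNIV"
    using summable_on_Sigma_banach[OF S(2)[unfolded o]] by (simp add: cor_def)
  have i1: "infsum (cor f g) UNIV = infsum ?P (range ?h1)"
    using infsum_Sigma_banach[OF S(1)] unfolding infsum_reindex[OF inj(1)] o by (simp add: cor_def[abs_def])
  have i2: "(\<Sum>\<^sub>\<infinity>k. cor g f (Suc k)) = infsum ?P (range ?h2)"
    using infsum_Sigma_banach[OF S(2)] unfolding infsum_reindex[OF inj(2)] o by (simp add: cor_def)
  have "range ?h1 \<union> range ?h2 = UNIV" "range ?h1 \<inter> range ?h2 = {}" unfolding r1 r2 by auto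
  then have "infsum ?P UNIV = infsum ?P (range ?h1) + infsum ?P (range ?h2)"
    using infsum_Un_disjoint[OF s] by simp
  then show "infsum (cor f g) UNIV + (\<Sum>\<^sub>\<infinity>k. cor g f (Suc k)) = infsum f UNIV * infsum g UNIV"
    using i1 i2 prod_summable_on(2)[OF f(1) g(1)] by simp
qed

lemma cor_mono:
  assumes "\<And>n. 0 \<le> f n" "\<And>n. f n \<le> f' n" "\<And>n. 0 \<le> g n" "\<And>n. g n \<le> g' n"
    "f' summable_on UNIV" "g' summable_on UNIV"
  shows "cor f g k \<le> cor f' g' k"
proof -
  have g'0: "g' n \<ge> 0" for n using assms(3,4) order_trans by blast
  have le: "f j * g (k + j) \<le> f' j * g' (k + j)" for j
    using assms(1-4) by (meson mult_mono order_trans)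
  note s = cor_summable[OF assms(5,6) g'0, of k]
  have "(\<lambda>j. f j * g (k + j)) summable_on UNIV"
    by (rule summable_on_comparison_test[OF s]) (use le assms(1,3) in simp_all)
  then show ?thesis unfolding cor_def by (rule infsum_mono[OF _ s]) (use le in simp)
qed

lemma infsum_UNIV_Suc:
  fixes f :: "nat \<Rightarrow> real"
  assumes "f summable_on UNIV"
  shows "infsum f UNIV = f 0 + (\<Sum>\<^sub>\<infinity>k. f (Suc k))" "(\<lambda>k. f (Suc k)) summable_on UNIV"
proof -
  have s: "f summable_on range Suc" using summable_on_subset_banach[OF assms] by auto
  then show "(\<lambda>k. f (Suc k)) summable_on UNIV" using summable_on_reindex[of Suc UNIV f] by (simp add: o_def)
  have "infsum f UNIV = infsum f ({0} \<union> range Suc)" using UNIV_nat_eq by simp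
  also have "\<dots> = infsum f {0} + infsum f (range Suc)" by (rule infsum_Un_disjoint) (use s in auto)
  finally show "infsum f UNIV = f 0 + (\<Sum>\<^sub>\<infinity>k. f (Suc k))"
    using infsum_reindex[of Suc UNIV f] by (simp add: o_def)
qed

lemma summable_on_Suc_iff:
  fixes f :: "nat \<Rightarrow> real"
  assumes "(\<lambda>k. f (Suc k)) summable_on UNIV" shows "f summable_on UNIV"
proof -
  have "f summable_on range Suc" using summable_on_reindex[of Suc UNIV f] assms by (simp add: o_def)
  then have "f summable_on insert 0 (range Suc)" by (subst summable_on_insert_iff)
  then show ?thesis by (simp only: UNIV_nat_eq[symmetric])
qed

section \<open>The factorisation as a monotone limit\<close>

locale wh_data =
  fixes x a :: "nat \<Rightarrow> real"
  assumes x0: "x 0 = 0" and x_nonneg: "x n \<ge> 0" and x1: "x 1 > 0" and a_nonneg: "a n \<ge> 0"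
    and xs: "x summable_on UNIV" and as: "a summable_on UNIV" and mass: "infsum x UNIV + infsum a UNIV \<le> 1"
begin

text \<open>With \<open>X = \<kappa> * U\<close> and \<open>Y = \<kappa> * D\<close> the factorisation
  \<open>1 - x t - a (1 / t) = \<kappa> * (1 - U t) * (1 - D (1 / t))\<close> is a fixed point equation, iterated monotonically
  from \<open>X = Y = 0\<close>, \<open>\<kappa> = 1\<close>; the masses of \<open>X\<close> and \<open>Y\<close> stay below \<open>\<kappa>\<close>.\<close>
definition stepX where "stepX X Y \<kappa> n = (if n = 0 then 0 else x n + cor Y X n / \<kappa>)"
definition stepY where "stepY X Y \<kappa> n = (if n = 0 then 0 else a n + cor X Y n / \<kappa>)"
definition stepK where "stepK X Y \<kappa> = 1 - a 0 - cor X Y 0 / \<kappa>"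

definition sub :: "(nat \<Rightarrow> real) \<Rightarrow> (nat \<Rightarrow> real) \<Rightarrow> real \<Rightarrow> bool" where
  "sub X Y \<kappa> \<longleftrightarrow> (\<forall>n. X n \<ge> 0) \<and> (\<forall>n. Y n \<ge> 0) \<and> X summable_on UNIV \<and> Y summable_on UNIV \<and>
    infsum X UNIV \<le> \<kappa> \<and> infsum Y UNIV \<le> \<kappa> \<and> 0 < \<kappa> \<and> \<kappa> \<le> 1"

text \<open>The equation \<open>key\<close> is the factorisation evaluated at \<open>t = 1\<close>.
  Since the mass of \<open>X\<close> is at most \<open>\<kappa>\<close>, the product of the masses
  over \<open>\<kappa>\<close> is at most the mass of \<open>Y\<close>, hence at most that of the
  next \<open>Y\<close>; what remains bounds the next mass of \<open>X\<close> by the next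
  \<open>\<kappa>\<close>. The same holds with \<open>X\<close> and \<open>Y\<close> exchanged. The
  bound by \<open>x 1\<close> keeps \<open>\<kappa>\<close> away from 0.\<close>

lemma step_sub:
  assumes "sub X Y \<kappa>" and mono: "\<And>n. X n \<le> stepX X Y \<kappa> n" "\<And>n. Y n \<le> stepY X Y \<kappa> n"
  shows "sub (stepX X Y \<kappa>) (stepY X Y \<kappa>) (stepK X Y \<kappa>)" "x 1 \<le> stepK X Y \<kappa>"
proof -
  have X: "\<And>n. X n \<ge> 0" "X summable_on UNIV" "infsum X UNIV \<le> \<kappa>"
    and Y: "\<And>n. Y n \<ge> 0" "Y summable_on UNIV" "infsum Y UNIV \<le> \<kappa>" and k: "\<kappa> > 0"
    using assms(1) by (auto simp: sub_def)
  note t = cor_total[OF X(2,1) Y(2,1)]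
  define P1 P2 where "P1 = (\<Sum>\<^sub>\<infinity>k. cor Y X (Suc k))" and "P2 = (\<Sum>\<^sub>\<infinity>k. cor X Y (Suc k))"
  note tS = infsum_UNIV_Suc[OF t(1)]
  have tot: "cor X Y 0 + P2 + P1 = infsum X UNIV * infsum Y UNIV"
    using t(3) tS(1) by (simp add: P1_def P2_def)
  note xS = infsum_UNIV_Suc[OF xs] and aS = infsum_UNIV_Suc[OF as]
  have eX: "stepX X Y \<kappa> (Suc n) = x (Suc n) + cor Y X (Suc n) * (1 / \<kappa>)"
    and eY: "stepY X Y \<kappa> (Suc n) = a (Suc n) + cor X Y (Suc n) * (1 / \<kappa>)" for n
    by (simp_all add: stepX_def stepY_def)
  have sX': "(\<lambda>n. stepX X Y \<kappa> (Suc n)) summable_on UNIV" and sY': "(\<lambda>n. stepY X Y \<kappa> (Suc n)) summable_on UNIV"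
    unfolding eX eY using xS(2) aS(2) t(2) tS(2) by (intro summable_on_add summable_on_cmult_left; simp)+
  have sX: "stepX X Y \<kappa> summable_on UNIV" and sY: "stepY X Y \<kappa> summable_on UNIV"
    by (rule summable_on_Suc_iff[OF sX'], rule summable_on_Suc_iff[OF sY'])
  have "(\<Sum>\<^sub>\<infinity>n. stepX X Y \<kappa> (Suc n)) = (\<Sum>\<^sub>\<infinity>n. x (Suc n)) + P1 * (1 / \<kappa>)"
    unfolding eX P1_def using xS(2) t(2) by (simp only: infsum_add summable_on_cmult_left infsum_cmult_left')
  then have iX: "infsum (stepX X Y \<kappa>) UNIV = infsum x UNIV + P1 / \<kappa>"
    using infsum_UNIV_Suc(1)[OF sX] xS(1) x0 by (simp add: stepX_def)
  have "(\<Sum>\<^sub>\<infinity>n. stepY X Y \<kappa> (Suc n)) = (\<Sum>\<^sub>\<infinity>n. a (Suc n)) + P2 * (1 / \<kappa>)"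
    unfolding eY P2_def using aS(2) tS(2) by (simp only: infsum_add summable_on_cmult_left infsum_cmult_left')
  then have iY: "infsum (stepY X Y \<kappa>) UNIV = infsum a UNIV - a 0 + P2 / \<kappa>"
    using infsum_UNIV_Suc(1)[OF sY] aS(1) by (simp add: stepY_def)
  have nX: "stepX X Y \<kappa> n \<ge> 0" and nY: "stepY X Y \<kappa> n \<ge> 0" for n
    using order_trans[OF X(1) mono(1)] order_trans[OF Y(1) mono(2)] by blast+
  have "cor X Y 0 / \<kappa> + P2 / \<kappa> + P1 / \<kappa> = infsum X UNIV * infsum Y UNIV / \<kappa>"
    by (simp add: tot[symmetric] add_divide_distrib)
  then have key: "stepK X Y \<kappa> = 1 - infsum x UNIV - infsum a UNIV
    + infsum (stepX X Y \<kappa>) UNIV + infsum (stepY X Y \<kappa>) UNIV - infsum X UNIV * infsum Y UNIV / \<kappa>"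
    unfolding iX iY stepK_def by linarith
  have "infsum X UNIV * infsum Y UNIV / \<kappa> \<le> infsum Y UNIV"
    using mult_right_mono[OF X(3) infsum_nonneg[of UNIV Y]] k Y(1) by (simp add: pos_divide_le_eq mult.commute)
  also have "\<dots> \<le> infsum (stepY X Y \<kappa>) UNIV" by (rule infsum_mono[OF Y(2) sY mono(2)])
  finally have 1: "infsum (stepX X Y \<kappa>) UNIV \<le> stepK X Y \<kappa>" using key mass by linarith
  have "infsum X UNIV * infsum Y UNIV / \<kappa> \<le> infsum X UNIV"
    using Y(3) k infsum_nonneg[of UNIV X] X(1) by (simp add: pos_divide_le_eq mult_left_mono)
  also have "\<dots> \<le> infsum (stepX X Y \<kappa>) UNIV" by (rule infsum_mono[OF X(2) sX mono(1)])
  finally have 2: "infsum (stepY X Y \<kappa>) UNIV \<le> stepK X Y \<kappa>" using key mass by linarith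
  have "x 1 \<le> stepX X Y \<kappa> 1" using cor_nonneg[OF Y(1) X(1), where k = 1] k by (simp add: stepX_def)
  also have "\<dots> \<le> infsum (stepX X Y \<kappa>) UNIV" by (rule summable_on_le_infsum[OF sX nX])
  finally show 3: "x 1 \<le> stepK X Y \<kappa>" using 1 by linarith
  have "0 \<le> cor X Y 0 / \<kappa>" using k by (intro divide_nonneg_pos cor_nonneg X(1) Y(1))
  then have "stepK X Y \<kappa> \<le> 1" using a_nonneg[of 0] unfolding stepK_def by linarith
  then show "sub (stepX X Y \<kappa>) (stepY X Y \<kappa>) (stepK X Y \<kappa>)"
    using 1 2 3 x1 nX nY sX sY unfolding sub_def by (auto intro: less_le_trans)
qed

lemma step_mono:
  assumes "sub X Y \<kappa>" "sub X' Y' \<kappa>'" "\<And>n. X n \<le> X' n" "\<And>n. Y n \<le> Y' n" "\<kappa>' \<le> \<kappa>"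
  shows "stepX X Y \<kappa> n \<le> stepX X' Y' \<kappa>' n" "stepY X Y \<kappa> n \<le> stepY X' Y' \<kappa>' n"
    "stepK X' Y' \<kappa>' \<le> stepK X Y \<kappa>"
proof -
  have p: "\<And>n. X n \<ge> 0" "\<And>n. Y n \<ge> 0" "X' summable_on UNIV" "Y' summable_on UNIV" "\<kappa>' > 0"
    using assms(1,2) by (auto simp: sub_def)
  have XY: "cor X Y k / \<kappa> \<le> cor X' Y' k / \<kappa>'" for k
    using cor_mono[OF p(1) assms(3) p(2) assms(4) p(3,4), where k = k] cor_nonneg[of X Y k, OF p(1,2)] p(5) assms(5)
    by (intro frac_le) auto
  have YX: "cor Y X k / \<kappa> \<le> cor Y' X' k / \<kappa>'" for k
    using cor_mono[OF p(2) assms(4) p(1) assms(3) p(4,3), where k = k] cor_nonneg[of Y X k, OF p(2,1)] p(5) assms(5)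
    by (intro frac_le) auto
  show "stepX X Y \<kappa> n \<le> stepX X' Y' \<kappa>' n" "stepY X Y \<kappa> n \<le> stepY X' Y' \<kappa>' n"
    "stepK X' Y' \<kappa>' \<le> stepK X Y \<kappa>"
    using XY YX by (simp_all add: stepX_def stepY_def stepK_def)
qed

primrec it :: "nat \<Rightarrow> (nat \<Rightarrow> real) \<times> (nat \<Rightarrow> real) \<times> real" where
  "it 0 = (\<lambda>_. 0, \<lambda>_. 0, 1)"
| "it (Suc m) = (case it m of (X, Y, \<kappa>) \<Rightarrow> (stepX X Y \<kappa>, stepY X Y \<kappa>, stepK X Y \<kappa>))"

definition "Xm m = fst (it m)"
definition "Ym m = fst (snd (it m))"
definition "Km m = snd (snd (it m))"

lemma it_Suc: "Xm (Suc m) = stepX (Xm m) (Ym m) (Km m)" "Ym (Suc m) = stepY (Xm m) (Ym m) (Km m)"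
  "Km (Suc m) = stepK (Xm m) (Ym m) (Km m)"
  by (simp_all add: Xm_def Ym_def Km_def case_prod_unfold)

lemma it_inv: "sub (Xm m) (Ym m) (Km m) \<and> (\<forall>n. Xm m n \<le> Xm (Suc m) n \<and> Ym m n \<le> Ym (Suc m) n) \<and> Km (Suc m) \<le> Km m"
proof (induction m)
  case 0
  have "Xm 0 = (\<lambda>_. 0)" "Ym 0 = (\<lambda>_. 0)" "Km 0 = 1" by (simp_all add: Xm_def Ym_def Km_def)
  then show ?case using x_nonneg a_nonneg
    by (auto simp: sub_def it_Suc stepX_def stepY_def stepK_def cor_def)
next
  case (Suc m)
  then have s: "sub (Xm (Suc m)) (Ym (Suc m)) (Km (Suc m))"
    unfolding it_Suc[of m] by (intro step_sub) (auto simp: it_Suc)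
  have m: "sub (Xm m) (Ym m) (Km m)" "\<And>n. Xm m n \<le> Xm (Suc m) n" "\<And>n. Ym m n \<le> Ym (Suc m) n" "Km (Suc m) \<le> Km m"
    using Suc by blast+
  show ?case using s step_mono[OF m(1) s m(2-4)] unfolding it_Suc[of "Suc m"] unfolding it_Suc[of m, symmetric] by blast
qed

lemma Km_ge: "x 1 \<le> Km (Suc m)"
  unfolding it_Suc by (rule step_sub(2)) (use it_inv[of m] in \<open>auto simp: it_Suc\<close>)

theorem wiener_hopf:
  obtains X Y \<kappa> where "\<kappa> > 0" "\<And>n. X n \<ge> 0" "\<And>n. Y n \<ge> 0" "X 0 = 0" "Y 0 = 0"
    "X summable_on UNIV" "Y summable_on UNIV" "infsum X UNIV \<le> \<kappa>" "infsum Y UNIV \<le> \<kappa>"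
    "\<And>n. n \<ge> 1 \<Longrightarrow> X n = x n + cor Y X n / \<kappa>" "\<And>n. n \<ge> 1 \<Longrightarrow> Y n = a n + cor X Y n / \<kappa>"
    "\<kappa> = 1 - a 0 - cor X Y 0 / \<kappa>"
proof -
  have sb: "\<And>n. Xm m n \<ge> 0" "\<And>n. Ym m n \<ge> 0" "Xm m summable_on UNIV" "Ym m summable_on UNIV"
    "infsum (Xm m) UNIV \<le> Km m" "infsum (Ym m) UNIV \<le> Km m" "Km m > 0" "Km m \<le> 1" for m
    using it_inv[of m] by (auto simp: sub_def)
  have le1: "Xm m n \<le> 1" "Ym m n \<le> 1" for m n
    using summable_on_le_infsum[OF sb(3,1), of m n] summable_on_le_infsum[OF sb(4,2), of m n] sb(5-8)[of m]
    by linarith+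
  have inc: "incseq (\<lambda>m. Xm m n)" "incseq (\<lambda>m. Ym m n)" "decseq Km" for n
    using it_inv by (auto intro!: incseq_SucI decseq_SucI)
  have "\<exists>L. (\<lambda>m. Xm m n) \<longlonglongrightarrow> L" "\<exists>L. (\<lambda>m. Ym m n) \<longlonglongrightarrow> L" for n
    using incseq_convergent[OF inc(1)[of n], of 1] incseq_convergent[OF inc(2)[of n], of 1] le1 by metis+
  then obtain X Y where lX: "\<And>n. (\<lambda>m. Xm m n) \<longlonglongrightarrow> X n" and lY: "\<And>n. (\<lambda>m. Ym m n) \<longlonglongrightarrow> Y n"
    by metis
  obtain \<kappa> where lK: "Km \<longlonglongrightarrow> \<kappa>"
    using decseq_convergent[OF inc(3), of 0] sb(7) by (metis less_imp_le)
  \<comment> \<open>The lower bound survives in the limit, which makes the divisions by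
    \<open>\<kappa>\<close> continuous there.\<close>
  have "x 1 \<le> \<kappa>" using Km_ge LIMSEQ_le_const[OF LIMSEQ_Suc[OF lK], of "x 1"] by auto
  then have kpos: "\<kappa> > 0" using x1 by linarith
  have X0: "X n \<ge> 0" "Y n \<ge> 0" and XY1: "X n \<le> 1" "Y n \<le> 1" and dom: "Xm m n \<le> X n" "Ym m n \<le> Y n" for n m
    using LIMSEQ_le_const[OF lX, of 0] LIMSEQ_le_const[OF lY, of 0] LIMSEQ_le_const2[OF lX, of _ 1]
      LIMSEQ_le_const2[OF lY, of _ 1] sb(1,2) le1 incseq_le[OF inc(1) lX] incseq_le[OF inc(2) lY] by blast+
  have fin: "(\<Sum>n\<le>N. Xm m n) \<le> Km m" "(\<Sum>n\<le>N. Ym m n) \<le> Km m" for N m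
    using infsum_mono2[of "Xm m" "{..N}" UNIV] infsum_mono2[of "Ym m" "{..N}" UNIV] sb[of m] by auto
  have "(\<Sum>n\<le>N. X n) \<le> \<kappa>" "(\<Sum>n\<le>N. Y n) \<le> \<kappa>" for N
    by (rule LIMSEQ_le[OF tendsto_sum lK], rule lX, use fin in blast)
      (rule LIMSEQ_le[OF tendsto_sum lK], rule lY, use fin in blast)
  then have SX: "X summable_on UNIV" "infsum X UNIV \<le> \<kappa>" and SY: "Y summable_on UNIV" "infsum Y UNIV \<le> \<kappa>"
    using infsum_le_of_partial[of X \<kappa>] infsum_le_of_partial[of Y \<kappa>] X0 by auto
  \<comment> \<open>Tannery's theorem: the limit \<open>F\<close> of the first factors is summable
    and dominates them, and the second factors are bounded by 1.\<close>
  have corlim: "(\<lambda>m. cor (f m) (g m) k) \<longlonglongrightarrow> cor F G k"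
    if lim: "\<And>n. (\<lambda>m. f m n) \<longlonglongrightarrow> F n" "\<And>n. (\<lambda>m. g m n) \<longlonglongrightarrow> G n"
      and nn: "\<And>m n. f m n \<ge> 0" "\<And>m n. g m n \<ge> 0" and bd: "\<And>m n. f m n \<le> F n" "\<And>m n. g m n \<le> 1"
      and s: "F summable_on UNIV" "G summable_on UNIV" "\<And>n. G n \<ge> 0"
      and sm: "\<And>m. f m summable_on UNIV" "\<And>m. g m summable_on UNIV"
    for f g F G k
  proof -
    have eq: "cor (f m) (g m) k = (\<Sum>j. f m j * g m (k + j))" for m
      unfolding cor_def using summable_on_sums[OF cor_summable[OF sm nn(2)]] by (simp add: sums_iff)
    have eq': "cor F G k = (\<Sum>j. F j * G (k + j))"
      unfolding cor_def using summable_on_sums[OF cor_summable[OF s]] by (simp add: sums_iff)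
    have "f m j * g m (k + j) \<le> F j * 1" for m j
      by (rule mult_mono) (use nn bd order_trans in blast)+
    then have "norm (f m j * g m (k + j)) \<le> F j" for m j using nn by simp
    then have ev: "\<forall>\<^sub>F (j, m) in at_top \<times>\<^sub>F sequentially. norm (f m j * g m (k + j)) \<le> F j"
      by (intro always_eventually) auto
    have sF: "summable F" using summable_on_sums[OF s(1)] by (simp add: sums_iff)
    have lm: "(\<lambda>m. f m j * g m (k + j)) \<longlonglongrightarrow> F j * G (k + j)" for j by (intro tendsto_mult lim)
    have "(\<lambda>m. \<Sum>j. f m j * g m (k + j)) \<longlonglongrightarrow> (\<Sum>j. F j * G (k + j))"
      using tannerys_theorem[OF lm ev sF] by simp
    then show ?thesis unfolding eq eq' .
  qed
  have cXY: "(\<lambda>m. cor (Xm m) (Ym m) k) \<longlonglongrightarrow> cor X Y k" for k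
    by (rule corlim) (use lX lY sb X0 dom le1 SX SY in auto)
  have cYX: "(\<lambda>m. cor (Ym m) (Xm m) k) \<longlonglongrightarrow> cor Y X k" for k
    by (rule corlim) (use lX lY sb X0 dom le1 SX SY in auto)
  show ?thesis
  proof (rule that[OF kpos X0 _ _ SX(1) SY(1) SX(2) SY(2)])
    show "X 0 = 0"
      by (rule LIMSEQ_unique[OF LIMSEQ_Suc[OF lX[of 0]]]) (simp add: it_Suc stepX_def)
    show "Y 0 = 0"
      by (rule LIMSEQ_unique[OF LIMSEQ_Suc[OF lY[of 0]]]) (simp add: it_Suc stepY_def)
    show "X n = x n + cor Y X n / \<kappa>" if "n \<ge> 1" for n
    proof (rule LIMSEQ_unique[OF LIMSEQ_Suc[OF lX[of n]]])
      have "(\<lambda>m. x n + cor (Ym m) (Xm m) n / Km m) \<longlonglongrightarrow> x n + cor Y X n / \<kappa>"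
        using kpos by (intro tendsto_intros cYX lK) auto
      then show "(\<lambda>m. Xm (Suc m) n) \<longlonglongrightarrow> x n + cor Y X n / \<kappa>" using that by (simp add: it_Suc stepX_def)
    qed
    show "Y n = a n + cor X Y n / \<kappa>" if "n \<ge> 1" for n
    proof (rule LIMSEQ_unique[OF LIMSEQ_Suc[OF lY[of n]]])
      have "(\<lambda>m. a n + cor (Xm m) (Ym m) n / Km m) \<longlonglongrightarrow> a n + cor X Y n / \<kappa>"
        using kpos by (intro tendsto_intros cXY lK) auto
      then show "(\<lambda>m. Ym (Suc m) n) \<longlonglongrightarrow> a n + cor X Y n / \<kappa>" using that by (simp add: it_Suc stepY_def)
    qed
    show "\<kappa> = 1 - a 0 - cor X Y 0 / \<kappa>"
    proof (rule LIMSEQ_unique[OF LIMSEQ_Suc[OF lK]])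
      have "(\<lambda>m. 1 - a 0 - cor (Xm m) (Ym m) 0 / Km m) \<longlonglongrightarrow> 1 - a 0 - cor X Y 0 / \<kappa>"
        using kpos by (intro tendsto_intros cXY lK) auto
      then show "(\<lambda>m. Km (Suc m)) \<longlonglongrightarrow> 1 - a 0 - cor X Y 0 / \<kappa>" by (simp add: it_Suc stepK_def)
    qed
  qed
qed

end

section \<open>Laurent series as summable families on the integers, and the maximum
  principle\<close>

definition conv :: "(int \<Rightarrow> real) \<Rightarrow> (int \<Rightarrow> real) \<Rightarrow> int \<Rightarrow> real" where
  "conv f g n = (\<Sum>\<^sub>\<infinity>k. f k * g (n - k))"

lemma summable_imp_bounded:
  fixes f :: "'a \<Rightarrow> real"
  assumes "f summable_on UNIV" shows "\<bar>f x\<bar> \<le> (\<Sum>\<^sub>\<infinity>x. \<bar>f x\<bar>)"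
  using assms summable_on_abs_iff[of f UNIV] by (intro summable_on_le_infsum[of "\<lambda>x. \<bar>f x\<bar>"]) auto

lemma conv_pair_summable:
  fixes f g :: "int \<Rightarrow> real"
  assumes "f summable_on UNIV" "g summable_on UNIV"
  shows "(\<lambda>(n, k). f k * g (n - k)) summable_on (UNIV :: (int \<times> int) set)"
proof -
  have "(\<lambda>(i, j). f i * g j) summable_on UNIV" using prod_summable_on(1)[OF assms] by simp
  then show ?thesis
    by (subst summable_on_reindex_bij_witness[where T = UNIV and i = "\<lambda>(i, j). (i + j, i)"
        and j = "\<lambda>(n, k). (k, n - k)" and h = "\<lambda>(i, j). f i * g j"]) auto
qed

lemma conv_summable:
  assumes "f summable_on UNIV" "g summable_on UNIV"
  shows "conv f g summable_on UNIV" "(\<lambda>k. f k * g (n - k)) summable_on UNIV"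
proof -
  have p: "(\<lambda>(n, k). f k * g (n - k)) summable_on UNIV \<times> UNIV" using conv_pair_summable[OF assms] by simp
  then show "conv f g summable_on UNIV"
    using summable_on_Sigma_banach[of "\<lambda>n k. f k * g (n - k)" UNIV "\<lambda>_. UNIV"] by (simp add: conv_def[abs_def])
  show "(\<lambda>k. f k * g (n - k)) summable_on UNIV"
    by (rule summable_on_bounded_mult[OF assms(1)]) (rule summable_imp_bounded[OF assms(2)])
qed

lemma conv_commute: "conv f g n = conv g f n"
  unfolding conv_def
  by (rule infsum_reindex_bij_witness[where i = "\<lambda>k. n - k" and j = "\<lambda>k. n - k"]) auto

lemma conv_assoc:
  assumes f: "f summable_on UNIV" and g: "g summable_on UNIV" and h: "h summable_on UNIV"
  shows "conv (conv f g) h n = conv f (conv g h) n"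
proof -
  have s: "(\<lambda>(k, j). f j * g (k - j) * h (n - k)) summable_on UNIV \<times> UNIV"
    using summable_on_bounded_mult[OF conv_pair_summable[OF f g], of "\<lambda>(k, j). h (n - k)" "\<Sum>\<^sub>\<infinity>x. \<bar>h x\<bar>"]
      summable_imp_bounded[OF h] by (simp add: case_prod_unfold)
  have "conv (conv f g) h n = (\<Sum>\<^sub>\<infinity>k. \<Sum>\<^sub>\<infinity>j. f j * g (k - j) * h (n - k))"
    by (simp add: conv_def infsum_cmult_left')
  also have "\<dots> = (\<Sum>\<^sub>\<infinity>j. \<Sum>\<^sub>\<infinity>k. f j * g (k - j) * h (n - k))"
    by (rule infsum_swap_banach[OF s])
  also have "\<dots> = (\<Sum>\<^sub>\<infinity>j. f j * conv g h (n - j))"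
  proof (rule infsum_cong)
    fix j
    have "(\<Sum>\<^sub>\<infinity>k. f j * g (k - j) * h (n - k)) = (\<Sum>\<^sub>\<infinity>i. f j * (g i * h (n - j - i)))"
      by (rule infsum_reindex_bij_witness[where i = "\<lambda>i. i + j" and j = "\<lambda>k. k - j"]) auto
    then show "(\<Sum>\<^sub>\<infinity>k. f j * g (k - j) * h (n - k)) = f j * conv g h (n - j)"
      by (simp add: conv_def infsum_cmult_right')
  qed
  finally show ?thesis by (simp add: conv_def)
qed

text \<open>Consider the last index at which the modulus of \<open>w\<close> is maximal among the
  indices from \<open>N\<close> on; it exists because \<open>w\<close> tends to 0. There
  \<open>w\<close> is a combination of later values, all strictly smaller in modulus, with weights
  of total mass at most 1.\<close>

lemma max_principle:
  fixes w d :: "nat \<Rightarrow> real"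
  assumes lim: "w \<longlonglongrightarrow> 0" and d: "\<And>j. d j \<ge> 0" "d 0 = 0" "d summable_on UNIV" "infsum d UNIV \<le> 1"
    and eq: "\<And>m. w m = (\<Sum>\<^sub>\<infinity>j. d j * w (m + j))"
  shows "w N = 0"
proof (rule ccontr)
  assume wN: "w N \<noteq> 0"
  obtain C where C: "\<And>m. \<bar>w m\<bar> \<le> C"
    using convergent_imp_Bseq[OF convergentI[OF lim]] by (auto simp: Bseq_def)
  obtain M where M: "\<And>m. m \<ge> M \<Longrightarrow> \<bar>w m\<bar> < \<bar>w N\<bar>"
    using LIMSEQ_D[OF lim, of "\<bar>w N\<bar>"] wN by auto
  define H where "H = Max ((\<lambda>m. \<bar>w m\<bar>) ` {N..N + M})"
  define P where "P = {m \<in> {N..N + M}. \<bar>w m\<bar> = H}"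
  have "H \<in> (\<lambda>m. \<bar>w m\<bar>) ` {N..N + M}" unfolding H_def by (rule Max_in) auto
  then have P: "P \<noteq> {}" "finite P" by (auto simp: P_def)
  have Hge: "\<bar>w m\<bar> \<le> H" if "m \<in> {N..N + M}" for m unfolding H_def using that by (intro Max_ge) auto
  have H0: "H \<ge> \<bar>w N\<bar>" "H > 0" using Hge[of N] wN by auto
  define p where "p = Max P"
  have p: "p \<in> P" unfolding p_def using P by (intro Max_in)
  have lt: "\<bar>w (p + j)\<bar> < H" if "j \<ge> 1" for j
  proof (cases "p + j \<le> N + M")
    case True
    have "p + j \<notin> P" using Max_ge[OF P(2), of "p + j"] that p_def by auto
    then show ?thesis using Hge[of "p + j"] True p by (auto simp: P_def)
  next
    case False
    then show ?thesis using M[of "p + j"] H0 by simp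
  qed
  have s1: "(\<lambda>j. d j * \<bar>w (p + j)\<bar>) summable_on UNIV"
    by (rule summable_on_bounded_mult[OF d(3), of _ C]) (use C in simp)
  have s2: "(\<lambda>j. d j * H) summable_on UNIV" by (rule summable_on_cmult_left[OF d(3)])
  have s3: "(\<lambda>j. d j * (H - \<bar>w (p + j)\<bar>)) summable_on UNIV"
    by (rule summable_on_bounded_mult[OF d(3), of _ "H + C"]) (use C H0 in \<open>smt (verit)\<close>)
  have "H = \<bar>w p\<bar>" using p by (simp add: P_def)
  also have "\<dots> = \<bar>\<Sum>\<^sub>\<infinity>j. d j * w (p + j)\<bar>" by (rule arg_cong[OF eq])
  also have "\<dots> \<le> (\<Sum>\<^sub>\<infinity>j. norm (d j * w (p + j)))"
    using norm_infsum_bound[of "\<lambda>j. d j * w (p + j)" UNIV] s1 d(1) by (simp add: abs_mult)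
  also have "\<dots> = (\<Sum>\<^sub>\<infinity>j. d j * \<bar>w (p + j)\<bar>)" using d(1) by (simp add: abs_mult)
  finally have le: "H \<le> (\<Sum>\<^sub>\<infinity>j. d j * \<bar>w (p + j)\<bar>)" .
  have "(\<Sum>\<^sub>\<infinity>j. d j * H) = (\<Sum>\<^sub>\<infinity>j. d j * (H - \<bar>w (p + j)\<bar>)) + (\<Sum>\<^sub>\<infinity>j. d j * \<bar>w (p + j)\<bar>)"
    by (subst infsum_add[OF s3 s1, symmetric]) (simp add: algebra_simps)
  moreover have "(\<Sum>\<^sub>\<infinity>j. d j * H) \<le> H" using d(4) H0 by (simp add: infsum_cmult_left')
  ultimately have "(\<Sum>\<^sub>\<infinity>j. d j * (H - \<bar>w (p + j)\<bar>)) \<le> 0" using le by linarith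
  moreover have nn: "d j * (H - \<bar>w (p + j)\<bar>) \<ge> 0" for j
    using lt[of j] d by (cases "j = 0") auto
  ultimately have "d j * (H - \<bar>w (p + j)\<bar>) \<le> 0" for j
    using summable_on_le_infsum[OF s3 nn, of j] by linarith
  then have "d j = 0" for j
    using lt[of j] d(1)[of j] d(2) by (cases "j = 0") (simp, smt (verit) One_nat_def Suc_leI gr0I mult_pos_pos)
  then show False using le H0 by simp
qed

lemma infsum_nat_int:
  fixes f :: "int \<Rightarrow> real"
  assumes "\<And>k. k > 0 \<Longrightarrow> f k = 0"
  shows "infsum f UNIV = (\<Sum>\<^sub>\<infinity>j. f (- int j))"
proof -
  have "infsum f UNIV = infsum f {..0}" by (rule infsum_cong_neutral) (use assms in auto)
  also have "\<dots> = (\<Sum>\<^sub>\<infinity>j. f (- int j))"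
    by (rule infsum_reindex_bij_witness[where i = "\<lambda>j. - int j" and j = "\<lambda>k. nat (- k)"]) auto
  finally show ?thesis .
qed

text \<open>The coefficients of \<open>U t - 1\<close> and of \<open>1 - D (1 / t)\<close>.\<close>
definition lplus :: "(nat \<Rightarrow> real) \<Rightarrow> int \<Rightarrow> real" where
  "lplus u m = (if m < 0 then 0 else if m = 0 then -1 else u (nat m))"
definition lminus :: "(nat \<Rightarrow> real) \<Rightarrow> int \<Rightarrow> real" where
  "lminus d m = (if m > 0 then 0 else if m = 0 then 1 else - d (nat (- m)))"

lemma summable_int_nat:
  fixes f :: "int \<Rightarrow> real"
  assumes "(\<lambda>j. f (int j)) summable_on UNIV" "\<And>k. k < 0 \<Longrightarrow> f k = 0"
  shows "f summable_on UNIV"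
proof -
  have "f summable_on {0..}"
    using assms(1) by (subst summable_on_reindex_bij_witness[where T = UNIV and i = "\<lambda>j. int j" and j = nat and h = "\<lambda>j. f (int j)"]) auto
  then show ?thesis by (rule summable_on_cong_neutral[THEN iffD1, rotated -1]) (use assms(2) in auto)
qed

lemma lplus_summable: "u summable_on UNIV \<Longrightarrow> lplus u summable_on UNIV"
proof (rule summable_int_nat)
  assume u: "u summable_on UNIV"
  have "(\<lambda>j. lplus u (int (Suc j))) summable_on UNIV"
    using infsum_UNIV_Suc(2)[OF u] by (simp add: lplus_def nat_add_distrib)
  then show "(\<lambda>j. lplus u (int j)) summable_on UNIV" by (rule summable_on_Suc_iff)
qed (simp add: lplus_def)

lemma lminus_eq: "lminus d m = - lplus d (- m)"
  by (simp add: lplus_def lminus_def)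

lemma lminus_summable: "d summable_on UNIV \<Longrightarrow> lminus d summable_on UNIV"
proof -
  assume "d summable_on UNIV"
  then have "lplus d summable_on UNIV" by (rule lplus_summable)
  then have "(\<lambda>m. lplus d (- m)) summable_on UNIV"
    by (subst summable_on_reindex_bij_witness[where T = UNIV and i = uminus and j = uminus and h = "lplus d"]) auto
  then show ?thesis unfolding lminus_eq[abs_def] by (simp only: summable_on_uminus)
qed

lemma conv_lminus:
  assumes d: "d summable_on UNIV" "d 0 = 0" and z: "z summable_on UNIV"
  shows "conv (lminus d) z n = z n - (\<Sum>\<^sub>\<infinity>j. d j * z (n + int j))"
proof -
  have "conv (lminus d) z n = (\<Sum>\<^sub>\<infinity>j. lminus d (- int j) * z (n + int j))"
    unfolding conv_def by (subst infsum_nat_int) (auto simp: lminus_def)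
  also have "\<dots> = (\<Sum>\<^sub>\<infinity>j. (if j = 0 then z n else 0) + - (d j * z (n + int j)))"
    by (rule infsum_cong) (use d(2) in \<open>auto simp: lminus_def\<close>)
  also have "\<dots> = (\<Sum>\<^sub>\<infinity>j. if j = (0::nat) then z n else 0) + (\<Sum>\<^sub>\<infinity>j. - (d j * z (n + int j)))"
  proof (rule infsum_add)
    show "(\<lambda>j. if j = (0::nat) then z n else 0) summable_on UNIV"
      by (rule finite_nonzero_values_imp_summable_on) simp
    show "(\<lambda>j. - (d j * z (n + int j))) summable_on UNIV"
      unfolding summable_on_uminus by (rule summable_on_bounded_mult[OF d(1) summable_imp_bounded[OF z]])
  qed
  also have "(\<Sum>\<^sub>\<infinity>j. if j = (0::nat) then z n else 0) = (\<Sum>\<^sub>\<infinity>j\<in>{0::nat}. z n)"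
    by (rule infsum_cong_neutral) auto
  finally show ?thesis by (simp add: infsum_uminus)
qed

text \<open>Cancellation of the factor \<open>1 - D (1 / t)\<close>. It only shifts indices
  downwards, so the coefficients of index at least 2 satisfy a closed system, to which the maximum
  principle applies.\<close>

lemma conv_lminus_eq_0:
  assumes d: "\<And>j. d j \<ge> 0" "d 0 = 0" "d summable_on UNIV" "infsum d UNIV \<le> 1" and z: "z summable_on UNIV"
    and eq: "\<And>n. n \<ge> 2 \<Longrightarrow> conv (lminus d) z n = 0" and n: "n \<ge> 2"
  shows "z n = 0"
proof -
  define w where "w m = z (int m + 2)" for m
  have "w summable_on UNIV"
  proof -
    have "z summable_on (\<lambda>m. int m + 2) ` UNIV" using summable_on_subset_banach[OF z] by auto
    then show ?thesis using summable_on_reindex[of "\<lambda>m. int m + 2" UNIV z] by (simp add: w_def[abs_def] o_def inj_def)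
  qed
  then have "w \<longlonglongrightarrow> 0" using summable_on_sums summable_LIMSEQ_zero by (auto simp: sums_iff)
  then have "w N = 0" for N
  proof (rule max_principle[OF _ d])
    fix m
    have "z (int m + 2) = (\<Sum>\<^sub>\<infinity>j. d j * z (int m + 2 + int j))"
      using conv_lminus[OF d(3,2) z, of "int m + 2"] eq[of "int m + 2"] by simp
    then show "w m = (\<Sum>\<^sub>\<infinity>j. d j * w (m + j))" by (simp add: w_def ac_simps)
  qed
  from this[of "nat (n - 2)"] n show ?thesis by (simp add: w_def)
qed

text \<open>\<open>bc n\<close> for \<open>n \<ge> 1\<close> are the coefficients of \<open>1 - sqrt (1 - t)\<close>; \<open>bc 0 = -1\<close> turns the
  series into that of \<open>- sqrt (1 - t)\<close>.\<close>
primrec bc :: "nat \<Rightarrow> real" where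
  "bc 0 = -1"
| "bc (Suc n) = bc n * ((real n - 1 / 2) / (real n + 1))"

lemma bc_gbinomial: "bc n = - ((-1) ^ n * ((1 / 2) gchoose n))"
proof (induction n)
  case (Suc n)
  have "(real n + 1) * ((1 / 2 :: real) gchoose Suc n) = (1 / 2 - real n) * ((1 / 2) gchoose n)"
    using gbinomial_mult_1[of "1 / 2 :: real" n] by (simp add: algebra_simps)
  then have "((1 / 2 :: real) gchoose Suc n) = - ((real n - 1 / 2) / (real n + 1)) * ((1 / 2) gchoose n)"
    by (simp add: field_simps)
  then show ?case using Suc by simp
qed simp

lemma bc_convolution:
  assumes "n \<ge> 2" shows "(\<Sum>i\<le>n. bc i * bc (n - i)) = 0"
proof -
  have "(\<Sum>i\<le>n. bc i * bc (n - i)) = (-1) ^ n * (\<Sum>i\<le>n. ((1 / 2 :: real) gchoose i) * ((1 / 2) gchoose (n - i)))"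
    unfolding sum_distrib_left
  proof (rule sum.cong[OF refl])
    fix i assume "i \<in> {..n}"
    then have "(-1 :: real) ^ n = (-1) ^ i * (-1) ^ (n - i)" by (simp add: power_add[symmetric])
    then show "bc i * bc (n - i) = (-1) ^ n * (((1 / 2) gchoose i) * ((1 / 2) gchoose (n - i)))"
      by (simp add: bc_gbinomial)
  qed
  also have "(\<Sum>i\<le>n. ((1 / 2 :: real) gchoose i) * ((1 / 2) gchoose (n - i))) = (1 :: real) gchoose n"
    using gbinomial_Vandermonde[of "1 / 2 :: real" "1 / 2" n] by (simp add: atLeast0AtMost)
  also have "(1 :: real) gchoose n = 0"
  proof -
    have "1 choose n = 0" by (rule binomial_eq_0) (use assms in simp)
    then have "real (1 choose n) = 0" by (simp only: of_nat_0)
    then show ?thesis using binomial_gbinomial[of 1 n, where 'a = real] by (simp only: of_nat_1)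
  qed
  finally show ?thesis by simp
qed

lemma bc_pos: "n \<ge> 1 \<Longrightarrow> bc n > 0"
proof (induction n rule: dec_induct)
  case (step n)
  then show ?case by (auto intro!: mult_pos_pos)
qed simp

text \<open>The square of the series is \<open>1 - \<alpha> * t\<close> with
  \<open>\<alpha> = 2 * u 1\<close>, so the series is \<open>- sqrt (1 - \<alpha> * t)\<close>. As
  \<open>u 0 = -1\<close> is invertible, each equation determines \<open>u n\<close> from the
  earlier terms.\<close>

lemma quadratic_rec_unique:
  fixes u :: "nat \<Rightarrow> real"
  assumes u0: "u 0 = -1" and rec: "\<And>n. n \<ge> 2 \<Longrightarrow> (\<Sum>i\<le>n. u i * u (n - i)) = 0"
  shows "u n = bc n * (2 * u 1) ^ n"
proof (induction n rule: less_induct)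
  case (less n)
  consider "n = 0" | "n = 1" | "n \<ge> 2" by linarith
  then show ?case
  proof cases
    case 3
    have split: "(\<Sum>i\<le>n. f i * f (n - i)) = 2 * f 0 * f n + (\<Sum>i\<in>{1..n - 1}. f i * f (n - i))" for f :: "nat \<Rightarrow> real"
    proof -
      have "{..n} = insert 0 (insert n {1..n - 1})" using 3 by auto
      then show ?thesis using 3 by simp
    qed
    have "2 * u n = (\<Sum>i\<in>{1..n - 1}. u i * u (n - i))" using rec[OF 3] split[of u] u0 by simp
    also have "\<dots> = (\<Sum>i\<in>{1..n - 1}. bc i * bc (n - i) * (2 * u 1) ^ n)"
    proof (rule sum.cong[OF refl])
      fix i assume i: "i \<in> {1..n - 1}"
      have "(2 * u 1) ^ n = (2 * u 1) ^ i * (2 * u 1) ^ (n - i)" proof -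
        have "n = i + (n - i)" using i by auto
        then show ?thesis by (metis power_add)
      qed
      moreover have "u i = bc i * (2 * u 1) ^ i" "u (n - i) = bc (n - i) * (2 * u 1) ^ (n - i)"
        using less[of i] less[of "n - i"] i by auto
      ultimately show "u i * u (n - i) = bc i * bc (n - i) * (2 * u 1) ^ n" by simp
    qed
    also have "\<dots> = 2 * bc n * (2 * u 1) ^ n"
      using bc_convolution[OF 3] split[of bc] by (simp add: sum_distrib_right[symmetric])
    finally show ?thesis by simp
  qed (simp_all add: u0)
qed

text \<open>A crude bound: it only has to exclude exponential decay.\<close>

lemma bc_lower: "n \<ge> 1 \<Longrightarrow> bc n \<ge> 1 / (2 * real n ^ 2)"
proof (induction n rule: dec_induct)
  case (step n)
  have n: "real n \<ge> 1" using step by simp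
  have "1 / (2 * real (Suc n) ^ 2) \<le> 1 / (2 * real n ^ 2) * ((real n - 1 / 2) / (real n + 1))"
  proof -
    have "real n ^ 2 \<le> (real n - 1 / 2) * (real n + 1)"
      using n by (simp add: algebra_simps power2_eq_square)
    then have "real n ^ 2 / (real n + 1) ^ 2 \<le> (real n - 1 / 2) * (real n + 1) / (real n + 1) ^ 2"
      by (rule divide_right_mono) simp
    also have "\<dots> = (real n - 1 / 2) / (real n + 1)" using n by (simp add: power2_eq_square)
    finally have "1 / (2 * real n ^ 2) * (real n ^ 2 / (real n + 1) ^ 2)
      \<le> 1 / (2 * real n ^ 2) * ((real n - 1 / 2) / (real n + 1))" by (rule mult_left_mono) simp
    moreover have "1 / (2 * real n ^ 2) * (real n ^ 2 / (real n + 1) ^ 2) = 1 / (2 * real (Suc n) ^ 2)"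
      using n by (simp add: add.commute)
    ultimately show ?thesis by simp
  qed
  also have "\<dots> \<le> bc n * ((real n - 1 / 2) / (real n + 1))"
    using step n by (intro mult_right_mono) auto
  finally show ?case by simp
qed simp

definition bz :: "int \<Rightarrow> real" where
  "bz m = (if m < 0 then 0 else bc (nat m))"

section \<open>Identification of the factor \<open>U\<close> with the square root\<close>

context norm_tutte
begin

lemma mass: "(\<lambda>n. 2 * v n) summable_on UNIV" "a summable_on UNIV"
  "(\<Sum>\<^sub>\<infinity>n. 2 * v n) + infsum a UNIV \<le> 1"
proof -
  have "(\<Sum>n\<le>N. 2 * v n + a n) \<le> 1" for N
  proof -
    have "(\<Sum>n\<le>N. 2 * v n + a n) = 2 * (\<Sum>i\<le>N. v i) + (\<Sum>k<Suc N. a k)"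
      by (simp add: sum.distrib sum_distrib_left lessThan_Suc_atMost)
    also have "\<dots> \<le> 2 * (\<Sum>i\<le>Suc N. v i) + (\<Sum>k<Suc N. a k)" using v_nonneg by simp
    finally show ?thesis using mass_le_1[of "Suc N"] by linarith
  qed
  then have s: "(\<lambda>n. 2 * v n + a n) summable_on UNIV" "(\<Sum>\<^sub>\<infinity>n. 2 * v n + a n) \<le> 1"
    using infsum_le_of_partial[of "\<lambda>n. 2 * v n + a n" 1] v_nonneg a_nonneg by auto
  show sv: "(\<lambda>n. 2 * v n) summable_on UNIV"
    by (rule summable_on_comparison_test[OF s(1)]) (use v_nonneg a_nonneg in auto)
  show sa: "a summable_on UNIV"
    by (rule summable_on_comparison_test[OF s(1)]) (use v_nonneg a_nonneg in auto)
  show "(\<Sum>\<^sub>\<infinity>n. 2 * v n) + infsum a UNIV \<le> 1"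
    using s(2) infsum_add[OF sv sa] by simp
qed

text \<open>The product \<open>(1 - D (1 / t)) * (U t - 1)\<close> is compared with
  \<open>2 * V t + A (1 / t) - 1\<close>; the sign is the one for which \<open>2 * v n\<close> and
  \<open>a k\<close> appear positively. Index 0 carries both \<open>a 0\<close> and the constant
  \<open>-1\<close>.\<close>

lemma laurent_factorization:
  obtains \<kappa> u d where "\<kappa> > 0" "\<And>n. u n \<ge> 0" "\<And>n. d n \<ge> 0" "u 0 = 0" "d 0 = 0"
    "u summable_on UNIV" "d summable_on UNIV" "infsum u UNIV \<le> 1" "infsum d UNIV \<le> 1"
    "\<And>n. n \<ge> 1 \<Longrightarrow> \<kappa> * conv (lminus d) (lplus u) (int n) = 2 * v n"
    "\<kappa> * conv (lminus d) (lplus u) 0 = a 0 - 1"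
    "\<And>k. k \<ge> 1 \<Longrightarrow> \<kappa> * conv (lminus d) (lplus u) (- int k) = a k"
proof -
  interpret wh_data "\<lambda>n. 2 * v n" a
    by unfold_locales (use v_0 v_nonneg v_1 a_nonneg mass in auto)
  obtain X Y \<kappa> where k: "\<kappa> > 0" and X0: "\<And>n. X n \<ge> 0" and Y0: "\<And>n. Y n \<ge> 0" and z: "X 0 = 0" "Y 0 = 0"
    and s: "X summable_on UNIV" "Y summable_on UNIV" and le: "infsum X UNIV \<le> \<kappa>" "infsum Y UNIV \<le> \<kappa>"
    and eX: "\<And>n. n \<ge> 1 \<Longrightarrow> X n = 2 * v n + cor Y X n / \<kappa>"
    and eY: "\<And>n. n \<ge> 1 \<Longrightarrow> Y n = a n + cor X Y n / \<kappa>" and eK: "\<kappa> = 1 - a 0 - cor X Y 0 / \<kappa>"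
    by (rule wiener_hopf) blast
  define u where "u n = X n * (1 / \<kappa>)" for n
  define d where "d n = Y n * (1 / \<kappa>)" for n
  have u: "u summable_on UNIV" "\<And>n. u n \<ge> 0" "u 0 = 0" "infsum u UNIV \<le> 1"
  proof -
    show "u summable_on UNIV" unfolding u_def[abs_def] by (rule summable_on_cmult_left[OF s(1)])
    have "infsum u UNIV = infsum X UNIV * (1 / \<kappa>)" unfolding u_def[abs_def] by (rule infsum_cmult_left')
    then show "infsum u UNIV \<le> 1" using le k by simp
    show "u n \<ge> 0" "u 0 = 0" for n using X0 z k by (simp_all add: u_def)
  qed
  have d: "d summable_on UNIV" "\<And>n. d n \<ge> 0" "d 0 = 0" "infsum d UNIV \<le> 1"
  proof -
    show "d summable_on UNIV" unfolding d_def[abs_def] by (rule summable_on_cmult_left[OF s(2)])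
    have "infsum d UNIV = infsum Y UNIV * (1 / \<kappa>)" unfolding d_def[abs_def] by (rule infsum_cmult_left')
    then show "infsum d UNIV \<le> 1" using le k by simp
    show "d n \<ge> 0" "d 0 = 0" for n using Y0 z k by (simp_all add: d_def)
  qed
  note cv = conv_lminus[OF d(1,3) lplus_summable[OF u(1)]]
  have cYX: "(\<Sum>\<^sub>\<infinity>j. d j * u (n + j)) = cor Y X n / \<kappa> / \<kappa>" for n
  proof -
    have "(\<Sum>\<^sub>\<infinity>j. d j * u (n + j)) = (\<Sum>\<^sub>\<infinity>j. Y j * X (n + j) * (1 / \<kappa> * (1 / \<kappa>)))"
      by (simp add: u_def d_def)
    also have "\<dots> = cor Y X n * (1 / \<kappa> * (1 / \<kappa>))" unfolding cor_def by (rule infsum_cmult_left')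
    finally show ?thesis by simp
  qed
  have cXY: "(\<Sum>\<^sub>\<infinity>j. d (n + j) * u j) = cor X Y n / \<kappa> / \<kappa>" for n
  proof -
    have "(\<Sum>\<^sub>\<infinity>j. d (n + j) * u j) = (\<Sum>\<^sub>\<infinity>j. X j * Y (n + j) * (1 / \<kappa> * (1 / \<kappa>)))"
      by (simp add: u_def d_def mult_ac)
    also have "\<dots> = cor X Y n * (1 / \<kappa> * (1 / \<kappa>))" unfolding cor_def by (rule infsum_cmult_left')
    finally show ?thesis by simp
  qed
  show ?thesis
  proof (rule that[OF k u(2) d(2) u(3) d(3) u(1) d(1) u(4) d(4)])
    fix n :: nat assume n: "n \<ge> 1"
    have "conv (lminus d) (lplus u) (int n) = u n - (\<Sum>\<^sub>\<infinity>j. d j * u (n + j))"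
      unfolding cv using n by (simp add: lplus_def nat_add_distrib)
    also have "\<dots> = (X n - cor Y X n / \<kappa>) / \<kappa>" unfolding cYX by (simp add: u_def diff_divide_distrib)
    finally show "\<kappa> * conv (lminus d) (lplus u) (int n) = 2 * v n" using eX[OF n] k by simp
  next
    have "(\<Sum>\<^sub>\<infinity>j. d j * lplus u (int j)) = (\<Sum>\<^sub>\<infinity>j. d (0 + j) * u j)"
      by (rule infsum_cong) (use d(3) in \<open>auto simp: lplus_def\<close>)
    then have "conv (lminus d) (lplus u) 0 = -1 - cor X Y 0 / \<kappa> / \<kappa>"
      unfolding cv using cXY[of 0] by (simp add: lplus_def)
    then have "\<kappa> * conv (lminus d) (lplus u) 0 = - \<kappa> - cor X Y 0 / \<kappa>" using k by (simp add: field_simps)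
    then show "\<kappa> * conv (lminus d) (lplus u) 0 = a 0 - 1" using eK by linarith
  next
    fix n :: nat assume n: "n \<ge> 1"
    have s1: "(\<lambda>i. d (n + i) * lplus u (int i)) summable_on UNIV"
    proof (rule summable_on_bounded_mult)
      show "(\<lambda>i. d (n + i)) summable_on UNIV"
      proof -
        have "d summable_on (\<lambda>i. n + i) ` UNIV" using summable_on_subset_banach[OF d(1)] by auto
        then show ?thesis using summable_on_reindex[of "\<lambda>i. n + i" UNIV d] by (simp add: o_def)
      qed
      show "\<bar>lplus u (int i)\<bar> \<le> (\<Sum>\<^sub>\<infinity>x. \<bar>lplus u x\<bar>)" for i by (rule summable_imp_bounded[OF lplus_summable[OF u(1)]])
    qed
    have "(\<Sum>\<^sub>\<infinity>j. d j * lplus u (- int n + int j)) = (\<Sum>\<^sub>\<infinity>j\<in>{n..}. d j * lplus u (- int n + int j))"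
      by (rule infsum_cong_neutral) (auto simp: lplus_def)
    also have "\<dots> = (\<Sum>\<^sub>\<infinity>i. d (n + i) * lplus u (int i))"
      by (rule infsum_reindex_bij_witness[where i = "\<lambda>i. n + i" and j = "\<lambda>j. j - n"]) auto
    also have "\<dots> = - d n + (\<Sum>\<^sub>\<infinity>i. d (n + Suc i) * u (Suc i))"
      using infsum_UNIV_Suc(1)[OF s1] by (simp add: lplus_def nat_add_distrib)
    also have "(\<Sum>\<^sub>\<infinity>i. d (n + Suc i) * u (Suc i)) = (\<Sum>\<^sub>\<infinity>i. d (n + i) * u i)"
    proof -
      have s2: "(\<lambda>i. d (n + i) * u i) summable_on UNIV"
        using cor_summable[OF u(1) d(1,2), of n] by (simp add: mult.commute)
      show ?thesis using infsum_UNIV_Suc(1)[OF s2] u(3) by simp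
    qed
    finally have "conv (lminus d) (lplus u) (- int n) = d n - cor X Y n / \<kappa> / \<kappa>"
      unfolding cv using n cXY[of n] by (simp add: lplus_def)
    also have "\<dots> = (Y n - cor X Y n / \<kappa>) / \<kappa>" by (simp add: d_def diff_divide_distrib)
    finally show "\<kappa> * conv (lminus d) (lplus u) (- int n) = a n" using eY[OF n] k by simp
  qed
qed

text \<open>Up to \<open>\<kappa>\<close>, \<open>F\<close> is the Laurent series itself. In its
  square at index \<open>n \<ge> 2\<close>, the terms with both indices positive give 4 times the
  convolution of \<open>v\<close>, and the two outer ranges are mirror images. By Tutte's equation
  each of these gives \<open>-2\<close> times that convolution, so everything cancels.\<close>

theorem bc_factorization:
  obtains \<kappa> d where "\<kappa> > 0" "\<And>n. d n \<ge> 0" "d 0 = 0" "d summable_on UNIV" "infsum d UNIV \<le> 1"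
    "\<And>n. n \<ge> 1 \<Longrightarrow> 2 * v n = \<kappa> * (bz (int n) - (\<Sum>\<^sub>\<infinity>j. d j * bz (int n + int j)))"
    "a 0 - 1 = \<kappa> * (bz 0 - (\<Sum>\<^sub>\<infinity>j. d j * bz (int j)))"
    "\<And>k. k \<ge> 1 \<Longrightarrow> a k = \<kappa> * (bz (- int k) - (\<Sum>\<^sub>\<infinity>j. d j * bz (- int k + int j)))"
proof -
  obtain \<kappa> u d where k: "\<kappa> > 0" and u0: "\<And>n. u n \<ge> 0" and d0: "\<And>n. d n \<ge> 0" and z: "u 0 = 0" "d 0 = 0"
    and s: "u summable_on UNIV" "d summable_on UNIV" and le: "infsum u UNIV \<le> 1" "infsum d UNIV \<le> 1"
    and e1: "\<And>n. n \<ge> 1 \<Longrightarrow> \<kappa> * conv (lminus d) (lplus u) (int n) = 2 * v n"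
    and e2: "\<kappa> * conv (lminus d) (lplus u) 0 = a 0 - 1"
    and e3: "\<And>k. k \<ge> 1 \<Longrightarrow> \<kappa> * conv (lminus d) (lplus u) (- int k) = a k"
    by (rule laurent_factorization) blast
  define D U where "D = lminus d" and "U = lplus u"
  have sD: "D summable_on UNIV" and sU: "U summable_on UNIV"
    unfolding D_def U_def by (rule lminus_summable[OF s(2)], rule lplus_summable[OF s(1)])
  define F where "F = conv D U"
  have sF: "F summable_on UNIV" unfolding F_def by (rule conv_summable(1)[OF sD sU])
  have Fp: "F (int n) = 2 * v n / \<kappa>" if "n \<ge> 1" for n
    using e1[OF that] k by (simp add: F_def D_def U_def field_simps)
  have Fn: "F (- int j) = (a j - (if j = 0 then 1 else 0)) / \<kappa>" for j
    using e2 e3[of j] k by (cases "j = 0") (simp_all add: F_def D_def U_def field_simps)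
  have FF: "conv F F n = 0" if n2: "n \<ge> 2" for n
  proof -
    define N where "N = nat n"
    have N1: "n = int N" using n2 by (simp add: N_def)
    then have "N \<ge> 2" using n2 by linarith
    note N = N1 this
    define P where "P k = F k * F (n - k)" for k
    have sP: "P summable_on UNIV" unfolding P_def[abs_def] by (rule conv_summable(2)[OF sF sF])
    have sub: "P summable_on A" for A using summable_on_subset_banach[OF sP] by auto
    have U: "UNIV = {..0} \<union> ({1..n - 1} \<union> {n..})" using n2 by auto
    have "conv F F n = infsum P UNIV" by (simp add: conv_def P_def[abs_def])
    also have "\<dots> = infsum P ({..0} \<union> ({1..n - 1} \<union> {n..}))" using U by simp
    also have "\<dots> = infsum P {..0} + infsum P ({1..n - 1} \<union> {n..})"
      by (rule infsum_Un_disjoint[OF sub sub]) (use n2 in auto)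
    also have "infsum P ({1..n - 1} \<union> {n..}) = infsum P {1..n - 1} + infsum P {n..}"
      by (rule infsum_Un_disjoint[OF sub sub]) auto
    also have "infsum P {n..} = infsum P {..0}"
      by (rule infsum_reindex_bij_witness[where i = "\<lambda>k. n - k" and j = "\<lambda>k. n - k"]) (auto simp: P_def)
    also have "infsum P {1..n - 1} = (\<Sum>i\<in>{1..N - 1}. P (int i))"
      unfolding infsum_finite[OF finite_atLeastAtMost_int]
      by (rule sum.reindex_bij_witness[where i = int and j = nat]) (use N in auto)
    also have "(\<Sum>i\<in>{1..N - 1}. P (int i)) = 4 / \<kappa>\<^sup>2 * (\<Sum>i\<le>N. v i * v (N - i))"
    proof -
      have "(\<Sum>i\<le>N. v i * v (N - i)) = (\<Sum>i\<in>{1..N - 1}. v i * v (N - i))"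
        by (rule sum.mono_neutral_right) (use v_0 in \<open>auto simp: not_le le_Suc_eq\<close>)
      moreover have "P (int i) = 4 / \<kappa>\<^sup>2 * (v i * v (N - i))" if "i \<in> {1..N - 1}" for i
      proof -
        have "n - int i = int (N - i)" "N - i \<ge> 1" "i \<ge> 1" using that N by auto
        then have "P (int i) = (2 * v i / \<kappa>) * (2 * v (N - i) / \<kappa>)" unfolding P_def using Fp by metis
        then show ?thesis by (simp add: power2_eq_square)
      qed
      ultimately show ?thesis by (simp add: sum_distrib_left)
    qed
    also have "infsum P {..0} = (\<Sum>\<^sub>\<infinity>j. P (- int j))"
      by (rule infsum_reindex_bij_witness[where i = "\<lambda>j. - int j" and j = "\<lambda>k. nat (- k)"]) auto
    also have "\<dots> = 2 / \<kappa>\<^sup>2 * (- (\<Sum>i\<le>N. v i * v (N - i)))"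
    proof -
      have e: "P (- int j) = 2 / \<kappa>\<^sup>2 * (a j * v (N + j)) + (if j = 0 then - (2 / \<kappa>\<^sup>2 * v N) else 0)" for j
        using Fp[of "N + j"] Fn[of j] N
        by (cases "j = 0") (simp_all add: P_def power2_eq_square diff_divide_distrib left_diff_distrib)
      have sm: "(\<lambda>j. 2 / \<kappa>\<^sup>2 * (a j * v (N + j))) sums (2 / \<kappa>\<^sup>2 * (v N - (\<Sum>i\<le>N. v i * v (N - i))))"
        by (rule sums_mult[OF tutte[OF N(2)]])
      have "(\<lambda>j::nat. if j = 0 then - (2 / \<kappa>\<^sup>2 * v N) else 0) sums (- (2 / \<kappa>\<^sup>2 * v N))"
        using sums_single[of 0 "\<lambda>_. - (2 / \<kappa>\<^sup>2 * v N)"] by simp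
      from sums_add[OF sm this] have "(\<lambda>j. P (- int j)) sums (2 / \<kappa>\<^sup>2 * (v N - (\<Sum>i\<le>N. v i * v (N - i))) + (- (2 / \<kappa>\<^sup>2 * v N)))"
        unfolding e .
      moreover have "(\<lambda>j. P (- int j)) summable_on UNIV"
      proof -
        have "P summable_on (\<lambda>j::nat. - int j) ` UNIV" by (rule sub)
        then show ?thesis using summable_on_reindex[of "\<lambda>j::nat. - int j" UNIV P] by (simp add: o_def inj_def)
      qed
      ultimately have "(\<Sum>\<^sub>\<infinity>j. P (- int j)) = 2 / \<kappa>\<^sup>2 * (v N - (\<Sum>i\<le>N. v i * v (N - i))) + (- (2 / \<kappa>\<^sup>2 * v N))"
        using summable_on_sums sums_unique2 by blast
      then show ?thesis by (simp add: right_diff_distrib)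
    qed
    finally show ?thesis by simp
  qed
  define G where "G = conv U U"
  have sG: "G summable_on UNIV" unfolding G_def by (rule conv_summable(1)[OF sU sU])
  have FG: "conv F F = conv D (conv D G)"
  proof
    fix n
    have c: "conv f g = conv g f" for f g by (rule ext) (rule conv_commute)
    have as: "conv (conv f g) h = conv f (conv g h)" if "f summable_on UNIV" "g summable_on UNIV" "h summable_on UNIV" for f g h
      by (rule ext) (rule conv_assoc[OF that])
    have "conv F F = conv D (conv U (conv D U))"
      unfolding F_def by (rule as[OF sD sU conv_summable(1)[OF sD sU]])
    also have "conv U (conv D U) = conv (conv D U) U" by (rule c)
    also have "\<dots> = conv D (conv U U)" by (rule as[OF sD sU sU])
    finally show "conv F F n = conv D (conv D G) n" by (simp add: G_def)
  qed
  \<comment> \<open>The factor \<open>1 - D (1 / t)\<close> occurs squared in the square of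
    \<open>F\<close>, so it is cancelled twice.\<close>
  have "conv D G n = 0" if "n \<ge> 2" for n
    unfolding D_def
    by (rule conv_lminus_eq_0[OF d0 z(2) s(2) le(2) _ _ that])
      (use conv_summable(1)[OF sD sG] FF FG in \<open>simp_all add: D_def\<close>)
  then have G0: "G n = 0" if "n \<ge> 2" for n
    by (rule conv_lminus_eq_0[OF d0 z(2) s(2) le(2) sG _ that, folded D_def])
  define w where "w n = U (int n)" for n
  have w: "w n = bc n * (2 * w 1) ^ n" for n
  proof (rule quadratic_rec_unique)
    show "w 0 = -1" by (simp add: w_def U_def lplus_def)
    fix n :: nat assume n: "n \<ge> 2"
    have "G (int n) = infsum (\<lambda>k. U k * U (int n - k)) {0..int n}"
      unfolding G_def conv_def by (rule infsum_cong_neutral) (auto simp: U_def lplus_def)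
    also have "\<dots> = (\<Sum>i\<le>n. w i * w (n - i))"
      unfolding infsum_finite[OF finite_atLeastAtMost_int]
      by (rule sum.reindex_bij_witness[where i = int and j = nat]) (auto simp: w_def of_nat_diff nat_le_iff)
    finally show "(\<Sum>i\<le>n. w i * w (n - i)) = 0" using G0[of "int n"] n by simp
  qed
  define \<alpha> where "\<alpha> = 2 * w 1"
  have wu: "w n = u n" if "n \<ge> 1" for n using that by (simp add: w_def U_def lplus_def)
  have un: "u n = bc n * \<alpha> ^ n" if "n \<ge> 1" for n using w[of n] wu[OF that] by (simp add: \<alpha>_def)
  have al0: "\<alpha> \<ge> 0" using wu[of 1] u0 by (simp add: \<alpha>_def)
  have u1: "u n \<le> 1" for n using summable_on_le_infsum[OF s(1) u0] le(1) order_trans by blast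
  \<comment> \<open>Since \<open>bc\<close> decays only polynomially, a larger
    \<open>\<alpha>\<close> would push \<open>u n = bc n * \<alpha> ^ n\<close> above 1.\<close>
  have al1: "\<alpha> \<le> 1"
  proof (rule ccontr)
    assume "\<not> \<alpha> \<le> 1"
    then have al: "\<alpha> > 1" by simp
    have "\<alpha> ^ n / (2 * real n ^ 2) \<le> 1" if "n \<ge> 1" for n
      using mult_right_mono[OF bc_lower[OF that], of "\<alpha> ^ n"] un[OF that] u1[of n] al by simp
    then have "real n ^ 2 * (1 / \<alpha>) ^ n \<ge> 1 / 2" if "n \<ge> 1" for n
      using that al by (simp add: field_simps)
    moreover have "(\<lambda>n. real n ^ 2 * (1 / \<alpha>) ^ n) \<longlonglongrightarrow> 0"
    proof -
      have "(\<lambda>n. (real n * sqrt (1 / \<alpha>) ^ n) ^ 2) \<longlonglongrightarrow> 0 ^ 2"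
        using al by (intro tendsto_power powser_times_n_limit_0) (simp add: real_sqrt_less_iff)
      moreover have "(real n * sqrt (1 / \<alpha>) ^ n) ^ 2 = real n ^ 2 * (1 / \<alpha>) ^ n" for n
        using al by (simp add: power_mult_distrib power_mult[symmetric] mult.commute[of n 2])
          (simp add: power_mult)
      ultimately show ?thesis by simp
    qed
    ultimately have "(1 / 2 :: real) \<le> 0" by (intro LIMSEQ_le_const) auto
    then show False by simp
  qed
  \<comment> \<open>From \<open>2 * v n \<le> \<kappa> * u n\<close> and
    \<open>\<kappa> \<le> 1\<close> one gets \<open>v n \<le> u n\<close>. With
    \<open>\<alpha> < 1\<close>, all \<open>v n * y ^ n\<close> would be at most 1 for some
    \<open>y > 1\<close>, against \<open>radius\<close>.\<close>
  have al_ge: "\<alpha> \<ge> 1"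
  proof (rule ccontr)
    assume al: "\<not> \<alpha> \<ge> 1"
    define y where "y = (if \<alpha> = 0 then 2 else 1 / \<alpha>)"
    have y: "y > 1" "\<alpha> * y \<le> 1" using al al0 by (auto simp: y_def)
    have bc1: "bc n \<le> 1" for n
    proof (induction n)
      case (Suc n)
      have "(real n - 1 / 2) / (real n + 1) \<le> 1" by simp
      moreover have "bc (Suc n) \<le> 1"
      proof (cases "n = 0")
        case False
        then have "bc n * ((real n - 1 / 2) / (real n + 1)) \<le> 1 * 1"
          using Suc bc_pos[of n] by (intro mult_mono) auto
        then show ?thesis by simp
      qed simp
      ultimately show ?case by simp
    qed simp
    have k1: "\<kappa> \<le> 1"
    proof -
      have "\<kappa> * conv D U 0 = \<kappa> * (-1 - (\<Sum>\<^sub>\<infinity>j. d j * U (int j)))"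
        unfolding D_def conv_lminus[OF s(2) z(2) sU] by (simp add: U_def lplus_def)
      moreover have "(\<Sum>\<^sub>\<infinity>j. d j * U (int j)) \<ge> 0"
      proof (rule infsum_nonneg)
        show "0 \<le> d j * U (int j)" for j
          using d0[of j] u0[of j] z by (cases "j = 0") (auto simp: U_def lplus_def)
      qed
      moreover have "\<kappa> * conv D U 0 = a 0 - 1" using e2 by (simp add: D_def U_def)
      moreover have "a 0 \<ge> 0" by (rule a_nonneg)
      ultimately show ?thesis using k by (simp add: algebra_simps) (smt (verit) mult_nonneg_nonneg)
    qed
    obtain n where n: "v n * y ^ n > 1" using radius[OF y(1)] by blast
    then have n1: "n \<ge> 1" using v_0 by (cases n) auto
    have "2 * v n = \<kappa> * (u n - (\<Sum>\<^sub>\<infinity>j. d j * U (int n + int j)))"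
      using e1[OF n1] n1 conv_lminus[OF s(2) z(2) sU, of "int n"] by (simp add: D_def U_def lplus_def)
    moreover have "(\<Sum>\<^sub>\<infinity>j. d j * U (int n + int j)) \<ge> 0"
      using d0 u0 n1 by (intro infsum_nonneg) (simp add: U_def lplus_def)
    then have "\<kappa> * (\<Sum>\<^sub>\<infinity>j. d j * U (int n + int j)) \<ge> 0" using k by simp
    ultimately have "2 * v n \<le> \<kappa> * u n" unfolding right_diff_distrib by linarith
    also have "\<dots> \<le> 1 * u n" using k1 u0 by (intro mult_right_mono) auto
    finally have "v n \<le> u n" using v_nonneg[of n] by simp
    then have "v n * y ^ n \<le> u n * y ^ n" using y by (intro mult_right_mono) auto
    also have "\<dots> = bc n * (\<alpha> * y) ^ n" using un[OF n1] by (simp add: power_mult_distrib)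
    also have "\<dots> \<le> 1 * 1"
      using bc1 y al0 by (intro mult_mono power_le_one) auto
    finally show False using n by simp
  qed
  have Ubz: "U = bz"
  proof
    fix m
    show "U m = bz m" using un[of "nat m"] al1 al_ge by (auto simp: U_def lplus_def bz_def)
  qed
  have cv: "conv D U n = bz n - (\<Sum>\<^sub>\<infinity>j. d j * bz (n + int j))" for n
    unfolding D_def conv_lminus[OF s(2) z(2) sU] unfolding Ubz ..
  show ?thesis
    by (rule that[OF k d0 z(2) s(2) le(2)])
      (use e1 e2 e3 in \<open>simp_all add: cv[unfolded D_def U_def]\<close>)
qed

end

text \<open>Partial sums are the coefficients of
  \<open>- sqrt (1 - t) / (1 - t) = - 1 / sqrt (1 - t)\<close>, which is \<open>-2\<close> times the
  derivative of \<open>- sqrt (1 - t)\<close>.\<close>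

lemma bc_partial_sum: "(\<Sum>N\<le>n. bc N) = - 2 * (real n + 1) * bc (Suc n)"
proof (induction n)
  case (Suc n)
  have "bc (Suc (Suc n)) = bc (Suc n) * ((real (Suc n) - 1 / 2) / (real (Suc n) + 1))" by (rule bc.simps(2))
  moreover have "real (Suc n) - 1 / 2 = real n + 1 / 2" "real (Suc n) + 1 = real n + 2" by simp_all
  ultimately have r: "bc (Suc (Suc n)) * (real n + 2) = bc (Suc n) * (real n + 1 / 2)"
    by (simp del: bc.simps add: add.commute)
  have "(\<Sum>N\<le>Suc n. bc N) = - 2 * (bc (Suc n) * (real n + 1 / 2))"
    using Suc by (simp del: bc.simps add: algebra_simps)
  also have "\<dots> = - 2 * (real (Suc n) + 1) * bc (Suc (Suc n))" unfolding r[symmetric] by (simp del: bc.simps add: algebra_simps)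
  finally show ?case .
qed simp

text \<open>The quantity is \<open>n ^ 3 * (bc n) ^ 2\<close>, whose consecutive ratio
  \<open>(n + 1) * (n - 1 / 2) ^ 2 / n ^ 3\<close> is at most 1. It yields the true order
  \<open>n powr (- 3 / 2)\<close>, which the later absolute convergence requires.\<close>

lemma bc_upper: "n \<ge> 1 \<Longrightarrow> real n * (real n * bc n)\<^sup>2 \<le> 1 / 4"
proof (induction n rule: dec_induct)
  case (step n)
  define x where "x = real n"
  have x: "x \<ge> 1" using step by (simp add: x_def)
  have e: "real (Suc n) * bc (Suc n) = bc n * (x - 1 / 2)" using x by (simp add: x_def add.commute)
  have "real (Suc n) * (real (Suc n) * bc (Suc n))\<^sup>2 = (x + 1) * (x - 1 / 2)\<^sup>2 * (bc n)\<^sup>2"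
    unfolding e by (simp add: x_def power_mult_distrib mult_ac add.commute)
  also have "\<dots> \<le> x ^ 3 * (bc n)\<^sup>2"
  proof (rule mult_right_mono)
    have "(x + 1) * (x - 1 / 2)\<^sup>2 = x ^ 3 - 3 / 4 * x + 1 / 4"
      by (simp add: power2_eq_square power3_eq_cube algebra_simps)
    then show "(x + 1) * (x - 1 / 2)\<^sup>2 \<le> x ^ 3" using x by simp
  qed simp
  also have "\<dots> = x * (x * bc n)\<^sup>2" by (simp add: power2_eq_square power3_eq_cube)
  also have "\<dots> \<le> 1 / 4" using step by (simp add: x_def)
  finally show ?case .
qed (simp add: power2_eq_square)

lemma bc_upper_powr: "n \<ge> 1 \<Longrightarrow> bc n \<le> real n powr (- 3 / 2)"
proof -
  assume n: "n \<ge> 1"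
  define x where "x = real n"
  have x: "x \<ge> 1" using n by (simp add: x_def)
  have "(real n * bc n)\<^sup>2 \<le> 1 / 4 / x" using bc_upper[OF n] x by (simp add: x_def field_simps)
  also have "\<dots> \<le> (1 / sqrt x)\<^sup>2" using x by (simp add: power_divide field_simps)
  finally have "x * bc n \<le> 1 / sqrt x" unfolding x_def
    by (rule power2_le_imp_le) simp
  then have "bc n \<le> 1 / (x * sqrt x)" using x by (simp add: field_simps)
  also have "x * sqrt x = x powr (3 / 2)"
  proof -
    have "x powr (3 / 2) = x powr (1 + 1 / 2)" by simp
    also have "\<dots> = x powr 1 * x powr (1 / 2)" by (rule powr_add)
    finally have "x powr (3 / 2) = x powr 1 * x powr (1 / 2)" .
    then show ?thesis using x by (simp add: powr_half_sqrt)
  qed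
  finally show ?thesis using x by (simp add: x_def powr_minus_divide)
qed

lemma bc_abs_summable: "(\<lambda>n. \<bar>bc n\<bar>) summable_on UNIV" "bc summable_on UNIV"
proof -
  have "summable (\<lambda>n. real n powr (- 3 / 2))" by (subst summable_real_powr_iff) simp
  then have "summable (\<lambda>n. \<bar>bc n\<bar>)"
  proof (rule summable_comparison_test_ev[rotated])
    show "\<forall>\<^sub>F n in sequentially. norm \<bar>bc n\<bar> \<le> real n powr (- 3 / 2)"
      using eventually_ge_at_top[of 1]
    proof eventually_elim
      case (elim n)
      then show ?case using bc_upper_powr[of n] bc_pos[of n] by simp
    qed
  qed
  then show "(\<lambda>n. \<bar>bc n\<bar>) summable_on UNIV" by (rule summable_nonneg_imp_summable_on) simp
  then show "bc summable_on UNIV" using summable_on_abs_iff[of bc UNIV] by simp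
qed

lemma real_summable_diff:
  fixes f g :: "'a \<Rightarrow> real"
  assumes "f summable_on A" "g summable_on A"
  shows "(\<lambda>x. f x - g x) summable_on A" "(\<Sum>\<^sub>\<infinity>x\<in>A. f x - g x) = infsum f A - infsum g A"
proof -
  have g: "(\<lambda>x. - g x) summable_on A" using assms(2) by (simp only: summable_on_uminus)
  show "(\<lambda>x. f x - g x) summable_on A" using summable_on_add[OF assms(1) g] by simp
  show "(\<Sum>\<^sub>\<infinity>x\<in>A. f x - g x) = infsum f A - infsum g A"
    using infsum_add[OF assms(1) g] by (simp add: infsum_uminus)
qed

lemma half_int_abs: "\<bar>real_of_int m - 1 / 2\<bar> \<ge> 1 / 2"
proof (cases "m \<ge> 1")
  case False
  then have "real_of_int m \<le> 0" by simp
  then show ?thesis by simp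
qed simp

section \<open>A kernel inverting the square root\<close>

text \<open>A discrete Hilbert transform of \<open>bc\<close>; the half-integer shift keeps every
  denominator away from 0.\<close>

definition Jf :: "int \<Rightarrow> real" where
  "Jf k = (\<Sum>\<^sub>\<infinity>N. bc N / (real_of_int (int N + k) - 1 / 2))"

lemma Jf_summable: "(\<lambda>N. bc N / (real_of_int (int N + k) - 1 / 2)) summable_on UNIV"
proof -
  have "(\<lambda>N. bc N * (1 / (real_of_int (int N + k) - 1 / 2))) summable_on UNIV"
  proof (rule summable_on_bounded_mult[OF bc_abs_summable(2)])
    fix N
    have "1 / \<bar>real_of_int (int N + k) - 1 / 2\<bar> \<le> 1 / (1 / 2)"
      using half_int_abs[of "int N + k"] by (intro divide_left_mono) auto
    then show "\<bar>1 / (real_of_int (int N + k) - 1 / 2)\<bar> \<le> 2" by simp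
  qed
  then show ?thesis by simp
qed

text \<open>The sum of \<open>N * bc N / (N + k - 1 / 2)\<close> is evaluated twice. Subtracting a
  multiple of the denominator from \<open>N\<close> gives \<open>Jf k\<close>; shifting the index
  and using \<open>(N + 1) * bc (N + 1) = (N - 1 / 2) * bc N\<close> gives
  \<open>Jf (k + 1)\<close>.\<close>

lemma Jf_rec: "(real_of_int k + 1) * Jf (k + 1) = (real_of_int k - 1 / 2) * Jf k"
proof -
  define h where "h m = real_of_int m - 1 / 2" for m
  have h0: "h m \<noteq> 0" for m using half_int_abs[of m] by (auto simp: h_def)
  have s: "(\<lambda>N. bc N / h (int N + k)) summable_on UNIV" for k unfolding h_def by (rule Jf_summable)
  define f where "f N = real N * (bc N / h (int N + k))" for N
  have f1: "f N = bc N - (real_of_int k - 1 / 2) * (bc N / h (int N + k))" for N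
    using h0[of "int N + k"] unfolding f_def by (simp add: field_simps) (simp add: h_def algebra_simps)
  have f2: "f (Suc N) = bc N - (real_of_int k + 1) * (bc N / h (int N + (k + 1)))" for N
  proof -
    have "real (Suc N) * bc (Suc N) = (real N - 1 / 2) * bc N" by (simp add: field_simps)
    then have "f (Suc N) = (real N - 1 / 2) * bc N / h (int N + (k + 1))"
      by (simp only: f_def times_divide_eq_right of_nat_Suc of_int_of_nat_eq) (simp add: ac_simps)
    moreover have "real N - 1 / 2 = h (int N + (k + 1)) - (real_of_int k + 1)" by (simp add: h_def)
    ultimately show ?thesis using h0[of "int N + (k + 1)"]
      by (simp add: left_diff_distrib diff_divide_distrib)
  qed
  have sf: "f summable_on UNIV" unfolding f1[abs_def]
    by (intro real_summable_diff(1) summable_on_cmult_right s bc_abs_summable)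
  have "infsum f UNIV = infsum bc UNIV - (real_of_int k - 1 / 2) * Jf k"
    unfolding f1[abs_def] Jf_def h_def[symmetric]
    by (subst real_summable_diff(2)[OF bc_abs_summable(2) summable_on_cmult_right[OF s]]) (simp only: infsum_cmult_right')
  moreover have "infsum f UNIV = infsum bc UNIV - (real_of_int k + 1) * Jf (k + 1)"
  proof -
    have "infsum f UNIV = (\<Sum>\<^sub>\<infinity>N. f (Suc N))" using infsum_UNIV_Suc(1)[OF sf] by (simp add: f_def)
    also have "\<dots> = infsum bc UNIV - (real_of_int k + 1) * Jf (k + 1)"
      unfolding f2 Jf_def h_def[symmetric]
      by (subst real_summable_diff(2)[OF bc_abs_summable(2) summable_on_cmult_right[OF s]]) (simp only: infsum_cmult_right')
    finally show ?thesis .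
  qed
  ultimately show ?thesis by simp
qed

lemma bz_simps: "bz (int n) = bc n" "m < 0 \<Longrightarrow> bz m = 0" "bz 0 = -1"
  by (simp_all add: bz_def)

text \<open>For \<open>k \<ge> 0\<close> the recursion is the one that defines \<open>bc\<close>. At
  \<open>k = -1\<close> its left-hand side vanishes, which forces \<open>Jf (- 1) = 0\<close> and
  then, going down, all values at negative indices to be 0.\<close>

lemma Jf_eq: "Jf k = - Jf 0 * bz k"
proof (cases "k \<ge> 0")
  case True
  have "Jf (int n) = - Jf 0 * bc n" for n
  proof (induction n)
    case (Suc n)
    have "(real n + 1) * Jf (int n + 1) = (real n - 1 / 2) * Jf (int n)" using Jf_rec[of "int n"] by simp
    then have "Jf (int n + 1) = (real n - 1 / 2) / (real n + 1) * Jf (int n)" by (simp add: field_simps)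
    then show ?case using Suc by (simp add: add.commute)
  qed simp
  from this[of "nat k"] True show ?thesis by (simp add: bz_def)
next
  case False
  have "Jf (- int (Suc n)) = 0" for n
  proof (induction n)
    case 0
    show ?case using Jf_rec[of "-1"] by simp
  next
    case (Suc n)
    have "(real_of_int (- int (Suc (Suc n))) - 1 / 2) * Jf (- int (Suc (Suc n))) = 0"
      using Jf_rec[of "- int (Suc (Suc n))"] Suc by (simp add: add.commute)
    moreover have "real_of_int (- int (Suc (Suc n))) - 1 / 2 \<noteq> 0" by simp
    ultimately show ?case by (metis mult_eq_0_iff)
  qed
  from this[of "nat (- k) - 1"] False show ?thesis by (simp add: bz_def)
qed

lemma Jf_0_pos: "Jf 0 > 0"
proof -
  have "infsum (\<lambda>N. bc N / (real_of_int (int N + 0) - 1 / 2)) {0} \<le> Jf 0"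
    unfolding Jf_def
  proof (rule infsum_mono2)
    show "(\<lambda>N. bc N / (real_of_int (int N + 0) - 1 / 2)) summable_on UNIV" by (rule Jf_summable)
    show "0 \<le> bc N / (real_of_int (int N + 0) - 1 / 2)" if "N \<in> UNIV - {0}" for N
      using that bc_pos[of N] by (intro divide_nonneg_nonneg) auto
  qed auto
  then show ?thesis by simp
qed

section \<open>The kernel and its action on \<open>bc\<close>\<close>

definition ohs :: "nat \<Rightarrow> real" where "ohs n = (\<Sum>i<n. 1 / (2 * real i + 1))"
text \<open>The even extension of \<open>ohs\<close>. It satisfies the difference equation
  \<open>oz_step\<close> at all integers, because the odd numbers are symmetric about 0.\<close>

definition oz :: "int \<Rightarrow> real" where "oz x = ohs (nat \<bar>x\<bar>)"

lemma ohs_simps: "ohs 0 = 0" "ohs (Suc n) = ohs n + 1 / (2 * real n + 1)"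
  by (simp_all add: ohs_def)

lemma ohs_mono: "m \<le> n \<Longrightarrow> ohs m \<le> ohs n"
  unfolding ohs_def by (rule sum_mono2) auto

lemma oz_step: "oz (x + 1) - oz x = 1 / (2 * real_of_int x + 1)"
proof (cases "x \<ge> 0")
  case True
  then have "nat \<bar>x + 1\<bar> = Suc (nat \<bar>x\<bar>)" by linarith
  then show ?thesis using True by (simp add: oz_def ohs_simps)
next
  case False
  then have "nat \<bar>x\<bar> = Suc (nat \<bar>x + 1\<bar>)" by linarith
  moreover have "2 * real (nat \<bar>x + 1\<bar>) + 1 = - (2 * real_of_int x + 1)" using False by simp
  ultimately have "oz x = oz (x + 1) + 1 / (- (2 * real_of_int x + 1))" by (simp only: oz_def ohs_simps)
  then show ?thesis by (simp only: divide_minus_right)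
qed

lemma oz_minus: "oz (- x) = oz x" by (simp add: oz_def)

lemma oz_diff_sum: "oz (x + int k) - oz x = (\<Sum>i<k. 1 / (2 * real_of_int (x + int i) + 1))"
proof (induction k)
  case (Suc k)
  have "oz (x + int (Suc k)) - oz (x + int k) = 1 / (2 * real_of_int (x + int k) + 1)"
    using oz_step[of "x + int k"] by (simp add: ac_simps)
  then show ?case using Suc by simp
qed simp

lemma odd_abs: "\<bar>2 * real_of_int x + 1\<bar> \<ge> 1"
proof (cases "x \<ge> 0")
  case False
  then have "real_of_int x \<le> -1" by linarith
  then show ?thesis by linarith
qed simp

lemma oz_lipschitz: "\<bar>oz (x + int k) - oz x\<bar> \<le> real k"
proof -
  have "\<bar>oz (x + int k) - oz x\<bar> \<le> (\<Sum>i<k. \<bar>1 / (2 * real_of_int (x + int i) + 1)\<bar>)"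
    unfolding oz_diff_sum by (rule sum_abs)
  also have "\<dots> \<le> (\<Sum>i<k. 1)"
  proof (rule sum_mono)
    fix i
    have "1 / \<bar>2 * real_of_int (x + int i) + 1\<bar> \<le> 1 / 1"
      using odd_abs[of "x + int i"] by (intro divide_left_mono) auto
    then show "\<bar>1 / (2 * real_of_int (x + int i) + 1)\<bar> \<le> 1" by simp
  qed
  finally show ?thesis by simp
qed

text \<open>An increment of \<open>oz\<close> over the window from \<open>m - j\<close> to
  \<open>m + j\<close>, so a finite sum of reciprocals of odd numbers, to each of which
  \<open>Jf_eq\<close> applies; it is odd in \<open>m\<close>. The weights \<open>ev l j\<close> are
  differences of \<open>1 / (l + j - 1 / 2)\<close>, which prepares the summations by parts over
  \<open>j\<close>.\<close>

definition av :: "int \<Rightarrow> nat \<Rightarrow> real" where "av m j = oz (m + int j) - oz (m - int j)"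
definition ev :: "nat \<Rightarrow> nat \<Rightarrow> real" where "ev l j = 1 / ((real l + real j)\<^sup>2 - 1 / 4)"
definition Tf :: "nat \<Rightarrow> int \<Rightarrow> real" where "Tf l m = (\<Sum>\<^sub>\<infinity>j. av m j * ev l j)"

lemma av_minus: "av (- m) j = - av m j"
proof -
  have "oz (- m + int j) = oz (m - int j)" "oz (- m - int j) = oz (m + int j)"
    using oz_minus[of "m - int j"] oz_minus[of "m + int j"] by simp_all
  then show ?thesis by (simp add: av_def)
qed

lemma av_0: "av 0 j = 0" using oz_minus[of "int j"] by (simp add: av_def)

lemma av_le_j: "\<bar>av m j\<bar> \<le> 2 * real j"
  using oz_lipschitz[of "m - int j" "2 * j"] by (simp add: av_def ac_simps)

lemma av_le_m: "\<bar>av m j\<bar> \<le> 2 * \<bar>real_of_int m\<bar>"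
proof -
  have pos: "\<bar>av (int k) j\<bar> \<le> 2 * real k" for k
    using oz_lipschitz[of "int j - int k" "2 * k"] oz_minus[of "int j - int k"] by (simp add: av_def add.commute)
  show ?thesis
  proof (cases "m \<ge> 0")
    case True
    then show ?thesis using pos[of "nat m"] by simp
  next
    case False
    then show ?thesis using pos[of "nat (- m)"] av_minus[of m j] by simp
  qed
qed

lemma av_nonneg: "m \<ge> 0 \<Longrightarrow> av m j \<ge> 0"
  unfolding av_def oz_def by (simp add: ohs_mono)

lemma ev_nonneg: "l \<ge> 1 \<Longrightarrow> ev l j \<ge> 0"
proof -
  assume l: "l \<ge> 1"
  then have "(1 :: real)\<^sup>2 \<le> (real l + real j)\<^sup>2" by (intro power_mono) auto
  then show ?thesis by (simp add: ev_def)
qed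

lemma ev_le: "l \<ge> 1 \<Longrightarrow> j \<ge> 1 \<Longrightarrow> ev l j \<le> real j powr (-2)"
proof -
  assume l: "l \<ge> 1" and j: "j \<ge> 1"
  have "real j ^ 2 + 1 \<le> (real j + 1)\<^sup>2" by (simp add: power2_eq_square algebra_simps)
  also have "\<dots> \<le> (real l + real j)\<^sup>2" using l by (intro power_mono) auto
  finally have "real j ^ 2 \<le> (real l + real j)\<^sup>2 - 1 / 4" by simp
  moreover have "real j ^ 2 > 0" using j by simp
  moreover from calculation have "0 < (real l + real j)\<^sup>2 - 1 / 4" by linarith
  ultimately have "ev l j \<le> 1 / real j ^ 2" unfolding ev_def by (intro divide_left_mono mult_pos_pos) auto
  also have "1 / real j ^ 2 = real j powr (-2)" using j by (simp add: powr_minus_divide powr_numeral)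
  finally show ?thesis .
qed

text \<open>Interpolation between the two bounds for \<open>av\<close>. The exponents are chosen so
  that both series that remain converge like \<open>n powr (- 5 / 4)\<close>: \<open>1 / 4\<close>
  is set against the decay \<open>- 3 / 2\<close> of \<open>bc\<close>, and \<open>3 / 4\<close>
  against the decay \<open>- 2\<close> of \<open>ev l\<close>.\<close>

lemma min_le_powr:
  fixes t x y :: real
  assumes "t \<le> x" "t \<le> y" "0 \<le> t"
  shows "t \<le> x powr (1 / 4) * y powr (3 / 4)"
proof (cases "t = 0")
  case False
  then have "t = t powr (1 / 4 + 3 / 4)" using assms by simp
  also have "\<dots> = t powr (1 / 4) * t powr (3 / 4)" by (rule powr_add)
  also have "\<dots> \<le> x powr (1 / 4) * y powr (3 / 4)"
    using assms by (intro mult_mono powr_mono2) auto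
  finally show ?thesis .
qed simp

lemma av_le_powr: "\<bar>av m j\<bar> \<le> 2 * (\<bar>real_of_int m\<bar> powr (1 / 4) * real j powr (3 / 4))"
  using min_le_powr[of "\<bar>av m j\<bar> / 2" "\<bar>real_of_int m\<bar>" "real j"] av_le_m[of m j] av_le_j[of m j] by simp

lemma summable_powr_54: "(\<lambda>n. real n powr (- 5 / 4)) summable_on UNIV"
proof (rule summable_nonneg_imp_summable_on)
  show "summable (\<lambda>n. real n powr (- 5 / 4))" by (subst summable_real_powr_iff) simp
qed simp

lemma ev_weighted_summable:
  assumes "l \<ge> 1" shows "(\<lambda>j. real j powr (3 / 4) * ev l j) summable_on UNIV"
proof (rule summable_on_comparison_test[OF summable_powr_54])
  fix j
  show "0 \<le> real j powr (3 / 4) * ev l j" using ev_nonneg[OF assms] by simp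
  show "real j powr (3 / 4) * ev l j \<le> real j powr (- 5 / 4)"
  proof (cases "j = 0")
    case False
    then have "real j powr (3 / 4) * ev l j \<le> real j powr (3 / 4) * real j powr (-2)"
      using ev_le[OF assms, of j] by (intro mult_left_mono) auto
    also have "\<dots> = real j powr (3 / 4 + (-2))" by (simp only: powr_add)
    finally show ?thesis by simp
  qed simp
qed

lemma bc_weighted_summable: "(\<lambda>N. \<bar>bc N\<bar> * \<bar>real_of_int (int N - int n)\<bar> powr (1 / 4)) summable_on UNIV"
proof -
  define f where "f N = \<bar>bc N\<bar> * \<bar>real_of_int (int N - int n)\<bar> powr (1 / 4)" for N
  have "(\<lambda>N. f (Suc N)) summable_on UNIV"
  proof (rule summable_on_comparison_test)
    show "(\<lambda>N. real (Suc N) powr (- 5 / 4) * (real n + 1) powr (1 / 4)) summable_on UNIV"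
      by (intro summable_on_cmult_left infsum_UNIV_Suc(2)[OF summable_powr_54])
    fix N
    show "0 \<le> f (Suc N)" by (simp add: f_def)
    define x where "x = real (Suc N)"
    have x: "x \<ge> 1" by (simp add: x_def)
    have b: "0 \<le> bc (Suc N)" "bc (Suc N) \<le> x powr (- 3 / 2)"
      using bc_pos[of "Suc N"] bc_upper_powr[of "Suc N"] by (simp_all add: x_def less_imp_le del: bc.simps)
    have "real n * 1 \<le> real n * x" using x by (intro mult_left_mono) auto
    then have "\<bar>x - real n\<bar> \<le> x * (real n + 1)" using x by (simp add: algebra_simps)
    then have "\<bar>x - real n\<bar> powr (1 / 4) \<le> (x * (real n + 1)) powr (1 / 4)" by (intro powr_mono2) auto
    also have "\<dots> = x powr (1 / 4) * (real n + 1) powr (1 / 4)" using x by (simp add: powr_mult)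
    finally have "bc (Suc N) * \<bar>x - real n\<bar> powr (1 / 4) \<le> x powr (- 3 / 2) * (x powr (1 / 4) * (real n + 1) powr (1 / 4))"
      using b by (intro mult_mono) auto
    also have "\<dots> = x powr (- 3 / 2 + 1 / 4) * (real n + 1) powr (1 / 4)" by (simp only: powr_add mult.assoc)
    finally have "bc (Suc N) * \<bar>x - real n\<bar> powr (1 / 4) \<le> x powr (- 5 / 4) * (real n + 1) powr (1 / 4)" by simp
    moreover have "f (Suc N) = bc (Suc N) * \<bar>x - real n\<bar> powr (1 / 4)" using b by (simp add: f_def x_def del: bc.simps)
    ultimately show "f (Suc N) \<le> real (Suc N) powr (- 5 / 4) * (real n + 1) powr (1 / 4)" by (simp add: x_def)
  qed
  then show ?thesis unfolding f_def[symmetric] by (rule summable_on_Suc_iff)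
qed

lemma T_pair_summable:
  assumes l: "l \<ge> 1"
  shows "(\<lambda>(N, j). bc N * (av (int N - int n) j * ev l j)) summable_on UNIV \<times> UNIV"
proof -
  define A where "A N = \<bar>bc N\<bar> * \<bar>real_of_int (int N - int n)\<bar> powr (1 / 4)" for N
  define B where "B j = real j powr (3 / 4) * ev l j" for j
  have "(\<lambda>(N, j). A N * B j) summable_on UNIV \<times> UNIV"
    by (rule prod_summable_on(1)) (unfold A_def B_def, rule bc_weighted_summable, rule ev_weighted_summable[OF l])
  then have "(\<lambda>p. 2 * (case p of (N, j) \<Rightarrow> A N * B j)) summable_on UNIV \<times> UNIV" by (rule summable_on_cmult_right)
  then have "(\<lambda>p. norm (case p of (N, j) \<Rightarrow> bc N * (av (int N - int n) j * ev l j))) summable_on UNIV \<times> UNIV"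
  proof (rule Infinite_Sum.abs_summable_on_comparison_test')
    fix p :: "nat \<times> nat"
    obtain N j where p: "p = (N, j)" by fastforce
    have "\<bar>bc N\<bar> * (\<bar>av (int N - int n) j\<bar> * ev l j)
      \<le> \<bar>bc N\<bar> * (2 * (\<bar>real_of_int (int N - int n)\<bar> powr (1 / 4) * real j powr (3 / 4)) * ev l j)"
      using ev_nonneg[OF l, of j] av_le_powr[of "int N - int n" j] by (intro mult_left_mono mult_right_mono) auto
    then show "norm (case p of (N, j) \<Rightarrow> bc N * (av (int N - int n) j * ev l j)) \<le> 2 * (case p of (N, j) \<Rightarrow> A N * B j)"
      using ev_nonneg[OF l, of j] by (simp add: p A_def B_def abs_mult mult_ac)
  qed
  then show ?thesis by (rule Infinite_Sum.abs_summable_summable)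
qed

text \<open>The window consists of \<open>2 * j\<close> reciprocals, and \<open>Jf_eq\<close> sums
  each of them against \<open>bc\<close>. The indices \<open>q i\<close> run from
  \<open>1 - n - j\<close> to \<open>j - n\<close>. As the lower end is at most 0, the values
  \<open>bz (q i)\<close> add up to an initial sum of \<open>bc\<close>, or to 0 if
  \<open>j < n\<close>.\<close>

lemma av_bc_sum:
  assumes n: "n \<ge> 1"
  shows "(\<Sum>\<^sub>\<infinity>N. bc N * av (int N - int n) j)
    = (if j < n then 0 else Jf 0 * (real (j - n) + 1) * bc (Suc (j - n)))"
proof -
  define q where "q i = int i - int n - int j + 1" for i
  have av: "av (int N - int n) j = (\<Sum>i<2 * j. 1 / 2 * (1 / (real_of_int (int N + q i) - 1 / 2)))" for N
  proof -
    have e: "int N - int n + int j = (int N - int n - int j) + int (2 * j)" by simp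
    have "av (int N - int n) j = (\<Sum>i<2 * j. 1 / (2 * real_of_int (int N - int n - int j + int i) + 1))"
      unfolding av_def e by (rule oz_diff_sum)
    also have "\<dots> = (\<Sum>i<2 * j. 1 / 2 * (1 / (real_of_int (int N + q i) - 1 / 2)))"
    proof (rule sum.cong[OF refl])
      fix i
      have "2 * real_of_int (int N - int n - int j + int i) + 1 = 2 * (real_of_int (int N + q i) - 1 / 2)"
        by (simp add: q_def)
      then show "1 / (2 * real_of_int (int N - int n - int j + int i) + 1)
        = 1 / 2 * (1 / (real_of_int (int N + q i) - 1 / 2))" by simp
    qed
    finally show ?thesis .
  qed
  have hs: "((\<lambda>N. \<Sum>i<K. 1 / 2 * (bc N / (real_of_int (int N + q i) - 1 / 2))) has_sum (\<Sum>i<K. 1 / 2 * Jf (q i))) UNIV" for K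
  proof (induction K)
    case (Suc K)
    have "((\<lambda>N. 1 / 2 * (bc N / (real_of_int (int N + q K) - 1 / 2))) has_sum (1 / 2 * Jf (q K))) UNIV"
      unfolding Jf_def by (intro has_sum_cmult_right has_sum_infsum Jf_summable)
    then show ?case using has_sum_add[OF Suc] by simp
  qed simp
  have "(\<Sum>\<^sub>\<infinity>N. bc N * av (int N - int n) j) = (\<Sum>\<^sub>\<infinity>N. \<Sum>i<2 * j. 1 / 2 * (bc N / (real_of_int (int N + q i) - 1 / 2)))"
    by (simp add: av sum_distrib_left)
  also have "\<dots> = (\<Sum>i<2 * j. 1 / 2 * Jf (q i))" by (rule infsumI[OF hs])
  also have "\<dots> = - Jf 0 / 2 * (\<Sum>i<2 * j. bz (q i))"
    unfolding sum_distrib_left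
  proof (rule sum.cong[OF refl])
    fix i show "1 / 2 * Jf (q i) = - Jf 0 / 2 * bz (q i)" using Jf_eq[of "q i"] by simp
  qed
  also have "(\<Sum>i<2 * j. bz (q i)) = (if j < n then 0 else - 2 * (real (j - n) + 1) * bc (Suc (j - n)))"
  proof (cases "j < n")
    case True
    then have "(\<Sum>i<2 * j. bz (q i)) = 0" by (intro sum.neutral) (auto simp: q_def bz_def)
    then show ?thesis using True by simp
  next
    case False
    have "(\<Sum>i<2 * j. bz (q i)) = (\<Sum>i\<in>{n + j - 1..<2 * j}. bz (q i))"
      by (rule sum.mono_neutral_right) (use n in \<open>auto simp: q_def bz_def\<close>)
    also have "\<dots> = (\<Sum>t\<le>j - n. bc t)"
      by (rule sum.reindex_bij_witness[where i = "\<lambda>t. t + (n + j - 1)" and j = "\<lambda>i. i - (n + j - 1)"])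
        (use n False in \<open>auto simp: q_def bz_def of_nat_diff nat_diff_distrib intro!: arg_cong[where f = bc]\<close>)
    finally show ?thesis using False bc_partial_sum by simp
  qed
  finally show ?thesis by (cases "j < n") (simp_all del: bc.simps add: algebra_simps)
qed

lemma ev_eq: "l \<ge> 1 \<Longrightarrow> ev l j = 1 / (real l + real j - 1 / 2) - 1 / (real l + real j + 1 / 2)"
proof -
  assume "l \<ge> 1"
  then have "real l + real j - 1 / 2 \<noteq> 0" "real l + real j + 1 / 2 \<noteq> 0" by linarith+
  moreover have "(real l + real j)\<^sup>2 - 1 / 4 = (real l + real j - 1 / 2) * (real l + real j + 1 / 2)"
    by (simp add: power2_eq_square algebra_simps)
  ultimately show ?thesis unfolding ev_def by (simp add: diff_frac_eq)
qed

text \<open>With \<open>g k = k * bc k / (l + k - 1 / 2)\<close> the summand is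
  \<open>g k - g (k + 1)\<close> minus half a term of \<open>Jf l\<close>. The differences sum to 0
  because \<open>g 0 = 0\<close>.\<close>

lemma bc_telescope_sum:
  assumes l: "l \<ge> 1"
  shows "(\<Sum>\<^sub>\<infinity>k. (real k + 1) * bc (Suc k) * ev l k) = Jf 0 / 2 * bc l"
proof -
  define x where "x = real l - 1 / 2"
  have x: "x > 0" using l by (simp add: x_def)
  define g where "g k = bc k * (real k / (x + real k))" for k
  have sg: "g summable_on UNIV" unfolding g_def[abs_def]
    by (rule summable_on_bounded_mult[OF bc_abs_summable(2), of _ 1]) (use x in \<open>simp add: abs_of_nonneg\<close>)
  have J: "bc k / (real_of_int (int k + int l) - 1 / 2) = bc k / (x + real k)" for k by (simp add: x_def algebra_simps)
  have sJ: "(\<lambda>k. 1 / 2 * (bc k / (x + real k))) summable_on UNIV"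
    using Jf_summable[of "int l"] unfolding J by (rule summable_on_cmult_right)
  have e: "(real k + 1) * bc (Suc k) * ev l k = (g k - 1 / 2 * (bc k / (x + real k))) - g (Suc k)" for k
  proof -
    have r: "(real k + 1) * bc (Suc k) = bc k * (real k - 1 / 2)" by (simp add: add.commute)
    have "ev l k = 1 / (x + real k) - 1 / (x + real k + 1)" unfolding ev_eq[OF l] by (simp add: x_def algebra_simps)
    then have "(real k + 1) * bc (Suc k) * ev l k
      = bc k * (real k - 1 / 2) / (x + real k) - (real k + 1) * bc (Suc k) / (x + real k + 1)"
      using r by (simp add: right_diff_distrib del: bc.simps)
    moreover have "bc k * (real k - 1 / 2) / (x + real k) = g k - 1 / 2 * (bc k / (x + real k))"
      by (simp add: g_def right_diff_distrib diff_divide_distrib)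
    moreover have "(real k + 1) * bc (Suc k) / (x + real k + 1) = g (Suc k)" by (simp add: g_def ac_simps del: bc.simps)
    ultimately show ?thesis by simp
  qed
  have "(\<Sum>\<^sub>\<infinity>k. (real k + 1) * bc (Suc k) * ev l k)
    = infsum g UNIV - (\<Sum>\<^sub>\<infinity>k. 1 / 2 * (bc k / (x + real k))) - (\<Sum>\<^sub>\<infinity>k. g (Suc k))"
    unfolding e using real_summable_diff[OF sg sJ] infsum_UNIV_Suc(2)[OF sg]
    by (subst real_summable_diff(2)) simp_all
  also have "(\<Sum>\<^sub>\<infinity>k. 1 / 2 * (bc k / (x + real k))) = 1 / 2 * Jf (int l)"
    unfolding Jf_def J by (rule infsum_cmult_right')
  also have "infsum g UNIV = (\<Sum>\<^sub>\<infinity>k. g (Suc k))" using infsum_UNIV_Suc(1)[OF sg] by (simp add: g_def)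
  also have "Jf (int l) = - Jf 0 * bc l" using Jf_eq[of "int l"] by (simp add: bz_simps)
  finally show ?thesis by simp
qed

text \<open>The sum over \<open>N\<close> turns \<open>av\<close> into a multiple of
  \<open>bc\<close>, and the sum over \<open>j\<close> then telescopes.\<close>
theorem T_bc_identity:
  assumes l: "l \<ge> 1" and n: "n \<ge> 1"
  shows "(\<Sum>\<^sub>\<infinity>N. bc N * Tf l (int N - int n)) = (Jf 0)\<^sup>2 / 2 * bc (l + n)"
    "(\<lambda>N. bc N * Tf l (int N - int n)) summable_on UNIV"
proof -
  let ?f = "\<lambda>N j. bc N * (av (int N - int n) j * ev l j)"
  note s = T_pair_summable[OF l, of n]
  have eq: "bc N * Tf l (int N - int n) = (\<Sum>\<^sub>\<infinity>j. ?f N j)" for N by (simp only: Tf_def infsum_cmult_right')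
  show "(\<lambda>N. bc N * Tf l (int N - int n)) summable_on UNIV"
    unfolding eq using summable_on_Sigma_banach[OF s] by simp
  have "(\<Sum>\<^sub>\<infinity>N. bc N * Tf l (int N - int n)) = (\<Sum>\<^sub>\<infinity>j. \<Sum>\<^sub>\<infinity>N. ?f N j)"
    unfolding eq by (rule infsum_swap_banach[OF s])
  also have "\<dots> = (\<Sum>\<^sub>\<infinity>j. (\<Sum>\<^sub>\<infinity>N. bc N * av (int N - int n) j) * ev l j)"
    unfolding mult.assoc[symmetric] by (simp only: infsum_cmult_left')
  also have "\<dots> = (\<Sum>\<^sub>\<infinity>j\<in>{n..}. Jf 0 * (real (j - n) + 1) * bc (Suc (j - n)) * ev l j)"
    unfolding av_bc_sum[OF n] by (rule infsum_cong_neutral) auto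
  also have "\<dots> = (\<Sum>\<^sub>\<infinity>k. Jf 0 * ((real k + 1) * bc (Suc k) * ev (l + n) k))"
    by (rule infsum_reindex_bij_witness[where i = "\<lambda>k. n + k" and j = "\<lambda>j. j - n"])
      (auto simp: ev_def mult.assoc add.assoc[symmetric] of_nat_diff simp del: bc.simps)
  also have "\<dots> = Jf 0 * (Jf 0 / 2 * bc (l + n))"
    using bc_telescope_sum[of "l + n"] l by (simp only: infsum_cmult_right')
  finally show "(\<Sum>\<^sub>\<infinity>N. bc N * Tf l (int N - int n)) = (Jf 0)\<^sup>2 / 2 * bc (l + n)"
    by (simp add: power2_eq_square)
qed

section \<open>Closed form and bounds of the kernel\<close>

definition Tn :: "nat \<Rightarrow> nat \<Rightarrow> real" where "Tn l m = Tf l (int m)"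

lemma Tn_sums:
  assumes l: "l \<ge> 1" shows "(\<lambda>j. av (int m) j * ev l j) sums Tn l m"
proof -
  have s: "(\<lambda>j. ev l j * av (int m) j) summable_on UNIV"
  proof (rule summable_on_bounded_mult)
    have "summable (\<lambda>n. real n powr (- 2))" by (subst summable_real_powr_iff) simp
    then have "summable (ev l)"
    proof (rule summable_comparison_test_ev[rotated])
      show "\<forall>\<^sub>F n in sequentially. norm (ev l n) \<le> real n powr (- 2)"
        using eventually_ge_at_top[of 1] by eventually_elim (use ev_le[OF l] ev_nonneg[OF l] in simp)
    qed
    then show "ev l summable_on UNIV" by (rule summable_nonneg_imp_summable_on) (rule ev_nonneg[OF l])
    show "\<bar>av (int m) j\<bar> \<le> 2 * \<bar>real_of_int (int m)\<bar>" for j by (rule av_le_m)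
  qed
  have "(\<lambda>j. av (int m) j * ev l j) summable_on UNIV" using s by (simp add: mult.commute)
  from summable_on_sums[OF this] show ?thesis by (simp add: Tn_def Tf_def)
qed

lemma Tn_nonneg: "l \<ge> 1 \<Longrightarrow> Tn l m \<ge> 0"
  unfolding Tn_def Tf_def by (intro infsum_nonneg mult_nonneg_nonneg av_nonneg ev_nonneg) auto

lemma Tn_0: "Tn l 0 = 0" by (simp add: Tn_def Tf_def av_0)

lemma oz_shift_tendsto: "(\<lambda>J. oz (int J + s) - oz (int J + t)) \<longlonglongrightarrow> 0"
proof -
  have base: "(\<lambda>J. oz (int J + (r + int k)) - oz (int J + r)) \<longlonglongrightarrow> 0" for r k
  proof -
    have e: "oz (int J + (r + int k)) - oz (int J + r) = (\<Sum>i<k. 1 / (2 * real J + (2 * real_of_int (r + int i) + 1)))" for J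
      using oz_diff_sum[of "int J + r" k] by (simp add: ac_simps distrib_left)
    have "(\<lambda>J. 1 / (2 * real J + (2 * real_of_int (r + int i) + 1))) \<longlonglongrightarrow> 0" for i by real_asymp
    then have "(\<lambda>J. \<Sum>i<k. 1 / (2 * real J + (2 * real_of_int (r + int i) + 1))) \<longlonglongrightarrow> (\<Sum>i<k. 0)"
      by (intro tendsto_sum)
    then show ?thesis unfolding e by simp
  qed
  show ?thesis
  proof (cases "s \<ge> t")
    case True
    then show ?thesis using base[of t "nat (s - t)"] by simp
  next
    case False
    then show ?thesis using tendsto_minus[OF base[of s "nat (t - s)"]] by simp
  qed
qed

text \<open>Summation by parts with \<open>ev l j = E j - E (j + 1)\<close>; the boundary term
  vanishes because \<open>av\<close> is bounded in \<open>j\<close>.\<close>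

lemma Tn_partial:
  assumes l: "l \<ge> 1"
  defines "E \<equiv> \<lambda>j. 1 / (real l + real j - 1 / 2)"
  shows "(\<lambda>J. \<Sum>j<J. (av (int m) (Suc j) - av (int m) j) * E (Suc j)) \<longlonglongrightarrow> Tn l m"
proof -
  have ev: "ev l j = E j - E (Suc j)" for j unfolding ev_eq[OF l] E_def by (simp add: algebra_simps)
  have p: "(\<Sum>j<J. av (int m) j * ev l j) + av (int m) J * E J = (\<Sum>j<J. (av (int m) (Suc j) - av (int m) j) * E (Suc j))" for J
  proof (induction J)
    case 0
    show ?case by (simp add: av_def)
  next
    case (Suc J)
    have "(\<Sum>j<Suc J. av (int m) j * ev l j) + av (int m) (Suc J) * E (Suc J)
      = ((\<Sum>j<J. av (int m) j * ev l j) + av (int m) J * E J) + (av (int m) (Suc J) - av (int m) J) * E (Suc J)"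
      unfolding ev sum.lessThan_Suc by (simp add: algebra_simps)
    then show ?case unfolding Suc by simp
  qed
  have "(\<lambda>J. av (int m) J * E J) \<longlonglongrightarrow> 0"
  proof (rule Lim_null_comparison)
    show "\<forall>\<^sub>F J in sequentially. norm (av (int m) J * E J) \<le> 2 * real m * \<bar>E J\<bar>"
      using av_le_m[of "int m"] by (intro always_eventually allI) (simp add: abs_mult mult_right_mono)
    have "E \<longlonglongrightarrow> 0" unfolding E_def by real_asymp
    then have "(\<lambda>J. 2 * real m * \<bar>E J\<bar>) \<longlonglongrightarrow> 2 * real m * \<bar>0\<bar>" by (intro tendsto_intros)
    then show "(\<lambda>J. 2 * real m * \<bar>E J\<bar>) \<longlonglongrightarrow> 0" by simp
  qed
  from tendsto_add[OF Tn_sums[OF l, of m, unfolded sums_def] this] show ?thesis by (simp add: p)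
qed

lemma av_diff:
  "av (int m) (Suc j) - av (int m) j
    = (oz (int m + int (Suc j)) - oz (int m + int j)) + (oz (int m - int j) - oz (int m - int (Suc j)))"
  by (simp add: av_def)

lemma oz_up: "oz (int m + int (Suc j)) - oz (int m + int j) = 1 / (2 * real m + 2 * real j + 1)"
  using oz_step[of "int m + int j"] by (simp add: ac_simps)

lemma oz_down: "oz (int m - int j) - oz (int m - int (Suc j)) = 1 / (2 * real m - 2 * real j - 1)"
  using oz_step[of "int m - int (Suc j)"] by (simp add: algebra_simps)

text \<open>After the summation by parts each term is a product of reciprocals of two odd numbers.
  Partial fractions split these with the factors \<open>1 / (l - m)\<close> and
  \<open>1 / (l + m)\<close>; both sums telescope in \<open>oz\<close>, and the contributions of the
  far ends cancel in the limit.\<close>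

lemma Tn_closed:
  assumes l: "l \<ge> 1" and m: "m \<ge> 1" "m \<noteq> l"
  shows "Tn l m = 2 * real m * (ohs l - ohs m) / ((real l)\<^sup>2 - (real m)\<^sup>2)"
proof -
  define U where "U s j = oz (int s + int (Suc j)) - oz (int s + int j)" for s j
  define V where "V j = oz (int m - int j) - oz (int m - int (Suc j))" for j
  define A B where "A = real l - real m" and "B = real l + real m"
  have AB: "A \<noteq> 0" "B \<noteq> 0" using m l by (auto simp: A_def B_def)
  have term_eq: "(av (int m) (Suc j) - av (int m) j) * (1 / (real l + real (Suc j) - 1 / 2))
    = 1 / A * (U m j - U l j) + 1 / B * (V j + U l j)" for j
  proof -
    define x where "x = 2 * real j + 1"
    have n1: "2 * real m + x \<noteq> 0" "2 * real l + x \<noteq> 0" by (auto simp: x_def add_nonneg_eq_0_iff)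
    have n2: "2 * real m - x \<noteq> 0"
    proof
      assume "2 * real m - x = 0"
      then have "real (2 * m) = real (2 * j + 1)" by (simp add: x_def)
      then have "2 * m = 2 * j + 1" by (simp only: of_nat_eq_iff)
      then show False by presburger
    qed
    have u: "U m j = 1 / (2 * real m + x)" "U l j = 1 / (2 * real l + x)" "V j = 1 / (2 * real m - x)"
      unfolding U_def V_def oz_up oz_down x_def by (simp_all add: algebra_simps)
    have Ex: "1 / (real l + real (Suc j) - 1 / 2) = 2 / (2 * real l + x)"
      using n1(2) by (simp add: x_def field_simps)
    have p1: "1 / (2 * real m + x) * (2 / (2 * real l + x)) = 1 / A * (1 / (2 * real m + x) - 1 / (2 * real l + x))"
    proof -
      have "1 / (2 * real m + x) - 1 / (2 * real l + x) = 2 * A / ((2 * real m + x) * (2 * real l + x))"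
        using n1 by (simp add: diff_frac_eq A_def algebra_simps)
      then show ?thesis using AB by simp
    qed
    have p2: "1 / (2 * real m - x) * (2 / (2 * real l + x)) = 1 / B * (1 / (2 * real m - x) + 1 / (2 * real l + x))"
    proof -
      have "1 / (2 * real m - x) + 1 / (2 * real l + x) = 2 * B / ((2 * real m - x) * (2 * real l + x))"
        using n1 n2 by (simp add: add_frac_eq B_def algebra_simps)
      then show ?thesis using AB by simp
    qed
    have avUV: "av (int m) (Suc j) - av (int m) j = U m j + V j" unfolding av_diff U_def V_def ..
    show ?thesis by (simp only: avUV Ex u distrib_right p1 p2)
  qed
  have telU: "(\<Sum>j<J. U s j) = oz (int s + int J) - oz (int s)" for s J
    unfolding U_def by (subst sum_lessThan_telescope) simp
  have telV: "(\<Sum>j<J. V j) = oz (int m) - oz (int m - int J)" for J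
    unfolding V_def by (subst sum_lessThan_telescope') simp
  have "(\<Sum>j<J. (av (int m) (Suc j) - av (int m) j) * (1 / (real l + real (Suc j) - 1 / 2)))
    = 1 / A * ((\<Sum>j<J. U m j) - (\<Sum>j<J. U l j)) + 1 / B * ((\<Sum>j<J. V j) + (\<Sum>j<J. U l j))" for J
    unfolding term_eq by (simp only: sum.distrib sum_subtractf sum_distrib_left[symmetric])
  then have part: "(\<Sum>j<J. (av (int m) (Suc j) - av (int m) j) * (1 / (real l + real (Suc j) - 1 / 2)))
    = 1 / A * ((oz (int J + int m) - oz (int J + int l)) + (ohs l - ohs m))
      + 1 / B * ((oz (int J + int l) - oz (int J + (- int m))) + (ohs m - ohs l))" for J
    unfolding telU telV using oz_minus[of "int m - int J"] by (simp add: oz_def[of "int m"] oz_def[of "int l"] algebra_simps)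
  have "(\<lambda>J. \<Sum>j<J. (av (int m) (Suc j) - av (int m) j) * (1 / (real l + real (Suc j) - 1 / 2)))
    \<longlonglongrightarrow> 1 / A * (0 + (ohs l - ohs m)) + 1 / B * (0 + (ohs m - ohs l))"
    unfolding part by (intro tendsto_intros oz_shift_tendsto)
  from LIMSEQ_unique[OF Tn_partial[OF l] this]
  have "Tn l m = (ohs l - ohs m) / A - (ohs l - ohs m) / B" by (simp add: diff_divide_distrib)
  also have "\<dots> = (ohs l - ohs m) * (B - A) / (A * B)" using AB by (simp add: diff_frac_eq algebra_simps)
  also have "A * B = (real l)\<^sup>2 - (real m)\<^sup>2" by (simp add: A_def B_def power2_eq_square algebra_simps)
  finally show ?thesis by (simp add: A_def B_def mult.commute)
qed

text \<open>At \<open>m = l\<close> the partial fraction with \<open>1 / (l - m)\<close> breaks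
  down. The squares \<open>2 / (2 * y + 1) ^ 2\<close>, with \<open>y = l + j\<close>, that occur in
  its place are dominated by a telescoping sum.\<close>

lemma Tn_diag: assumes l: "l \<ge> 1" shows "Tn l l \<le> 1 / (2 * real l)"
proof -
  define U where "U j = oz (int l + int (Suc j)) - oz (int l + int j)" for j
  define V where "V j = oz (int l - int j) - oz (int l - int (Suc j))" for j
  have le: "(av (int l) (Suc j) - av (int l) j) * (1 / (real l + real (Suc j) - 1 / 2))
    \<le> 1 / 2 * (1 / (real l + real j) - 1 / (real l + real (Suc j))) + 1 / (2 * real l) * (V j + U j)" for j
  proof -
    define y where "y = real l + real j"
    define x where "x = 2 * real j + 1"
    have y: "y \<ge> 1" using l by (simp add: y_def)
    have n1: "2 * real l + x > 0" by (simp add: x_def add_nonneg_pos)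
    have n2: "2 * real l - x \<noteq> 0"
    proof
      assume "2 * real l - x = 0"
      then have "real (2 * l) = real (2 * j + 1)" by (simp add: x_def)
      then have "2 * l = 2 * j + 1" by (simp only: of_nat_eq_iff)
      then show False by presburger
    qed
    have u: "U j = 1 / (2 * real l + x)" "V j = 1 / (2 * real l - x)"
      unfolding U_def V_def oz_up oz_down x_def by (simp_all add: algebra_simps)
    have Ex: "1 / (real l + real (Suc j) - 1 / 2) = 2 / (2 * real l + x)"
      using n1 by (simp add: x_def field_simps)
    have p2: "1 / (2 * real l - x) * (2 / (2 * real l + x)) = 1 / (2 * real l) * (1 / (2 * real l - x) + 1 / (2 * real l + x))"
    proof -
      have "1 / (2 * real l - x) + 1 / (2 * real l + x) = 4 * real l / ((2 * real l - x) * (2 * real l + x))"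
        using n1 n2 by (simp add: add_frac_eq algebra_simps)
      then show ?thesis using l by simp
    qed
    have "1 / (2 * real l + x) * (2 / (2 * real l + x)) = 2 / (2 * y + 1)\<^sup>2"
      by (simp add: x_def y_def power2_eq_square algebra_simps)
    also have "\<dots> \<le> 2 / (2 * y * (2 * y + 2))"
    proof (rule divide_left_mono)
      show "2 * y * (2 * y + 2) \<le> (2 * y + 1)\<^sup>2" by (simp add: power2_eq_square algebra_simps)
      show "0 < (2 * y + 1)\<^sup>2 * (2 * y * (2 * y + 2))" using y by (intro mult_pos_pos zero_less_power) auto
    qed simp
    also have "\<dots> = 1 / 2 * (1 / y - 1 / (y + 1))"
    proof -
      have "1 / y - 1 / (y + 1) = 1 / (y * (y + 1))" using y by (simp add: diff_frac_eq)
      moreover have "2 * y * (2 * y + 2) = 4 * (y * (y + 1))" by (simp add: algebra_simps)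
      ultimately show ?thesis by (simp only:) simp
    qed
    finally have p1: "1 / (2 * real l + x) * (2 / (2 * real l + x)) \<le> 1 / 2 * (1 / y - 1 / (y + 1))" .
    have avUV: "av (int l) (Suc j) - av (int l) j = U j + V j" unfolding av_diff U_def V_def ..
    have ys: "real l + real (Suc j) = y + 1" "real l + real j = y" by (simp_all add: y_def)
    show ?thesis unfolding avUV Ex u distrib_right p2 unfolding ys by (rule add_right_mono[OF p1])
  qed
  have "(\<Sum>j<J. (av (int l) (Suc j) - av (int l) j) * (1 / (real l + real (Suc j) - 1 / 2)))
    \<le> 1 / (2 * real l) + 1 / (2 * real l) * (oz (int J + int l) - oz (int J + (- int l)))" for J
  proof -
    have "(\<Sum>j<J. (av (int l) (Suc j) - av (int l) j) * (1 / (real l + real (Suc j) - 1 / 2)))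
      \<le> (\<Sum>j<J. 1 / 2 * (1 / (real l + real j) - 1 / (real l + real (Suc j))) + 1 / (2 * real l) * (V j + U j))"
      by (rule sum_mono) (rule le)
    also have "\<dots> = 1 / 2 * (\<Sum>j<J. 1 / (real l + real j) - 1 / (real l + real (Suc j)))
      + 1 / (2 * real l) * ((\<Sum>j<J. V j) + (\<Sum>j<J. U j))"
      by (simp only: sum.distrib sum_distrib_left[symmetric])
    also have "(\<Sum>j<J. 1 / (real l + real j) - 1 / (real l + real (Suc j))) = 1 / real l - 1 / (real l + real J)"
      by (subst sum_lessThan_telescope') simp
    also have "(\<Sum>j<J. V j) = oz (int l) - oz (int l - int J)" unfolding V_def by (subst sum_lessThan_telescope') simp
    also have "(\<Sum>j<J. U j) = oz (int l + int J) - oz (int l)" unfolding U_def by (subst sum_lessThan_telescope) simp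
    also have "oz (int l - int J) = oz (int J + (- int l))" using oz_minus[of "int l - int J"] by simp
    finally have fin: "(\<Sum>j<J. (av (int l) (Suc j) - av (int l) j) * (1 / (real l + real (Suc j) - 1 / 2)))
      \<le> 1 / 2 * (1 / real l - 1 / (real l + real J)) + 1 / (2 * real l) * (oz (int l) - oz (int J + (- int l)) + (oz (int l + int J) - oz (int l)))" .
    have t1: "1 / 2 * (1 / real l - 1 / (real l + real J)) \<le> 1 / (2 * real l)" by simp
    have E: "oz (int l) - oz (int J + (- int l)) + (oz (int l + int J) - oz (int l))
      = oz (int J + int l) - oz (int J + (- int l))" by (simp add: add.commute)
    show ?thesis using fin[unfolded E] t1 by linarith
  qed
  moreover have "(\<lambda>J. 1 / (2 * real l) + 1 / (2 * real l) * (oz (int J + int l) - oz (int J + (- int l))))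
    \<longlonglongrightarrow> 1 / (2 * real l) + 1 / (2 * real l) * 0"
    by (intro tendsto_intros oz_shift_tendsto)
  ultimately show ?thesis
    using LIMSEQ_le[OF Tn_partial[OF l, of l]] by fastforce
qed

lemma ohs_diff_le: "m \<le> n \<Longrightarrow> ohs n - ohs m \<le> (real n - real m) / (2 * real m + 1)"
proof (induction n rule: dec_induct)
  case (step n)
  have "1 / (2 * real n + 1) \<le> 1 / (2 * real m + 1)" using step by (intro divide_left_mono) auto
  then show ?case using step by (simp add: ohs_simps diff_divide_distrib add_divide_distrib)
qed simp

text \<open>Uniform boundedness is the point: it makes the kernel summable against the sequences
  \<open>cc j\<close>, with a bound independent of \<open>j\<close>.\<close>

lemma Tn_le_2: assumes l: "l \<ge> 1" shows "Tn l m \<le> 2"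
proof -
  consider "m = 0" | "m = l" | "m \<ge> 1" "m < l" | "m > l" by linarith
  then show ?thesis
  proof cases
    case 2
    have "1 / (2 * real l) \<le> 1 / 1" using l by (intro divide_left_mono) auto
    then show ?thesis using Tn_diag[OF l] 2 by simp
  next
    case 3
    have "ohs l - ohs m \<le> (real l - real m) / (2 * real m + 1)" using 3 by (intro ohs_diff_le) simp
    also have "\<dots> \<le> (real l - real m) / 1" using 3 by (intro divide_left_mono) auto
    finally have o: "ohs l - ohs m \<le> real l - real m" by simp
    have sq: "(real l)\<^sup>2 - (real m)\<^sup>2 = (real l - real m) * (real l + real m)" by (simp add: power2_eq_square algebra_simps)
    have "2 * real m * (ohs l - ohs m) \<le> 2 * real m * (real l - real m)" using o by (intro mult_left_mono) auto
    also have "\<dots> \<le> 2 * ((real l - real m) * (real l + real m))" using 3 by (simp add: mult_right_mono)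
    finally have "2 * real m * (ohs l - ohs m) \<le> 2 * ((real l)\<^sup>2 - (real m)\<^sup>2)" unfolding sq .
    moreover have "(real l)\<^sup>2 - (real m)\<^sup>2 > 0" unfolding sq using 3 by simp
    ultimately show ?thesis using Tn_closed[OF l, of m] 3 by (simp add: pos_divide_le_eq)
  next
    case 4
    have "ohs m - ohs l \<le> (real m - real l) / (2 * real l + 1)" using 4 by (intro ohs_diff_le) simp
    also have "\<dots> \<le> (real m - real l) / 1" using 4 by (intro divide_left_mono) auto
    finally have o: "ohs m - ohs l \<le> real m - real l" by simp
    have sq: "(real m)\<^sup>2 - (real l)\<^sup>2 = (real m - real l) * (real m + real l)" by (simp add: power2_eq_square algebra_simps)
    have "2 * real m * (ohs m - ohs l) \<le> 2 * real m * (real m - real l)" using o by (intro mult_left_mono) auto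
    also have "\<dots> \<le> 2 * ((real m - real l) * (real m + real l))" using 4 by (simp add: mult_right_mono)
    finally have "2 * real m * (ohs m - ohs l) \<le> 2 * ((real m)\<^sup>2 - (real l)\<^sup>2)" unfolding sq .
    moreover have "(real m)\<^sup>2 - (real l)\<^sup>2 > 0" unfolding sq using 4 by simp
    moreover have "Tn l m = 2 * real m * (ohs m - ohs l) / ((real m)\<^sup>2 - (real l)\<^sup>2)"
    proof -
      have "Tn l m = (- (2 * real m * (ohs l - ohs m))) / (- ((real l)\<^sup>2 - (real m)\<^sup>2))"
      proof -
        have g: "x / p = (- x) / (- p)" for x p :: real by simp
        have "Tn l m = 2 * real m * (ohs l - ohs m) / ((real l)\<^sup>2 - (real m)\<^sup>2)" using Tn_closed[OF l, of m] 4 by simp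
        then show ?thesis by (rule trans) (rule g)
      qed
      moreover have "- (2 * real m * (ohs l - ohs m)) = 2 * real m * (ohs m - ohs l)"
        "- ((real l)\<^sup>2 - (real m)\<^sup>2) = (real m)\<^sup>2 - (real l)\<^sup>2" by (simp_all add: algebra_simps)
      ultimately show ?thesis by (simp only:)
    qed
    ultimately show ?thesis by (simp add: pos_divide_le_eq)
  qed (simp add: Tn_0)
qed

section \<open>Elimination of the factor \<open>D\<close>\<close>

lemma bz_abs_reindex:
  "(\<lambda>k. \<bar>bz (int j + int k + 2)\<bar>) summable_on UNIV" "(\<Sum>\<^sub>\<infinity>k. \<bar>bz (int j + int k + 2)\<bar>) \<le> (\<Sum>\<^sub>\<infinity>n. \<bar>bc n\<bar>)"
  "(\<lambda>k. \<bar>bz (int j - int k)\<bar>) summable_on UNIV" "(\<Sum>\<^sub>\<infinity>k. \<bar>bz (int j - int k)\<bar>) \<le> (\<Sum>\<^sub>\<infinity>n. \<bar>bc n\<bar>)"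
proof -
  note s = bc_abs_summable(1)
  have sub: "(\<lambda>n. \<bar>bc n\<bar>) summable_on A" for A using summable_on_subset_banach[OF s] by auto
  have le: "infsum (\<lambda>n. \<bar>bc n\<bar>) A \<le> (\<Sum>\<^sub>\<infinity>n. \<bar>bc n\<bar>)" for A
    by (rule infsum_mono2[OF sub s]) auto
  have e1: "\<bar>bz (int j + int k + 2)\<bar> = ((\<lambda>n. \<bar>bc n\<bar>) \<circ> (\<lambda>k. j + k + 2)) k" for k
    by (simp add: bz_def nat_add_distrib del: bc.simps)
  have inj: "inj (\<lambda>k. j + k + 2)" by (auto simp: inj_def)
  show "(\<lambda>k. \<bar>bz (int j + int k + 2)\<bar>) summable_on UNIV"
    unfolding e1 using summable_on_reindex[OF inj, of "\<lambda>n. \<bar>bc n\<bar>"] sub by (simp add: o_def del: bc.simps)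
  show "(\<Sum>\<^sub>\<infinity>k. \<bar>bz (int j + int k + 2)\<bar>) \<le> (\<Sum>\<^sub>\<infinity>n. \<bar>bc n\<bar>)"
    unfolding e1 infsum_reindex[OF inj, symmetric] by (rule le)
  show "(\<lambda>k. \<bar>bz (int j - int k)\<bar>) summable_on UNIV"
  proof (rule finite_nonzero_values_imp_summable_on)
    show "finite {k \<in> UNIV. \<bar>bz (int j - int k)\<bar> \<noteq> 0}"
      by (rule finite_subset[of _ "{..j}"]) (auto simp: bz_def split: if_splits)
  qed
  have "(\<Sum>\<^sub>\<infinity>k. \<bar>bz (int j - int k)\<bar>) = (\<Sum>\<^sub>\<infinity>k\<in>{..j}. \<bar>bz (int j - int k)\<bar>)"
    by (rule infsum_cong_neutral) (auto simp: bz_def)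
  also have "\<dots> = infsum (\<lambda>n. \<bar>bc n\<bar>) {..j}"
    by (rule infsum_reindex_bij_witness[where i = "\<lambda>n. j - n" and j = "\<lambda>k. j - k"])
      (auto simp: bz_def nat_diff_distrib)
  also have "\<dots> \<le> (\<Sum>\<^sub>\<infinity>n. \<bar>bc n\<bar>)" by (rule le)
  finally show "(\<Sum>\<^sub>\<infinity>k. \<bar>bz (int j - int k)\<bar>) \<le> (\<Sum>\<^sub>\<infinity>n. \<bar>bc n\<bar>)" .
qed

text \<open>For the Laurent series \<open>- t ^ (- j) * sqrt (1 - t)\<close>, the coefficient at
  \<open>k + 2\<close> minus the one at \<open>- k\<close>: twice its odd part about index
  1.\<close>

definition cc :: "nat \<Rightarrow> nat \<Rightarrow> real" where
  "cc j k = bz (int j + int k + 2) - bz (int j - int k)"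

lemma cc_abs: "(\<lambda>k. \<bar>cc j k\<bar>) summable_on UNIV" "(\<Sum>\<^sub>\<infinity>k. \<bar>cc j k\<bar>) \<le> 2 * (\<Sum>\<^sub>\<infinity>n. \<bar>bc n\<bar>)"
proof -
  note b = bz_abs_reindex[of j]
  have s: "(\<lambda>k. \<bar>bz (int j + int k + 2)\<bar> + \<bar>bz (int j - int k)\<bar>) summable_on UNIV" by (rule summable_on_add[OF b(1,3)])
  have le: "\<bar>cc j k\<bar> \<le> \<bar>bz (int j + int k + 2)\<bar> + \<bar>bz (int j - int k)\<bar>" for k
    unfolding cc_def by (rule abs_triangle_ineq4)
  show c: "(\<lambda>k. \<bar>cc j k\<bar>) summable_on UNIV" by (rule summable_on_comparison_test[OF s le]) auto
  have "(\<Sum>\<^sub>\<infinity>k. \<bar>cc j k\<bar>) \<le> (\<Sum>\<^sub>\<infinity>k. \<bar>bz (int j + int k + 2)\<bar> + \<bar>bz (int j - int k)\<bar>)"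
    by (rule infsum_mono[OF c s le])
  also have "\<dots> = (\<Sum>\<^sub>\<infinity>k. \<bar>bz (int j + int k + 2)\<bar>) + (\<Sum>\<^sub>\<infinity>k. \<bar>bz (int j - int k)\<bar>)"
    by (rule infsum_add[OF b(1,3)])
  finally show "(\<Sum>\<^sub>\<infinity>k. \<bar>cc j k\<bar>) \<le> 2 * (\<Sum>\<^sub>\<infinity>n. \<bar>bc n\<bar>)" using b(2,4) by linarith
qed

lemma Tn_cc_summable:
  assumes l: "l \<ge> 1"
  shows "(\<lambda>k. \<bar>Tn l (Suc k) * cc j k\<bar>) summable_on UNIV"
    "(\<Sum>\<^sub>\<infinity>k. \<bar>Tn l (Suc k) * cc j k\<bar>) \<le> 4 * (\<Sum>\<^sub>\<infinity>n. \<bar>bc n\<bar>)"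
proof -
  have le: "\<bar>Tn l (Suc k) * cc j k\<bar> \<le> 2 * \<bar>cc j k\<bar>" for k
    using Tn_nonneg[OF l, of "Suc k"] Tn_le_2[OF l, of "Suc k"] by (simp add: abs_mult mult_right_mono)
  have s: "(\<lambda>k. 2 * \<bar>cc j k\<bar>) summable_on UNIV" by (rule summable_on_cmult_right[OF cc_abs(1)])
  show t: "(\<lambda>k. \<bar>Tn l (Suc k) * cc j k\<bar>) summable_on UNIV" by (rule summable_on_comparison_test[OF s le]) auto
  have "(\<Sum>\<^sub>\<infinity>k. \<bar>Tn l (Suc k) * cc j k\<bar>) \<le> (\<Sum>\<^sub>\<infinity>k. 2 * \<bar>cc j k\<bar>)" by (rule infsum_mono[OF t s le])
  also have "\<dots> = 2 * (\<Sum>\<^sub>\<infinity>k. \<bar>cc j k\<bar>)" by (rule infsum_cmult_right')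
  finally show "(\<Sum>\<^sub>\<infinity>k. \<bar>Tn l (Suc k) * cc j k\<bar>) \<le> 4 * (\<Sum>\<^sub>\<infinity>n. \<bar>bc n\<bar>)" using cc_abs(2)[of j] by linarith
qed

lemma Tf_minus: "Tf l (- m) = - Tf l m"
  by (simp add: Tf_def av_minus infsum_uminus)

text \<open>The identity \<open>T_bc_identity\<close> folded at the origin, \<open>Tf l\<close> being odd.\<close>
lemma Tn_cc_sum:
  assumes l: "l \<ge> 1"
  shows "(\<Sum>\<^sub>\<infinity>k. Tn l (Suc k) * cc j k) = (Jf 0)\<^sup>2 / 2 * bc (l + Suc j)"
proof -
  define n where "n = Suc j"
  define f where "f N = bc N * Tf l (int N - int n)" for N
  have sf: "f summable_on UNIV" unfolding f_def[abs_def] by (rule T_bc_identity(2)[OF l]) (simp add: n_def)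
  have sub: "f summable_on A" for A using summable_on_subset_banach[OF sf] by auto
  have "(UNIV :: nat set) = {..<n} \<union> ({n} \<union> {n<..})" by auto
  then have "infsum f UNIV = infsum f ({..<n} \<union> ({n} \<union> {n<..}))" by simp
  also have "\<dots> = infsum f {..<n} + infsum f ({n} \<union> {n<..})"
    by (rule infsum_Un_disjoint[OF sub sub]) auto
  also have "infsum f ({n} \<union> {n<..}) = infsum f {n} + infsum f {n<..}"
    by (rule infsum_Un_disjoint[OF sub sub]) auto
  also have "infsum f {n} = 0" using Tn_0[of l] by (simp add: f_def Tn_def)
  also have "infsum f {n<..} = (\<Sum>\<^sub>\<infinity>k. Tn l (Suc k) * bz (int j + int k + 2))"
    by (rule infsum_reindex_bij_witness[where i = "\<lambda>k. n + Suc k" and j = "\<lambda>N. N - Suc n"])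
      (auto simp: f_def Tn_def n_def bz_def of_nat_diff nat_add_distrib nat_diff_distrib mult.commute simp del: bc.simps
        intro!: arg_cong2[where f = "(*)"] arg_cong[where f = bc] arg_cong[where f = "Tf l"])
  also have "infsum f {..<n} = (\<Sum>\<^sub>\<infinity>k\<in>{..j}. - (Tn l (Suc k) * bz (int j - int k)))"
  proof (rule infsum_reindex_bij_witness[where i = "\<lambda>k. j - k" and j = "\<lambda>N. j - N"])
    fix N assume "N \<in> {..<n}"
    then have N: "N \<le> j" by (simp add: n_def)
    have "int N - int n = - int (Suc (j - N))" using N by (simp add: n_def of_nat_diff)
    then have "f N = - (bc N * Tn l (Suc (j - N)))" by (simp only: f_def Tf_minus Tn_def)
    moreover have "bz (int j - int (j - N)) = bc N" using N by (simp add: bz_def of_nat_diff)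
    ultimately show "- (Tn l (Suc (j - N)) * bz (int j - int (j - N))) = f N" by simp
  qed (auto simp: n_def)
  also have "\<dots> = (\<Sum>\<^sub>\<infinity>k. - (Tn l (Suc k) * bz (int j - int k)))"
    by (rule infsum_cong_neutral) (auto simp: bz_def)
  also have "\<dots> = - (\<Sum>\<^sub>\<infinity>k. Tn l (Suc k) * bz (int j - int k))" by (rule infsum_uminus)
  finally have tot: "infsum f UNIV = (\<Sum>\<^sub>\<infinity>k. Tn l (Suc k) * bz (int j + int k + 2)) - (\<Sum>\<^sub>\<infinity>k. Tn l (Suc k) * bz (int j - int k))"
    by simp
  have T2: "\<bar>Tn l (Suc k)\<bar> \<le> 2" for k using Tn_nonneg[OF l] Tn_le_2[OF l] by simp
  have s1: "(\<lambda>k. Tn l (Suc k) * bz (int j + int k + 2)) summable_on UNIV"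
    using summable_on_bounded_mult[of "\<lambda>k. bz (int j + int k + 2)" UNIV "\<lambda>k. Tn l (Suc k)" 2] T2
      bz_abs_reindex(1)[of j] summable_on_abs_iff[of "\<lambda>k. bz (int j + int k + 2)" UNIV] by (simp add: mult.commute)
  have s2: "(\<lambda>k. Tn l (Suc k) * bz (int j - int k)) summable_on UNIV"
    using summable_on_bounded_mult[of "\<lambda>k. bz (int j - int k)" UNIV "\<lambda>k. Tn l (Suc k)" 2] T2
      bz_abs_reindex(3)[of j] summable_on_abs_iff[of "\<lambda>k. bz (int j - int k)" UNIV] by (simp add: mult.commute)
  have "(\<Sum>\<^sub>\<infinity>k. Tn l (Suc k) * cc j k) = infsum f UNIV"
    unfolding tot cc_def right_diff_distrib by (rule real_summable_diff(2)[OF s1 s2])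
  also have "\<dots> = (Jf 0)\<^sup>2 / 2 * bc (l + n)"
    unfolding f_def[abs_def] by (rule T_bc_identity(1)[OF l]) (simp add: n_def)
  finally show ?thesis by (simp add: n_def)
qed

context norm_tutte
begin

text \<open>\<open>dl k\<close> is \<open>\<delta> (k + 1)\<close> in the notation of the
  overview.\<close>

definition dl :: "nat \<Rightarrow> real" where "dl k = a k - 2 * v (k + 2)"

text \<open>By \<open>gam\<close>, the sequence \<open>dl\<close> is up to sign and the extra 1 at
  index 0 a combination of the sequences \<open>cc j\<close>, with weights \<open>1\<close> for
  \<open>cc 0\<close> and \<open>- d j\<close>. The kernel sends \<open>cc j\<close> to a multiple
  of \<open>bc (l + j + 1)\<close>, and the same weights reassemble \<open>v (l + 1)\<close>. The
  extra 1 becomes \<open>Tn l 1\<close>.\<close>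

theorem v_representation:
  assumes l: "l \<ge> 1"
  shows "(\<lambda>k. dl k * Tn l (Suc k)) summable_on UNIV"
    "Tn l 1 - (\<Sum>\<^sub>\<infinity>k. dl k * Tn l (Suc k)) = (Jf 0)\<^sup>2 * v (l + 1)"
proof -
  obtain \<kappa> d where k: "\<kappa> > 0" and d: "\<And>n. d n \<ge> 0" "d 0 = 0" "d summable_on UNIV" "infsum d UNIV \<le> 1"
    and p1: "\<And>n. n \<ge> 1 \<Longrightarrow> 2 * v n = \<kappa> * (bz (int n) - (\<Sum>\<^sub>\<infinity>j. d j * bz (int n + int j)))"
    and p2: "a 0 - 1 = \<kappa> * (bz 0 - (\<Sum>\<^sub>\<infinity>j. d j * bz (int j)))"
    and p3: "\<And>k. k \<ge> 1 \<Longrightarrow> a k = \<kappa> * (bz (- int k) - (\<Sum>\<^sub>\<infinity>j. d j * bz (- int k + int j)))"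
    by (rule bc_factorization) blast
  define C where "C = (\<Sum>\<^sub>\<infinity>n. \<bar>bc n\<bar>)"
  have C: "C \<ge> 0" unfolding C_def by (rule infsum_nonneg) simp
  have bz_bd: "\<bar>bz m\<bar> \<le> C" for m
    using summable_on_le_infsum[OF bc_abs_summable(1), of "nat m"] C by (simp add: bz_def C_def)
  have sd: "(\<lambda>j. d j * bz (m j)) summable_on UNIV" for m by (rule summable_on_bounded_mult[OF d(3) bz_bd])
  have gam: "(if i = 0 then 1 else 0) - dl i = \<kappa> * (cc 0 i - (\<Sum>\<^sub>\<infinity>j. d j * cc j i))" for i
  proof -
    have "(\<Sum>\<^sub>\<infinity>j. d j * cc j i) = (\<Sum>\<^sub>\<infinity>j. d j * bz (int (i + 2) + int j)) - (\<Sum>\<^sub>\<infinity>j. d j * bz (- int i + int j))"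
      unfolding cc_def right_diff_distrib by (subst real_summable_diff(2)[OF sd sd]) (simp add: ac_simps)
    moreover have "a i - (if i = 0 then 1 else 0) = \<kappa> * (bz (- int i) - (\<Sum>\<^sub>\<infinity>j. d j * bz (- int i + int j)))"
      using p2 p3[of i] by (cases "i = 0") auto
    moreover have "2 * v (i + 2) = \<kappa> * (bz (int (i + 2)) - (\<Sum>\<^sub>\<infinity>j. d j * bz (int (i + 2) + int j)))" by (rule p1) simp
    moreover have "cc 0 i = bz (int (i + 2)) - bz (- int i)" by (simp add: cc_def ac_simps)
    ultimately show ?thesis unfolding dl_def by (simp add: right_diff_distrib)
  qed
  have s0: "(\<lambda>i. Tn l (Suc i) * cc j i) summable_on UNIV" for j
    using Tn_cc_summable(1)[OF l, of j] summable_on_abs_iff[of "\<lambda>i. Tn l (Suc i) * cc j i" UNIV] by simp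
  \<comment> \<open>Absolute summability of the double series comes from the bound in
    \<open>Tn_cc_summable\<close>, which is uniform in \<open>j\<close>, and from the summability of
    \<open>d\<close>.\<close>
  have sm: "(\<lambda>(j, i). d j * (Tn l (Suc i) * cc j i)) summable_on UNIV \<times> UNIV"
  proof -
    have "(\<lambda>p. norm (d (fst p) * (Tn l (Suc (snd p)) * cc (fst p) (snd p)))) summable_on UNIV \<times> UNIV"
      unfolding Infinite_Sum.abs_summable_on_Sigma_iff
    proof (intro conjI ballI)
      fix j
      show "(\<lambda>i. norm (d (fst (j, i)) * (Tn l (Suc (snd (j, i))) * cc (fst (j, i)) (snd (j, i))))) summable_on UNIV"
        using summable_on_cmult_right[OF Tn_cc_summable(1)[OF l, of j], of "\<bar>d j\<bar>"] by (simp add: abs_mult)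
    next
      have e: "(\<Sum>\<^sub>\<infinity>i. norm (d (fst (j, i)) * (Tn l (Suc (snd (j, i))) * cc (fst (j, i)) (snd (j, i)))))
        = d j * (\<Sum>\<^sub>\<infinity>i. \<bar>Tn l (Suc i) * cc j i\<bar>)" for j
        using d(1)[of j] by (simp add: abs_mult infsum_cmult_right')
      have "(\<lambda>j. d j * (\<Sum>\<^sub>\<infinity>i. \<bar>Tn l (Suc i) * cc j i\<bar>)) summable_on UNIV"
      proof (rule summable_on_bounded_mult[OF d(3)])
        fix j
        have "0 \<le> (\<Sum>\<^sub>\<infinity>i. \<bar>Tn l (Suc i) * cc j i\<bar>)" by (rule infsum_nonneg) simp
        then show "\<bar>\<Sum>\<^sub>\<infinity>i. \<bar>Tn l (Suc i) * cc j i\<bar>\<bar> \<le> 4 * C" using Tn_cc_summable(2)[OF l, of j] by (simp add: C_def)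
      qed
      then show "(\<lambda>j. norm (\<Sum>\<^sub>\<infinity>i. norm (d (fst (j, i)) * (Tn l (Suc (snd (j, i))) * cc (fst (j, i)) (snd (j, i)))))) summable_on UNIV"
        unfolding e unfolding real_norm_def by (rule summable_on_abs_iff[THEN iffD1])
    qed
    then have "(\<lambda>p. d (fst p) * (Tn l (Suc (snd p)) * cc (fst p) (snd p))) summable_on UNIV \<times> UNIV"
      by (rule Infinite_Sum.abs_summable_summable)
    then show ?thesis by (simp add: case_prod_unfold)
  qed
  have sm': "(\<lambda>(i, j). d j * (Tn l (Suc i) * cc j i)) summable_on UNIV \<times> UNIV"
    using summable_on_swap[of "\<lambda>(j, i). d j * (Tn l (Suc i) * cc j i)" UNIV UNIV] sm by (simp add: case_prod_unfold)
  have inner: "(\<Sum>\<^sub>\<infinity>j. d j * (Tn l (Suc i) * cc j i)) = Tn l (Suc i) * (\<Sum>\<^sub>\<infinity>j. d j * cc j i)" for i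
    by (simp only: mult.left_commute[of _ "Tn l (Suc i)"] infsum_cmult_right')
  have s1: "(\<lambda>i. Tn l (Suc i) * (\<Sum>\<^sub>\<infinity>j. d j * cc j i)) summable_on UNIV"
    using summable_on_Sigma_banach[of "\<lambda>i j. d j * (Tn l (Suc i) * cc j i)" UNIV "\<lambda>_. UNIV"] sm' by (simp add: inner)
  have v1: "(\<Sum>\<^sub>\<infinity>i. Tn l (Suc i) * (\<Sum>\<^sub>\<infinity>j. d j * cc j i)) = (\<Sum>\<^sub>\<infinity>j. d j * ((Jf 0)\<^sup>2 / 2 * bc (l + Suc j)))"
  proof -
    have "(\<Sum>\<^sub>\<infinity>i. Tn l (Suc i) * (\<Sum>\<^sub>\<infinity>j. d j * cc j i)) = (\<Sum>\<^sub>\<infinity>i. \<Sum>\<^sub>\<infinity>j. d j * (Tn l (Suc i) * cc j i))"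
      by (simp only: inner)
    also have "\<dots> = (\<Sum>\<^sub>\<infinity>j. \<Sum>\<^sub>\<infinity>i. d j * (Tn l (Suc i) * cc j i))" by (rule infsum_swap_banach[OF sm'])
    finally show ?thesis by (simp only: infsum_cmult_right' Tn_cc_sum[OF l])
  qed
  have "(\<Sum>\<^sub>\<infinity>j. d j * ((Jf 0)\<^sup>2 / 2 * bc (l + Suc j))) = (Jf 0)\<^sup>2 / 2 * (\<Sum>\<^sub>\<infinity>j. d j * bz (int (l + 1) + int j))"
  proof -
    have "bz (int (l + 1) + int j) = bc (l + Suc j)" for j
      using bz_simps(1)[of "l + Suc j"] by (simp add: ac_simps del: bc.simps)
    then show ?thesis by (simp only: mult.left_commute[of _ "(Jf 0)\<^sup>2 / 2"] infsum_cmult_right')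
  qed
  note v1' = v1[unfolded this]
  have v0: "(\<Sum>\<^sub>\<infinity>i. Tn l (Suc i) * cc 0 i) = (Jf 0)\<^sup>2 / 2 * bz (int (l + 1))"
    using Tn_cc_sum[OF l, of 0] bz_simps(1)[of "l + 1"] by (simp del: bc.simps)
  define G where "G i = Tn l (Suc i) * ((if i = 0 then 1 else 0) - dl i)" for i
  have Ge: "G i = \<kappa> * (Tn l (Suc i) * cc 0 i - Tn l (Suc i) * (\<Sum>\<^sub>\<infinity>j. d j * cc j i))" for i
    unfolding G_def gam by (simp add: algebra_simps)
  have sG: "G summable_on UNIV" unfolding Ge[abs_def]
    by (intro summable_on_cmult_right real_summable_diff(1) s0 s1)
  have "infsum G UNIV = \<kappa> * ((Jf 0)\<^sup>2 / 2 * bz (int (l + 1)) - (Jf 0)\<^sup>2 / 2 * (\<Sum>\<^sub>\<infinity>j. d j * bz (int (l + 1) + int j)))"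
    unfolding Ge[abs_def] by (simp only: infsum_cmult_right' real_summable_diff(2)[OF s0 s1] v0 v1')
  also have "\<dots> = (Jf 0)\<^sup>2 / 2 * (\<kappa> * (bz (int (l + 1)) - (\<Sum>\<^sub>\<infinity>j. d j * bz (int (l + 1) + int j))))"
    by (simp only: right_diff_distrib mult.left_commute)
  also have "\<dots> = (Jf 0)\<^sup>2 / 2 * (2 * v (l + 1))" by (simp only: p1[of "l + 1", OF le_add2])
  finally have vG: "infsum G UNIV = (Jf 0)\<^sup>2 * v (l + 1)" by simp
  define I where "I i = (if i = (0::nat) then Tn l 1 else 0)" for i
  have sI: "I summable_on UNIV" by (rule finite_nonzero_values_imp_summable_on) (simp add: I_def)
  have vI: "infsum I UNIV = Tn l 1"
  proof -
    have "infsum I UNIV = infsum I {0}" by (rule infsum_cong_neutral) (auto simp: I_def)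
    then show ?thesis by (simp add: I_def)
  qed
  have e: "dl i * Tn l (Suc i) = I i - G i" for i by (simp add: I_def G_def algebra_simps)
  show "(\<lambda>k. dl k * Tn l (Suc k)) summable_on UNIV" unfolding e by (rule real_summable_diff(1)[OF sI sG])
  show "Tn l 1 - (\<Sum>\<^sub>\<infinity>k. dl k * Tn l (Suc k)) = (Jf 0)\<^sup>2 * v (l + 1)"
    unfolding e real_summable_diff(2)[OF sI sG] vI vG by simp
qed

end

context norm_tutte
begin

text \<open>Both \<open>bc\<close> and its differences satisfy the same two-sided ratio bound, hence so does \<open>v\<close>, which is
  a non-negative combination of them.\<close>
lemma v_ratio_tendsto: "(\<lambda>n. v (Suc n) / v n) \<longlonglongrightarrow> 1"
proof -
  obtain \<kappa> d where k: "\<kappa> > 0" and d: "\<And>n. d n \<ge> 0" "d 0 = 0" "d summable_on UNIV" "infsum d UNIV \<le> 1"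
    and p1: "\<And>n. n \<ge> 1 \<Longrightarrow> 2 * v n = \<kappa> * (bz (int n) - (\<Sum>\<^sub>\<infinity>j. d j * bz (int n + int j)))"
    by (rule bc_factorization) blast
  have bzn: "bz (int n + int j) = bc (n + j)" for n j using bz_simps(1)[of "n + j"] by simp
  have bd: "\<bar>bc n\<bar> \<le> (\<Sum>\<^sub>\<infinity>n. \<bar>bc n\<bar>)" for n by (rule summable_imp_bounded[OF bc_abs_summable(2)])
  have s1: "(\<lambda>j. d j * bc (m + j)) summable_on UNIV" for m by (rule summable_on_bounded_mult[OF d(3) bd])
  have s2: "(\<lambda>j. d j * bc m) summable_on UNIV" for m by (rule summable_on_cmult_left[OF d(3)])
  have s3: "(\<lambda>j. d j * (bc m - bc (m + j))) summable_on UNIV" for m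
    using real_summable_diff(1)[OF s2 s1] by (simp only: right_diff_distrib)
  define D where "D = infsum d UNIV"
  have rep: "2 * v n = \<kappa> * ((1 - D) * bc n + (\<Sum>\<^sub>\<infinity>j. d j * (bc n - bc (n + j))))" if "n \<ge> 1" for n
  proof -
    have X: "(\<Sum>\<^sub>\<infinity>j. d j * (bc n - bc (n + j))) = D * bc n - (\<Sum>\<^sub>\<infinity>j. d j * bc (n + j))"
      unfolding right_diff_distrib real_summable_diff(2)[OF s2 s1] D_def by (simp only: infsum_cmult_left')
    show ?thesis unfolding X using p1[OF that] unfolding bzn bz_simps(1) by (simp add: algebra_simps)
  qed
  define e where "e m = bc m - bc (Suc m)" for m
  \<comment> \<open>The ratio \<open>e (n + 1) / e n\<close> of consecutive differences. It is
    smaller than the ratio of \<open>bc\<close> itself, so it serves as a lower bound for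
    both.\<close>
  define \<rho> where "\<rho> n = (real n - 1 / 2) / (real n + 2)" for n
  have e_eq: "e m = bc m * (3 / 2 / (real m + 1))" for m
  proof -
    have "1 - (real m - 1 / 2) / (real m + 1) = 3 / 2 / (real m + 1)" by (simp add: field_simps)
    moreover have "e m = bc m * (1 - (real m - 1 / 2) / (real m + 1))" by (simp add: e_def right_diff_distrib)
    ultimately show ?thesis by simp
  qed
  have e_rec: "e (Suc m) = e m * \<rho> m" for m
  proof -
    have "e (Suc m) = bc m * ((real m - 1 / 2) / (real m + 1)) * (3 / 2 / (real m + 2))"
      by (simp add: e_eq add.commute)
    also have "\<dots> = e m * \<rho> m" unfolding e_eq \<rho>_def by (simp add: field_simps)
    finally show ?thesis .
  qed
  have rho_mono: "\<rho> n \<le> \<rho> m" if "n \<le> m" for n m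
  proof -
    have "\<rho> n = 1 - 5 / 2 / (real n + 2)" for n unfolding \<rho>_def by (simp add: field_simps)
    moreover have "5 / 2 / (real m + 2) \<le> 5 / 2 / (real n + 2)" using that by (intro divide_left_mono) auto
    ultimately show ?thesis by simp
  qed
  have rho_le1: "\<rho> n \<le> 1" for n by (simp add: \<rho>_def)
  have e_pos: "e m \<ge> 0" if "m \<ge> 1" for m unfolding e_eq using bc_pos[OF that] by simp
  have e_bd: "\<rho> n * e m \<le> e (Suc m)" "e (Suc m) \<le> e m" if "n \<le> m" "n \<ge> 1" for n m
    using e_pos[of m] rho_mono[OF that(1)] rho_le1[of m] that unfolding e_rec
    by (auto simp: mult.commute[of "\<rho> n"] intro: mult_left_mono mult_left_le)
  have diff: "bc n - bc (n + j) = (\<Sum>i<j. e (n + i))" for n j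
    by (induction j) (simp_all add: e_def del: bc.simps)
  have diff_bd: "\<rho> n * (bc n - bc (n + j)) \<le> bc (Suc n) - bc (Suc n + j)" "bc (Suc n) - bc (Suc n + j) \<le> bc n - bc (n + j)"
    if "n \<ge> 1" for n j
    unfolding diff sum_distrib_left using e_bd[of n] that by (auto intro!: sum_mono)
  have bc_bd: "\<rho> n * bc n \<le> bc (Suc n)" "bc (Suc n) \<le> bc n" if "n \<ge> 1" for n
  proof -
    have "(real n - 1 / 2) / (real n + 2) \<le> (real n - 1 / 2) / (real n + 1)" using that by (intro divide_left_mono) auto
    then have "bc n * ((real n - 1 / 2) / (real n + 2)) \<le> bc n * ((real n - 1 / 2) / (real n + 1))"
      by (rule mult_left_mono) (use bc_pos[OF that] in simp)
    then show "\<rho> n * bc n \<le> bc (Suc n)" by (simp only: \<rho>_def bc.simps mult.commute)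
    show "bc (Suc n) \<le> bc n" using e_pos[OF that] by (simp add: e_def)
  qed
  have D1: "1 - D \<ge> 0" using d(4) by (simp add: D_def)
  have up: "v (Suc n) \<le> v n" if n: "n \<ge> 1" for n
  proof -
    have "(1 - D) * bc (Suc n) + (\<Sum>\<^sub>\<infinity>j. d j * (bc (Suc n) - bc (Suc n + j)))
      \<le> (1 - D) * bc n + (\<Sum>\<^sub>\<infinity>j. d j * (bc n - bc (n + j)))"
      by (intro add_mono mult_left_mono infsum_mono s3 bc_bd diff_bd n D1 d(1))
    then have "\<kappa> * ((1 - D) * bc (Suc n) + (\<Sum>\<^sub>\<infinity>j. d j * (bc (Suc n) - bc (Suc n + j))))
      \<le> \<kappa> * ((1 - D) * bc n + (\<Sum>\<^sub>\<infinity>j. d j * (bc n - bc (n + j))))" by (rule mult_left_mono) (use k in simp)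
    moreover have "Suc n \<ge> 1" by simp
    ultimately show ?thesis using rep[OF n] rep[of "Suc n"] by linarith
  qed
  have lo: "\<rho> n * v n \<le> v (Suc n)" if n: "n \<ge> 1" for n
  proof -
    have "\<rho> n * ((1 - D) * bc n + (\<Sum>\<^sub>\<infinity>j. d j * (bc n - bc (n + j))))
      = (1 - D) * (\<rho> n * bc n) + (\<Sum>\<^sub>\<infinity>j. d j * (\<rho> n * (bc n - bc (n + j))))"
      unfolding mult.left_commute[of _ "\<rho> n"] by (simp only: infsum_cmult_right' distrib_left)
    also have "\<dots> \<le> (1 - D) * bc (Suc n) + (\<Sum>\<^sub>\<infinity>j. d j * (bc (Suc n) - bc (Suc n + j)))"
    proof (intro add_mono mult_left_mono infsum_mono s3 bc_bd diff_bd n D1 d(1))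
      show "(\<lambda>j. d j * (\<rho> n * (bc n - bc (n + j)))) summable_on UNIV"
        unfolding mult.left_commute[of _ "\<rho> n"] by (intro summable_on_cmult_right s3)
    qed
    finally have "\<kappa> * (\<rho> n * ((1 - D) * bc n + (\<Sum>\<^sub>\<infinity>j. d j * (bc n - bc (n + j)))))
      \<le> \<kappa> * ((1 - D) * bc (Suc n) + (\<Sum>\<^sub>\<infinity>j. d j * (bc (Suc n) - bc (Suc n + j))))"
      by (rule mult_left_mono) (use k in simp)
    then have "\<rho> n * (2 * v n) \<le> 2 * v (Suc n)" using rep[OF n] rep[of "Suc n"] by (simp only: mult.left_commute[of \<kappa>])
    then show ?thesis by simp
  qed
  show ?thesis
  proof (rule tendsto_sandwich)
    show "\<forall>\<^sub>F n in sequentially. \<rho> n \<le> v (Suc n) / v n"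
      using eventually_ge_at_top[of 1] by eventually_elim (use lo v_pos in \<open>simp add: pos_le_divide_eq\<close>)
    show "\<forall>\<^sub>F n in sequentially. v (Suc n) / v n \<le> 1"
      using eventually_ge_at_top[of 1] by eventually_elim (use up v_pos in \<open>simp add: pos_divide_le_eq\<close>)
    show "\<rho> \<longlonglongrightarrow> 1" unfolding \<rho>_def by real_asymp
  qed simp
qed

end

section \<open>Slow variation\<close>

lemma ohs_lower: "ln (real n + 1) / 2 \<le> ohs n"
proof -
  have "ohs n \<ge> harm n / 2"
  proof (induction n)
    case (Suc n)
    have "inverse (real (Suc n)) / 2 \<le> 1 / (2 * real n + 1)" by (simp add: field_simps)
    then show ?case using Suc by (simp add: ohs_simps harm_Suc)
  qed (simp add: ohs_simps harm_def)
  then show ?thesis using ln_le_harm[of n] by simp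
qed

lemma ohs_upper: "n \<ge> 1 \<Longrightarrow> ohs n \<le> 1 + ln (real n)"
proof (induction n rule: dec_induct)
  case (step n)
  define x where "x = real n"
  have x: "x \<ge> 1" using step by (simp add: x_def)
  have "1 / (2 * x + 1) \<le> 1 / (x + 1)" using x by (intro divide_left_mono) auto
  also have "1 / (x + 1) \<le> - ln (x / (x + 1))"
  proof -
    have "ln (x / (x + 1)) \<le> x / (x + 1) - 1" using x by (intro ln_le_minus_one) simp
    also have "\<dots> = - (1 / (x + 1))" using x by (simp add: field_simps)
    finally show ?thesis by simp
  qed
  also have "\<dots> = ln (real (Suc n)) - ln x" using x by (simp add: ln_div x_def add.commute)
  finally show ?case using step by (simp add: ohs_simps x_def)
qed (simp add: ohs_def)

text \<open>In this scaling the kernel is \<open>2 * (ohs l - ohs m)\<close> up to a bounded error,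
  as long as \<open>m < l\<close>; the factor \<open>m\<close> removed here is put into the weights
  \<open>wt\<close>.\<close>

definition Q :: "nat \<Rightarrow> nat \<Rightarrow> real" where "Q l m = (real l)\<^sup>2 * Tn l m / real m"

text \<open>Write \<open>l ^ 2 = (l ^ 2 - m ^ 2) + m ^ 2\<close> in the closed form. The second part
  stays bounded since \<open>ohs l - ohs m\<close> is at most \<open>(l - m) / (2 * m + 1)\<close>,
  which cancels the small factor \<open>l - m\<close> of the denominator.\<close>

lemma Q_below:
  assumes "1 \<le> m" "m < l"
  shows "Q l m = 2 * (ohs l - ohs m) + 2 * (real m)\<^sup>2 * (ohs l - ohs m) / ((real l)\<^sup>2 - (real m)\<^sup>2)"
    "0 \<le> Q l m - 2 * (ohs l - ohs m)" "Q l m - 2 * (ohs l - ohs m) \<le> 1 / 2"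
proof -
  define x y u where "x = real m" and "y = real l" and "u = ohs l - ohs m"
  have xy: "x \<ge> 1" "x < y" using assms by (simp_all add: x_def y_def)
  have sq: "y\<^sup>2 - x\<^sup>2 = (y - x) * (y + x)" by (simp add: power2_eq_square algebra_simps)
  have pos: "y\<^sup>2 - x\<^sup>2 > 0" unfolding sq using xy by simp
  have u: "u \<ge> 0" "u \<le> (y - x) / (2 * x + 1)"
    using ohs_mono[of m l] ohs_diff_le[of m l] assms by (simp_all add: u_def x_def y_def)
  have "Q l m = y\<^sup>2 * (2 * x * u / (y\<^sup>2 - x\<^sup>2)) / x"
    using Tn_closed[of l m] assms by (simp add: Q_def x_def y_def u_def)
  also have "\<dots> = 2 * y\<^sup>2 * u / (y\<^sup>2 - x\<^sup>2)" using xy by simp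
  also have "2 * y\<^sup>2 * u = 2 * u * (y\<^sup>2 - x\<^sup>2) + 2 * x\<^sup>2 * u" by (simp add: algebra_simps)
  also have "(2 * u * (y\<^sup>2 - x\<^sup>2) + 2 * x\<^sup>2 * u) / (y\<^sup>2 - x\<^sup>2) = 2 * u + 2 * x\<^sup>2 * u / (y\<^sup>2 - x\<^sup>2)"
    using pos by (simp add: add_divide_distrib)
  finally have Q: "Q l m = 2 * u + 2 * x\<^sup>2 * u / (y\<^sup>2 - x\<^sup>2)" .
  then show "Q l m = 2 * (ohs l - ohs m) + 2 * (real m)\<^sup>2 * (ohs l - ohs m) / ((real l)\<^sup>2 - (real m)\<^sup>2)"
    by (simp add: x_def y_def u_def)
  show "0 \<le> Q l m - 2 * (ohs l - ohs m)" using Q pos u by (simp add: u_def[symmetric])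
  have "2 * x\<^sup>2 * u \<le> 1 / 2 * (y\<^sup>2 - x\<^sup>2)"
  proof -
    have "2 * x\<^sup>2 * u \<le> 2 * x\<^sup>2 * ((y - x) / (2 * x + 1))" using u by (intro mult_left_mono) auto
    also have "\<dots> = (2 * x\<^sup>2 / (2 * x + 1)) * (y - x)" by simp
    also have "\<dots> \<le> (1 / 2 * (y + x)) * (y - x)"
    proof (rule mult_right_mono)
      have "2 * x\<^sup>2 \<le> x * (2 * x + 1)" using xy by (simp add: power2_eq_square algebra_simps)
      then have "2 * x\<^sup>2 / (2 * x + 1) \<le> x" using xy by (simp add: pos_divide_le_eq)
      then show "2 * x\<^sup>2 / (2 * x + 1) \<le> 1 / 2 * (y + x)" using xy by simp
    qed (use xy in simp)
    finally show ?thesis unfolding sq by (simp add: mult_ac)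
  qed
  then have "2 * x\<^sup>2 * u / (y\<^sup>2 - x\<^sup>2) \<le> 1 / 2" using pos by (simp add: pos_divide_le_eq)
  then show "Q l m - 2 * (ohs l - ohs m) \<le> 1 / 2" using Q by (simp add: u_def[symmetric])
qed

lemma Q_above:
  assumes "1 \<le> l" "l \<le> m" shows "0 \<le> Q l m" "Q l m \<le> 1 / 2"
proof -
  show "0 \<le> Q l m" using Tn_nonneg[OF assms(1)] by (simp add: Q_def)
  show "Q l m \<le> 1 / 2"
  proof (cases "m = l")
    case True
    have "Q l l = real l * Tn l l" using assms by (simp add: Q_def power2_eq_square)
    also have "\<dots> \<le> real l * (1 / (2 * real l))" by (rule mult_left_mono[OF Tn_diag[OF assms(1)]]) simp
    finally show ?thesis using assms True by simp
  next
    case False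
    define x y u where "x = real m" and "y = real l" and "u = ohs m - ohs l"
    have xy: "y \<ge> 1" "y < x" using assms False by (simp_all add: x_def y_def)
    have sq: "x\<^sup>2 - y\<^sup>2 = (x - y) * (x + y)" by (simp add: power2_eq_square algebra_simps)
    have pos: "x\<^sup>2 - y\<^sup>2 > 0" unfolding sq using xy by simp
    have u: "u \<le> (x - y) / (2 * y + 1)" using ohs_diff_le[of l m] assms by (simp add: u_def x_def y_def)
    have g: "s / t = (- s) / (- t)" for s t :: real by simp
    have "Q l m = y\<^sup>2 * (2 * x * (- u) / (y\<^sup>2 - x\<^sup>2)) / x"
      using Tn_closed[of l m] assms False by (simp add: Q_def x_def y_def u_def)
    also have "\<dots> = 2 * y\<^sup>2 * (- u) / (y\<^sup>2 - x\<^sup>2)" using xy by simp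
    also have "\<dots> = (- (2 * y\<^sup>2 * (- u))) / (- (y\<^sup>2 - x\<^sup>2))" by (rule g)
    also have "\<dots> = 2 * y\<^sup>2 * u / (x\<^sup>2 - y\<^sup>2)" by simp
    finally have Q: "Q l m = 2 * y\<^sup>2 * u / (x\<^sup>2 - y\<^sup>2)" .
    have "2 * y\<^sup>2 * u \<le> 2 * y\<^sup>2 * ((x - y) / (2 * y + 1))" using u by (intro mult_left_mono) auto
    also have "\<dots> = (2 * y\<^sup>2 / (2 * y + 1)) * (x - y)" by simp
    also have "\<dots> \<le> (1 / 2 * (x + y)) * (x - y)"
    proof (rule mult_right_mono)
      have "2 * y\<^sup>2 \<le> y * (2 * y + 1)" using xy by (simp add: power2_eq_square algebra_simps)
      then have "2 * y\<^sup>2 / (2 * y + 1) \<le> y" using xy by (simp add: pos_divide_le_eq)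
      then show "2 * y\<^sup>2 / (2 * y + 1) \<le> 1 / 2 * (x + y)" using xy by simp
    qed (use xy in simp)
    also have "\<dots> = 1 / 2 * (x\<^sup>2 - y\<^sup>2)" unfolding sq by (simp add: mult_ac)
    finally show ?thesis unfolding Q using pos by (simp add: pos_divide_le_eq)
  qed
qed

lemma Q_approx:
  assumes "1 \<le> l" "1 \<le> m" shows "\<bar>Q l m - 2 * (ohs l - min (ohs l) (ohs m))\<bar> \<le> 1 / 2"
proof (cases "m < l")
  case True
  then have "ohs m \<le> ohs l" by (intro ohs_mono) simp
  then show ?thesis using Q_below(2,3)[OF assms(2) True] by (simp add: min_absorb2)
next
  case False
  then have "ohs l \<le> ohs m" by (intro ohs_mono) simp
  then show ?thesis using Q_above[OF assms(1), of m] False by (simp add: min_absorb1)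
qed

text \<open>\<open>Q l m / (2 * l\<^sup>2)\<close> is, for \<open>m < l\<close>, a weighted mean of the decreasing numbers \<open>1 / (2 i + 1)\<^sup>2\<close> with
  \<open>m \<le> i < l\<close>.\<close>
lemma Q_le_Q1:
  assumes l: "2 \<le> l" and m: "1 \<le> m" shows "Q l m \<le> Q l 1"
proof -
  define y where "y = real l"
  define r where "r i = (ohs l - ohs i) / (y\<^sup>2 - (real i)\<^sup>2)" for i
  have Qr: "Q l i = 2 * y\<^sup>2 * r i" if "1 \<le> i" "i < l" for i
    using Tn_closed[of l i] that by (simp add: Q_def r_def y_def)
  have pos: "y\<^sup>2 - (real i)\<^sup>2 > 0" if "i < l" for i
    using power_strict_mono[of "real i" y 2] that by (simp add: y_def)
  have sqs: "(real (Suc n))\<^sup>2 - (real n)\<^sup>2 = 2 * real n + 1" for n by (simp add: power2_eq_square algebra_simps)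
  have bound: "ohs l - ohs i \<le> (y\<^sup>2 - (real i)\<^sup>2) / (2 * real i + 1)\<^sup>2" if "i \<le> l" for i
    using that unfolding y_def
  proof (induction l rule: dec_induct)
    case (step n)
    have "1 / (2 * real n + 1) = (2 * real n + 1) / (2 * real n + 1)\<^sup>2" by (simp add: power2_eq_square)
    also have "\<dots> \<le> (2 * real n + 1) / (2 * real i + 1)\<^sup>2" using step by (intro divide_left_mono power_mono) auto
    also have "\<dots> = ((real (Suc n))\<^sup>2 - (real n)\<^sup>2) / (2 * real i + 1)\<^sup>2" unfolding sqs ..
    finally show ?case using step by (simp add: ohs_simps diff_divide_distrib)
  qed simp
  \<comment> \<open>Going from \<open>i\<close> to \<open>i + 1\<close> removes from the weighted
    mean its largest value, \<open>1 / t ^ 2\<close>, which has weight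
    \<open>t = 2 * i + 1\<close>.\<close>
  have dec: "r (Suc i) \<le> r i" if i: "Suc i < l" for i
  proof -
    define A B where "A = ohs l - ohs (Suc i)" and "B = y\<^sup>2 - (real (Suc i))\<^sup>2"
    define t where "t = 2 * real i + 1"
    have t: "t > 0" by (simp add: t_def)
    have B: "B > 0" unfolding B_def by (rule pos[OF i])
    have "A \<le> B / (2 * real (Suc i) + 1)\<^sup>2" unfolding A_def B_def using i by (intro bound) simp
    also have "\<dots> \<le> B / t\<^sup>2" using B t by (intro divide_left_mono power_mono) (auto simp: t_def)
    finally have AB: "A * t\<^sup>2 \<le> B" using t by (simp add: pos_le_divide_eq)
    have e: "ohs l - ohs i = A + 1 / t" "y\<^sup>2 - (real i)\<^sup>2 = B + t"
      using sqs[of i] by (simp_all add: A_def B_def t_def ohs_simps)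
    have "A * (B + t) \<le> (A + 1 / t) * B"
    proof -
      have "A * t = A * t\<^sup>2 / t" using t by (simp add: power2_eq_square)
      also have "\<dots> \<le> B / t" using AB t by (intro divide_right_mono) auto
      finally show ?thesis by (simp add: algebra_simps)
    qed
    moreover have "B + t > 0" using B t by simp
    ultimately show ?thesis unfolding r_def e A_def[symmetric] B_def[symmetric]
      by (simp only: pos_divide_le_eq[OF B] times_divide_eq_left pos_le_divide_eq)
  qed
  have r_le: "r i \<le> r 1" if "1 \<le> i" "i < l" for i
    using that
  proof (induction i rule: dec_induct)
    case (step n)
    then show ?case using dec[of n] by simp
  qed simp
  show ?thesis
  proof (cases "m < l")
    case True
    then show ?thesis using Qr[OF m True] Qr[of 1] r_le[OF m True] l by (simp add: mult_left_mono)
  next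
    case False
    have "Q l 1 \<ge> 2 * (ohs l - ohs 1)" using Q_below(2)[of 1 l] l by simp
    \<comment> \<open>For \<open>m \<ge> l\<close> the kernel is at most \<open>1 / 2\<close> by
      \<open>Q_above\<close>, so this lower bound settles the case.\<close>
    have "1 / 2 \<le> Q l 1"
    proof -
      have "r 1 \<ge> 1 / (2 * y)\<^sup>2"
      proof -
        have "ohs l - ohs 1 \<ge> (y\<^sup>2 - 1) / (2 * y)\<^sup>2"
          using l unfolding y_def
        proof (induction l rule: dec_induct)
          case base
          show ?case by (simp add: ohs_def numeral_2_eq_2)
        next
          case (step n)
          have n: "real n \<ge> 2" using step by simp
          have "((real (Suc n))\<^sup>2 - 1) / (2 * real (Suc n))\<^sup>2 \<le> 1 / 4" by (simp add: power_mult_distrib divide_simps) (simp add: power2_eq_square algebra_simps)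
          moreover have "ohs (Suc n) - ohs 1 \<ge> ohs 2 - ohs 1" using step by (intro diff_right_mono ohs_mono) simp
          moreover have "ohs 2 - ohs 1 \<ge> 1 / 4" by (simp add: ohs_def numeral_2_eq_2)
          ultimately show ?case by linarith
        qed
        then have "(y\<^sup>2 - 1) / (2 * y)\<^sup>2 / (y\<^sup>2 - 1) \<le> (ohs l - ohs 1) / (y\<^sup>2 - 1)"
          using pos[of 1] l by (intro divide_right_mono) auto
        moreover have "y\<^sup>2 - 1 \<noteq> 0" using pos[of 1] l by simp
        ultimately show ?thesis by (simp add: r_def)
      qed
      then have "2 * y\<^sup>2 * (1 / (2 * y)\<^sup>2) \<le> Q l 1" using Qr[of 1] l by (simp only:) (intro mult_left_mono; simp)
      then show ?thesis using l by (simp add: y_def power_mult_distrib)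
    qed
    then show ?thesis using Q_above(2)[of l m] False l by simp
  qed
qed

context norm_tutte
begin

text \<open>These are the numbers \<open>m * \<delta> m\<close> of the overview, with
  \<open>m = k + 1\<close>.\<close>

definition wt :: "nat \<Rightarrow> real" where "wt k = (real k + 1) * dl k"
definition R :: "nat \<Rightarrow> nat \<Rightarrow> real" where "R l k = Q l 1 - Q l (Suc k)"

text \<open>In the difference of the two approximations the leading \<open>ohs l\<close> cancels.
  The error is uniform in \<open>k\<close>, so if \<open>ohs l\<close> changes by a bounded amount,
  then \<open>R l k\<close> changes by an amount bounded uniformly in \<open>k\<close>.\<close>

lemma R_approx: "1 \<le> l \<Longrightarrow> \<bar>R l k - 2 * (min (ohs l) (ohs (Suc k)) - min (ohs l) (ohs 1))\<bar> \<le> 1"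
proof -
  assume l: "1 \<le> l"
  have k: "1 \<le> Suc k" by simp
  have g: "\<bar>a - b - 2 * (m2 - m1)\<bar> \<le> 1"
    if "\<bar>a - 2 * (x - m1)\<bar> \<le> 1 / 2" "\<bar>b - 2 * (x - m2)\<bar> \<le> 1 / 2" for a b x m1 m2 :: real
    using that unfolding abs_le_iff by argo
  show ?thesis unfolding R_def by (rule g[OF Q_approx[OF l order_refl] Q_approx[OF l k]])
qed

lemma R_nonneg: "2 \<le> l \<Longrightarrow> R l k \<ge> 0"
  using Q_le_Q1[of l "Suc k"] by (simp add: R_def)

lemma Q1_lower: "2 \<le> l \<Longrightarrow> Q l 1 \<ge> ln (real l + 1) - 2"
  using Q_below(2)[of 1 l] ohs_lower[of l] by (simp add: ohs_def)

lemma Q1_upper: "2 \<le> l \<Longrightarrow> Q l 1 \<le> 2 + 2 * ln (real l)"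
  using Q_below(3)[of 1 l] ohs_upper[of l] by (simp add: ohs_def)

lemma Q1_at_top: "filterlim (\<lambda>l. Q l 1) at_top sequentially"
proof (rule filterlim_at_top_mono)
  show "filterlim (\<lambda>l. ln (real l + 1) - 2) at_top sequentially" by real_asymp
  show "\<forall>\<^sub>F l in sequentially. ln (real l + 1) - 2 \<le> Q l 1"
    using eventually_ge_at_top[of 2] by eventually_elim (rule Q1_lower)
qed

text \<open>For fixed \<open>m\<close> the correction in \<open>Q_below\<close> is at most of order
  \<open>ln l / l ^ 2\<close>.\<close>

lemma R_tendsto: "(\<lambda>l. R l k) \<longlonglongrightarrow> 2 * (ohs (Suc k) - ohs 1)"
proof -
  have *: "(\<lambda>l. Q l m - 2 * (ohs l - ohs m)) \<longlonglongrightarrow> 0" if m: "m \<ge> 1" for m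
  proof (rule tendsto_sandwich[of "\<lambda>_. 0" _ _ "\<lambda>l. 2 * (real m)\<^sup>2 * (1 + ln (real l)) / ((real l)\<^sup>2 - (real m)\<^sup>2)"])
    show "\<forall>\<^sub>F l in sequentially. 0 \<le> Q l m - 2 * (ohs l - ohs m)"
      using eventually_gt_at_top[of m] by eventually_elim (rule Q_below(2)[OF m])
    show "\<forall>\<^sub>F l in sequentially. Q l m - 2 * (ohs l - ohs m)
        \<le> 2 * (real m)\<^sup>2 * (1 + ln (real l)) / ((real l)\<^sup>2 - (real m)\<^sup>2)"
      using eventually_gt_at_top[of m]
    proof eventually_elim
      case (elim l)
      have "(real m)\<^sup>2 \<le> (real l)\<^sup>2" using elim by (intro power_mono) auto
      moreover have "ohs l - ohs m \<le> 1 + ln (real l)"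
        using ohs_upper[of l] ohs_mono[of 0 m] elim m by (simp add: ohs_simps)
      ultimately show ?case
        unfolding Q_below(1)[OF m elim] by (simp add: divide_right_mono mult_left_mono)
    qed
    show "(\<lambda>l. 2 * (real m)\<^sup>2 * (1 + ln (real l)) / ((real l)\<^sup>2 - (real m)\<^sup>2)) \<longlonglongrightarrow> 0" by real_asymp
  qed simp
  have "(\<lambda>l. (Q l 1 - 2 * (ohs l - ohs 1)) - (Q l (Suc k) - 2 * (ohs l - ohs (Suc k))) + 2 * (ohs (Suc k) - ohs 1))
    \<longlonglongrightarrow> 0 - 0 + 2 * (ohs (Suc k) - ohs 1)"
    by (intro tendsto_add tendsto_diff tendsto_const *) auto
  then show ?thesis by (simp add: R_def algebra_simps)
qed

lemma v_rep_Q: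
  assumes l: "l \<ge> 1"
  shows "(\<lambda>k. wt k * Q l (Suc k)) summable_on UNIV"
    "Q l 1 - (\<Sum>\<^sub>\<infinity>k. wt k * Q l (Suc k)) = (Jf 0)\<^sup>2 * ((real l)\<^sup>2 * v (l + 1))"
proof -
  have e: "wt k * Q l (Suc k) = (real l)\<^sup>2 * (dl k * Tn l (Suc k))" for k by (simp add: wt_def Q_def add.commute)
  show "(\<lambda>k. wt k * Q l (Suc k)) summable_on UNIV"
    unfolding e by (rule summable_on_cmult_right[OF v_representation(1)[OF l]])
  have "(\<Sum>\<^sub>\<infinity>k. wt k * Q l (Suc k)) = (real l)\<^sup>2 * (\<Sum>\<^sub>\<infinity>k. dl k * Tn l (Suc k))"
    unfolding e by (rule infsum_cmult_right')
  then have "Q l 1 - (\<Sum>\<^sub>\<infinity>k. wt k * Q l (Suc k)) = (real l)\<^sup>2 * (Tn l 1 - (\<Sum>\<^sub>\<infinity>k. dl k * Tn l (Suc k)))"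
    by (simp add: Q_def right_diff_distrib)
  then show "Q l 1 - (\<Sum>\<^sub>\<infinity>k. wt k * Q l (Suc k)) = (Jf 0)\<^sup>2 * ((real l)\<^sup>2 * v (l + 1))"
    unfolding v_representation(2)[OF l] by (simp add: mult.left_commute)
qed

end

section \<open>Consequences of the sign condition on \<open>dl\<close>\<close>

locale norm_tutte_dom = norm_tutte +
  assumes dl_nonneg: "dl k \<ge> 0"
begin

lemma wt_nonneg: "wt k \<ge> 0" using dl_nonneg by (simp add: wt_def)

text \<open>If finitely many weights summed to \<open>1 + \<epsilon>\<close>, positivity of
  \<open>v\<close> would bound \<open>\<epsilon> * Q l 1\<close> by a finite sum of terms
  \<open>wt k * R l k\<close>. But \<open>Q l 1\<close> tends to infinity, whereas each
  \<open>R l k\<close> converges.\<close>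

lemma wt_partial: "(\<Sum>k\<le>N. wt k) \<le> 1"
proof (rule ccontr)
  assume "\<not> ?thesis"
  define \<epsilon> where "\<epsilon> = (\<Sum>k\<le>N. wt k) - 1"
  have eps: "\<epsilon> > 0" using \<open>\<not> _\<close> by (simp add: \<epsilon>_def)
  have "\<epsilon> * Q l 1 \<le> (\<Sum>k\<le>N. wt k * R l k)" if l: "l \<ge> 2" for l
  proof -
    have Q0: "Q l (Suc k) \<ge> 0" for k using Tn_nonneg[of l "Suc k"] l by (simp add: Q_def)
    have "(\<Sum>k\<le>N. wt k * Q l (Suc k)) \<le> (\<Sum>\<^sub>\<infinity>k. wt k * Q l (Suc k))"
      using infsum_mono2[of "\<lambda>k. wt k * Q l (Suc k)" "{..N}" UNIV] v_rep_Q(1)[of l] l wt_nonneg Q0 by simp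
    also have "\<dots> \<le> Q l 1" using v_rep_Q(2)[of l] l v_nonneg[of "l + 1"] by simp (smt (verit) mult_nonneg_nonneg zero_le_power2)
    finally have "(\<Sum>k\<le>N. wt k * (Q l 1 - R l k)) \<le> Q l 1" by (simp add: R_def)
    then show ?thesis by (simp add: \<epsilon>_def right_diff_distrib sum_subtractf sum_distrib_right[symmetric] left_diff_distrib)
  qed
  then have "\<forall>\<^sub>F l in sequentially. \<epsilon> * Q l 1 \<le> (\<Sum>k\<le>N. wt k * R l k)"
    by (intro eventually_sequentiallyI[of 2])
  moreover have "filterlim (\<lambda>l. \<epsilon> * Q l 1) at_top sequentially"
    by (rule filterlim_tendsto_pos_mult_at_top[OF tendsto_const eps Q1_at_top])
  ultimately have "filterlim (\<lambda>l. \<Sum>k\<le>N. wt k * R l k) at_top sequentially"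
    by (rule filterlim_at_top_mono[rotated])
  moreover have "(\<lambda>l. \<Sum>k\<le>N. wt k * R l k) \<longlonglongrightarrow> (\<Sum>k\<le>N. wt k * (2 * (ohs (Suc k) - ohs 1)))"
    by (intro tendsto_intros R_tendsto)
  ultimately show False using not_tendsto_and_filterlim_at_infinity[OF sequentially_bot]
      filterlim_at_top_imp_at_infinity by blast
qed

definition sg :: real where "sg = infsum wt UNIV"

lemma wt_summable: "wt summable_on UNIV" and sg_le: "sg \<le> 1"
  using infsum_le_of_partial[of wt 1, OF wt_nonneg wt_partial] by (simp_all add: sg_def)

text \<open>Writing \<open>Q l 1 - \<Sum>wt * Q\<close> this way makes both terms non-negative; the first one
  dominates if \<open>sg < 1\<close>, while it vanishes if \<open>sg = 1\<close>.\<close>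
definition A :: "nat \<Rightarrow> real" where "A l = (1 - sg) * Q l 1 + (\<Sum>\<^sub>\<infinity>k. wt k * R l k)"

lemma wtR_summable: assumes "l \<ge> 1" shows "(\<lambda>k. wt k * R l k) summable_on UNIV"
  unfolding R_def right_diff_distrib
  by (rule real_summable_diff(1)[OF summable_on_cmult_left[OF wt_summable] v_rep_Q(1)[OF assms]])

lemma A_eq: assumes l: "l \<ge> 1" shows "A l = (Jf 0)\<^sup>2 * ((real l)\<^sup>2 * v (l + 1))"
proof -
  have "(\<Sum>\<^sub>\<infinity>k. wt k * R l k) = sg * Q l 1 - (\<Sum>\<^sub>\<infinity>k. wt k * Q l (Suc k))"
    unfolding R_def right_diff_distrib sg_def
    by (subst real_summable_diff(2)[OF summable_on_cmult_left[OF wt_summable] v_rep_Q(1)[OF l]])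
      (simp only: infsum_cmult_left')
  then show ?thesis unfolding A_def v_rep_Q(2)[OF l, symmetric] by (simp add: algebra_simps)
qed

lemma A_pos: "l \<ge> 1 \<Longrightarrow> A l > 0"
  unfolding A_eq using v_pos[of "l + 1"] Jf_0_pos by simp

lemma A_upper: assumes l: "l \<ge> 2" shows "A l \<le> Q l 1"
proof -
  have Q0: "Q l (Suc k) \<ge> 0" for k using Tn_nonneg[of l "Suc k"] l by (simp add: Q_def)
  have "(\<Sum>\<^sub>\<infinity>k. wt k * Q l (Suc k)) \<ge> 0" by (intro infsum_nonneg mult_nonneg_nonneg wt_nonneg Q0)
  then show ?thesis using v_rep_Q(2)[of l] A_eq[of l] l by simp
qed

lemma wtR_sum_nonneg: "l \<ge> 2 \<Longrightarrow> (\<Sum>\<^sub>\<infinity>k. wt k * R l k) \<ge> 0"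
  by (intro infsum_nonneg mult_nonneg_nonneg wt_nonneg R_nonneg)

lemma A_at_top: assumes "sg < 1" shows "filterlim A at_top sequentially"
proof (rule filterlim_at_top_mono)
  show "filterlim (\<lambda>l. (1 - sg) * Q l 1) at_top sequentially"
    by (rule filterlim_tendsto_pos_mult_at_top[OF tendsto_const _ Q1_at_top]) (use assms in simp)
  show "\<forall>\<^sub>F l in sequentially. (1 - sg) * Q l 1 \<le> A l"
    using eventually_ge_at_top[of 2] by eventually_elim (use wtR_sum_nonneg in \<open>simp add: A_def\<close>)
qed

text \<open>For \<open>sg = 1\<close> only the sum of the \<open>wt k * R l k\<close> is left, and
  one positive weight with \<open>k \<ge> 1\<close> keeps it away from 0. Such a weight exists:
  \<open>R l 0 = 0\<close>, so otherwise \<open>A\<close> would vanish.\<close>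

lemma A_lower: "\<exists>\<eta>>0. \<forall>\<^sub>F l in sequentially. \<eta> \<le> A l"
proof (cases "sg < 1")
  case True
  then have "\<forall>\<^sub>F l in sequentially. 1 \<le> A l" using A_at_top by (simp add: filterlim_at_top)
  then show ?thesis by (intro exI[of _ 1]) simp
next
  case False
  then have sg1: "sg = 1" using sg_le by simp
  have "\<exists>k\<ge>1. wt k > 0"
  proof (rule ccontr)
    assume "\<not> ?thesis"
    then have z: "wt k = 0" if "k \<ge> 1" for k using wt_nonneg[of k] that by force
    have "wt k * R 2 k = 0" for k by (cases k) (simp_all add: R_def z)
    then have "(\<Sum>\<^sub>\<infinity>k. wt k * R 2 k) = 0" by (intro infsum_0)
    then have "A 2 = 0" by (simp add: A_def sg1)
    then show False using A_pos[of 2] by simp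
  qed
  then obtain k where k: "k \<ge> 1" "wt k > 0" by blast
  define L where "L = wt k * (2 * (ohs (Suc k) - ohs 1))"
  have "ohs (Suc 1) \<le> ohs (Suc k)" using k by (intro ohs_mono) simp
  moreover have "ohs (Suc 1) = ohs 1 + 1 / 3" unfolding ohs_simps(2)[of 1] by simp
  ultimately have "ohs (Suc k) - ohs 1 > 0" by linarith
  then have "L > 0" unfolding L_def using k(2) by (intro mult_pos_pos) auto
  moreover have "(\<lambda>l. wt k * R l k) \<longlonglongrightarrow> L" unfolding L_def by (intro tendsto_intros R_tendsto)
  ultimately have "\<forall>\<^sub>F l in sequentially. L / 2 < wt k * R l k" by (intro order_tendstoD(1)) auto
  then have "\<forall>\<^sub>F l in sequentially. L / 2 \<le> A l"
    using eventually_ge_at_top[of 2]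
  proof eventually_elim
    case (elim l)
    have nn: "wt k * R l k \<ge> 0" for k using wt_nonneg R_nonneg[OF elim(2)] by simp
    have "wt k * R l k \<le> (\<Sum>\<^sub>\<infinity>k. wt k * R l k)"
      by (rule summable_on_le_infsum[OF wtR_summable nn]) (use elim in simp)
    then show ?case using elim by (simp add: A_def sg1)
  qed
  then show ?thesis using \<open>L > 0\<close> by (intro exI[of _ "L / 2"]) simp
qed

text \<open>Each term of \<open>S (f x) - S (g x)\<close> tends to 0 and is dominated by the
  summable \<open>wt k * (2 + 4 * B)\<close>, so Tannery's theorem applies. The other part of
  \<open>A\<close> changes by a bounded amount, which is negligible for \<open>sg < 1\<close>
  because \<open>A\<close> tends to infinity; for \<open>sg = 1\<close> it is absent and the lower
  bound for \<open>A\<close> suffices.\<close>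

lemma A_ratio:
  fixes f g :: "real \<Rightarrow> nat"
  assumes f: "filterlim f at_top at_top" and g: "filterlim g at_top at_top"
    and B: "\<forall>\<^sub>F x in at_top. \<bar>ohs (f x) - ohs (g x)\<bar> \<le> B"
  shows "((\<lambda>x. A (f x) / A (g x)) \<longlongrightarrow> 1) at_top"
proof -
  let ?E = "\<lambda>x. f x \<ge> 2 \<and> g x \<ge> 2 \<and> \<bar>ohs (f x) - ohs (g x)\<bar> \<le> B"
  have ev: "\<forall>\<^sub>F x in at_top. ?E x"
    using f g B by (auto simp: filterlim_at_top eventually_conj_iff)
  define S where "S l = (\<Sum>\<^sub>\<infinity>k. wt k * R l k)" for l
  have S0: "((\<lambda>x. S (f x) - S (g x)) \<longlongrightarrow> 0) at_top"
  proof -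
    define h where "h k x = wt k * (R (f x) k - R (g x) k)" for k x
    have "((\<lambda>x. h k x) \<longlongrightarrow> wt k * (2 * (ohs (Suc k) - ohs 1) - 2 * (ohs (Suc k) - ohs 1))) at_top" for k
      unfolding h_def by (intro tendsto_intros filterlim_compose[OF R_tendsto f] filterlim_compose[OF R_tendsto g])
    then have lim: "((\<lambda>x. h k x) \<longlongrightarrow> 0) at_top" for k by simp
    have bd: "\<bar>h k x\<bar> \<le> wt k * (2 + 4 * B)" if "?E x" for k x
    proof -
      have "\<bar>R (f x) k - R (g x) k\<bar> \<le> 2 + 4 * B"
        using R_approx[of "f x" k] R_approx[of "g x" k] that by (simp add: min_def abs_if split: if_splits)
      then show ?thesis using wt_nonneg by (simp add: h_def abs_mult mult_left_mono)
    qed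
    have "\<forall>\<^sub>F (k, x) in at_top \<times>\<^sub>F at_top. norm (h k x) \<le> wt k * (2 + 4 * B)"
    proof -
      have "\<forall>\<^sub>F p in (at_top :: nat filter) \<times>\<^sub>F at_top. ?E (snd p)"
        using ev by (rule eventually_compose_filterlim[OF _ filterlim_snd])
      then show ?thesis by eventually_elim (use bd in auto)
    qed
    moreover have "summable (\<lambda>k. wt k * (2 + 4 * B))"
      using summable_on_sums[OF wt_summable] by (intro summable_mult2) (simp add: sums_iff)
    ultimately have "((\<lambda>x. \<Sum>k. h k x) \<longlongrightarrow> 0) at_top"
      using tannerys_theorem[of h "\<lambda>_. 0" at_top, OF lim] by simp
    moreover have "\<forall>\<^sub>F x in at_top. (\<Sum>k. h k x) = S (f x) - S (g x)"
      using ev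
    proof eventually_elim
      case (elim x)
      have sf: "(\<lambda>k. wt k * R (f x) k) summable_on UNIV" and sgg: "(\<lambda>k. wt k * R (g x) k) summable_on UNIV"
        by (rule wtR_summable, use elim in simp)+
      have "(\<lambda>k. h k x) sums (S (f x) - S (g x))"
        unfolding h_def right_diff_distrib S_def by (intro sums_diff summable_on_sums sf sgg)
      then show ?case by (simp add: sums_iff)
    qed
    ultimately show ?thesis by (simp add: suminf_zero cong: tendsto_cong)
  qed
  obtain \<eta> where eta: "\<eta> > 0" "\<forall>\<^sub>F l in sequentially. \<eta> \<le> A l" using A_lower by blast
  have eta_g: "\<forall>\<^sub>F x in at_top. \<eta> \<le> A (g x)" by (rule eventually_compose_filterlim[OF eta(2) g])
  have "((\<lambda>x. (A (f x) - A (g x)) / A (g x)) \<longlongrightarrow> 0) at_top"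
  proof (cases "sg < 1")
    case True
    have inv: "((\<lambda>x. inverse (A (g x))) \<longlongrightarrow> 0) at_top"
      by (rule tendsto_inverse_0_at_top[OF filterlim_compose[OF A_at_top[OF True] g]])
    have bdd: "\<forall>\<^sub>F x in at_top. norm (A (f x) - A (g x)) \<le> (1 + 2 * B) + 1"
    proof -
      have "\<forall>\<^sub>F x in at_top. \<bar>S (f x) - S (g x)\<bar> < 1" using tendstoD[OF S0, of 1] by (simp add: dist_real_def)
      then show ?thesis using ev
      proof eventually_elim
        case (elim x)
        have m: "min (ohs (f x)) (ohs 1) = ohs 1" "min (ohs (g x)) (ohs 1) = ohs 1"
          using elim by (auto intro!: min_absorb2 ohs_mono)
        have e: "1 \<le> f x" "1 \<le> g x" "ohs (f x) - ohs (g x) \<le> B" "ohs (g x) - ohs (f x) \<le> B"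
          using elim unfolding abs_le_iff by auto
        have arith: "\<bar>a - b\<bar> \<le> 1 + 2 * B"
          if "\<bar>a - 2 * (x - o1)\<bar> \<le> 1 / 2" "\<bar>b - 2 * (y - o1)\<bar> \<le> 1 / 2" "x - y \<le> B" "y - x \<le> B" for a b x y o1 :: real
          using that unfolding abs_le_iff by argo
        have "\<bar>Q (f x) 1 - Q (g x) 1\<bar> \<le> 1 + 2 * B"
          by (rule arith[OF Q_approx[OF e(1) order_refl, unfolded m] Q_approx[OF e(2) order_refl, unfolded m] e(3,4)])
        moreover have "0 \<le> sg" unfolding sg_def by (rule infsum_nonneg) (rule wt_nonneg)
        then have "\<bar>(1 - sg) * (Q (f x) 1 - Q (g x) 1)\<bar> \<le> 1 * \<bar>Q (f x) 1 - Q (g x) 1\<bar>"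
          unfolding abs_mult using sg_le by (intro mult_right_mono) auto
        moreover have "A (f x) - A (g x) = (1 - sg) * (Q (f x) 1 - Q (g x) 1) + (S (f x) - S (g x))"
          by (simp add: A_def S_def algebra_simps)
        ultimately show ?case using elim by simp
      qed
    qed
    show ?thesis
    proof (rule Lim_null_comparison)
      have "((\<lambda>x. ((1 + 2 * B) + 1) * \<bar>inverse (A (g x))\<bar>) \<longlongrightarrow> ((1 + 2 * B) + 1) * \<bar>0\<bar>) at_top"
        by (intro tendsto_intros inv)
      then show "((\<lambda>x. ((1 + 2 * B) + 1) * \<bar>inverse (A (g x))\<bar>) \<longlongrightarrow> 0) at_top" by simp
      show "\<forall>\<^sub>F x in at_top. norm ((A (f x) - A (g x)) / A (g x)) \<le> ((1 + 2 * B) + 1) * \<bar>inverse (A (g x))\<bar>"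
        using bdd
      proof eventually_elim
        case (elim x)
        have "norm ((A (f x) - A (g x)) / A (g x)) = \<bar>A (f x) - A (g x)\<bar> * \<bar>inverse (A (g x))\<bar>"
          by (simp add: divide_inverse abs_mult)
        also have "\<dots> \<le> ((1 + 2 * B) + 1) * \<bar>inverse (A (g x))\<bar>" using elim by (intro mult_right_mono) auto
        finally show ?case .
      qed
    qed
  next
    case False
    then have sg1: "sg = 1" using sg_le by simp
    show ?thesis
    proof (rule Lim_null_comparison)
      have "((\<lambda>x. \<bar>S (f x) - S (g x)\<bar> / \<eta>) \<longlongrightarrow> \<bar>0\<bar> / \<eta>) at_top" using eta by (intro tendsto_intros S0) auto
      then show "((\<lambda>x. \<bar>S (f x) - S (g x)\<bar> / \<eta>) \<longlongrightarrow> 0) at_top" by simp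
      show "\<forall>\<^sub>F x in at_top. norm ((A (f x) - A (g x)) / A (g x)) \<le> \<bar>S (f x) - S (g x)\<bar> / \<eta>"
        using eta_g
      proof eventually_elim
        case (elim x)
        then show ?case using eta(1) by (simp add: A_def S_def sg1 abs_divide frac_le)
      qed
    qed
  qed
  then have "((\<lambda>x. (A (f x) - A (g x)) / A (g x) + 1) \<longlongrightarrow> 1) at_top" using tendsto_add[OF _ tendsto_const[of 1]] by fastforce
  moreover have "\<forall>\<^sub>F x in at_top. (A (f x) - A (g x)) / A (g x) + 1 = A (f x) / A (g x)"
    using eta_g by eventually_elim (use eta(1) in \<open>simp add: diff_divide_distrib\<close>)
  ultimately show ?thesis using tendsto_cong by force
qed

end

section \<open>The slowly varying function and the conclusion\<close>

context norm_tutte_dom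
begin

text \<open>Extended to real arguments by rounding down, and normalised so that the claimed
  equivalence is an equality for every \<open>l \<ge> 1\<close>.\<close>

definition Lfun :: "real \<Rightarrow> real" where
  "Lfun x = 2 * (real (nat \<lfloor>x\<rfloor>))\<^sup>2 * v (nat \<lfloor>x\<rfloor> + 1)"

lemma Lfun_nat: "l \<ge> 1 \<Longrightarrow> Lfun (real l) = 2 / (Jf 0)\<^sup>2 * A l"
  unfolding A_eq Lfun_def using Jf_0_pos by simp

lemma floor_scaled_at_top: "t > 0 \<Longrightarrow> filterlim (\<lambda>x::real. nat \<lfloor>t * x\<rfloor>) at_top at_top"
  by (intro filterlim_compose[OF filterlim_nat_sequentially] filterlim_compose[OF filterlim_floor_sequentially])
    real_asymp

lemma Lfun_slowly_varying: "slowly_varying Lfun"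
  unfolding slowly_varying_def
proof (intro allI impI)
  fix t :: real assume t: "t > 0"
  \<comment> \<open>The factor \<open>1\<close> in \<open>g\<close> lets
    \<open>floor_scaled_at_top\<close> cover both functions.\<close>
  define f g where "f x = nat \<lfloor>t * x\<rfloor>" and "g x = nat \<lfloor>1 * x\<rfloor>" for x :: real
  have lim: "filterlim f at_top at_top" "filterlim g at_top at_top"
    unfolding f_def g_def using floor_scaled_at_top t zero_less_one by blast+
  \<comment> \<open>Arguments of bounded ratio have values of \<open>ohs\<close> at bounded
    distance; this is the only property of the scaling that \<open>A_ratio\<close> asks for.\<close>
  have "\<forall>\<^sub>F x in at_top. \<bar>ohs (f x) - ohs (g x)\<bar> \<le> t + 1 / t"
    using eventually_ge_at_top[of 1] eventually_ge_at_top[of "1 / t"]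
  proof eventually_elim
    case (elim x)
    have tx: "t * x \<ge> 1" using elim(2) t by (simp add: field_simps)
    have fx: "real (f x) \<le> t * x" "t * x < real (f x) + 1" and gx: "real (g x) \<le> x" "x < real (g x) + 1"
      using tx elim(1) unfolding f_def g_def by (simp_all add: of_nat_nat)
    show ?case
    proof (cases "g x \<le> f x")
      case True
      have "ohs (f x) - ohs (g x) \<le> (real (f x) - real (g x)) / (2 * real (g x) + 1)" by (rule ohs_diff_le[OF True])
      also have "\<dots> \<le> t * x / x" using True fx gx elim(1) by (intro frac_le) auto
      also have "\<dots> = t" using elim(1) by simp
      finally show ?thesis using ohs_mono[OF True] t by (simp add: add_increasing2)
    next
      case False
      then have le: "f x \<le> g x" by simp
      have "ohs (g x) - ohs (f x) \<le> (real (g x) - real (f x)) / (2 * real (f x) + 1)" by (rule ohs_diff_le[OF le])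
      also have "\<dots> \<le> x / (t * x)" using le fx gx tx by (intro frac_le) auto
      also have "\<dots> = 1 / t" using elim(1) by simp
      finally show ?thesis using ohs_mono[OF le] t by (simp add: add_increasing)
    qed
  qed
  from A_ratio[OF lim this] have "((\<lambda>x. A (f x) / A (g x)) \<longlongrightarrow> 1) at_top" .
  moreover have "\<forall>\<^sub>F x in at_top. A (f x) / A (g x) = Lfun (t * x) / Lfun x"
  proof -
    have "\<forall>\<^sub>F x in at_top. f x \<ge> 1" "\<forall>\<^sub>F x in at_top. g x \<ge> 1"
      using lim by (simp_all add: filterlim_at_top)
    then show ?thesis
    proof eventually_elim
      case (elim x)
      have n: "Lfun (real m) = 2 * (real m)\<^sup>2 * v (m + 1)" for m by (simp add: Lfun_def)
      have "Lfun (t * x) = Lfun (real (f x))" unfolding n by (simp only: Lfun_def f_def)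
      moreover have "Lfun x = Lfun (real (g x))" unfolding n by (simp only: Lfun_def g_def mult_1)
      ultimately have "Lfun (t * x) = 2 / (Jf 0)\<^sup>2 * A (f x)" "Lfun x = 2 / (Jf 0)\<^sup>2 * A (g x)"
        using Lfun_nat[OF elim(1)] Lfun_nat[OF elim(2)] by simp_all
      then show ?case using Jf_0_pos by simp
    qed
  qed
  ultimately show "((\<lambda>x. Lfun (t * x) / Lfun x) \<longlongrightarrow> 1) at_top" by (simp cong: tendsto_cong)
qed

lemma Lfun_bigo: "(\<lambda>l::nat. 1 :: real) \<in> O(\<lambda>l. Lfun (real l))" "(\<lambda>l::nat. Lfun (real l)) \<in> O(\<lambda>l. ln (real l))"
proof -
  define P where "P = 2 / (Jf 0)\<^sup>2"
  have P: "P > 0" using Jf_0_pos by (simp add: P_def)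
  obtain \<eta> where eta: "\<eta> > 0" "\<forall>\<^sub>F l in sequentially. \<eta> \<le> A l" using A_lower by blast
  show "(\<lambda>l::nat. 1 :: real) \<in> O(\<lambda>l. Lfun (real l))"
  proof (rule bigoI)
    show "\<forall>\<^sub>F l in sequentially. norm (1 :: real) \<le> 1 / (P * \<eta>) * norm (Lfun (real l))"
      using eta(2) eventually_ge_at_top[of 1]
    proof eventually_elim
      case (elim l)
      have "P * \<eta> \<le> P * A l" using P elim by (intro mult_left_mono) auto
      moreover have "Lfun (real l) = P * A l" using Lfun_nat[OF elim(2)] by (simp add: P_def)
      ultimately have le: "P * \<eta> \<le> \<bar>Lfun (real l)\<bar>" by simp
      have pos: "P * \<eta> > 0" using P eta by simp
      have "1 \<le> \<bar>Lfun (real l)\<bar> / (P * \<eta>)" using le by (subst pos_le_divide_eq[OF pos]) simp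
      then show ?case by simp
    qed
  qed
  show "(\<lambda>l::nat. Lfun (real l)) \<in> O(\<lambda>l. ln (real l))"
  proof (rule bigoI)
    have "\<forall>\<^sub>F l in sequentially. 1 \<le> ln (real l)" by real_asymp
    then show "\<forall>\<^sub>F l in sequentially. norm (Lfun (real l)) \<le> (P * 4) * norm (ln (real l))"
      using eventually_ge_at_top[of 2]
    proof eventually_elim
      case (elim l)
      have "Lfun (real l) = P * A l" using Lfun_nat[of l] elim by (simp add: P_def)
      moreover have "0 < A l" "A l \<le> 2 + 2 * ln (real l)" using A_pos[of l] A_upper[of l] Q1_upper[of l] elim by auto
      moreover have "P * A l \<le> P * (4 * ln (real l))" using P calculation(3) elim by (intro mult_left_mono) auto
      ultimately show ?case using P elim by (simp add: abs_mult)
    qed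
  qed
qed

end

theorem theorem1p1:
  fixes q :: "nat \<Rightarrow> real"
  assumes nonneg: "\<forall>k\<ge>1. q k \<ge> 0"
    and nonzero: "\<exists>k\<ge>1. q k \<noteq> 0"
    and adm: "admissible q"
    and cond: "\<forall>k\<ge>1. q k - 2 * W q k / c_q q ^ (2 * k) \<ge> 0"
  shows "\<exists>L :: real \<Rightarrow> real. slowly_varying L \<and>
           (\<lambda>l::nat. 1::real) \<in> O(\<lambda>l. L (real l)) \<and>
           (\<lambda>l::nat. L (real l)) \<in> O(\<lambda>l. ln (real l)) \<and>
           (\<lambda>l::nat. W q l) \<sim>[at_top] (\<lambda>l. c_q q ^ (l + 1) * L (real l) / (2 * real l ^ 2))"
proof -
  define Z where "Z l = (if l = 0 then 1 else W q l)" for l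
  interpret map_tutte q Z
  proof
    show "Z l \<ge> 0" for l by (simp add: Z_def W_def)
    show "(\<lambda>k. q (Suc k) * Z (l + Suc k)) sums (Z (Suc l) - (\<Sum>b\<le>l. Z b * Z (l - b)))" for l
      using tutte_equation[OF nonneg adm, of l] unfolding Z_def .
  qed (use nonneg nonzero in \<open>auto simp: Z_def\<close>)
  have Wv: "W q l = c ^ (l + 1) * v (l + 1)" if "l \<ge> 1" for l
    using that c_pos by (simp add: v_def Z_def)
  \<comment> \<open>The constant of the statement is this ratio limit, whereas \<open>c\<close> is a
    supremum of roots; the ratio limit 1 of \<open>v\<close> identifies them.\<close>
  have "(\<lambda>l. W q (l + 1) / W q l) \<longlonglongrightarrow> c"
  proof (rule Lim_transform_eventually)
    have "(\<lambda>l. c * (v (Suc (Suc l)) / v (Suc l))) \<longlonglongrightarrow> c * 1"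
      by (intro tendsto_mult tendsto_const LIMSEQ_Suc[OF v_ratio_tendsto])
    then show "(\<lambda>l. c * (v (Suc (Suc l)) / v (Suc l))) \<longlonglongrightarrow> c" by simp
    show "\<forall>\<^sub>F l in sequentially. c * (v (Suc (Suc l)) / v (Suc l)) = W q (l + 1) / W q l"
      using eventually_ge_at_top[of 1]
    proof eventually_elim
      case (elim l)
      then show ?case using Wv[of l] Wv[of "l + 1"] c_pos by simp
    qed
  qed
  then have cq: "c_q q = c" unfolding c_q_def by (rule limI)
  \<comment> \<open>As \<open>W q (k + 1) = c ^ (k + 2) * v (k + 2)\<close>, the hypothesis at index
    \<open>k + 1\<close>, multiplied by \<open>c ^ k\<close>, is exactly
    \<open>dl k \<ge> 0\<close>.\<close>
  interpret norm_tutte_dom v a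
  proof
    fix k
    have "2 * W q (Suc k) / c ^ (2 * Suc k) \<le> q (Suc k)" using cond cq by force
    then have "2 * W q (Suc k) / c ^ (2 * Suc k) * c ^ k \<le> q (Suc k) * c ^ k" using c_pos by (intro mult_right_mono) auto
    moreover have "2 * W q (Suc k) / c ^ (2 * Suc k) * c ^ k = 2 * v (k + 2)"
    proof -
      have "c ^ (2 * Suc k) = c ^ (k + 2) * c ^ k" by (simp only: power_add[symmetric]) (simp add: mult_2)
      moreover have "c ^ k \<noteq> 0" using c_pos by simp
      moreover have "W q (Suc k) = c ^ (k + 2) * v (k + 2)" using Wv[of "Suc k"] by simp
      moreover have "c ^ (k + 2) \<noteq> 0" using c_pos by simp
      ultimately show ?thesis by (simp only:) simp
    qed
    ultimately show "dl k \<ge> 0" by (simp add: dl_def a_def)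
  qed
  have "\<forall>\<^sub>F l in sequentially. W q l = c_q q ^ (l + 1) * Lfun (real l) / (2 * real l ^ 2)"
    using eventually_ge_at_top[of 1]
  proof eventually_elim
    case (elim l)
    then show ?case using Wv[OF elim] by (simp add: cq Lfun_def)
  qed
  then have "(\<lambda>l. W q l) \<sim>[at_top] (\<lambda>l. c_q q ^ (l + 1) * Lfun (real l) / (2 * real l ^ 2))"
    by (rule asymp_equiv_refl_ev)
  then show ?thesis using Lfun_slowly_varying Lfun_bigo by blast
qed

end
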